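(* Consider the linear quadratic Q-noise optimal control problem of minimizing $$J(\boldsymbol{u},\boldsymbol{x}_0)=\mathbb{E}\Big[\int_0^T\big(\langle\boldsymbol{x}_t,(\boldsymbol{M}+m\mathbb{I})\boldsymbol{x}_t\rangle+\langle\boldsymbol{u}_t,(\mathbf{R}+r\mathbb{I})\boldsymbol{u}_t\rangle\big)dt+\langle\boldsymbol{x}_T,(\boldsymbol{M}_T+m_T\mathbb{I})\boldsymbol{x}_T\rangle\Big]$$ over admissible controls for $$d\boldsymbol{x}_t=\big((\boldsymbol{A}+a\mathbb{I})\boldsymbol{x}_t+(\boldsymbol{B}+b\mathbb{I})\boldsymbol{u}_t\big)dt+d\boldsymbol{w}_t,\qquad \boldsymbol{x}_0\in L_2[0,1],$$ where $\boldsymbol{w}$ is a Q-noise with covariance operator $\mathbf{Q}$ and all the operators $\boldsymbol{A},\boldsymbol{B},\mathbf{Q},\boldsymbol{M},\boldsymbol{M}_T,\mathbf{R}$ are low rank with respect to a common $N$-dimensional invariant subspace $\mathcal{S}\subset L_2[0,1]$ with orthonormal basis $\boldsymbol{f}_1,\dots,\boldsymbol{f}_N$, and their projections onto $\mathcal{S}$ are the $N\times N$ matrices $A,B,Q,M,M_T,R$ respectively. Then the optimal control $\boldsymbol{u}^0_t\in L_2[0,1]$, $t\in[0,T]$, is $$\boldsymbol{u}^0_t=\boldsymbol{u}^{\boldsymbol{f}}_t+\breve{\boldsymbol{u}}_t,\qquad \boldsymbol{u}^{\boldsymbol{f}}_t=\sum_{k=1}^N\big[-(R+rI)^{-1}(B+bI)^*P_tx^{\boldsymbol{f}}_t\big]_k\boldsymbol{f}_k,\qquad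 \breve{\boldsymbol{u}}_t=-\frac{b}{r}\,p_t\,\breve{\boldsymbol{x}}_t,$$ where $P_t\in\mathbb{R}^{N\times N}$ and $p_t\in\mathbb{R}$ solve the $N$-dimensional and one-dimensional Riccati equations $$-\dot P_t=(A+aI)^*P_t+P_t(A+aI)-P_t(B+bI)^*(R+rI)^{-1}(B+bI)P_t+(M+mI),\qquad P_T=M_T+m_TI,$$ $$-\dot p_t=2ap_t-\frac{b^2}{r}p_t^2+m,\qquad p_T=m_T.$$
   Context: All operators act on the real Hilbert space $L_2[0,1]$ with inner product $\langle\cdot,\cdot\rangle$; $\mathbb{I}$ is the identity on $L_2[0,1]$ and $I$ the $N\times N$ identity matrix; $a,b,m,m_T,r\in\mathbb{R}$. An invariant subspace of an operator $\mathbb{T}$ is a subspace $\mathcal{S}$ with $\mathbb{T}\boldsymbol{x}\in\mathcal{S}$ for all $\boldsymbol{x}\in\mathcal{S}$. An operator $\mathbb{T}$ is low rank with respect to an invariant subspace $\mathcal{S}$ if $\mathbb{T}\breve{\boldsymbol{v}}=0$ for all $\breve{\boldsymbol{v}}\in\mathcal{S}^\perp$. Standing assumptions: $\mathcal{S}$ is spanned by finitely many orthonormal functions $\boldsymbol{f}=(\boldsymbol{f}_1,\dots,\boldsymbol{f}_N)$ in $L_2[0,1]$; $\boldsymbol{A},\boldsymbol{B}$ are finite rank self-adjoint (graphon) integral operators sharing the invariant subspace $\mathcal{S}$ and vanishing on $\mathcal{S}^\perp$; the noise is $\boldsymbol{w}_t=\sum_{k=1}^N\sqrt{\lambda_k}\,\boldsymbol{f}_kW^k_t$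 with $\lambda_k\ge0$ and independent standard Brownian motions $W^k$ (so $\mathbf{Q}$ is low rank with respect to $\mathcal{S}$ and $Q=\operatorname{diag}(\lambda_1,\dots,\lambda_N)$); $\boldsymbol{M},\boldsymbol{M}_T,\mathbf{R}$ are self-adjoint and non-negative, $m,m_T\ge0$, $r>0$. Projected matrices: $A_{ij}=\langle\boldsymbol{A}\boldsymbol{f}_i,\boldsymbol{f}_j\rangle$, and likewise $B,M,M_T,R$ from $\boldsymbol{B},\boldsymbol{M},\boldsymbol{M}_T,\mathbf{R}$. The matrix adjoint is denoted $^*$. Decomposition: $\boldsymbol{x}_t=\boldsymbol{x}^{\boldsymbol{f}}_t+\breve{\boldsymbol{x}}_t$ and $\boldsymbol{u}_t=\boldsymbol{u}^{\boldsymbol{f}}_t+\breve{\boldsymbol{u}}_t$, where $\boldsymbol{x}^{\boldsymbol{f}}_t,\boldsymbol{u}^{\boldsymbol{f}}_t$ are the orthogonal projections onto $\mathcal{S}$ and $\breve{\boldsymbol{x}}_t,\breve{\boldsymbol{u}}_t$ those onto $\mathcal{S}^\perp$; $x^{\boldsymbol{f}}_t=(\langle\boldsymbol{x}^{\boldsymbol{f}}_t,\boldsymbol{f}_1\rangle,\dots,\langle\boldsymbol{x}^{\boldsymbol{f}}_t,\boldsymbol{f}_N\rangle)\in\mathbb{R}^N$ is the coordinate vector of $\boldsymbol{x}^{\boldsymbol{f}}_t$ (as a column vector). $[v]_k$ is the $k$-th entry of $v\in\mathbb{R}^N$. Admissible controls are $L_2[0,1]$-valued, adapted to the filtration generated by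 $\boldsymbol{w}$, with $\int_0^T\|\boldsymbol{u}_t\|_2^2dt<\infty$. Solutions are mild solutions. *)

theory Defs
  imports "HOL-Probability.Probability"
begin

definition leb01 :: "real measure" where
  "leb01 = restrict_space lborel {0..1}"

definition sq_integrable01 :: "(real \<Rightarrow> real) \<Rightarrow> bool" where
  "sq_integrable01 g \<longleftrightarrow> g \<in> borel_measurable leb01 \<and> integrable leb01 (\<lambda>x. (g x)\<^sup>2)"

lemma space_leb01 [simp]: "space leb01 = {0..1}"
  by (simp add: leb01_def space_restrict_space)

interpretation leb01: prob_space leb01
proof
  show "emeasure leb01 (space leb01) = 1"
    by (simp add: leb01_def space_restrict_space emeasure_restrict_space)
qed

lemma sq_integrable01_meas [measurable_dest]: "sq_integrable01 g \<Longrightarrow> g \<in> borel_measurable leb01"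
  and sq_integrable01_int: "sq_integrable01 g \<Longrightarrow> integrable leb01 (\<lambda>x. (g x)\<^sup>2)"
  by (auto simp: sq_integrable01_def)

lemma sq_integrable01_mult:
  assumes "sq_integrable01 g" "sq_integrable01 h"
  shows "integrable leb01 (\<lambda>x. g x * h x)"
proof (rule Bochner_Integration.integrable_bound)
  show "integrable leb01 (\<lambda>x. (g x)\<^sup>2 + (h x)\<^sup>2)"
    using assms by (auto simp: sq_integrable01_def)
  show "(\<lambda>x. g x * h x) \<in> borel_measurable leb01"
    using assms by (auto simp: sq_integrable01_def)
  have "\<bar>g x * h x\<bar> \<le> (g x)\<^sup>2 + (h x)\<^sup>2" for x
  proof -
    have "2 * (\<bar>g x\<bar> * \<bar>h x\<bar>) \<le> (g x)\<^sup>2 + (h x)\<^sup>2"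
      using sum_squares_bound[of "\<bar>g x\<bar>" "\<bar>h x\<bar>"] by (simp add: mult.assoc)
    moreover have "0 \<le> \<bar>g x\<bar> * \<bar>h x\<bar>" by simp
    ultimately have "\<bar>g x\<bar> * \<bar>h x\<bar> \<le> (g x)\<^sup>2 + (h x)\<^sup>2" by linarith
    then show ?thesis by (simp only: abs_mult)
  qed
  then show "AE x in leb01. norm (g x * h x) \<le> norm ((g x)\<^sup>2 + (h x)\<^sup>2)"
    by (auto intro!: AE_I2)
qed

lemma sq_integrable01_add:
  assumes "sq_integrable01 g" "sq_integrable01 h"
  shows "sq_integrable01 (\<lambda>x. g x + h x)"
  using assms sq_integrable01_mult[OF assms]
  by (auto simp: sq_integrable01_def power2_sum mult.assoc)

lemma sq_integrable01_scale:
  assumes "sq_integrable01 g" shows "sq_integrable01 (\<lambda>x. c * g x)"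
  using assms by (auto simp: sq_integrable01_def power_mult_distrib)

lemma sq_integrable01_uminus:
  assumes "sq_integrable01 g" shows "sq_integrable01 (\<lambda>x. - g x)"
  using assms by (auto simp: sq_integrable01_def)

lemma sq_integrable01_minus:
  assumes "sq_integrable01 g" "sq_integrable01 h"
  shows "sq_integrable01 (\<lambda>x. g x - h x)"
  using sq_integrable01_add[OF assms(1) sq_integrable01_uminus[OF assms(2)]] by simp

lemma sq_integrable01_zero: "sq_integrable01 (\<lambda>x. 0)"
  by (auto simp: sq_integrable01_def)

lemma sq_integrable01_indicator:
  assumes "A \<in> sets borel"
  shows "sq_integrable01 (indicator A)"
proof -
  have "(indicator A :: real \<Rightarrow> real) \<in> borel_measurable leb01"
    unfolding leb01_def using assms by (intro measurable_restrict_space1) auto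
  moreover from this have "integrable leb01 (\<lambda>x. (indicator A x :: real)\<^sup>2)"
    by (intro leb01.integrable_const_bound[where B=1]) (auto split: split_indicator)
  ultimately show ?thesis unfolding sq_integrable01_def by blast
qed

text \<open>The space $L_2[0,1]$.  Borel instead of Lebesgue measurable representatives give the same
  space, since every Lebesgue measurable function agrees almost everywhere with a Borel one.\<close>

quotient_type L2_01 = "real \<Rightarrow> real" / partial:
  "\<lambda>g h. sq_integrable01 g \<and> sq_integrable01 h \<and> (AE x in leb01. g x = h x)"
proof (rule part_equivpI)
  show "\<exists>x. sq_integrable01 x \<and> sq_integrable01 x \<and> (AE xa in leb01. x xa = x xa)"
    using sq_integrable01_zero by auto
  show "symp (\<lambda>g h. sq_integrable01 g \<and> sq_integrable01 h \<and> (AE x in leb01. g x = h x))"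
    by (auto simp: symp_def)
  show "transp (\<lambda>g h. sq_integrable01 g \<and> sq_integrable01 h \<and> (AE x in leb01. g x = h x))"
  proof (rule transpI, elim conjE, intro conjI)
    fix g h k :: "real \<Rightarrow> real"
    assume "AE x in leb01. g x = h x" "AE x in leb01. h x = k x"
    then show "AE x in leb01. g x = k x" by eventually_elim simp
  qed auto
qed

lemma rep_L2_01: "sq_integrable01 (rep_L2_01 v)"
  using Quotient3_rep_reflp[OF Quotient3_L2_01, of v] by auto

lemma abs_rep_L2_01: "abs_L2_01 (rep_L2_01 v) = v"
  by (rule Quotient3_abs_rep[OF Quotient3_L2_01])

lemma rep_abs_L2_01: "sq_integrable01 g \<Longrightarrow> AE x in leb01. rep_L2_01 (abs_L2_01 g) x = g x"
  using rep_abs_rsp[OF Quotient3_L2_01, of g g] by auto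

lemma abs_L2_01_eq_iff:
  "sq_integrable01 g \<Longrightarrow> sq_integrable01 h \<Longrightarrow>
    abs_L2_01 g = abs_L2_01 h \<longleftrightarrow> (AE x in leb01. g x = h x)"
  using Quotient3_rel[OF Quotient3_L2_01, of g h] by auto

instantiation L2_01 :: real_vector
begin

lift_definition zero_L2_01 :: L2_01 is "\<lambda>x. 0"
  by (simp add: sq_integrable01_zero)

lift_definition plus_L2_01 :: "L2_01 \<Rightarrow> L2_01 \<Rightarrow> L2_01" is "\<lambda>g h x. g x + h x"
  by (auto intro: sq_integrable01_add)

lift_definition minus_L2_01 :: "L2_01 \<Rightarrow> L2_01 \<Rightarrow> L2_01" is "\<lambda>g h x. g x - h x"
  by (auto intro: sq_integrable01_minus)

lift_definition uminus_L2_01 :: "L2_01 \<Rightarrow> L2_01" is "\<lambda>g x. - g x"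
  by (auto intro: sq_integrable01_uminus)

lift_definition scaleR_L2_01 :: "real \<Rightarrow> L2_01 \<Rightarrow> L2_01" is "\<lambda>c g x. c * g x"
  by (auto intro: sq_integrable01_scale)

instance
proof
  fix u v w :: L2_01 and r s :: real
  show "u + v + w = u + (v + w)" by transfer (auto intro!: sq_integrable01_add simp: add.assoc)
  show "u + v = v + u" by transfer (auto intro!: sq_integrable01_add simp: add.commute)
  show "0 + u = u" by transfer auto
  show "- u + u = 0" by transfer (auto intro!: sq_integrable01_zero)
  show "u - v = u + - v" by transfer (auto intro!: sq_integrable01_minus)
  show "r *\<^sub>R (u + v) = r *\<^sub>R u + r *\<^sub>R v"
    by transfer (auto intro!: sq_integrable01_scale sq_integrable01_add simp: algebra_simps)
  show "(r + s) *\<^sub>R u = r *\<^sub>R u + s *\<^sub>R u"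
    by transfer (auto intro!: sq_integrable01_scale sq_integrable01_add simp: algebra_simps)
  show "r *\<^sub>R s *\<^sub>R u = (r * s) *\<^sub>R u"
    by transfer (auto intro!: sq_integrable01_scale simp: algebra_simps)
  show "1 *\<^sub>R u = u" by transfer auto
qed

end

instantiation L2_01 :: real_inner
begin

lift_definition inner_L2_01 :: "L2_01 \<Rightarrow> L2_01 \<Rightarrow> real" is "\<lambda>g h. \<integral>x. g x * h x \<partial>leb01"
proof -
  fix g h g' h' :: "real \<Rightarrow> real"
  assume *: "sq_integrable01 g \<and> sq_integrable01 h \<and> (AE x in leb01. g x = h x)"
    and **: "sq_integrable01 g' \<and> sq_integrable01 h' \<and> (AE x in leb01. g' x = h' x)"
  then have [measurable]: "g \<in> borel_measurable leb01" "h \<in> borel_measurable leb01"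
    "g' \<in> borel_measurable leb01" "h' \<in> borel_measurable leb01"
    by (auto simp: sq_integrable01_def)
  from * ** have "AE x in leb01. g x = h x" "AE x in leb01. g' x = h' x" by auto
  then have "AE x in leb01. g x * g' x = h x * h' x" by eventually_elim simp
  then show "(\<integral>x. g x * g' x \<partial>leb01) = (\<integral>x. h x * h' x \<partial>leb01)"
    by (intro integral_cong_AE) auto
qed

definition norm_L2_01 :: "L2_01 \<Rightarrow> real" where "norm_L2_01 v = sqrt (v \<bullet> v)"
definition sgn_L2_01 :: "L2_01 \<Rightarrow> L2_01" where "sgn_L2_01 v = v /\<^sub>R norm v"
definition dist_L2_01 :: "L2_01 \<Rightarrow> L2_01 \<Rightarrow> real" where "dist_L2_01 u v = norm (u - v)"
definition uniformity_L2_01 :: "(L2_01 \<times> L2_01) filter"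
  where "uniformity_L2_01 = (INF e\<in>{0<..}. principal {(x::L2_01, y). dist x y < e})"
definition open_L2_01 :: "L2_01 set \<Rightarrow> bool"
  where "open_L2_01 U \<longleftrightarrow> (\<forall>x\<in>U. \<forall>\<^sub>F (x', y) in uniformity. x' = x \<longrightarrow> y \<in> U)"

instance
proof
  fix u v w :: L2_01 and r s :: real and U :: "L2_01 set"
  show "dist u v = norm (u - v)" by (rule dist_L2_01_def)
  show "sgn u = u /\<^sub>R norm u" by (rule sgn_L2_01_def)
  show "uniformity = (INF e\<in>{0<..}. principal {(x::L2_01, y). dist x y < e})"
    by (rule uniformity_L2_01_def)
  show "open U \<longleftrightarrow> (\<forall>x\<in>U. \<forall>\<^sub>F (x', y) in uniformity. x' = x \<longrightarrow> y \<in> U)"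
    by (rule open_L2_01_def)
  show "u \<bullet> v = v \<bullet> u" by transfer (simp add: mult.commute)
  show "(u + v) \<bullet> w = u \<bullet> w + v \<bullet> w"
    by transfer (auto simp: distrib_right sq_integrable01_mult)
  show "r *\<^sub>R u \<bullet> v = r * (u \<bullet> v)" by transfer (simp add: mult.assoc)
  show "0 \<le> u \<bullet> u" by transfer simp
  show "u \<bullet> u = 0 \<longleftrightarrow> u = 0"
  proof transfer
    fix g :: "real \<Rightarrow> real"
    assume "sq_integrable01 g \<and> sq_integrable01 g \<and> (AE x in leb01. g x = g x)"
    then have g: "sq_integrable01 g" by simp
    have "(\<integral>x. g x * g x \<partial>leb01) = 0 \<longleftrightarrow> (AE x in leb01. g x * g x = 0)"
      using sq_integrable01_mult[OF g g] by (intro integral_nonneg_eq_0_iff_AE) auto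
    then show "((\<integral>x. g x * g x \<partial>leb01) = 0) =
        (sq_integrable01 g \<and> sq_integrable01 (\<lambda>x. 0) \<and> (AE x in leb01. g x = 0))"
      using g sq_integrable01_zero by auto
  qed
  show "norm u = sqrt (u \<bullet> u)" by (rule norm_L2_01_def)
qed

end

lemma abs_L2_01_minus:
  "sq_integrable01 g \<Longrightarrow> sq_integrable01 h \<Longrightarrow>
    abs_L2_01 g - abs_L2_01 h = abs_L2_01 (\<lambda>x. g x - h x)"
  by (rule minus_L2_01.abs_eq) auto

lemma abs_L2_01_plus:
  "sq_integrable01 g \<Longrightarrow> sq_integrable01 h \<Longrightarrow>
    abs_L2_01 g + abs_L2_01 h = abs_L2_01 (\<lambda>x. g x + h x)"
  by (rule plus_L2_01.abs_eq) auto

lemma abs_L2_01_scaleR: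
  "sq_integrable01 g \<Longrightarrow> c *\<^sub>R abs_L2_01 g = abs_L2_01 (\<lambda>x. c * g x)"
  by (rule scaleR_L2_01.abs_eq) auto

lemma norm_abs_L2_01:
  "sq_integrable01 g \<Longrightarrow> norm (abs_L2_01 g) ^ 2 = (\<integral>x. (g x)\<^sup>2 \<partial>leb01)"
  by (subst power2_norm_eq_inner, subst inner_L2_01.abs_eq) (auto simp: power2_eq_square)

lemma nn_norm_abs_L2_01:
  "sq_integrable01 g \<Longrightarrow> (\<integral>\<^sup>+x. ennreal ((g x)\<^sup>2) \<partial>leb01) = ennreal (norm (abs_L2_01 g) ^ 2)"
  by (subst nn_integral_eq_integral) (auto simp: norm_abs_L2_01 sq_integrable01_int)

lemma sq_integrable01I:
  assumes "g \<in> borel_measurable leb01" "(\<integral>\<^sup>+x. ennreal ((g x)\<^sup>2) \<partial>leb01) < \<infinity>"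
  shows "sq_integrable01 g"
  using assms by (auto simp: sq_integrable01_def integrable_iff_bounded)

lemma nn_L1_le_L2:
  assumes g: "sq_integrable01 g"
  shows "(\<integral>\<^sup>+x. ennreal \<bar>g x\<bar> \<partial>leb01) \<le> ennreal (norm (abs_L2_01 g))"
proof -
  have int: "integrable leb01 (\<lambda>x. \<bar>g x\<bar>)"
    using leb01.square_integrable_imp_integrable[of "g"] g
    by (auto simp: sq_integrable01_def)
  have "(\<integral>x. \<bar>g x\<bar> \<partial>leb01) ^ 2 \<le> (\<integral>x. (g x)\<^sup>2 \<partial>leb01)"
  proof -
    have "0 \<le> leb01.variance (\<lambda>x. \<bar>g x\<bar>)" by (rule leb01.variance_positive)
    also have "leb01.variance (\<lambda>x. \<bar>g x\<bar>) = (\<integral>x. \<bar>g x\<bar>\<^sup>2 \<partial>leb01) - (\<integral>x. \<bar>g x\<bar> \<partial>leb01)\<^sup>2"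
      by (rule leb01.variance_eq[OF int]) (simp add: sq_integrable01_int[OF g])
    finally show ?thesis by simp
  qed
  also have "\<dots> = norm (abs_L2_01 g) ^ 2" using norm_abs_L2_01[OF g] by simp
  finally have "(\<integral>x. \<bar>g x\<bar> \<partial>leb01) \<le> norm (abs_L2_01 g)"
    by (rule power2_le_imp_le) simp
  then show ?thesis by (subst nn_integral_eq_integral[OF int]) auto
qed

instance L2_01 :: banach
proof
  fix X :: "nat \<Rightarrow> L2_01"
  assume X: "Cauchy X"
  have "\<exists>N. \<forall>m\<ge>N. \<forall>n\<ge>N. dist (X m) (X n) < (1/2)^j" for j :: nat
    using X by (auto intro: metric_CauchyD)
  then obtain N where N: "\<And>j m n. m \<ge> N j \<Longrightarrow> n \<ge> N j \<Longrightarrow> dist (X m) (X n) < (1/2)^j"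
    by metis
  define k where "k j = (\<Sum>i\<le>j. N i)" for j
  have kN: "N j \<le> k j" for j by (auto simp: k_def intro: member_le_sum)
  have kmono: "k i \<le> k j" if "i \<le> j" for i j
    unfolding k_def using that by (intro sum_mono2) auto
  define g where "g j = rep_L2_01 (X (k j))" for j
  have g[simp]: "sq_integrable01 (g j)" for j by (simp add: g_def rep_L2_01)
  have [measurable]: "g j \<in> borel_measurable leb01" for j by (rule sq_integrable01_meas[OF g])
  have absg: "abs_L2_01 (g j) = X (k j)" for j by (simp add: g_def abs_rep_L2_01)
  have gdiff: "norm (abs_L2_01 (\<lambda>x. g i x - g j x)) = dist (X (k i)) (X (k j))" for i j
    using abs_L2_01_minus[OF g[of i] g[of j]] by (simp add: absg dist_norm)
  have close: "dist (X (k i)) (X (k j)) < (1/2)^l" if "i \<ge> l" "j \<ge> l" for i j l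
    using N[of l "k i" "k j"] kN[of l] kmono that by (meson le_trans)
  have "(\<integral>\<^sup>+x. (\<Sum>j. ennreal \<bar>g (Suc j) x - g j x\<bar>) \<partial>leb01)
      = (\<Sum>j. \<integral>\<^sup>+x. ennreal \<bar>g (Suc j) x - g j x\<bar> \<partial>leb01)"
    by (rule nn_integral_suminf) auto
  also have "\<dots> \<le> (\<Sum>j. ennreal ((1/2)^j))"
  proof (intro suminf_le summableI)
    fix j
    have "(\<integral>\<^sup>+x. ennreal \<bar>g (Suc j) x - g j x\<bar> \<partial>leb01) \<le> ennreal (dist (X (k (Suc j))) (X (k j)))"
      using nn_L1_le_L2[OF sq_integrable01_minus[OF g[of "Suc j"] g[of j]]] gdiff by simp
    also have "\<dots> \<le> ennreal ((1/2)^j)"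
      using close[of j "Suc j" j] by (intro ennreal_leI) auto
    finally show "(\<integral>\<^sup>+x. ennreal \<bar>g (Suc j) x - g j x\<bar> \<partial>leb01) \<le> ennreal ((1/2)^j)" .
  qed
  also have "\<dots> < \<infinity>"
    by (subst suminf_ennreal2) (auto intro!: summable_geometric)
  finally have "AE x in leb01. (\<Sum>j. ennreal \<bar>g (Suc j) x - g j x\<bar>) \<noteq> \<infinity>"
    by (intro nn_integral_PInf_AE) auto
  then have conv: "AE x in leb01. convergent (\<lambda>j. g j x)"
  proof eventually_elim
    case (elim x)
    then have "summable (\<lambda>j. \<bar>g (Suc j) x - g j x\<bar>)"
      by (intro summable_suminf_not_top) auto
    then have "summable (\<lambda>j. g (Suc j) x - g j x)" by (rule summable_rabs_cancel)
    then have "convergent (\<lambda>n. \<Sum>j<n. g (Suc j) x - g j x)" by (simp add: summable_iff_convergent)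
    then have "convergent (\<lambda>n. g n x - g 0 x)" by (simp only: sum_lessThan_telescope[where f="\<lambda>j. g j x"])
    then have "convergent (\<lambda>n. (g n x - g 0 x) + g 0 x)" by (intro convergent_add convergent_const)
    then show ?case by simp
  qed
  define G where "G x = lim (\<lambda>j. g j x)" for x
  have [measurable]: "G \<in> borel_measurable leb01" unfolding G_def[abs_def] by measurable
  have lim: "AE x in leb01. (\<lambda>j. g j x) \<longlonglongrightarrow> G x"
    using conv by eventually_elim (simp add: G_def convergent_LIMSEQ_iff)
  have key: "(\<integral>\<^sup>+x. ennreal ((G x - g i x)\<^sup>2) \<partial>leb01) \<le> ennreal (((1/2)^l)\<^sup>2)" if "i \<ge> l" for i l
  proof -
    have "(\<integral>\<^sup>+x. ennreal ((G x - g i x)\<^sup>2) \<partial>leb01)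
        = (\<integral>\<^sup>+x. liminf (\<lambda>j. ennreal ((g j x - g i x)\<^sup>2)) \<partial>leb01)"
    proof (rule nn_integral_cong_AE)
      show "AE x in leb01. ennreal ((G x - g i x)\<^sup>2) = liminf (\<lambda>j. ennreal ((g j x - g i x)\<^sup>2))"
        using lim
      proof eventually_elim
        case (elim x)
        then have "(\<lambda>j. ennreal ((g j x - g i x)\<^sup>2)) \<longlonglongrightarrow> ennreal ((G x - g i x)\<^sup>2)"
          by (intro tendsto_intros)
        then show ?case by (rule lim_imp_Liminf[symmetric, rotated]) simp
      qed
    qed
    also have "\<dots> \<le> liminf (\<lambda>j. \<integral>\<^sup>+x. ennreal ((g j x - g i x)\<^sup>2) \<partial>leb01)"
      by (rule nn_integral_liminf) auto
    also have "\<dots> \<le> liminf (\<lambda>j. ennreal (((1/2)^l)\<^sup>2))"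
    proof (rule Liminf_mono)
      show "\<forall>\<^sub>F j in sequentially. (\<integral>\<^sup>+x. ennreal ((g j x - g i x)\<^sup>2) \<partial>leb01) \<le> ennreal (((1/2)^l)\<^sup>2)"
        using eventually_ge_at_top[of l]
      proof eventually_elim
        case (elim j)
        have "(\<integral>\<^sup>+x. ennreal ((g j x - g i x)\<^sup>2) \<partial>leb01) = ennreal (dist (X (k j)) (X (k i)) ^ 2)"
          using nn_norm_abs_L2_01[OF sq_integrable01_minus[OF g[of j] g[of i]]] gdiff by simp
        also have "\<dots> \<le> ennreal (((1/2)^l)\<^sup>2)"
          using close[OF elim that] by (intro ennreal_leI power_mono) auto
        finally show ?case .
      qed
    qed
    also have "\<dots> = ennreal (((1/2)^l)\<^sup>2)" by (simp add: Liminf_const)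
    finally show ?thesis .
  qed
  have sqd: "sq_integrable01 (\<lambda>x. G x - g i x)" for i
    using key[of i i] by (intro sq_integrable01I) (auto intro: le_less_trans)
  have "sq_integrable01 (\<lambda>x. (G x - g 0 x) + g 0 x)" by (rule sq_integrable01_add[OF sqd g])
  then have sqG: "sq_integrable01 G" by simp
  have distG: "dist (X (k i)) (abs_L2_01 G) \<le> (1/2)^l" if "i \<ge> l" for i l
  proof -
    have "ennreal (norm (abs_L2_01 (\<lambda>x. G x - g i x)) ^ 2) \<le> ennreal (((1/2)^l)\<^sup>2)"
      using key[OF that] nn_norm_abs_L2_01[OF sqd] by simp
    then have "norm (abs_L2_01 (\<lambda>x. G x - g i x)) ^ 2 \<le> ((1/2)^l)\<^sup>2"
      by (subst (asm) ennreal_le_iff) auto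
    then have "norm (abs_L2_01 (\<lambda>x. G x - g i x)) \<le> (1/2)^l"
      by (rule power2_le_imp_le) simp
    then show ?thesis
      using abs_L2_01_minus[OF sqG g[of i]] by (simp add: absg dist_norm norm_minus_commute)
  qed
  have "X \<longlonglongrightarrow> abs_L2_01 G"
  proof (rule metric_LIMSEQ_I)
    fix e :: real assume "0 < e"
    then obtain l where l: "(1/2)^l < e/2"
      using real_arch_pow_inv[of "e/2" "1/2"] by auto
    have "dist (X n) (abs_L2_01 G) < e" if n: "n \<ge> k l" for n
    proof -
      have "dist (X n) (X (k l)) < (1/2)^l"
        using N[of l n "k l"] kN[of l] n by (meson le_trans)
      moreover have "dist (X (k l)) (abs_L2_01 G) \<le> (1/2)^l" by (rule distG) simp
      ultimately show ?thesis using l dist_triangle[of "X n" "abs_L2_01 G" "X (k l)"] by linarith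
    qed
    then show "\<exists>no. \<forall>n\<ge>no. dist (X n) (abs_L2_01 G) < e" by blast
  qed
  then show "convergent X" by (auto simp: convergent_def)
qed


lemma tendsto_abs_L2_01:
  assumes s: "\<And>n. sq_integrable01 (s n)" and g: "sq_integrable01 g" and h: "sq_integrable01 h"
    and lim: "\<And>x. x \<in> {0..1} \<Longrightarrow> (\<lambda>n. s n x) \<longlonglongrightarrow> g x"
    and s_le: "\<And>n x. x \<in> {0..1} \<Longrightarrow> \<bar>s n x\<bar> \<le> h x"
    and g_le: "\<And>x. x \<in> {0..1} \<Longrightarrow> \<bar>g x\<bar> \<le> h x"
  shows "(\<lambda>n. abs_L2_01 (s n)) \<longlonglongrightarrow> abs_L2_01 g"
proof -
  have [measurable]: "s n \<in> borel_measurable leb01" "g \<in> borel_measurable leb01" for n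
    using s g by (auto simp: sq_integrable01_def)
  have "(\<lambda>n. \<integral>x. (s n x - g x)\<^sup>2 \<partial>leb01) \<longlonglongrightarrow> (\<integral>x. 0 \<partial>leb01)"
  proof (rule integral_dominated_convergence[where w="\<lambda>x. (2 * h x)\<^sup>2"])
    show "integrable leb01 (\<lambda>x. (2 * h x)\<^sup>2)"
      by (rule sq_integrable01_int[OF sq_integrable01_scale[OF h]])
    show "AE x in leb01. (\<lambda>n. (s n x - g x)\<^sup>2) \<longlonglongrightarrow> 0"
    proof (rule AE_I2)
      fix x assume "x \<in> space leb01"
      then have "(\<lambda>n. (s n x - g x)\<^sup>2) \<longlonglongrightarrow> (g x - g x)\<^sup>2"
        by (intro tendsto_intros lim) simp
      then show "(\<lambda>n. (s n x - g x)\<^sup>2) \<longlonglongrightarrow> 0" by simp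
    qed
    show "AE x in leb01. norm ((s n x - g x)\<^sup>2) \<le> (2 * h x)\<^sup>2" for n
    proof (rule AE_I2)
      fix x assume "x \<in> space leb01"
      then have "\<bar>s n x - g x\<bar> \<le> \<bar>2 * h x\<bar>" using s_le[of x n] g_le[of x] by simp
      then show "norm ((s n x - g x)\<^sup>2) \<le> (2 * h x)\<^sup>2" by (simp only: abs_le_square_iff) simp
    qed
  qed auto
  also have "(\<lambda>n. \<integral>x. (s n x - g x)\<^sup>2 \<partial>leb01) = (\<lambda>n. (norm (abs_L2_01 (s n) - abs_L2_01 g))\<^sup>2)"
    using norm_abs_L2_01[OF sq_integrable01_minus[OF s g]] by (simp add: abs_L2_01_minus s g)
  finally have "(\<lambda>n. sqrt ((norm (abs_L2_01 (s n) - abs_L2_01 g))\<^sup>2)) \<longlonglongrightarrow> sqrt 0"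
    by (intro tendsto_real_sqrt) simp
  then show ?thesis by (simp add: LIM_zero_iff tendsto_norm_zero_iff)
qed

lemma rat_approx:
  fixes c :: real
  shows "\<exists>r. (\<forall>n. c < of_rat (r n)) \<and> (\<lambda>n::nat. of_rat (r n) :: real) \<longlonglongrightarrow> c"
proof -
  have "\<exists>q. c < of_rat q \<and> of_rat q < c + 1 / real (Suc n)" for n
    by (rule of_rat_dense) simp
  then obtain r where r: "\<And>n. c < of_rat (r n) \<and> of_rat (r n) < c + 1 / real (Suc n)" by metis
  have lim: "(\<lambda>n. of_rat (r n) :: real) \<longlonglongrightarrow> c"
  proof (rule real_tendsto_sandwich)
    show "(\<lambda>n. c) \<longlonglongrightarrow> c" by simp
    show "(\<lambda>n. c + 1 / real (Suc n)) \<longlonglongrightarrow> c"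
      using tendsto_add[OF tendsto_const LIMSEQ_Suc[OF lim_1_over_n], of c] by simp
  qed (use r in \<open>auto intro!: always_eventually less_imp_le\<close>)
  then show ?thesis using r by blast
qed

lemma L2_01_separable: "\<exists>D :: L2_01 set. countable D \<and> closure D = UNIV"
proof -
  define H where "H a = abs_L2_01 (indicator {..a})" for a :: real
  define C where "C xs = (\<Sum>(c, q)\<leftarrow>xs. of_rat c *\<^sub>R H (of_rat q))" for xs :: "(rat \<times> rat) list"
  define D where "D = range C"
  define V where "V = closure D"
  have D_add: "x + y \<in> D" if "x \<in> D" "y \<in> D" for x y
  proof -
    obtain xs ys where "x = C xs" "y = C ys" using \<open>x \<in> D\<close> \<open>y \<in> D\<close> unfolding D_def by blast
    then have "x + y = C (xs @ ys)" by (simp add: C_def)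
    then show ?thesis by (auto simp: D_def)
  qed
  have D_scale: "of_rat c *\<^sub>R x \<in> D" if "x \<in> D" for c x
  proof -
    obtain xs where "x = C xs" using \<open>x \<in> D\<close> unfolding D_def by blast
    moreover have "of_rat c *\<^sub>R C xs = C (map (\<lambda>(d, q). (c * d, q)) xs)"
      by (induction xs) (auto simp: C_def scaleR_right_distrib of_rat_mult)
    ultimately show ?thesis by (auto simp: D_def)
  qed
  have V_add: "x + y \<in> V" if "x \<in> V" "y \<in> V" for x y
  proof -
    obtain X Y where "\<And>n. X n \<in> D" "X \<longlonglongrightarrow> x" "\<And>n. Y n \<in> D" "Y \<longlonglongrightarrow> y"
      using \<open>x \<in> V\<close> \<open>y \<in> V\<close> unfolding V_def closure_sequential by metis
    then show ?thesis
      unfolding V_def closure_sequential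
      by (intro exI[of _ "\<lambda>n. X n + Y n"]) (auto intro!: D_add tendsto_add)
  qed
  have V_scale: "c *\<^sub>R x \<in> V" if "x \<in> V" for c x
  proof -
    obtain X where X: "\<And>n. X n \<in> D" "X \<longlonglongrightarrow> x"
      using \<open>x \<in> V\<close> unfolding V_def closure_sequential by metis
    obtain r where r: "\<And>n. c < of_rat (r n)" "(\<lambda>n. of_rat (r n) :: real) \<longlonglongrightarrow> c"
      using rat_approx[of c] by auto
    then show ?thesis
      using X unfolding V_def closure_sequential
      by (intro exI[of _ "\<lambda>n. of_rat (r n) *\<^sub>R X n"]) (auto intro!: D_scale tendsto_scaleR)
  qed
  have V_minus: "x - y \<in> V" if "x \<in> V" "y \<in> V" for x y
    using V_add[OF that(1) V_scale[OF that(2), of "-1"]] by simp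
  have "C [] \<in> D" by (auto simp: D_def)
  then have V_0: "0 \<in> V" unfolding V_def using closure_subset[of D] by (auto simp: C_def)
  have V_lim: "x \<in> V" if "\<And>n. X n \<in> V" "X \<longlonglongrightarrow> x" for X x
    using closed_sequentially[of V X x] that by (auto simp: V_def)
  have V_H: "H a \<in> V" for a
  proof -
    obtain r where r: "\<And>n. a < of_rat (r n)" and lim_r: "(\<lambda>n. of_rat (r n) :: real) \<longlonglongrightarrow> a"
      using rat_approx[of a] by auto
    have H_r: "H (of_rat (r n)) \<in> V" for n
    proof -
      have "C [(1, r n)] \<in> D" by (auto simp: D_def)
      then show ?thesis unfolding V_def using closure_subset[of D] by (auto simp: C_def)
    qed
    have "(\<lambda>n. H (of_rat (r n))) \<longlonglongrightarrow> H a"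
      unfolding H_def
    proof (rule tendsto_abs_L2_01)
      show "sq_integrable01 (\<lambda>x. 1)" by (simp add: sq_integrable01_def)
      fix x :: real
      show "(\<lambda>n. indicator {..of_rat (r n)} x :: real) \<longlonglongrightarrow> indicator {..a} x"
      proof (cases "x \<le> a")
        case True
        then have "x \<le> of_rat (r n)" for n using r[of n] by linarith
        then show ?thesis using True by simp
      next
        case False
        then have "\<forall>\<^sub>F n in sequentially. of_rat (r n) < x"
          by (intro order_tendstoD(2)[OF lim_r]) simp
        then have "\<forall>\<^sub>F n in sequentially. indicator {..of_rat (r n)} x = (0::real)"
          by eventually_elim simp
        then show ?thesis using False by (simp add: tendsto_eventually)
      qed
    qed (auto intro!: sq_integrable01_indicator simp: indicator_def)
    then show ?thesis by (rule V_lim[OF H_r])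
  qed
  have V_ind: "abs_L2_01 (indicator A) \<in> V" if "A \<in> sets borel" for A
  proof -
    have borel: "sigma_sets UNIV (range (\<lambda>a::real. {..a})) = sets borel"
      unfolding borel_eq_atMost by simp
    have "Int_stable (range (\<lambda>a::real. {..a}))"
      by (auto intro!: Int_stableI_image)
    moreover have "range (\<lambda>a::real. {..a}) \<subseteq> Pow UNIV" by simp
    moreover have "A \<in> sigma_sets UNIV (range (\<lambda>a::real. {..a}))"
      using that borel by simp
    ultimately show ?thesis
    proof (induction rule: sigma_sets_induct_disjoint)
      case (basic A) then show ?case using V_H by (auto simp: H_def)
    next
      case empty
      then show ?case using V_0 by (simp add: zero_L2_01.abs_eq indicator_def)
    next
      case (compl A)
      have A: "sq_integrable01 (indicator A)" and 1: "sq_integrable01 (indicator {..1})"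
        and U: "sq_integrable01 (indicator (UNIV - A))"
        using compl by (auto intro!: sq_integrable01_indicator simp: borel)
      have "abs_L2_01 (indicator (UNIV - A)) = H 1 - abs_L2_01 (indicator A)"
        unfolding H_def abs_L2_01_minus[OF 1 A] abs_L2_01_eq_iff[OF U sq_integrable01_minus[OF 1 A]]
        by (auto intro!: AE_I2 simp: indicator_def)
      then show ?case using V_minus[OF V_H compl(2)] by simp
    next
      case (union A)
      have Ab: "A i \<in> sets borel" for i using union borel by auto
      have fin: "abs_L2_01 (indicator (\<Union>i<n. A i)) \<in> V" for n
      proof (induction n)
        case 0
        then show ?case using V_0 by (simp add: zero_L2_01.abs_eq indicator_def)
      next
        case (Suc n)
        have disj: "(\<Union>i<n. A i) \<inter> A n = {}"
        proof -
          have "A i \<inter> A n = {}" if "i < n" for i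
            using union(1) that unfolding disjoint_family_on_def by (metis UNIV_I less_irrefl)
          then show ?thesis by blast
        qed
        have "indicator (\<Union>i<Suc n. A i) = (\<lambda>x. indicator (\<Union>i<n. A i) x + indicator (A n) x :: real)"
          using disj by (auto simp: lessThan_Suc indicator_def fun_eq_iff)
        then have "abs_L2_01 (indicator (\<Union>i<Suc n. A i))
            = abs_L2_01 (indicator (\<Union>i<n. A i)) + abs_L2_01 (indicator (A n))"
          using Ab by (subst abs_L2_01_plus) (auto intro!: sq_integrable01_indicator)
        then show ?case using V_add[OF Suc union(3)] by simp
      qed
      show ?case
      proof (rule V_lim[OF fin])
        show "(\<lambda>n. abs_L2_01 (indicator (\<Union>i<n. A i))) \<longlonglongrightarrow> abs_L2_01 (indicator (\<Union>i. A i))"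
        proof (rule tendsto_abs_L2_01)
          show "sq_integrable01 (\<lambda>x. 1)" by (simp add: sq_integrable01_def)
          show "(\<lambda>n. indicator (\<Union>i<n. A i) x :: real) \<longlonglongrightarrow> indicator (\<Union>i. A i) x" for x
            by (rule LIMSEQ_indicator_UN)
        qed (use Ab in \<open>auto intro!: sq_integrable01_indicator simp: indicator_def\<close>)
      qed
    qed
  qed
  have V_sum: "(\<Sum>i\<in>I. X i) \<in> V" if "\<And>i. i \<in> I \<Longrightarrow> X i \<in> V" for I :: "real set" and X
    using that by (induction I rule: infinite_finite_induct) (auto intro: V_0 V_add)
  have V_simple: "sq_integrable01 s \<and> abs_L2_01 s \<in> V" if s: "simple_function leb01 s" for s
  proof -
    define A where "A y = s -` {y} \<inter> {0..1}" for y
    have A: "A y \<in> sets borel" for y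
    proof -
      have "A y \<in> sets leb01" using simple_functionD(2)[OF s] by (simp add: A_def)
      then show ?thesis by (simp add: leb01_def sets_restrict_space_iff)
    qed
    have fin: "finite (s ` {0..1})" using simple_functionD(1)[OF s] by simp
    have comb: "sq_integrable01 (\<lambda>x. \<Sum>y\<in>I. y * indicator (A y) x) \<and>
       abs_L2_01 (\<lambda>x. \<Sum>y\<in>I. y * indicator (A y) x) \<in> V" if "finite I" for I
      using that
    proof induction
      case empty
      then show ?case using V_0 by (simp add: zero_L2_01.abs_eq sq_integrable01_zero)
    next
      case (insert y I)
      have y: "sq_integrable01 (\<lambda>x. y * indicator (A y) x)"
        by (intro sq_integrable01_scale sq_integrable01_indicator A)
      have "abs_L2_01 (\<lambda>x. y * indicator (A y) x) \<in> V"
        using V_scale[OF V_ind[OF A], of y y] abs_L2_01_scaleR[OF sq_integrable01_indicator[OF A]]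
        by simp
      moreover have "(\<lambda>x. \<Sum>z\<in>insert y I. z * indicator (A z) x)
          = (\<lambda>x. y * indicator (A y) x + (\<Sum>z\<in>I. z * indicator (A z) x))"
        by (rule ext, rule sum.insert[OF insert(1,2)])
      moreover have I: "sq_integrable01 (\<lambda>x. \<Sum>z\<in>I. z * indicator (A z) x)"
        "abs_L2_01 (\<lambda>x. \<Sum>z\<in>I. z * indicator (A z) x) \<in> V"
        using insert by blast+
      ultimately show ?case
        using V_add sq_integrable01_add[OF y I(1)]
        by (simp only: abs_L2_01_plus[OF y I(1), symmetric] simp_thms)
    qed
    let ?t = "\<lambda>x. \<Sum>y\<in>s ` {0..1}. y * indicator (A y) x"
    have eq: "s x = ?t x" if "x \<in> {0..1}" for x
    proof -
      have "?t x = (\<Sum>y\<in>s ` {0..1}. if y = s x then y else 0)"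
        using that by (intro sum.cong) (auto simp: A_def indicator_def)
      also have "\<dots> = s x" using fin that by (simp add: sum.delta)
      finally show ?thesis by simp
    qed
    define t where "t = ?t"
    have st: "s x = t x" if "x \<in> space leb01" for x
      using eq that by (simp only: t_def space_leb01)
    have t: "sq_integrable01 t" "abs_L2_01 t \<in> V"
      using comb[OF fin] by (auto simp only: t_def)
    have "s \<in> borel_measurable leb01 \<longleftrightarrow> t \<in> borel_measurable leb01"
      by (intro measurable_cong st)
    moreover have "integrable leb01 (\<lambda>x. (s x)\<^sup>2) \<longleftrightarrow> integrable leb01 (\<lambda>x. (t x)\<^sup>2)"
      by (intro Bochner_Integration.integrable_cong refl) (simp only: st)
    ultimately have sq: "sq_integrable01 s"
      using t(1) by (simp only: sq_integrable01_def)
    have "abs_L2_01 s = abs_L2_01 t"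
      using abs_L2_01_eq_iff[OF sq t(1)] st by (blast intro: AE_I2)
    then show ?thesis using sq t by simp
  qed
  have "v \<in> V" for v
  proof -
    define g where "g = rep_L2_01 v"
    have g: "sq_integrable01 g" by (simp add: g_def rep_L2_01)
    obtain s where s: "\<And>i. simple_function leb01 (s i)" "\<And>x. x \<in> space leb01 \<Longrightarrow> (\<lambda>i. s i x) \<longlonglongrightarrow> g x"
      "\<And>i x. x \<in> space leb01 \<Longrightarrow> dist (s i x) 0 \<le> 2 * dist (g x) 0"
      using borel_measurable_implies_sequence_metric[OF sq_integrable01_meas[OF g], of 0] by metis
    have "(\<lambda>i. abs_L2_01 (s i)) \<longlonglongrightarrow> abs_L2_01 g"
    proof (rule tendsto_abs_L2_01[where h="\<lambda>x. 2 * \<bar>g x\<bar>"])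
      show "sq_integrable01 (\<lambda>x. 2 * \<bar>g x\<bar>)"
        using g by (intro sq_integrable01_scale) (auto simp: sq_integrable01_def)
    qed (use g s V_simple in \<open>auto simp: dist_real_def\<close>)
    moreover have "abs_L2_01 (s i) \<in> V" for i using V_simple[OF s(1)] by (rule conjunct2)
    ultimately have "abs_L2_01 g \<in> V" by (rule V_lim[rotated])
    then show ?thesis by (simp add: g_def abs_rep_L2_01)
  qed
  then show ?thesis by (intro exI[of _ D]) (auto simp: V_def D_def)
qed

instance L2_01 :: second_countable_topology
proof
  obtain D :: "L2_01 set" where D: "countable D" "closure D = UNIV" using L2_01_separable by auto
  define B where "B = (\<lambda>(d, n). ball d (1 / real (Suc n))) ` (D \<times> UNIV)"
  have "countable B" using D by (auto simp: B_def)
  moreover have "topological_basis B"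
  proof (rule topological_basisI)
    fix U :: "L2_01 set" and x assume "open U" "x \<in> U"
    then obtain e where e: "e > 0" "ball x e \<subseteq> U" by (auto simp: open_contains_ball)
    obtain n where n: "1 / real (Suc n) < e / 2" using e by (metis half_gt_zero nat_approx_posE)
    have "x \<in> closure D" using D by simp
    then obtain d where d: "d \<in> D" "dist d x < 1 / real (Suc n)"
      unfolding closure_approachable by (meson of_nat_0_less_iff zero_less_Suc zero_less_divide_1_iff)
    have "ball d (1 / real (Suc n)) \<subseteq> ball x e"
    proof
      fix y assume "y \<in> ball d (1 / real (Suc n))"
      then show "y \<in> ball x e"
        using d n dist_triangle[of x y d] by (simp add: dist_commute)
    qed
    then show "\<exists>B'\<in>B. x \<in> B' \<and> B' \<subseteq> U"
      using d e by (intro bexI[of _ "ball d (1 / real (Suc n))"]) (auto simp: B_def)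
  qed (auto simp: B_def)
  ultimately show "\<exists>B::L2_01 set set. countable B \<and> open = generate_topology B"
    by (auto dest: topological_basis_imp_subbasis)
qed

section \<open>Operators on $L_2[0,1]$ and the invariant subspace\<close>

definition self_adjoint :: "('a::real_inner \<Rightarrow>\<^sub>L 'a) \<Rightarrow> bool" where
  "self_adjoint X \<longleftrightarrow> (\<forall>u v. X u \<bullet> v = u \<bullet> X v)"

definition nonneg_operator :: "('a::real_inner \<Rightarrow>\<^sub>L 'a) \<Rightarrow> bool" where
  "nonneg_operator X \<longleftrightarrow> (\<forall>v. 0 \<le> v \<bullet> X v)"

text \<open>Graphon operators are the case of a bounded kernel.\<close>

definition symmetric_integral_operator :: "(L2_01 \<Rightarrow>\<^sub>L L2_01) \<Rightarrow> bool" where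
  "symmetric_integral_operator X \<longleftrightarrow>
    (\<exists>K :: real \<Rightarrow> real \<Rightarrow> real.
      (\<lambda>(\<alpha>, \<beta>). K \<alpha> \<beta>) \<in> borel_measurable (leb01 \<Otimes>\<^sub>M leb01) \<and>
      integrable (leb01 \<Otimes>\<^sub>M leb01) (\<lambda>(\<alpha>, \<beta>). (K \<alpha> \<beta>)\<^sup>2) \<and>
      (\<forall>\<alpha> \<beta>. K \<alpha> \<beta> = K \<beta> \<alpha>) \<and>
      (\<forall>v. AE \<alpha> in leb01. rep_L2_01 (X v) \<alpha> = (\<integral>\<beta>. K \<alpha> \<beta> * rep_L2_01 v \<beta> \<partial>leb01)))"

definition invariant_subspace :: "('a::real_inner \<Rightarrow>\<^sub>L 'a) \<Rightarrow> 'a set \<Rightarrow> bool" where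
  "invariant_subspace X S \<longleftrightarrow> subspace S \<and> (\<forall>v\<in>S. X v \<in> S)"

definition low_rank :: "('a::real_inner \<Rightarrow>\<^sub>L 'a) \<Rightarrow> 'a set \<Rightarrow> bool" where
  "low_rank X S \<longleftrightarrow> invariant_subspace X S \<and> (\<forall>v\<in>S\<^sup>\<bottom>. X v = 0)"

definition orthonormal_family :: "('n \<Rightarrow> 'a::real_inner) \<Rightarrow> bool" where
  "orthonormal_family f \<longleftrightarrow> (\<forall>i j. f i \<bullet> f j = (if i = j then 1 else 0))"

definition orth_proj :: "'a::real_inner set \<Rightarrow> 'a \<Rightarrow> 'a" where
  "orth_proj S v = (THE y. y \<in> S \<and> v - y \<in> S\<^sup>\<bottom>)"

lemma orth_proj_eqI:
  assumes "subspace S" "y \<in> S" "v - y \<in> S\<^sup>\<bottom>"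
  shows "orth_proj S v = y"
  unfolding orth_proj_def
proof (rule the_equality)
  fix z assume z: "z \<in> S \<and> v - z \<in> S\<^sup>\<bottom>"
  have "z - y \<in> S" using assms(1,2) z by (blast intro: subspace_diff)
  then have "(z - y) \<bullet> (v - y) = 0" "(z - y) \<bullet> (v - z) = 0"
    using assms(3) z unfolding orthogonal_comp_def orthogonal_def by blast+
  then have "(z - y) \<bullet> (z - y) = 0"
    using inner_diff_right[of "z - y" "v - y" "v - z"] by simp
  then show "z = y" by simp
qed (use assms in auto)

lemma
  fixes f :: "'n::finite \<Rightarrow> 'a::real_inner"
  assumes f: "orthonormal_family f"
  shows orth_proj_span_range: "orth_proj (span (range f)) v = (\<Sum>k\<in>UNIV. (v \<bullet> f k) *\<^sub>R f k)"
    and orth_proj_orthogonal_comp: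
      "orth_proj ((span (range f))\<^sup>\<bottom>) v = v - (\<Sum>k\<in>UNIV. (v \<bullet> f k) *\<^sub>R f k)"
proof -
  let ?S = "span (range f)" and ?y = "\<Sum>k\<in>UNIV. (v \<bullet> f k) *\<^sub>R f k"
  have y: "?y \<in> ?S" by (rule span_sum) (simp add: span_base span_scale)
  have "f j \<bullet> ?y = (\<Sum>k\<in>UNIV. if j = k then v \<bullet> f k else 0)" for j
    unfolding inner_sum_right using f by (intro sum.cong) (auto simp: orthonormal_family_def)
  then have "f j \<bullet> ?y = f j \<bullet> v" for j
    by (simp add: inner_commute)
  then have "orthogonal (v - ?y) (f j)" for j
    unfolding orthogonal_def inner_diff_left by (metis diff_self inner_commute)
  then have "orthogonal (v - ?y) z" if "z \<in> ?S" for z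
    using orthogonal_to_span[OF that, of "v - ?y"] by blast
  then have perp: "v - ?y \<in> ?S\<^sup>\<bottom>"
    by (simp add: orthogonal_comp_def orthogonal_commute)
  show "orth_proj ?S v = ?y" by (intro orth_proj_eqI y perp subspace_span)
  show "orth_proj (?S\<^sup>\<bottom>) v = v - ?y"
  proof (rule orth_proj_eqI[OF subspace_orthogonal_comp perp])
    have "v - (v - ?y) = ?y" by simp
    then show "v - (v - ?y) \<in> (?S\<^sup>\<bottom>)\<^sup>\<bottom>"
      using y by (simp add: orthogonal_comp_def orthogonal_commute)
  qed
qed

definition proj_matrix :: "('n \<Rightarrow> 'a::real_inner) \<Rightarrow> ('a \<Rightarrow>\<^sub>L 'a) \<Rightarrow> real^'n^'n" where
  "proj_matrix f X = (\<chi> i j. X (f i) \<bullet> f j)"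

definition proj_coords :: "('n \<Rightarrow> 'a::real_inner) \<Rightarrow> 'a \<Rightarrow> real^'n" where
  "proj_coords f v = (\<chi> k. orth_proj (span (range f)) v \<bullet> f k)"

definition op_exp :: "('a::real_normed_vector \<Rightarrow>\<^sub>L 'a) \<Rightarrow> ('a \<Rightarrow>\<^sub>L 'a)" where
  "op_exp G = (\<Sum>n. (1 / fact n) *\<^sub>R ((\<lambda>X. G o\<^sub>L X) ^^ n) id_blinfun)"

section \<open>Q-noise and Wiener integrals\<close>

definition standard_brownian_motion :: "'w measure \<Rightarrow> (real \<Rightarrow> 'w \<Rightarrow> real) \<Rightarrow> bool" where
  "standard_brownian_motion \<Omega> W \<longleftrightarrow>
    (\<forall>t\<ge>0. W t \<in> borel_measurable \<Omega>) \<and>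
    (AE \<omega> in \<Omega>. W 0 \<omega> = 0) \<and>
    (\<forall>\<tau> :: nat \<Rightarrow> real. \<forall>n. 0 \<le> \<tau> 0 \<and> incseq \<tau> \<longrightarrow>
      prob_space.indep_vars \<Omega> (\<lambda>_. borel) (\<lambda>i \<omega>. W (\<tau> (Suc i)) \<omega> - W (\<tau> i) \<omega>) {..<n}) \<and>
    (\<forall>s t. 0 \<le> s \<and> s < t \<longrightarrow>
      distributed \<Omega> lborel (\<lambda>\<omega>. W t \<omega> - W s \<omega>) (normal_density 0 (sqrt (t - s)))) \<and>
    (\<forall>\<omega>\<in>space \<Omega>. continuous_on {0..} (\<lambda>t. W t \<omega>))"

definition independent_processes :: "'w measure \<Rightarrow> ('n \<Rightarrow> real \<Rightarrow> 'w \<Rightarrow> real) \<Rightarrow> bool" where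
  "independent_processes \<Omega> W \<longleftrightarrow>
    prob_space.indep_vars \<Omega> (\<lambda>_. PiM {0..} (\<lambda>_. borel)) (\<lambda>k \<omega>. \<lambda>t\<in>{0..}. W k t \<omega>) UNIV"

definition Q_noise ::
  "'w measure \<Rightarrow> (L2_01 \<Rightarrow>\<^sub>L L2_01) \<Rightarrow> ('n::finite \<Rightarrow> L2_01) \<Rightarrow> ('n \<Rightarrow> real) \<Rightarrow>
    ('n \<Rightarrow> real \<Rightarrow> 'w \<Rightarrow> real) \<Rightarrow> (real \<Rightarrow> 'w \<Rightarrow> L2_01) \<Rightarrow> bool" where
  "Q_noise \<Omega> Q f lam W w \<longleftrightarrow>
    (\<forall>k. 0 \<le> lam k \<and> Q (f k) = lam k *\<^sub>R f k) \<and>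
    (\<forall>k. standard_brownian_motion \<Omega> (W k)) \<and>
    independent_processes \<Omega> W \<and>
    (\<forall>t\<ge>0. \<forall>\<omega>\<in>space \<Omega>. w t \<omega> = (\<Sum>k\<in>UNIV. (sqrt (lam k) * W k t \<omega>) *\<^sub>R f k))"

definition step_operator ::
  "nat \<Rightarrow> (nat \<Rightarrow> real) \<Rightarrow> (nat \<Rightarrow> (L2_01 \<Rightarrow>\<^sub>L L2_01)) \<Rightarrow> real \<Rightarrow> (L2_01 \<Rightarrow>\<^sub>L L2_01)" where
  "step_operator n \<tau> \<Psi> s = (\<Sum>i<n. indicat_real {\<tau> i<..\<tau> (Suc i)} s *\<^sub>R \<Psi> i)"

definition step_integral ::
  "nat \<Rightarrow> (nat \<Rightarrow> real) \<Rightarrow> (nat \<Rightarrow> (L2_01 \<Rightarrow>\<^sub>L L2_01)) \<Rightarrow> (real \<Rightarrow> 'w \<Rightarrow> L2_01) \<Rightarrow> 'w \<Rightarrow> L2_01" where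
  "step_integral n \<tau> \<Psi> w \<omega> = (\<Sum>i<n. \<Psi> i (w (\<tau> (Suc i)) \<omega> - w (\<tau> i) \<omega>))"

text \<open>\<open>Z\<close> is a version of $\int_0^t \Phi(s)\,dw_s$ for a deterministic operator-valued \<open>\<Phi>\<close>: the
  mean-square limit of the integrals of step functions that approximate \<open>\<Phi>\<close> in the norm
  $\int_0^t \mathrm{tr}(\Phi Q \Phi^*)\,ds = \int_0^t \sum_k \lambda_k \|\Phi(s) f_k\|^2\,ds$
  of the isometry.  It determines \<open>Z\<close> only almost surely.\<close>

definition has_wiener_integral ::
  "'w measure \<Rightarrow> ('n::finite \<Rightarrow> L2_01) \<Rightarrow> ('n \<Rightarrow> real) \<Rightarrow> (real \<Rightarrow> 'w \<Rightarrow> L2_01) \<Rightarrow> real \<Rightarrow>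
    (real \<Rightarrow> (L2_01 \<Rightarrow>\<^sub>L L2_01)) \<Rightarrow> ('w \<Rightarrow> L2_01) \<Rightarrow> bool" where
  "has_wiener_integral \<Omega> f lam w t \<Phi> Z \<longleftrightarrow>
    Z \<in> borel_measurable \<Omega> \<and>
    (\<forall>v. set_borel_measurable borel {0..t} (\<lambda>s. \<Phi> s v)) \<and>
    (\<exists>n \<tau> \<Psi>.
      (\<forall>j::nat. 0 \<le> \<tau> j 0 \<and> incseq (\<tau> j) \<and> \<tau> j (n j) \<le> t) \<and>
      (\<lambda>j. \<integral>\<^sup>+s\<in>{0..t}. ennreal (\<Sum>k\<in>UNIV.
          lam k * (norm ((step_operator (n j) (\<tau> j) (\<Psi> j) s - \<Phi> s) (f k)))\<^sup>2) \<partial>lborel)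
        \<longlonglongrightarrow> 0 \<and>
      (\<lambda>j. \<integral>\<^sup>+\<omega>. ennreal ((norm (step_integral (n j) (\<tau> j) (\<Psi> j) w \<omega> - Z \<omega>))\<^sup>2) \<partial>\<Omega>)
        \<longlonglongrightarrow> 0)"

section \<open>The control problem\<close>

definition natural_filtration :: "'w measure \<Rightarrow> (real \<Rightarrow> 'w \<Rightarrow> L2_01) \<Rightarrow> real \<Rightarrow> 'w measure" where
  "natural_filtration \<Omega> w t =
    sigma (space \<Omega>) {w s -` E \<inter> space \<Omega> | s E. 0 \<le> s \<and> s \<le> t \<and> E \<in> sets borel}"

definition time_prod :: "real \<Rightarrow> 'w measure \<Rightarrow> (real \<times> 'w) measure" where
  "time_prod T \<Omega> = restrict_space lborel {0..T} \<Otimes>\<^sub>M \<Omega>"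

text \<open>Joint measurability in \<open>(t, \<omega>)\<close> is the implicit assumption under which the time integrals
  below are defined.\<close>

definition admissible ::
  "'w measure \<Rightarrow> (real \<Rightarrow> 'w \<Rightarrow> L2_01) \<Rightarrow> real \<Rightarrow> (real \<Rightarrow> 'w \<Rightarrow> L2_01) \<Rightarrow> bool" where
  "admissible \<Omega> w T u \<longleftrightarrow>
    (\<lambda>(t, \<omega>). u t \<omega>) \<in> borel_measurable (time_prod T \<Omega>) \<and>
    (\<forall>t\<in>{0..T}. u t \<in> borel_measurable (natural_filtration \<Omega> w t)) \<and>
    (AE \<omega> in \<Omega>. (\<integral>\<^sup>+t\<in>{0..T}. ennreal ((norm (u t \<omega>))\<^sup>2) \<partial>lborel) < \<infinity>)"

text \<open>Mild solution of $dx_t = (G x_t + H u_t)\,dt + dw_t$ with initial state \<open>x0\<close>: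
  $x_t = e^{tG} x_0 + \int_0^t e^{(t-s)G} H u_s\,ds + \int_0^t e^{(t-s)G}\,dw_s$
  almost surely, for each \<open>t\<close>.  As the right-hand side determines \<open>x\<close> up to modification,
  adaptedness of \<open>x\<close> is not required separately.\<close>

definition mild_solution ::
  "'w measure \<Rightarrow> ('n::finite \<Rightarrow> L2_01) \<Rightarrow> ('n \<Rightarrow> real) \<Rightarrow> (real \<Rightarrow> 'w \<Rightarrow> L2_01) \<Rightarrow> real \<Rightarrow>
    (L2_01 \<Rightarrow>\<^sub>L L2_01) \<Rightarrow> (L2_01 \<Rightarrow>\<^sub>L L2_01) \<Rightarrow> L2_01 \<Rightarrow>
    (real \<Rightarrow> 'w \<Rightarrow> L2_01) \<Rightarrow> (real \<Rightarrow> 'w \<Rightarrow> L2_01) \<Rightarrow> bool" where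
  "mild_solution \<Omega> f lam w T G H x0 u x \<longleftrightarrow>
    (\<lambda>(t, \<omega>). x t \<omega>) \<in> borel_measurable (time_prod T \<Omega>) \<and>
    (\<forall>t\<in>{0..T}. \<exists>Z.
      has_wiener_integral \<Omega> f lam w t (\<lambda>s. op_exp ((t - s) *\<^sub>R G)) Z \<and>
      (AE \<omega> in \<Omega>. x t \<omega> = op_exp (t *\<^sub>R G) x0
        + (LINT s:{0..t}|lborel. op_exp ((t - s) *\<^sub>R G) (H (u s \<omega>))) + Z \<omega>))"

text \<open>The cost takes values in $[0,\infty]$; \<open>ennreal\<close> does not truncate anything when the three
  weight operators are non-negative.\<close>

definition lq_cost ::
  "'w measure \<Rightarrow> real \<Rightarrow> (L2_01 \<Rightarrow>\<^sub>L L2_01) \<Rightarrow> (L2_01 \<Rightarrow>\<^sub>L L2_01) \<Rightarrow> (L2_01 \<Rightarrow>\<^sub>L L2_01) \<Rightarrow>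
    (real \<Rightarrow> 'w \<Rightarrow> L2_01) \<Rightarrow> (real \<Rightarrow> 'w \<Rightarrow> L2_01) \<Rightarrow> ennreal" where
  "lq_cost \<Omega> T CM CR CMT u x =
    (\<integral>\<^sup>+\<omega>. ((\<integral>\<^sup>+t\<in>{0..T}. ennreal (x t \<omega> \<bullet> CM (x t \<omega>) + u t \<omega> \<bullet> CR (u t \<omega>)) \<partial>lborel)
        + ennreal (x T \<omega> \<bullet> CMT (x T \<omega>))) \<partial>\<Omega>)"

definition lq_optimal ::
  "'w measure \<Rightarrow> ('n::finite \<Rightarrow> L2_01) \<Rightarrow> ('n \<Rightarrow> real) \<Rightarrow> (real \<Rightarrow> 'w \<Rightarrow> L2_01) \<Rightarrow> real \<Rightarrow>
    (L2_01 \<Rightarrow>\<^sub>L L2_01) \<Rightarrow> (L2_01 \<Rightarrow>\<^sub>L L2_01) \<Rightarrow>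
    (L2_01 \<Rightarrow>\<^sub>L L2_01) \<Rightarrow> (L2_01 \<Rightarrow>\<^sub>L L2_01) \<Rightarrow> (L2_01 \<Rightarrow>\<^sub>L L2_01) \<Rightarrow> L2_01 \<Rightarrow>
    (real \<Rightarrow> 'w \<Rightarrow> L2_01) \<Rightarrow> (real \<Rightarrow> 'w \<Rightarrow> L2_01) \<Rightarrow> bool" where
  "lq_optimal \<Omega> f lam w T G H CM CR CMT x0 u x \<longleftrightarrow>
    admissible \<Omega> w T u \<and> mild_solution \<Omega> f lam w T G H x0 u x \<and>
    (\<forall>v y. admissible \<Omega> w T v \<and> mild_solution \<Omega> f lam w T G H x0 v y \<longrightarrow>
      lq_cost \<Omega> T CM CR CMT u x \<le> lq_cost \<Omega> T CM CR CMT v y)"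

definition matrix_riccati ::
  "real^'n^'n \<Rightarrow> real \<Rightarrow> real^'n^'n \<Rightarrow> real \<Rightarrow> real^'n^'n \<Rightarrow> real \<Rightarrow> real^'n^'n \<Rightarrow> real \<Rightarrow>
    real^'n^'n \<Rightarrow> real \<Rightarrow> real \<Rightarrow> (real \<Rightarrow> real^'n^'n) \<Rightarrow> bool" where
  "matrix_riccati A a B b M m MT mT R r T P \<longleftrightarrow>
    (\<forall>t\<in>{0..T}. (P has_vector_derivative
      - (transpose (A + mat a) ** P t + P t ** (A + mat a)
         - P t ** transpose (B + mat b) ** matrix_inv (R + mat r) ** (B + mat b) ** P t
         + (M + mat m))) (at t within {0..T})) \<and>
    P T = MT + mat mT"

definition scalar_riccati ::
  "real \<Rightarrow> real \<Rightarrow> real \<Rightarrow> real \<Rightarrow> real \<Rightarrow> real \<Rightarrow> (real \<Rightarrow> real) \<Rightarrow> bool" where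
  "scalar_riccati a b m mT r T p \<longleftrightarrow>
    (\<forall>t\<in>{0..T}. (p has_real_derivative
      - (2 * a * p t - b\<^sup>2 / r * (p t)\<^sup>2 + m)) (at t within {0..T})) \<and>
    p T = mT"

definition feedback_control ::
  "('n::finite \<Rightarrow> L2_01) \<Rightarrow> real^'n^'n \<Rightarrow> real \<Rightarrow> real^'n^'n \<Rightarrow> real \<Rightarrow>
    real^'n^'n \<Rightarrow> real \<Rightarrow> L2_01 \<Rightarrow> L2_01" where
  "feedback_control f B b R r Pt pt v =
    (\<Sum>k\<in>UNIV. ((- matrix_inv (R + mat r) ** transpose (B + mat b) ** Pt) *v proj_coords f v) $ k *\<^sub>R f k)
    + (- (b / r) * pt) *\<^sub>R orth_proj ((span (range f))\<^sup>\<bottom>) v"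

definition closed_loop ::
  "'w measure \<Rightarrow> ('n::finite \<Rightarrow> L2_01) \<Rightarrow> ('n \<Rightarrow> real) \<Rightarrow> (real \<Rightarrow> 'w \<Rightarrow> L2_01) \<Rightarrow> real \<Rightarrow>
    (L2_01 \<Rightarrow>\<^sub>L L2_01) \<Rightarrow> (L2_01 \<Rightarrow>\<^sub>L L2_01) \<Rightarrow> L2_01 \<Rightarrow> (real \<Rightarrow> L2_01 \<Rightarrow> L2_01) \<Rightarrow>
    (real \<Rightarrow> 'w \<Rightarrow> L2_01) \<Rightarrow> (real \<Rightarrow> 'w \<Rightarrow> L2_01) \<Rightarrow> bool" where
  "closed_loop \<Omega> f lam w T G H x0 K u x \<longleftrightarrow>
    admissible \<Omega> w T u \<and> mild_solution \<Omega> f lam w T G H x0 u x \<and>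
    (\<forall>t\<in>{0..T}. AE \<omega> in \<Omega>. u t \<omega> = K t (x t \<omega>))"

end

theory Submission imports Defs begin

text \<open>
  The cost is a convex quadratic functional of the control and the state depends affinely on the
  control, so the feedback control is optimal if and only if the first variation of the cost
  vanishes there.  Write $(u, X)$ for the control and the state of the closed loop.  For any other
  admissible control $v$ of finite cost with state $y$ put $\eta = v - u$ and $\delta = y - X$.  The noise is additive
  and drops out of the difference, which leaves
  $\delta_t = \int_0^t e^{(t-s)G} H \eta_s\,ds$ (lemma \<open>mild_difference\<close>), and the cost expands to
  $J(v) = J(u) + 2 L(\eta) + q(\eta)$ with $q(\eta) \ge r\, E \int \eta_t \cdot \eta_t\,dt$ and
  $L(\eta) = E \int \delta_t \cdot C_M X_t\,dt + E \int \eta_t \cdot C_R u_t\,dt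
    + E\, \delta_T \cdot C_{M_T} X_T$.
  If $L(\eta) = 0$, the control $u$ is optimal, and it is the only optimal one up to null sets
  because $q$ is positive definite (theorems \<open>closed_loop_minimizes\<close> and \<open>closed_loop_optimal\<close>).

  That $L$ vanishes is the heart of the matter (lemma \<open>cross_term_zero\<close>).  Fubini moves the
  convolution to the other factor: with the adjoint state
  $\Lambda_s = \int_s^T e^{(t-s)G} C_M X_t\,dt + e^{(T-s)G} C_{M_T} X_T$ one has
  $L(\eta) = E \int \eta_s \cdot (H \Lambda_s + C_R u_s)\,ds$, and $C_R K_s = - H P_s$ turns this into
  $E \int H \eta_s \cdot (\Lambda_s - P_s X_s)\,ds$.  Here $P$ solves the operator Riccati equation, so
  differentiating $e^{(t-s)G} P_t (X_t - w_t + w_s)$ with respect to $t \ge s$ shows that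
  $\Lambda_s - P_s X_s$ is a linear functional of the noise increments $w_t - w_s$, $t \ge s$
  (lemma \<open>adjoint_gap_eq\<close>).  These are orthogonal to the adapted $\eta_s$
  (lemma \<open>adjoint_gap_orthogonal\<close>).  The noise being additive, $X - w$ is differentiable in $t$,
  and this computation is ordinary calculus along each path.

  For the same reason the closed loop is solved path by path as a linear differential equation
  for $X - w$ (lemma \<open>state_exists\<close>), and the stochastic convolution has the continuous version
  $w_t + \int_0^t e^{(t-s)G} G w_s\,ds$ (theorem \<open>noise_conv_wiener_integral\<close>), which is the only
  one up to null sets by the isometry of the Wiener integral.  The closed loop is unique because
  the difference of two solutions satisfies a homogeneous Volterra equation.

  The Riccati equation is solved on the whole interval by $P_t = Y_t X_t^{-1}$, where $(X, Y)$ solves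
  the linear Hamiltonian system; nonnegativity of the weights keeps $X_t$ invertible
  (lemma \<open>hamiltonian_flow_injective\<close>, theorem \<open>riccati_solution_exists\<close>).  Finally, every operator of
  the problem acts as a matrix on the coordinates with respect to $f$ and as a scalar on the
  orthogonal complement (lemma \<open>low_rank_eq_lift\<close>).  Operators of this form are an algebra, in
  which the operator Riccati equation is the pair of the matrix and the scalar one and the gain
  $K$ is the stated feedback.
\<close>

section \<open>Linear differential equations in a Banach space\<close>

lemma has_vector_derivative_suminf:
  fixes y :: "nat \<Rightarrow> real \<Rightarrow> 'b::banach"
  assumes "convex S" "\<And>n t. t \<in> S \<Longrightarrow> (y n has_vector_derivative y' n t) (at t within S)"
    and M: "\<And>n t. t \<in> S \<Longrightarrow> norm (y' n t) \<le> M n" "summable M"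
    and "t0 \<in> S" "summable (\<lambda>n. y n t0)" "t \<in> S"
  shows "((\<lambda>t. \<Sum>n. y n t) has_vector_derivative (\<Sum>n. y' n t)) (at t within S)"
proof -
  have unif: "uniform_limit S (\<lambda>n t. \<Sum>i<n. y' i t) (\<lambda>t. \<Sum>i. y' i t) sequentially"
    by (rule Weierstrass_m_test[OF M])
  have "\<exists>g. \<forall>x\<in>S. (\<lambda>n. y n x) sums (g x)
      \<and> (g has_derivative (\<lambda>h. h *\<^sub>R (\<Sum>i. y' i x))) (at x within S)"
  proof (rule has_derivative_series[OF assms(1) _ _ \<open>t0 \<in> S\<close>])
    show "(y n has_derivative (\<lambda>h. h *\<^sub>R y' n x)) (at x within S)" if "x \<in> S" for n x
      using assms(2)[OF that] by (simp add: has_vector_derivative_def)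
    show "(\<lambda>n. y n t0) sums (\<Sum>n. y n t0)" using assms(6) by (rule summable_sums)
    fix e :: real assume "e > 0"
    from uniform_limitD[OF unif this]
    show "\<forall>\<^sub>F n in sequentially. \<forall>x\<in>S. \<forall>h. norm ((\<Sum>i<n. h *\<^sub>R y' i x) - h *\<^sub>R (\<Sum>i. y' i x))
        \<le> e * norm h"
    proof eventually_elim
      case (elim n)
      show ?case
      proof (intro ballI allI)
        fix x h assume "x \<in> S"
        have "norm ((\<Sum>i<n. h *\<^sub>R y' i x) - h *\<^sub>R (\<Sum>i. y' i x))
            = \<bar>h\<bar> * dist (\<Sum>i<n. y' i x) (\<Sum>i. y' i x)"
          by (simp flip: scaleR_sum_right scaleR_diff_right add: dist_norm)
        also have "\<dots> \<le> \<bar>h\<bar> * e" using elim \<open>x \<in> S\<close> by (intro mult_left_mono) (auto intro: less_imp_le)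
        finally show "norm ((\<Sum>i<n. h *\<^sub>R y' i x) - h *\<^sub>R (\<Sum>i. y' i x)) \<le> e * norm h"
          by (simp add: mult.commute)
      qed
    qed
  qed
  then obtain g where g: "\<And>x. x \<in> S \<Longrightarrow> (\<lambda>n. y n x) sums (g x)"
    "\<And>x. x \<in> S \<Longrightarrow> (g has_derivative (\<lambda>h. h *\<^sub>R (\<Sum>i. y' i x))) (at x within S)" by blast
  have "((\<lambda>t. \<Sum>n. y n t) has_derivative (\<lambda>h. h *\<^sub>R (\<Sum>i. y' i t))) (at t within S)"
    by (rule has_derivative_transform[OF \<open>t \<in> S\<close> _ g(2)[OF \<open>t \<in> S\<close>]])
      (use g(1) in \<open>auto simp: sums_iff\<close>)
  then show ?thesis by (simp add: has_vector_derivative_def)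
qed

text \<open>Instead of the Picard iterates these are their successive differences, so that the solution is a series.\<close>

primrec picard :: "(real \<Rightarrow> 'a \<Rightarrow>\<^sub>L 'a) \<Rightarrow> 'a \<Rightarrow> nat \<Rightarrow> real \<Rightarrow> 'a::banach" where
  "picard F x0 0 = (\<lambda>t. x0)"
| "picard F x0 (Suc n) = (\<lambda>t. integral {0..t} (\<lambda>s. F s (picard F x0 n s)))"

lemma blinfun_apply_continuous_on:
  assumes "continuous_on S F" "continuous_on S x"
  shows "continuous_on S (\<lambda>s. blinfun_apply (F s) (x s))"
  by (intro continuous_intros assms)

lemma picard_deriv:
  fixes F :: "real \<Rightarrow> 'a::banach \<Rightarrow>\<^sub>L 'a"
  assumes F: "continuous_on {0..T} F"
  shows "t \<in> {0..T} \<Longrightarrow> (picard F x0 (Suc n) has_vector_derivative F t (picard F x0 n t)) (at t within {0..T})"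
    and "continuous_on {0..T} (picard F x0 n)"
proof -
  have c: "continuous_on {0..T} (picard F x0 n)" for n
  proof (induction n)
    case (Suc n)
    then show ?case
      by (auto intro!: indefinite_integral_continuous_1 integrable_continuous_interval
          blinfun_apply_continuous_on F)
  qed simp
  show "continuous_on {0..T} (picard F x0 n)" by (rule c)
  show "t \<in> {0..T} \<Longrightarrow> (picard F x0 (Suc n) has_vector_derivative F t (picard F x0 n t)) (at t within {0..T})"
    unfolding picard.simps
    by (rule integral_has_vector_derivative) (auto intro!: blinfun_apply_continuous_on F c)
qed

lemma picard_bound:
  fixes F :: "real \<Rightarrow> 'a::banach \<Rightarrow>\<^sub>L 'a"
  assumes F: "continuous_on {0..T} F" and L: "\<And>t. t \<in> {0..T} \<Longrightarrow> norm (F t) \<le> L" and t: "t \<in> {0..T}"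
  shows "norm (picard F x0 n t) \<le> norm x0 * (L * t) ^ n / fact n"
  using t
proof (induction n arbitrary: t)
  case (Suc n)
  have L0: "0 \<le> L" using L[OF \<open>t \<in> {0..T}\<close>] norm_ge_zero order_trans by blast
  have t: "{0..t} \<subseteq> {0..T}" using Suc by auto
  let ?g = "\<lambda>s. norm x0 * L ^ Suc n / fact n * s ^ n"
  have der: "((\<lambda>s. norm x0 * (L * s) ^ Suc n / fact (Suc n)) has_vector_derivative ?g s) (at s within {0..t})" for s
  proof -
    have "((\<lambda>s. norm x0 * L ^ Suc n / fact (Suc n) * s ^ Suc n) has_real_derivative
        norm x0 * L ^ Suc n / fact (Suc n) * (real (Suc n) * s ^ n)) (at s within {0..t})"
      using DERIV_pow[of "Suc n" s "{0..t}"] by (intro DERIV_cmult) simp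
    moreover have "norm x0 * L ^ Suc n / fact (Suc n) * (real (Suc n) * s ^ n) = ?g s"
      by (simp add: fact_Suc field_simps del: of_nat_Suc)
    moreover have "(\<lambda>s. norm x0 * L ^ Suc n / fact (Suc n) * s ^ Suc n)
        = (\<lambda>s. norm x0 * (L * s) ^ Suc n / fact (Suc n))"
      by (simp add: power_mult_distrib mult_ac del: power_Suc fact_Suc)
    ultimately show ?thesis
      by (simp only: has_real_derivative_iff_has_vector_derivative)
  qed
  have int: "(?g has_integral norm x0 * (L * t) ^ Suc n / fact (Suc n)) {0..t}"
    using fundamental_theorem_of_calculus[of 0 t "\<lambda>s. norm x0 * (L * s) ^ Suc n / fact (Suc n)" ?g] der Suc.prems
    by simp
  have "norm (integral {0..t} (\<lambda>s. F s (picard F x0 n s))) \<le> integral {0..t} ?g"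
  proof (rule integral_norm_bound_integral)
    show "(\<lambda>s. F s (picard F x0 n s)) integrable_on {0..t}"
      by (intro integrable_continuous_interval blinfun_apply_continuous_on
          continuous_on_subset[OF F t] continuous_on_subset[OF picard_deriv(2)[OF F] t])
    show "?g integrable_on {0..t}" using int by blast
    fix s assume s: "s \<in> {0..t}"
    have "norm (F s (picard F x0 n s)) \<le> L * (norm x0 * (L * s) ^ n / fact n)"
      using s t by (intro order_trans[OF norm_blinfun] mult_mono L Suc.IH L0) auto
    then show "norm (F s (picard F x0 n s)) \<le> ?g s"
      by (simp add: power_mult_distrib field_simps)
  qed
  then show ?case using integral_unique[OF int] by (simp only: picard.simps)
qed simp

lemma continuous_bounded_Icc:
  fixes F :: "real \<Rightarrow> 'b::real_normed_vector"
  assumes "continuous_on {a..b} F"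
  obtains L where "0 < L" "\<And>t. t \<in> {a..b} \<Longrightarrow> norm (F t) \<le> L"
proof -
  have "bounded (F ` {a..b})"
    by (intro compact_imp_bounded compact_continuous_image assms) simp
  then show ?thesis unfolding bounded_pos using that by auto
qed

lemma summable_power_div_fact: "summable (\<lambda>k. (c::real) ^ k / fact k)"
  using summable_exp_generic[of c] by (simp add: field_simps)

theorem linear_ode_solution_exists:
  fixes F :: "real \<Rightarrow> 'a::banach \<Rightarrow>\<^sub>L 'a"
  assumes F: "continuous_on {0..T} F"
  obtains x where "x 0 = x0"
    "\<And>t. t \<in> {0..T} \<Longrightarrow> (x has_vector_derivative F t (x t)) (at t within {0..T})"
proof (cases "0 \<le> T")
  case True
  obtain L where L: "0 < L" "\<And>t. t \<in> {0..T} \<Longrightarrow> norm (F t) \<le> L"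
    using continuous_bounded_Icc[OF F] by metis
  define y' where "y' n t = (case n of 0 \<Rightarrow> 0 | Suc k \<Rightarrow> F t (picard F x0 k t))" for n t
  define M where "M n = (case n of 0 \<Rightarrow> 0 | Suc k \<Rightarrow> L * (norm x0 * ((L * T) ^ k / fact k)))" for n
  have sM: "summable M"
    by (rule summable_Suc_iff[THEN iffD1]) (unfold M_def nat.case, intro summable_mult summable_power_div_fact)
  have der: "(picard F x0 n has_vector_derivative y' n t) (at t within {0..T})" if "t \<in> {0..T}" for n t
    using picard_deriv(1)[OF F that] by (cases n) (auto simp: y'_def)
  have bd: "norm (y' n t) \<le> M n" if t: "t \<in> {0..T}" for n t
  proof (cases n)
    case (Suc k)
    have "norm (F t (picard F x0 k t)) \<le> L * (norm x0 * (L * t) ^ k / fact k)"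
      using t L(1) by (intro order_trans[OF norm_blinfun] mult_mono L picard_bound[OF F L(2)]) auto
    also have "\<dots> \<le> L * (norm x0 * (L * T) ^ k / fact k)"
      using t L(1) by (intro mult_left_mono divide_right_mono power_mono) auto
    finally show ?thesis using Suc by (simp add: y'_def M_def)
  qed (simp add: y'_def M_def)
  have summ: "summable (\<lambda>n. picard F x0 n t)" if "t \<in> {0..T}" for t
    by (rule summable_comparison_test'[OF summable_mult[OF summable_power_div_fact[of "L * t"], of "norm x0"], of 0])
      (use picard_bound[OF F L(2) that] in simp)
  define x where "x t = (\<Sum>n. picard F x0 n t)" for t
  have "(x has_vector_derivative F t (x t)) (at t within {0..T})" if t: "t \<in> {0..T}" for t
  proof -
    have "(x has_vector_derivative (\<Sum>n. y' n t)) (at t within {0..T})"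
      unfolding x_def
      by (rule has_vector_derivative_suminf[OF _ der bd sM t summ[OF t] t]) auto
    moreover have "(\<Sum>n. y' n t) = (\<Sum>n. y' (Suc n) t)"
      by (subst suminf_split_head) (auto intro!: summable_comparison_test'[OF sM] bd[OF t], simp add: y'_def)
    moreover have "(\<Sum>n. y' (Suc n) t) = F t (x t)"
      unfolding x_def y'_def
      by (simp add: bounded_linear.suminf[OF blinfun.bounded_linear_right summ[OF t]])
    ultimately show ?thesis by simp
  qed
  moreover have "x 0 = x0"
  proof -
    have "picard F x0 n 0 = (if n = 0 then x0 else 0)" for n by (cases n) auto
    then have "(\<lambda>n. picard F x0 n 0) = (\<lambda>n. if n = 0 then x0 else 0)" by (rule ext)
    then show ?thesis unfolding x_def using sums_single[of 0 "\<lambda>_. x0"] by (simp add: sums_iff)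
  qed
  ultimately show ?thesis using that by blast
qed (use that[of "\<lambda>_. x0"] in auto)

lemma gronwall:
  fixes \<phi> :: "real \<Rightarrow> real"
  assumes \<phi>: "continuous_on {0..T} \<phi>" and L: "0 \<le> L"
    and le: "\<And>t. t \<in> {0..T} \<Longrightarrow> \<phi> t \<le> a + L * integral {0..t} \<phi>" and t: "t \<in> {0..T}"
  shows "\<phi> t \<le> a * exp (L * t)"
proof -
  define \<psi> where "\<psi> t = exp (- L * t) * (a + L * integral {0..t} \<phi>)" for t
  have der: "(\<psi> has_real_derivative exp (- L * s) * L * (\<phi> s - (a + L * integral {0..s} \<phi>)))
      (at s within {0..T})" if "s \<in> {0..T}" for s
    unfolding \<psi>_def
    using integral_has_real_derivative[OF \<phi> that]
    by (auto intro!: derivative_eq_intros simp: algebra_simps)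
  have "\<psi> t \<le> \<psi> 0"
  proof (cases "t = 0")
    case False
    show ?thesis
    proof (rule DERIV_nonpos_imp_decreasing_open[of 0 t \<psi>])
      show "continuous_on {0..t} \<psi>"
        by (rule continuous_on_subset[of "{0..T}"])
          (use t in \<open>auto simp: continuous_on_eq_continuous_within intro!: DERIV_continuous[OF der]\<close>)
      fix s assume s: "0 < s" "s < t"
      then have "(\<psi> has_real_derivative exp (- L * s) * L * (\<phi> s - (a + L * integral {0..s} \<phi>))) (at s)"
        using der[of s] t by (simp add: at_within_Icc_at)
      moreover have "exp (- L * s) * L * (\<phi> s - (a + L * integral {0..s} \<phi>)) \<le> 0"
        using le[of s] s t L by (intro mult_nonneg_nonpos) auto
      ultimately show "\<exists>y. DERIV \<psi> s :> y \<and> y \<le> 0" by blast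
    qed (use t in auto)
  qed simp
  then have "exp (- L * t) * (a + L * integral {0..t} \<phi>) \<le> a" by (simp add: \<psi>_def)
  then have "exp (L * t) * (exp (- L * t) * (a + L * integral {0..t} \<phi>)) \<le> exp (L * t) * a"
    by (intro mult_left_mono) auto
  then have "a + L * integral {0..t} \<phi> \<le> a * exp (L * t)"
    by (simp add: mult.assoc[symmetric] exp_add[symmetric] mult.commute)
  then show ?thesis using le[OF t] by linarith
qed

section \<open>The exponential of a bounded operator\<close>

lemma comp_power_scaleR:
  fixes G :: "'a::real_normed_vector \<Rightarrow>\<^sub>L 'a"
  shows "((\<lambda>X. (t *\<^sub>R G) o\<^sub>L X) ^^ n) id_blinfun = t ^ n *\<^sub>R ((\<lambda>X. G o\<^sub>L X) ^^ n) id_blinfun"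
  by (induction n) (auto simp: blinfun.scaleR_left blinfun.scaleR_right intro!: blinfun_eqI)

lemma norm_comp_power:
  fixes G :: "'a::real_normed_vector \<Rightarrow>\<^sub>L 'a"
  shows "norm (((\<lambda>X. G o\<^sub>L X) ^^ n) id_blinfun) \<le> norm G ^ n"
proof (induction n)
  case (Suc n)
  then show ?case
    by (auto intro!: order_trans[OF norm_blinfun_compose] mult_left_mono)
qed (simp add: norm_blinfun_id_le)

lemma blinfun_compose_assoc: "(X o\<^sub>L Y) o\<^sub>L Z = X o\<^sub>L (Y o\<^sub>L Z)"
  by (rule blinfun_eqI) simp

lemma comp_power_commute:
  fixes G :: "'a::real_normed_vector \<Rightarrow>\<^sub>L 'a"
  shows "G o\<^sub>L ((\<lambda>X. G o\<^sub>L X) ^^ n) id_blinfun = ((\<lambda>X. G o\<^sub>L X) ^^ n) id_blinfun o\<^sub>L G"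
proof (induction n)
  case (Suc n)
  have "G o\<^sub>L (G o\<^sub>L X) = (G o\<^sub>L X) o\<^sub>L G" if "G o\<^sub>L X = X o\<^sub>L G" for X
    using that by (metis blinfun_compose_assoc)
  with Suc show ?case by simp
qed (auto intro!: blinfun_eqI)

lemma op_exp_scaleR:
  fixes G :: "'a::real_normed_vector \<Rightarrow>\<^sub>L 'a"
  shows "op_exp (t *\<^sub>R G) = (\<Sum>n. (t ^ n / fact n) *\<^sub>R ((\<lambda>X. G o\<^sub>L X) ^^ n) id_blinfun)"
  by (simp add: op_exp_def comp_power_scaleR)

lemma op_exp_summable:
  fixes G :: "'a::banach \<Rightarrow>\<^sub>L 'a"
  shows "summable (\<lambda>n. (t ^ n / fact n) *\<^sub>R ((\<lambda>X. G o\<^sub>L X) ^^ n) id_blinfun)"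
proof (rule summable_comparison_test'[of "\<lambda>n. (\<bar>t\<bar> * norm G) ^ n / fact n" 0])
  show "summable (\<lambda>n. (\<bar>t\<bar> * norm G) ^ n / fact n)"
    by (rule summable_power_div_fact)
  show "norm ((t ^ n / fact n) *\<^sub>R ((\<lambda>X. G o\<^sub>L X) ^^ n) id_blinfun) \<le> (\<bar>t\<bar> * norm G) ^ n / fact n" for n
    using mult_left_mono[OF norm_comp_power[where G=G and n=n], of "\<bar>t\<bar> ^ n / fact n"]
    by (simp add: power_mult_distrib power_abs)
qed

lemma op_exp_0: "op_exp (0 *\<^sub>R G) = id_blinfun" for G :: "'a::banach \<Rightarrow>\<^sub>L 'a"
proof -
  have "(\<lambda>n. (0 ^ n / fact n) *\<^sub>R ((\<lambda>X. G o\<^sub>L X) ^^ n) id_blinfun)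
      = (\<lambda>n. if n = 0 then id_blinfun else 0)" by (auto simp: fun_eq_iff)
  then show ?thesis
    unfolding op_exp_scaleR using sums_single[of 0 "\<lambda>_. id_blinfun"] by (simp add: sums_iff)
qed

lemma op_exp_commute:
  fixes G :: "'a::banach \<Rightarrow>\<^sub>L 'a"
  shows "G o\<^sub>L op_exp (t *\<^sub>R G) = op_exp (t *\<^sub>R G) o\<^sub>L G"
proof -
  have l: "bounded_linear (\<lambda>X. G o\<^sub>L X)" and r: "bounded_linear (\<lambda>X. X o\<^sub>L G)"
    by (simp_all add: bounded_bilinear.bounded_linear_left bounded_bilinear.bounded_linear_right
        bounded_bilinear_blinfun_compose)
  have "G o\<^sub>L ((t ^ n / fact n) *\<^sub>R ((\<lambda>X. G o\<^sub>L X) ^^ n) id_blinfun)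
      = ((t ^ n / fact n) *\<^sub>R ((\<lambda>X. G o\<^sub>L X) ^^ n) id_blinfun) o\<^sub>L G" for n
    using comp_power_commute[of G n] linear_cmul[OF bounded_linear.linear[OF l]]
      linear_cmul[OF bounded_linear.linear[OF r]] by metis
  then show ?thesis
    unfolding op_exp_scaleR bounded_linear.suminf[OF l op_exp_summable]
      bounded_linear.suminf[OF r op_exp_summable] by (simp only:)
qed

lemma op_exp_has_vector_derivative:
  fixes G :: "'a::banach \<Rightarrow>\<^sub>L 'a"
  shows "((\<lambda>t. op_exp (t *\<^sub>R G)) has_vector_derivative G o\<^sub>L op_exp (t *\<^sub>R G)) (at t within S)"
proof -
  let ?P = "\<lambda>n. ((\<lambda>X. G o\<^sub>L X) ^^ n) id_blinfun"
  define R where "R = \<bar>t\<bar> + 1"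
  define I where "I = {-R<..<R}"
  define y' where "y' n s = (case n of 0 \<Rightarrow> 0 | Suc k \<Rightarrow> (s ^ k / fact k) *\<^sub>R ?P (Suc k))" for n and s :: real
  define M where "M n = (case n of 0 \<Rightarrow> 0 | Suc k \<Rightarrow> norm G * ((R * norm G) ^ k / fact k))" for n
  have R: "t \<in> I" "0 < R" "0 \<in> I" by (auto simp: R_def I_def)
  have sM: "summable M"
    by (rule summable_Suc_iff[THEN iffD1]) (unfold M_def nat.case, intro summable_mult summable_power_div_fact)
  have "((\<lambda>t. \<Sum>n. (t ^ n / fact n) *\<^sub>R ?P n) has_vector_derivative (\<Sum>n. y' n t)) (at t within I)"
  proof (rule has_vector_derivative_suminf[OF _ _ _ sM R(3) op_exp_summable R(1)])
    fix n s assume s: "s \<in> I"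
    show "((\<lambda>t. (t ^ n / fact n) *\<^sub>R ?P n) has_vector_derivative y' n s) (at s within I)"
    proof (cases n)
      case (Suc k)
      have "((\<lambda>t. t ^ Suc k / fact (Suc k)) has_real_derivative real (Suc k) * s ^ k / fact (Suc k)) (at s within I)"
        using DERIV_pow[of "Suc k" s I] by (intro DERIV_cdivide) simp
      moreover have "real (Suc k) * s ^ k / fact (Suc k) = s ^ k / fact k"
        by (simp add: fact_Suc del: of_nat_Suc)
      ultimately have "((\<lambda>t. t ^ Suc k / fact (Suc k)) has_real_derivative s ^ k / fact k) (at s within I)"
        by (simp only:)
      then show ?thesis unfolding Suc y'_def nat.case
        by (auto intro!: has_vector_derivative_eq_rhs[OF has_vector_derivative_scaleR] simp del: power_Suc fact_Suc)
    qed (auto simp: y'_def)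
    show "norm (y' n s) \<le> M n"
    proof (cases n)
      case (Suc k)
      have "norm ((s ^ k / fact k) *\<^sub>R ?P (Suc k)) \<le> (R ^ k / fact k) * norm G ^ Suc k"
        using s unfolding norm_scaleR
        by (intro mult_mono norm_comp_power)
          (auto simp: I_def power_abs abs_mult intro!: divide_right_mono power_mono)
      then show ?thesis by (simp add: Suc y'_def M_def power_mult_distrib mult_ac)
    qed (simp add: y'_def M_def)
  qed (auto simp: I_def)
  moreover have "(\<Sum>n. y' n t) = G o\<^sub>L op_exp (t *\<^sub>R G)"
  proof -
    have l: "bounded_linear (\<lambda>X. G o\<^sub>L X)"
      by (simp add: bounded_bilinear.bounded_linear_right bounded_bilinear_blinfun_compose)
    have eq: "y' (Suc n) t = G o\<^sub>L ((t ^ n / fact n) *\<^sub>R ?P n)" for n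
      using linear_cmul[OF bounded_linear.linear[OF l], of "t ^ n / fact n" "?P n"]
      by (simp add: y'_def)
    have "summable (\<lambda>n. y' (Suc n) t)"
      unfolding eq by (rule bounded_linear.summable[OF l op_exp_summable])
    then have "summable (\<lambda>n. y' n t)" by (rule summable_Suc_iff[THEN iffD1])
    moreover have "y' 0 t = 0" by (simp add: y'_def)
    ultimately have "(\<Sum>n. y' n t) = (\<Sum>n. y' (Suc n) t)"
      using suminf_split_head[of "\<lambda>n. y' n t"] by (simp only: diff_zero)
    then show ?thesis
      unfolding op_exp_scaleR bounded_linear.suminf[OF l op_exp_summable] eq .
  qed
  ultimately have "((\<lambda>t. op_exp (t *\<^sub>R G)) has_vector_derivative G o\<^sub>L op_exp (t *\<^sub>R G)) (at t within I)"
    by (simp only: op_exp_scaleR)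
  moreover have "at t within I = at t" by (rule at_within_open[OF R(1)]) (simp add: I_def)
  ultimately have "((\<lambda>t. op_exp (t *\<^sub>R G)) has_vector_derivative G o\<^sub>L op_exp (t *\<^sub>R G)) (at t)"
    by (simp only:)
  then show ?thesis by (rule has_vector_derivative_at_within)
qed

lemma op_exp_continuous_on:
  fixes G :: "'a::banach \<Rightarrow>\<^sub>L 'a"
  shows "continuous_on S (\<lambda>t. op_exp (t *\<^sub>R G))"
  unfolding continuous_on_eq_continuous_within
  using op_exp_has_vector_derivative has_vector_derivative_continuous by blast

lemma op_exp_self_adjoint:
  fixes G :: "'a::{real_inner,banach} \<Rightarrow>\<^sub>L 'a"
  assumes "self_adjoint G"
  shows "self_adjoint (op_exp (t *\<^sub>R G))"
  unfolding self_adjoint_def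
proof (intro allI)
  fix u v
  let ?P = "\<lambda>n. ((\<lambda>X. G o\<^sub>L X) ^^ n) id_blinfun"
  have P: "?P n u \<bullet> v = u \<bullet> ?P n v" for n u v
  proof (induction n arbitrary: u v)
    case (Suc n)
    have "?P (Suc n) u \<bullet> v = u \<bullet> (?P n o\<^sub>L G) v"
      using assms Suc by (simp add: self_adjoint_def)
    then show ?case by (simp add: comp_power_commute[symmetric])
  qed simp
  have s: "(\<lambda>n. ((t ^ n / fact n) *\<^sub>R ?P n) u) sums op_exp (t *\<^sub>R G) u" for u
    unfolding op_exp_scaleR
    by (intro bounded_linear.sums[OF blinfun.bounded_linear_left] summable_sums op_exp_summable)
  have "(\<lambda>n. ((t ^ n / fact n) *\<^sub>R ?P n) u \<bullet> v) sums (op_exp (t *\<^sub>R G) u \<bullet> v)"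
    "(\<lambda>n. u \<bullet> ((t ^ n / fact n) *\<^sub>R ?P n) v) sums (u \<bullet> op_exp (t *\<^sub>R G) v)"
    by (intro bounded_linear.sums[OF bounded_linear_inner_left] bounded_linear.sums[OF bounded_linear_inner_right] s)+
  then show "op_exp (t *\<^sub>R G) u \<bullet> v = u \<bullet> op_exp (t *\<^sub>R G) v"
    by (simp add: P blinfun.scaleR_left sums_iff)
qed

section \<open>Solvability of the Riccati equation\<close>

text \<open>Caratheodory's form of the derivative: it reduces differentiability of the inverse matrix to its continuity.\<close>

lemma has_vector_derivative_slope:
  fixes f q :: "real \<Rightarrow> 'b::real_normed_vector"
  assumes "\<And>s. s \<in> S \<Longrightarrow> f s - f t = (s - t) *\<^sub>R q s"
  shows "(f has_vector_derivative D) (at t within S) \<longleftrightarrow> (q \<longlongrightarrow> D) (at t within S)"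
proof -
  have "norm (f s - f t - (s - t) *\<^sub>R D) / norm (s - t) = dist (q s) D" if "s \<noteq> t" "s \<in> S" for s
  proof -
    have "f s - f t - (s - t) *\<^sub>R D = (s - t) *\<^sub>R (q s - D)" using assms[OF that(2)] by (simp add: scaleR_diff_right)
    then show ?thesis using that by (simp add: dist_norm)
  qed
  then have "((\<lambda>s. norm (f s - f t - (s - t) *\<^sub>R D) / norm (s - t)) \<longlongrightarrow> 0) (at t within S)
      \<longleftrightarrow> ((\<lambda>s. dist (q s) D) \<longlongrightarrow> 0) (at t within S)"
    by (intro Lim_cong_within) auto
  then show ?thesis
    unfolding has_vector_derivative_def has_derivative_iff_norm
    by (simp add: bounded_linear_scaleR_left tendsto_dist_iff[symmetric])
qed

lemma bounded_bilinear_matrix_mult: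
  "bounded_bilinear (\<lambda>(A::real^'m^'n) (B::real^'k^'m). A ** B)"
  unfolding bilinear_conv_bounded_bilinear[symmetric]
  by (simp add: bilinear_def linear_iff vec_eq_iff matrix_matrix_mult_def sum.distrib
      sum_distrib_left algebra_simps)

lemma matrix_inv_eq:
  fixes X :: "real^'n^'n"
  assumes "invertible X"
  shows "X ** matrix_inv X = mat 1" "matrix_inv X ** X = mat 1"
proof -
  from assms have "X ** matrix_inv X = mat 1 \<and> matrix_inv X ** X = mat 1"
    unfolding invertible_def matrix_inv_def by (rule someI_ex)
  then show "X ** matrix_inv X = mat 1" "matrix_inv X ** X = mat 1" by auto
qed

text \<open>By Cramer's rule the entries of the inverse are quotients of polynomials in the entries of the matrix.\<close>

lemma matrix_inv_tendsto:
  fixes X :: "'b \<Rightarrow> real^'n^'n"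
  assumes X: "(X \<longlongrightarrow> X0) F" and inv: "invertible X0" "\<forall>\<^sub>F s in F. invertible (X s)"
  shows "((\<lambda>s. matrix_inv (X s)) \<longlongrightarrow> matrix_inv X0) F"
proof -
  have entry: "matrix_inv Y $ k $ j = det (\<chi> i l. if l = k then (axis j 1 :: real^'n) $ i else Y $ i $ l) / det Y"
    if "invertible Y" for Y :: "real^'n^'n" and j k
  proof -
    have "det Y \<noteq> 0" using that by (simp add: invertible_det_nz)
    moreover have "Y *v (matrix_inv Y *v axis j 1) = axis j 1"
      by (simp add: matrix_vector_mul_assoc matrix_inv_eq(1)[OF that])
    ultimately have "matrix_inv Y *v axis j 1
        = (\<chi> k. det (\<chi> i l. if l = k then (axis j 1 :: real^'n) $ i else Y $ i $ l) / det Y)"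
      by (simp add: cramer)
    then have "(matrix_inv Y *v axis j 1) $ k
        = det (\<chi> i l. if l = k then (axis j 1 :: real^'n) $ i else Y $ i $ l) / det Y" by simp
    then show ?thesis by (simp add: matrix_vector_mult_basis column_def)
  qed
  have det: "((\<lambda>s. det (Z s)) \<longlongrightarrow> det Z0) F"
    if "\<And>i j. ((\<lambda>s. Z s $ i $ j) \<longlongrightarrow> Z0 $ i $ j) F" for Z :: "'b \<Rightarrow> real^'n^'n" and Z0
    unfolding det_def by (intro tendsto_intros that)
  have ent: "((\<lambda>s. X s $ i $ j) \<longlongrightarrow> X0 $ i $ j) F" for i j
    by (intro tendsto_vec_nth X)
  have "((\<lambda>s. matrix_inv (X s) $ k $ j) \<longlongrightarrow> matrix_inv X0 $ k $ j) F" for k j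
  proof (rule Lim_transform_eventually)
    show "((\<lambda>s. det (\<chi> i l. if l = k then (axis j 1 :: real^'n) $ i else X s $ i $ l) / det (X s))
        \<longlongrightarrow> matrix_inv X0 $ k $ j) F"
      unfolding entry[OF inv(1)]
      using inv(1) by (intro tendsto_divide det ent) (auto simp: invertible_det_nz intro!: ent)
    show "\<forall>\<^sub>F s in F. det (\<chi> i l. if l = k then (axis j 1 :: real^'n) $ i else X s $ i $ l) / det (X s)
        = matrix_inv (X s) $ k $ j"
      using inv(2) by eventually_elim (simp add: entry)
  qed
  then show ?thesis by (intro vec_tendstoI)
qed

lemma matrix_inv_has_vector_derivative:
  fixes X :: "real \<Rightarrow> real^'n^'n"
  assumes X: "(X has_vector_derivative X') (at t within S)" and inv: "\<And>s. s \<in> S \<Longrightarrow> invertible (X s)"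
    and t: "t \<in> S"
  shows "((\<lambda>s. matrix_inv (X s)) has_vector_derivative - (matrix_inv (X t) ** X' ** matrix_inv (X t))) (at t within S)"
proof -
  interpret mm: bounded_bilinear "\<lambda>(A::real^'n^'n) (B::real^'n^'n). A ** B"
    by (rule bounded_bilinear_matrix_mult)
  let ?V = "\<lambda>s. matrix_inv (X s)"
  define q where "q s = (if s = t then X' else (X s - X t) /\<^sub>R (s - t))" for s
  have q: "X s - X t = (s - t) *\<^sub>R q s" for s by (simp add: q_def)
  then have lim_q: "(q \<longlongrightarrow> X') (at t within S)" using X has_vector_derivative_slope[of S X t q X'] by blast
  have "?V s - ?V t = (s - t) *\<^sub>R - (?V s ** q s ** ?V t)" if "s \<in> S" for s
  proof -
    have "?V s - ?V t = ?V s ** (X t ** ?V t) - (?V s ** X s) ** ?V t"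
      using inv t that by (simp add: matrix_inv_eq)
    also have "\<dots> = - (?V s ** (X s - X t) ** ?V t)"
      by (simp add: mm.diff_right mm.diff_left matrix_mul_assoc)
    also have "\<dots> = - ((s - t) *\<^sub>R (?V s ** q s ** ?V t))"
      unfolding q by (simp add: mm.scaleR_left mm.scaleR_right)
    finally show ?thesis by simp
  qed
  moreover have "(X \<longlongrightarrow> X t) (at t within S)"
    using has_vector_derivative_continuous[OF X] by (simp add: continuous_within)
  then have "((\<lambda>s. - (?V s ** q s ** ?V t)) \<longlongrightarrow> - (?V t ** X' ** ?V t)) (at t within S)"
    by (intro tendsto_minus mm.tendsto tendsto_const lim_q matrix_inv_tendsto inv t)
      (auto simp: eventually_at_filter intro!: always_eventually inv)
  ultimately show ?thesis by (subst has_vector_derivative_slope)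
qed

lemma inner_matrix_transpose: "(A *v x) \<bullet> y = x \<bullet> (transpose A *v y)" for A :: "real^'n^'m"
  by (metis dot_lmul_matrix inner_commute vector_transpose_matrix transpose_transpose)

text \<open>Along the Hamiltonian system $\xi \cdot \eta$ is nonincreasing, since its derivative is
  $- \eta \cdot S \eta - \xi \cdot M \xi$.  It vanishes at \<open>t0\<close> and is nonnegative at \<open>T\<close>, hence it is zero in between.  Then
  $S \eta = 0$ there, so $\xi$ solves the homogeneous equation $\xi' = A \xi$ and cannot leave zero.\<close>

lemma hamiltonian_flow_injective:
  fixes \<xi> \<eta> :: "real \<Rightarrow> real^'n" and A S M MT :: "real^'n^'n"
  assumes \<xi>: "\<And>t. (\<xi> has_vector_derivative A *v \<xi> t - S *v \<eta> t) (at t)"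
    and \<eta>: "\<And>t. (\<eta> has_vector_derivative - (M *v \<xi> t) - transpose A *v \<eta> t) (at t)"
    and S: "\<And>v. 0 \<le> v \<bullet> (S *v v)" "\<And>v. v \<bullet> (S *v v) = 0 \<Longrightarrow> S *v v = 0"
    and M: "\<And>v. 0 \<le> v \<bullet> (M *v v)"
    and T: "\<eta> T = MT *v \<xi> T" "0 \<le> \<xi> T \<bullet> (MT *v \<xi> T)"
    and t0: "t0 \<le> T" "\<xi> t0 = 0"
  shows "\<xi> T = 0"
proof (cases "t0 = T")
  case False
  with t0 have "t0 < T" by simp
  define g where "g t = \<xi> t \<bullet> \<eta> t" for t
  have g: "(g has_real_derivative - (\<eta> t \<bullet> (S *v \<eta> t)) - \<xi> t \<bullet> (M *v \<xi> t)) (at t)" for t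
  proof -
    have "(g has_vector_derivative \<xi> t \<bullet> (- (M *v \<xi> t) - transpose A *v \<eta> t) + (A *v \<xi> t - S *v \<eta> t) \<bullet> \<eta> t) (at t)"
      unfolding g_def by (rule bounded_bilinear.has_vector_derivative[OF bounded_bilinear_inner \<xi> \<eta>])
    moreover have "(A *v \<xi> t) \<bullet> \<eta> t = \<xi> t \<bullet> (transpose A *v \<eta> t)"
      "(S *v \<eta> t) \<bullet> \<eta> t = \<eta> t \<bullet> (S *v \<eta> t)"
      by (rule inner_matrix_transpose, rule inner_commute)
    ultimately show ?thesis
      by (simp add: has_real_derivative_iff_has_vector_derivative inner_diff_left inner_diff_right algebra_simps)
  qed
  have le: "g v \<le> g u" if "u \<le> v" for u v
    using that
  proof (rule DERIV_nonpos_imp_nonincreasing)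
    fix t
    show "\<exists>y. DERIV g t :> y \<and> y \<le> 0" using g[of t] S(1)[of "\<eta> t"] M[of "\<xi> t"] by force
  qed
  \<comment> \<open>a nonincreasing function that starts at zero and ends nonnegative\<close>
  have g0: "g t = 0" if "t0 \<le> t" "t \<le> T" for t
    using le[OF that(1)] le[OF that(2)] T t0 by (simp add: g_def inner_commute)
  have S0: "S *v \<eta> t = 0" if t: "t0 < t" "t < T" for t
  proof -
    have "(g has_real_derivative 0) (at t)"
    proof (rule has_field_derivative_transform_within_open[OF DERIV_const[of 0]])
      show "open {t0<..<T}" by simp
    qed (use t g0 in auto)
    then have "- (\<eta> t \<bullet> (S *v \<eta> t)) - \<xi> t \<bullet> (M *v \<xi> t) = 0" using g DERIV_unique by blast
    then have "\<eta> t \<bullet> (S *v \<eta> t) = 0" using S(1)[of "\<eta> t"] M[of "\<xi> t"] by linarith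
    then show ?thesis by (rule S(2))
  qed
  obtain L where L: "\<And>x. norm (A *v x) \<le> L * norm x"
    using bounded_linear.bounded[OF matrix_vector_mul_bounded_linear[of A]] by (metis mult.commute)
  \<comment> \<open>the energy estimate for \<open>\<xi>' = A \<xi>\<close>\<close>
  define k where "k t = exp (- 2 * L * t) * (\<xi> t \<bullet> \<xi> t)" for t
  have k: "(k has_real_derivative exp (- 2 * L * t) * (2 * (\<xi> t \<bullet> (A *v \<xi> t - S *v \<eta> t)) - 2 * L * (\<xi> t \<bullet> \<xi> t))) (at t)" for t
  proof -
    have "((\<lambda>t. \<xi> t \<bullet> \<xi> t) has_real_derivative 2 * (\<xi> t \<bullet> (A *v \<xi> t - S *v \<eta> t))) (at t)"
      using bounded_bilinear.has_vector_derivative[OF bounded_bilinear_inner \<xi> \<xi>]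
      by (simp add: has_real_derivative_iff_has_vector_derivative inner_commute)
    then show ?thesis unfolding k_def by (auto intro!: derivative_eq_intros simp: algebra_simps)
  qed
  have "k T \<le> k t0"
  proof (rule DERIV_nonpos_imp_decreasing_open[OF t0(1)])
    show "continuous_on {t0..T} k"
      using k by (auto intro!: continuous_at_imp_continuous_on DERIV_isCont)
    fix t assume t: "t0 < t" "t < T"
    have "\<xi> t \<bullet> (A *v \<xi> t) \<le> L * (\<xi> t \<bullet> \<xi> t)"
    proof -
      have "\<xi> t \<bullet> (A *v \<xi> t) \<le> norm (\<xi> t) * norm (A *v \<xi> t)" by (rule norm_cauchy_schwarz)
      also have "\<dots> \<le> norm (\<xi> t) * (L * norm (\<xi> t))" by (intro mult_left_mono L) simp
      finally show ?thesis by (simp add: dot_square_norm power2_eq_square mult_ac)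
    qed
    then have "exp (- 2 * L * t) * (2 * (\<xi> t \<bullet> (A *v \<xi> t - S *v \<eta> t)) - 2 * L * (\<xi> t \<bullet> \<xi> t)) \<le> 0"
      using S0[OF t] by (intro mult_nonneg_nonpos) auto
    then show "\<exists>y. DERIV k t :> y \<and> y \<le> 0" using k by blast
  qed
  then have "exp (- 2 * L * T) * (\<xi> T \<bullet> \<xi> T) \<le> 0" using t0 by (simp add: k_def)
  then have "\<xi> T \<bullet> \<xi> T \<le> 0" by (simp add: mult_le_0_iff)
  then show ?thesis using inner_ge_zero[of "\<xi> T"] by (metis inner_eq_zero_iff order_antisym)
qed (use t0 in simp)

text \<open>The Riccati equation is linearised by $P = Y X^{-1}$, where $(X, Y)$ solves a linear system with
  constant coefficients and terminal value $(1, M_T)$.  Applied to the columns \<open>X t *v c\<close> and \<open>Y t *v c\<close>,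
  the previous lemma says that $X_t$ has trivial kernel for all $t \le T$, so that $P$ does not blow up.\<close>

theorem riccati_solution_exists:
  fixes A S M MT :: "real^'n^'n"
  assumes S: "\<And>v. 0 \<le> v \<bullet> (S *v v)" "\<And>v. v \<bullet> (S *v v) = 0 \<Longrightarrow> S *v v = 0"
    and M: "\<And>v. 0 \<le> v \<bullet> (M *v v)" and MT: "\<And>v. 0 \<le> v \<bullet> (MT *v v)"
  obtains P where "P T = MT"
    "\<And>t. t \<le> T \<Longrightarrow> (P has_vector_derivative - (transpose A ** P t + P t ** A - P t ** S ** P t + M)) (at t within {..T})"
proof -
  interpret mm: bounded_bilinear "\<lambda>(A::real^'n^'n) (B::real^'n^'n). A ** B"
    by (rule bounded_bilinear_matrix_mult)
  define \<H> where "\<H> = Blinfun (\<lambda>(X::real^'n^'n, Y). (A ** X - S ** Y, - (M ** X) - transpose A ** Y))"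
  have \<H>: "\<H> (X, Y) = (A ** X - S ** Y, - (M ** X) - transpose A ** Y)" for X Y
  proof -
    have "bounded_linear (\<lambda>(X::real^'n^'n, Y). (A ** X - S ** Y, - (M ** X) - transpose A ** Y))"
      unfolding linear_conv_bounded_linear[symmetric]
      by (auto simp: linear_iff mm.add_right mm.scaleR_right scaleR_diff_right)
    then show ?thesis unfolding \<H>_def by (simp add: bounded_linear_Blinfun_apply)
  qed
  define Z where "Z t = op_exp ((t - T) *\<^sub>R \<H>) (mat 1, MT)" for t
  define X where "X t = fst (Z t)" for t
  define Y where "Y t = snd (Z t)" for t
  have Z: "(Z has_vector_derivative \<H> (Z t)) (at t)" for t
  proof -
    have "((\<lambda>s. op_exp ((s - T) *\<^sub>R \<H>)) has_vector_derivative \<H> o\<^sub>L op_exp ((t - T) *\<^sub>R \<H>)) (at t)"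
    proof -
      have "((\<lambda>s. s - T) has_vector_derivative 1) (at t)" by (auto intro!: derivative_eq_intros)
      from vector_diff_chain_at[OF this op_exp_has_vector_derivative] show ?thesis by (simp add: o_def)
    qed
    from bounded_linear.has_vector_derivative[OF blinfun.bounded_linear_left this]
    show ?thesis unfolding Z_def by simp
  qed
  have Zp: "Z t = (X t, Y t)" for t by (simp add: X_def Y_def)
  have X: "(X has_vector_derivative A ** X t - S ** Y t) (at t)" for t
    unfolding X_def[abs_def] using bounded_linear.has_vector_derivative[OF bounded_linear_fst Z[of t]]
    by (simp add: Zp \<H>)
  have Y: "(Y has_vector_derivative - (M ** X t) - transpose A ** Y t) (at t)" for t
    unfolding Y_def[abs_def] using bounded_linear.has_vector_derivative[OF bounded_linear_snd Z[of t]]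
    by (simp add: Zp \<H>)
  have XT: "X T = mat 1" "Y T = MT" by (simp_all add: X_def Y_def Z_def op_exp_0[of \<H>, simplified])
  have inv: "invertible (X t)" if "t \<le> T" for t
    unfolding invertible_left_inverse matrix_left_invertible_ker
  proof (intro allI impI)
    fix c assume c: "X t *v c = 0"
    have bl: "bounded_linear (\<lambda>X::real^'n^'n. X *v c)"
      unfolding linear_conv_bounded_linear[symmetric]
      by (auto simp: linear_iff matrix_vector_mult_add_rdistrib scaleR_matrix_vector_assoc)
    have "X T *v c = 0"
    proof (rule hamiltonian_flow_injective[where \<xi>="\<lambda>t. X t *v c" and \<eta>="\<lambda>t. Y t *v c"])
      show "((\<lambda>t. X t *v c) has_vector_derivative A *v (X s *v c) - S *v (Y s *v c)) (at s)" for s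
        using bounded_linear.has_vector_derivative[OF bl X[of s]]
        by (simp add: matrix_vector_mult_diff_rdistrib matrix_vector_mul_assoc)
      show "((\<lambda>t. Y t *v c) has_vector_derivative - (M *v (X s *v c)) - transpose A *v (Y s *v c)) (at s)" for s
        using bounded_linear.has_vector_derivative[OF bl Y[of s]] linear_neg[OF bounded_linear.linear[OF bl]]
        by (simp add: matrix_vector_mult_diff_rdistrib matrix_vector_mul_assoc)
      show "Y T *v c = MT *v (X T *v c)" "0 \<le> (X T *v c) \<bullet> (MT *v (X T *v c))"
        using MT by (simp_all add: XT)
    qed (use S M c that in auto)
    then show "c = 0" by (simp add: XT)
  qed
  define P where "P t = Y t ** matrix_inv (X t)" for t
  have "(P has_vector_derivative - (transpose A ** P t + P t ** A - P t ** S ** P t + M)) (at t within {..T})"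
    if t: "t \<le> T" for t
  proof -
    let ?V = "matrix_inv (X t)"
    have "(P has_vector_derivative Y t ** - (?V ** (A ** X t - S ** Y t) ** ?V)
        + (- (M ** X t) - transpose A ** Y t) ** ?V) (at t within {..T})"
      unfolding P_def
      by (intro mm.has_vector_derivative matrix_inv_has_vector_derivative
          has_vector_derivative_at_within[OF X] has_vector_derivative_at_within[OF Y]) (use t inv in auto)
    moreover have "Y t ** - (?V ** (A ** X t - S ** Y t) ** ?V) + (- (M ** X t) - transpose A ** Y t) ** ?V
        = - (transpose A ** P t + P t ** A - P t ** S ** P t + M)"
    proof -
      have e: "C ** X t ** ?V = C" for C
        using matrix_inv_eq(1)[OF inv[OF t]] by (metis matrix_mul_assoc matrix_mul_rid)
      show ?thesis
        by (simp add: P_def mm.diff_left mm.diff_right mm.minus_left mm.minus_right matrix_mul_assoc e)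
    qed
    ultimately show ?thesis by simp
  qed
  moreover have "P T = MT"
    using matrix_inv_eq(1)[of "mat 1 :: real^'n^'n"] inv[of T] by (simp add: P_def XT)
  ultimately show ?thesis using that by blast
qed

section \<open>Measurability of processes with continuous paths\<close>

abbreviation lebT :: "real \<Rightarrow> real measure" where
  "lebT t \<equiv> restrict_space lborel {0..t}"

lemma finite_lebT: "finite_measure (lebT t)"
  by (cases "0 \<le> t")
    (auto intro!: finite_measureI simp: emeasure_restrict_space space_restrict_space)

lemma sigma_finite_lebT: "sigma_finite_measure (lebT t)"
  using finite_lebT finite_measure.axioms(1) by blast

lemma space_lebT [simp]: "space (lebT t) = {0..t}"
  by (simp add: space_restrict_space)

lemma LINT_lebT:
  fixes g :: "real \<Rightarrow> 'b::{banach,second_countable_topology}"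
  shows "(LINT s:{0..t}|lborel. g s) = (\<integral>s. g s \<partial>lebT t)"
  unfolding set_lebesgue_integral_def by (subst integral_restrict_space) auto

lemma nn_integral_lebT: "(\<integral>\<^sup>+s\<in>{0..t}. g s \<partial>lborel) = (\<integral>\<^sup>+s. g s \<partial>lebT t)"
  by (subst nn_integral_restrict_space) auto

text \<open>The process is the limit of its values at the last grid point before the time; for each mesh these are countably many random variables.\<close>

lemma continuous_process_measurable:
  fixes Y :: "real \<Rightarrow> 'w \<Rightarrow> 'b::metric_space"
  assumes Y: "\<And>s. s \<in> {0..t} \<Longrightarrow> Y s \<in> borel_measurable M"
    and cont: "\<And>\<omega>. \<omega> \<in> space M \<Longrightarrow> continuous_on {0..t} (\<lambda>s. Y s \<omega>)"
  shows "(\<lambda>(s, \<omega>). Y s \<omega>) \<in> borel_measurable (lebT t \<Otimes>\<^sub>M M)"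
proof (cases "0 \<le> t")
  case True
  define r where "r n s = real_of_int \<lfloor>real (Suc n) * s\<rfloor> / real (Suc n)" for n s
  have r: "0 \<le> r n s" "r n s \<le> s" "s - r n s \<le> 1 / real (Suc n)" if "0 \<le> s" for n s
  proof -
    show "0 \<le> r n s" using that by (simp add: r_def)
    have "real_of_int \<lfloor>real (Suc n) * s\<rfloor> \<le> real (Suc n) * s" by (rule of_int_floor_le)
    then show "r n s \<le> s" unfolding r_def by (simp add: divide_le_eq mult.commute)
    have "real (Suc n) * s - real_of_int \<lfloor>real (Suc n) * s\<rfloor> \<le> 1" by linarith
    then have "(real (Suc n) * s - real_of_int \<lfloor>real (Suc n) * s\<rfloor>) / real (Suc n) \<le> 1 / real (Suc n)"
      by (intro divide_right_mono) auto
    then show "s - r n s \<le> 1 / real (Suc n)"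
      by (simp add: r_def diff_divide_distrib del: of_nat_Suc)
  qed
  show ?thesis
  proof (rule borel_measurable_LIMSEQ_metric)
    fix n
    \<comment> \<open>clipping to \<open>{0..t}\<close> only matters for grid points outside, which are never selected\<close>
    define g where "g i z = Y (max 0 (min t (real_of_int i / real (Suc n)))) (snd z)" for i :: int and z :: "real \<times> 'w"
    have "(\<lambda>z. g \<lfloor>real (Suc n) * fst z\<rfloor> z) \<in> borel_measurable (lebT t \<Otimes>\<^sub>M M)"
    proof (rule measurable_compose_countable)
      show "g i \<in> borel_measurable (lebT t \<Otimes>\<^sub>M M)" for i
        unfolding g_def by (rule measurable_compose[OF measurable_snd Y]) (use True in auto)
      have [measurable]: "fst \<in> borel_measurable (lebT t \<Otimes>\<^sub>M M)"
        by (rule measurable_compose[OF measurable_fst]) (auto intro: measurable_restrict_space1)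
      show "(\<lambda>z. \<lfloor>real (Suc n) * fst z\<rfloor>) \<in> measurable (lebT t \<Otimes>\<^sub>M M) (count_space UNIV)"
        by measurable
    qed
    moreover have "g \<lfloor>real (Suc n) * fst z\<rfloor> z = Y (r n (fst z)) (snd z)"
      if "z \<in> space (lebT t \<Otimes>\<^sub>M M)" for z
    proof -
      have "max 0 (min t (r n (fst z))) = r n (fst z)"
        using r[of "fst z" n] that by (auto simp: space_pair_measure)
      then show ?thesis by (simp only: g_def r_def[symmetric])
    qed
    ultimately show "(\<lambda>z. Y (r n (fst z)) (snd z)) \<in> borel_measurable (lebT t \<Otimes>\<^sub>M M)"
      by (subst measurable_cong) auto
  next
    fix z assume z: "z \<in> space (lebT t \<Otimes>\<^sub>M M)"
    then obtain s \<omega> where [simp]: "z = (s, \<omega>)" and s: "s \<in> {0..t}" and \<omega>: "\<omega> \<in> space M"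
      by (auto simp: space_pair_measure)
    have "(\<lambda>n. r n s) \<longlonglongrightarrow> s"
    proof (rule real_tendsto_sandwich)
      show "(\<lambda>n. s - 1 / real (Suc n)) \<longlonglongrightarrow> s"
        using tendsto_diff[OF tendsto_const LIMSEQ_Suc[OF lim_1_over_n], of s] by simp
      show "\<forall>\<^sub>F n in sequentially. s - 1 / real (Suc n) \<le> r n s"
        using r(3)[of s] s by (intro always_eventually) (auto simp: algebra_simps)
      show "\<forall>\<^sub>F n in sequentially. r n s \<le> s" using r(2)[of s] s by (intro always_eventually) auto
    qed simp
    then show "(\<lambda>n. Y (r n (fst z)) (snd z)) \<longlonglongrightarrow> (case z of (s, \<omega>) \<Rightarrow> Y s \<omega>)"
      using r s by (auto intro!: continuous_on_tendsto_compose[OF cont[OF \<omega>]] always_eventually order_trans[of _ s t])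
  qed
qed (auto intro!: measurable_cong[THEN iffD2, OF _ measurable_const[of undefined]]
    simp: space_pair_measure space_empty_iff)

lemma time_integral_measurable:
  fixes Y :: "real \<Rightarrow> 'w \<Rightarrow> 'b::{banach,second_countable_topology}"
  assumes "(\<lambda>(s, \<omega>). Y s \<omega>) \<in> borel_measurable (lebT t \<Otimes>\<^sub>M M)"
  shows "(\<lambda>\<omega>. \<integral>s. Y s \<omega> \<partial>lebT t) \<in> borel_measurable M"
proof -
  interpret sigma_finite_measure "lebT t" by (rule sigma_finite_lebT)
  have "(\<lambda>(\<omega>, s). Y s \<omega>) \<in> borel_measurable (M \<Otimes>\<^sub>M lebT t)"
    using measurable_pair_swap[OF assms] by (simp add: case_prod_beta')
  then show ?thesis by (rule borel_measurable_lebesgue_integral)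
qed

section \<open>Increments of Brownian motion\<close>

lemma brownian_increment:
  assumes W: "standard_brownian_motion \<Omega> W" and \<Omega>: "prob_space \<Omega>" and st: "0 \<le> s" "s \<le> t"
  shows "integrable \<Omega> (\<lambda>\<omega>. W t \<omega> - W s \<omega>)" "(\<integral>\<omega>. W t \<omega> - W s \<omega> \<partial>\<Omega>) = 0"
    "integrable \<Omega> (\<lambda>\<omega>. (W t \<omega> - W s \<omega>)\<^sup>2)" "(\<integral>\<omega>. (W t \<omega> - W s \<omega>)\<^sup>2 \<partial>\<Omega>) = t - s"
proof -
  let ?X = "\<lambda>\<omega>. W t \<omega> - W s \<omega>"
  have "integrable \<Omega> ?X \<and> (\<integral>\<omega>. ?X \<omega> \<partial>\<Omega>) = 0 \<and> integrable \<Omega> (\<lambda>\<omega>. (?X \<omega>)\<^sup>2) \<and> (\<integral>\<omega>. (?X \<omega>)\<^sup>2 \<partial>\<Omega>) = t - s"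
  proof (cases "s < t")
    case True
    let ?d = "normal_density 0 (sqrt (t - s))"
    have D: "distributed \<Omega> lborel ?X ?d"
      using W st True by (auto simp: standard_brownian_motion_def)
    have pos: "0 < sqrt (t - s)" using True by simp
    have "integrable lborel (\<lambda>x. ?d x * (x - 0) ^ (2 * 1))" "integrable lborel (\<lambda>x. ?d x * (x - 0) ^ 1)"
      by (rule integrable_normal_moment[OF pos])+
    moreover have "(\<integral>x. ?d x * (x - 0) ^ (2 * 1) \<partial>lborel) = fact (2 * 1) / ((2 / (sqrt (t - s))\<^sup>2) ^ 1 * fact 1)"
      by (rule integral_normal_moment_even[OF pos])
    moreover have "(\<integral>x. ?d x * (x - 0) ^ (2 * 0 + 1) \<partial>lborel) = 0"
      by (rule integral_normal_moment_odd[OF pos])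
    moreover have "integrable \<Omega> (\<lambda>\<omega>. g (?X \<omega>)) \<longleftrightarrow> integrable lborel (\<lambda>x. ?d x * g x)"
      "(\<integral>\<omega>. g (?X \<omega>) \<partial>\<Omega>) = (\<integral>x. ?d x * g x \<partial>lborel)"
      if "g \<in> borel_measurable borel" for g :: "real \<Rightarrow> real"
      using distributed_integrable[OF D, of g] distributed_integral[OF D, of g] that
      by (auto simp: normal_density_nonneg)
    from this[of "\<lambda>x. x"] this[of "\<lambda>x. x\<^sup>2"] have
      "integrable \<Omega> ?X \<longleftrightarrow> integrable lborel (\<lambda>x. ?d x * x)"
      "(\<integral>\<omega>. ?X \<omega> \<partial>\<Omega>) = (\<integral>x. ?d x * x \<partial>lborel)"
      "integrable \<Omega> (\<lambda>\<omega>. (?X \<omega>)\<^sup>2) \<longleftrightarrow> integrable lborel (\<lambda>x. ?d x * x\<^sup>2)"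
      "(\<integral>\<omega>. (?X \<omega>)\<^sup>2 \<partial>\<Omega>) = (\<integral>x. ?d x * x\<^sup>2 \<partial>lborel)"
      by auto
    ultimately show ?thesis using True by (simp add: fact_numeral)
  qed (use st in simp)
  then show "integrable \<Omega> ?X" "(\<integral>\<omega>. ?X \<omega> \<partial>\<Omega>) = 0"
    "integrable \<Omega> (\<lambda>\<omega>. (?X \<omega>)\<^sup>2)" "(\<integral>\<omega>. (?X \<omega>)\<^sup>2 \<partial>\<Omega>) = t - s" by auto
qed

text \<open>The times in \<open>J\<close>, together with $0$ and $s$ and followed by $t$, form a partition.  The values of
  \<open>W\<close> at times in \<open>J\<close> are almost surely sums of the increments up to \<open>s\<close>, hence independent of the last one, which has mean zero.\<close>

lemma brownian_increment_cylinder: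
  assumes W: "standard_brownian_motion \<Omega> W" and \<Omega>: "prob_space \<Omega>" and st: "0 \<le> s" "s \<le> t"
    and J: "finite J" "J \<subseteq> {0..s}" and E: "\<And>r. E r \<in> sets borel"
  shows "(\<integral>\<omega>. (if \<forall>r\<in>J. W r \<omega> \<in> E r then 1 else 0) * (W t \<omega> - W s \<omega>) \<partial>\<Omega>) = 0"
proof -
  interpret prob_space \<Omega> by (rule \<Omega>)
  define L where "L = sorted_list_of_set (insert 0 (insert s J))"
  define n where "n = length L - 1"
  define \<tau> where "\<tau> i = (if i \<le> n then L ! i else t)" for i
  have setL: "set L = insert 0 (insert s J)" and srt: "sorted L"
    using J unfolding L_def by (auto simp del: sorted_list_of_set_insert_remove)
  then have len: "length L = Suc n" by (cases L) (auto simp: n_def)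
  have idx: "\<exists>i\<le>n. L ! i = r" if "r \<in> set L" for r
    using that len by (auto simp: in_set_conv_nth less_Suc_eq_le)
  have mem: "L ! i \<in> {0..s}" if "i \<le> n" for i
    using nth_mem[of i L] that len setL J st by auto
  have L0: "L ! 0 = 0"
  proof -
    obtain i where "i \<le> n" "L ! i = 0" using idx[of 0] setL by auto
    then show ?thesis using sorted_nth_mono[OF srt, of 0 i] mem[of 0] len by auto
  qed
  have Ln: "L ! n = s"
  proof -
    obtain i where "i \<le> n" "L ! i = s" using idx[of s] setL by auto
    then show ?thesis using sorted_nth_mono[OF srt, of i n] mem[of n] len by auto
  qed
  have "incseq \<tau>"
    unfolding incseq_Suc_iff \<tau>_def
    using sorted_nth_mono[OF srt] len mem st by (auto simp: Suc_le_eq intro: order_trans)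
  moreover have "0 \<le> \<tau> 0" by (simp add: \<tau>_def L0)
  ultimately have "indep_vars (\<lambda>_. borel) (\<lambda>i \<omega>. W (\<tau> (Suc i)) \<omega> - W (\<tau> i) \<omega>) {..<Suc n}"
    using W unfolding standard_brownian_motion_def by blast
  from indep_var_restrict[OF this, of "{..<n}" "{n}"]
  have ind: "indep_var (PiM {..<n} (\<lambda>_. borel)) (\<lambda>\<omega>. \<lambda>i\<in>{..<n}. W (\<tau> (Suc i)) \<omega> - W (\<tau> i) \<omega>)
      (PiM {n} (\<lambda>_. borel)) (\<lambda>\<omega>. \<lambda>i\<in>{n}. W (\<tau> (Suc i)) \<omega> - W (\<tau> i) \<omega>)"
    by auto
  define \<phi> where "\<phi> x = (if \<forall>i\<in>{..n}. L ! i \<in> J \<longrightarrow> (\<Sum>j<i. x j) \<in> E (L ! i) then 1 else 0 :: real)" for x :: "nat \<Rightarrow> real"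
  have comp: "(\<lambda>x. x i) \<in> borel_measurable (PiM I (\<lambda>_. borel))" if "i \<in> I" for i :: nat and I
    by (rule measurable_component_singleton[OF that])
  have \<phi>: "\<phi> \<in> borel_measurable (PiM {..<n} (\<lambda>_. borel))"
  proof -
    have [measurable]: "(\<lambda>x. \<Sum>j<i. x j) \<in> borel_measurable (PiM {..<n} (\<lambda>_. borel :: real measure))" if "i \<in> {..n}" for i
      using that by (intro borel_measurable_sum comp) auto
    note [measurable] = E
    show ?thesis unfolding \<phi>_def by measurable
  qed
  from indep_var_compose[OF ind \<phi> comp[of n "{n}"]]
  have ind2: "indep_var borel (\<lambda>\<omega>. \<phi> (\<lambda>i\<in>{..<n}. W (\<tau> (Suc i)) \<omega> - W (\<tau> i) \<omega>))
     borel (\<lambda>\<omega>. W (\<tau> (Suc n)) \<omega> - W (\<tau> n) \<omega>)"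
    by (simp add: o_def)
  have \<tau>n: "\<tau> (Suc n) = t" "\<tau> n = s" by (auto simp: \<tau>_def Ln)
  note incr = brownian_increment[OF W \<Omega> st]
  have Wm [measurable]: "W r \<in> borel_measurable \<Omega>" if "0 \<le> r" for r
    using W that by (simp add: standard_brownian_motion_def)
  have \<phi>\<Omega>: "(\<lambda>\<omega>. \<phi> (\<lambda>i\<in>{..<n}. W (\<tau> (Suc i)) \<omega> - W (\<tau> i) \<omega>)) \<in> borel_measurable \<Omega>"
    using ind2 indep_var_rv1 by blast
  have "(\<integral>\<omega>. \<phi> (\<lambda>i\<in>{..<n}. W (\<tau> (Suc i)) \<omega> - W (\<tau> i) \<omega>) * (W t \<omega> - W s \<omega>) \<partial>\<Omega>) = 0"
  proof -
    have "integrable \<Omega> (\<lambda>\<omega>. \<phi> (\<lambda>i\<in>{..<n}. W (\<tau> (Suc i)) \<omega> - W (\<tau> i) \<omega>))"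
      by (rule integrable_const_bound[where B=1, OF _ \<phi>\<Omega>]) (simp add: \<phi>_def)
    from indep_var_lebesgue_integral[OF ind2 this] show ?thesis using incr by (simp add: \<tau>n)
  qed
  also have "(\<integral>\<omega>. \<phi> (\<lambda>i\<in>{..<n}. W (\<tau> (Suc i)) \<omega> - W (\<tau> i) \<omega>) * (W t \<omega> - W s \<omega>) \<partial>\<Omega>)
      = (\<integral>\<omega>. (if \<forall>r\<in>J. W r \<omega> \<in> E r then 1 else 0) * (W t \<omega> - W s \<omega>) \<partial>\<Omega>)"
  proof (rule integral_cong_AE)
    have [measurable]: "Measurable.pred \<Omega> (\<lambda>\<omega>. \<forall>r\<in>J. W r \<omega> \<in> E r)"
    proof (rule pred_intros_finite(3)[OF J(1)])
      fix r assume "r \<in> J"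
      then show "Measurable.pred \<Omega> (\<lambda>\<omega>. W r \<omega> \<in> E r)" using J by (intro pred_sets2[OF E Wm]) auto
    qed
    note [measurable] = Wm[OF st(1)] Wm[OF order_trans[OF st]]
    show "(\<lambda>\<omega>. (if \<forall>r\<in>J. W r \<omega> \<in> E r then 1 else 0) * (W t \<omega> - W s \<omega>)) \<in> borel_measurable \<Omega>" by measurable
    note [measurable] = \<phi>\<Omega>
    show "(\<lambda>\<omega>. \<phi> (\<lambda>i\<in>{..<n}. W (\<tau> (Suc i)) \<omega> - W (\<tau> i) \<omega>) * (W t \<omega> - W s \<omega>)) \<in> borel_measurable \<Omega>" by measurable
    have "AE \<omega> in \<Omega>. W 0 \<omega> = 0" using W by (simp add: standard_brownian_motion_def)
    then show "AE \<omega> in \<Omega>. \<phi> (\<lambda>i\<in>{..<n}. W (\<tau> (Suc i)) \<omega> - W (\<tau> i) \<omega>) * (W t \<omega> - W s \<omega>)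
        = (if \<forall>r\<in>J. W r \<omega> \<in> E r then 1 else 0) * (W t \<omega> - W s \<omega>)"
    proof eventually_elim
      case (elim \<omega>)
      have "(\<Sum>j<i. (\<lambda>i\<in>{..<n}. W (\<tau> (Suc i)) \<omega> - W (\<tau> i) \<omega>) j) = W (L ! i) \<omega>" if "i \<le> n" for i
      proof -
        have "(\<Sum>j<i. (\<lambda>i\<in>{..<n}. W (\<tau> (Suc i)) \<omega> - W (\<tau> i) \<omega>) j) = (\<Sum>j<i. W (\<tau> (Suc j)) \<omega> - W (\<tau> j) \<omega>)"
          using that by (intro sum.cong) auto
        also have "\<dots> = W (\<tau> i) \<omega> - W (\<tau> 0) \<omega>" by (rule sum_lessThan_telescope)
        finally show ?thesis using that elim by (simp add: \<tau>_def L0)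
      qed
      then have "(\<forall>i\<in>{..n}. L ! i \<in> J \<longrightarrow> (\<Sum>j<i. (\<lambda>i\<in>{..<n}. W (\<tau> (Suc i)) \<omega> - W (\<tau> i) \<omega>) j) \<in> E (L ! i))
          \<longleftrightarrow> (\<forall>i\<in>{..n}. L ! i \<in> J \<longrightarrow> W (L ! i) \<omega> \<in> E (L ! i))" by auto
      also have "\<dots> \<longleftrightarrow> (\<forall>r\<in>J. W r \<omega> \<in> E r)"
        using idx setL by (metis atMost_iff insertCI)
      finally show ?case by (simp only: \<phi>_def)
    qed
  qed
  finally show ?thesis .
qed

lemma abs_mult_le_squares: "\<bar>x * y\<bar> \<le> x\<^sup>2 + y\<^sup>2" for x y :: real
proof -
  have "2 * (\<bar>x\<bar> * \<bar>y\<bar>) \<le> x\<^sup>2 + y\<^sup>2"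
    using sum_squares_bound[of "\<bar>x\<bar>" "\<bar>y\<bar>"] by (simp add: mult.assoc)
  moreover have "0 \<le> \<bar>x\<bar> * \<bar>y\<bar>" by simp
  ultimately have "\<bar>x\<bar> * \<bar>y\<bar> \<le> x\<^sup>2 + y\<^sup>2" by linarith
  then show ?thesis by (simp only: abs_mult)
qed

locale brownian_family = prob_space \<Omega> for \<Omega> :: "'w measure" +
  fixes W :: "'n::finite \<Rightarrow> real \<Rightarrow> 'w \<Rightarrow> real"
  assumes brownian: "\<And>k. standard_brownian_motion \<Omega> (W k)"
    and independent: "independent_processes \<Omega> W"
begin

lemma W_measurable [measurable]: "0 \<le> r \<Longrightarrow> W k r \<in> borel_measurable \<Omega>"
  using brownian by (simp add: standard_brownian_motion_def)

lemmas increment = brownian_increment[OF brownian prob_space_axioms]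

definition past :: "real \<Rightarrow> 'w measure" where
  "past s = sigma (space \<Omega>) {W k r -` E \<inter> space \<Omega> | k r E. 0 \<le> r \<and> r \<le> s \<and> E \<in> sets borel}"

lemma past_gen: "{W k r -` E \<inter> space \<Omega> | k r E. 0 \<le> r \<and> r \<le> s \<and> E \<in> sets borel} \<subseteq> sets \<Omega>"
  by (auto intro!: measurable_sets W_measurable)

lemma space_past [simp]: "space (past s) = space \<Omega>"
  unfolding past_def by (intro space_measure_of) auto

lemma sets_past: "sets (past s)
    = sigma_sets (space \<Omega>) {W k r -` E \<inter> space \<Omega> | k r E. 0 \<le> r \<and> r \<le> s \<and> E \<in> sets borel}"
  unfolding past_def by (intro sets_measure_of) auto

lemma past_subalgebra: "subalgebra \<Omega> (past s)"
  unfolding subalgebra_def sets_past using sets.sigma_sets_subset[OF past_gen] by simp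

lemma W_past_measurable: "0 \<le> r \<Longrightarrow> r \<le> s \<Longrightarrow> W k r \<in> borel_measurable (past s)"
  by (rule measurableI) (auto simp: sets_past intro!: sigma_sets.Basic)

text \<open>All components are evaluated at the same finite set of times, which makes the cylinders stable under intersection; \<open>E k r = UNIV\<close> imposes no condition.\<close>

definition cylinder :: "real set \<Rightarrow> ('n \<Rightarrow> real \<Rightarrow> real set) \<Rightarrow> 'w set" where
  "cylinder J E = {\<omega> \<in> space \<Omega>. \<forall>k. \<forall>r\<in>J. W k r \<omega> \<in> E k r}"

lemma cylinder_measurable:
  assumes "finite J" "J \<subseteq> {0..s}" "\<And>k r. E k r \<in> sets borel"
  shows "cylinder J E \<in> sets (past s)"
proof -
  have "Measurable.pred (past s) (\<lambda>\<omega>. \<forall>k\<in>UNIV. \<forall>r\<in>J. W k r \<omega> \<in> E k r)"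
  proof (rule pred_intros_finite(3)[OF finite], rule pred_intros_finite(3)[OF assms(1)])
    fix k r assume "r \<in> J"
    then show "Measurable.pred (past s) (\<lambda>\<omega>. W k r \<omega> \<in> E k r)"
      using assms by (intro pred_sets2[OF assms(3) W_past_measurable]) auto
  qed
  then have "{\<omega> \<in> space (past s). \<forall>k\<in>UNIV. \<forall>r\<in>J. W k r \<omega> \<in> E k r} \<in> sets (past s)"
    by (simp add: pred_def)
  then show ?thesis by (simp add: cylinder_def)
qed

lemma sets_past_cylinders:
  "sets (past s) = sigma_sets (space \<Omega>)
    {cylinder J E | J E. finite J \<and> J \<subseteq> {0..s} \<and> (\<forall>k r. E k r \<in> sets borel)}" (is "_ = sigma_sets _ ?C")
proof
  show "sets (past s) \<subseteq> sigma_sets (space \<Omega>) ?C"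
    unfolding sets_past
  proof (rule sigma_sets_mono, clarify)
    fix k r and E :: "real set" assume r: "0 \<le> r" "r \<le> s" and E: "E \<in> sets borel"
    have eq: "W k r -` E \<inter> space \<Omega> = cylinder {r} (\<lambda>l _. if l = k then E else UNIV)"
      by (auto simp: cylinder_def)
    have "cylinder {r} (\<lambda>l _. if l = k then E else UNIV) \<in> ?C"
      using r E by (intro CollectI exI[of _ "{r}"] exI[of _ "\<lambda>l _. if l = k then E else UNIV"]) auto
    then show "W k r -` E \<inter> space \<Omega> \<in> sigma_sets (space \<Omega>) ?C"
      unfolding eq by (rule sigma_sets.Basic)
  qed
  show "sigma_sets (space \<Omega>) ?C \<subseteq> sets (past s)"
  proof -
    have "?C \<subseteq> sets (past s)" using cylinder_measurable by blast
    from sets.sigma_sets_subset[OF this] show ?thesis by simp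
  qed
qed

lemma cylinder_Int_stable:
  "Int_stable {cylinder J E | J E. finite J \<and> J \<subseteq> {0..s} \<and> (\<forall>k r. E k r \<in> sets borel)}"
proof (rule Int_stableI, clarify)
  fix J J' and E E' :: "'n \<Rightarrow> real \<Rightarrow> real set"
  assume *: "finite J" "J \<subseteq> {0..s}" "\<forall>k r. E k r \<in> sets borel"
    "finite J'" "J' \<subseteq> {0..s}" "\<forall>k r. E' k r \<in> sets borel"
  let ?E = "\<lambda>k r. (if r \<in> J then E k r else UNIV) \<inter> (if r \<in> J' then E' k r else UNIV)"
  have "cylinder J E \<inter> cylinder J' E' = cylinder (J \<union> J') ?E"
    by (auto simp: cylinder_def)
  then show "\<exists>J'' E''. cylinder J E \<inter> cylinder J' E' = cylinder J'' E'' \<and> finite J'' \<and> J'' \<subseteq> {0..s}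
      \<and> (\<forall>k r. E'' k r \<in> sets borel)"
    using * by (intro exI[of _ "J \<union> J'"] exI[of _ ?E]) (auto intro!: sets.Int)
qed

lemma path_component_measurable:
  "0 \<le> r \<Longrightarrow> (\<lambda>x. x r) \<in> borel_measurable (PiM {0..} (\<lambda>_. borel :: real measure))"
  by (rule measurable_component_singleton) simp

text \<open>By independence of the components the integral factorises, and the factor of the component \<open>k\<close> vanishes.\<close>

lemma increment_cylinder:
  assumes st: "0 \<le> s" "s \<le> t" and J: "finite J" "J \<subseteq> {0..s}" and E: "\<And>k r. E k r \<in> sets borel"
  shows "(\<integral>\<omega>. indicator (cylinder J E) \<omega> * (W k t \<omega> - W k s \<omega>) \<partial>\<Omega>) = 0"
proof -
  \<comment> \<open>the contribution of the component \<open>l\<close> as a functional of its path\<close>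
  define Y where "Y l x = (if l = k then x t - x s else 1) * (if \<forall>r\<in>J. x r \<in> E l r then 1 else 0)"
    for l and x :: "real \<Rightarrow> real"
  have Y: "Y l \<in> borel_measurable (PiM {0..} (\<lambda>_. borel))" for l
  proof -
    have "Measurable.pred (PiM {0..} (\<lambda>_. borel)) (\<lambda>x. \<forall>r\<in>J. x r \<in> E l r)"
    proof (rule pred_intros_finite(3)[OF J(1)])
      fix r assume "r \<in> J"
      then show "Measurable.pred (PiM {0..} (\<lambda>_. borel)) (\<lambda>x. x r \<in> E l r)"
        using J by (intro pred_sets2[OF E path_component_measurable]) auto
    qed
    note [measurable] = this path_component_measurable[OF st(1)] path_component_measurable[OF order_trans[OF st]]
    show ?thesis unfolding Y_def by measurable
  qed
  define X where "X l \<omega> = Y l (\<lambda>r\<in>{0..}. W l r \<omega>)" for l \<omega>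
  have X: "X l \<omega> = (if l = k then W l t \<omega> - W l s \<omega> else 1) * (if \<forall>r\<in>J. W l r \<omega> \<in> E l r then 1 else 0)" for l \<omega>
  proof -
    have "(\<forall>r\<in>J. (\<lambda>r\<in>{0..}. W l r \<omega>) r \<in> E l r) \<longleftrightarrow> (\<forall>r\<in>J. W l r \<omega> \<in> E l r)"
      using J(2) by (intro ball_cong refl) auto
    then show ?thesis using st by (simp add: X_def Y_def)
  qed
  have ind: "indep_vars (\<lambda>_. borel) X UNIV"
    unfolding X_def
    by (rule indep_vars_compose2[OF independent[unfolded independent_processes_def] Y])
  have Xm: "X l \<in> borel_measurable \<Omega>" for l using ind by (auto simp: indep_vars_def)
  have int: "integrable \<Omega> (X l)" for l
  proof (cases "l = k")
    case True
    show ?thesis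
      by (rule Bochner_Integration.integrable_bound[OF increment(1)[OF st, of k] Xm])
        (auto simp: X True)
  next
    case False
    show ?thesis by (rule integrable_const_bound[where B=1, OF _ Xm]) (auto simp: X False)
  qed
  have "(\<integral>\<omega>. indicator (cylinder J E) \<omega> * (W k t \<omega> - W k s \<omega>) \<partial>\<Omega>) = (\<integral>\<omega>. (\<Prod>l\<in>UNIV. X l \<omega>) \<partial>\<Omega>)"
  proof (rule Bochner_Integration.integral_cong[OF refl])
    fix \<omega> assume \<omega>: "\<omega> \<in> space \<Omega>"
    have "(\<Prod>l\<in>UNIV. X l \<omega>) = (\<Prod>l\<in>UNIV. if l = k then W l t \<omega> - W l s \<omega> else 1)
        * (\<Prod>l\<in>UNIV. if \<forall>r\<in>J. W l r \<omega> \<in> E l r then 1 else 0)"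
      unfolding X by (rule prod.distrib)
    also have "(\<Prod>l\<in>UNIV. if l = k then W l t \<omega> - W l s \<omega> else 1) = W k t \<omega> - W k s \<omega>"
      by simp
    also have "(\<Prod>l\<in>UNIV. if \<forall>r\<in>J. W l r \<omega> \<in> E l r then 1 else 0 :: real) = indicator (cylinder J E) \<omega>"
    proof (cases "\<omega> \<in> cylinder J E")
      case True
      then show ?thesis by (auto simp: cylinder_def intro!: prod.neutral)
    next
      case False
      with \<omega> obtain l where "\<not> (\<forall>r\<in>J. W l r \<omega> \<in> E l r)" by (auto simp: cylinder_def)
      then have "(\<Prod>l\<in>UNIV. if \<forall>r\<in>J. W l r \<omega> \<in> E l r then 1 else 0 :: real) = 0"
        by (intro prod_zero) auto
      then show ?thesis using False by simp
    qed
    finally show "indicator (cylinder J E) \<omega> * (W k t \<omega> - W k s \<omega>) = (\<Prod>l\<in>UNIV. X l \<omega>)" by simp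
  qed
  also have "\<dots> = (\<Prod>l\<in>UNIV. \<integral>\<omega>. X l \<omega> \<partial>\<Omega>)"
    by (rule indep_vars_lebesgue_integral[OF finite ind int])
  also have "\<dots> = 0"
  proof (rule prod_zero[OF finite], rule bexI[of _ k])
    show "(\<integral>\<omega>. X k \<omega> \<partial>\<Omega>) = 0"
      using brownian_increment_cylinder[OF brownian prob_space_axioms st J, of "E k" k] E
      by (simp add: X mult.commute)
  qed simp
  finally show ?thesis .
qed

text \<open>Cylinders generate the past and are stable under intersection, so Dynkin's theorem applies.\<close>

lemma increment_past_event:
  assumes st: "0 \<le> s" "s \<le> t" and A: "A \<in> sets (past s)"
  shows "(LINT \<omega>:A|\<Omega>. W k t \<omega> - W k s \<omega>) = 0"
proof -
  have sub: "B \<in> sets \<Omega>" if "B \<in> sets (past s)" for B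
    using that past_subalgebra[of s] unfolding subalgebra_def by blast
  have int: "set_integrable \<Omega> B (\<lambda>\<omega>. W k t \<omega> - W k s \<omega>)" if "B \<in> sets (past s)" for B
    unfolding set_integrable_def
    by (rule integrable_mult_indicator[OF sub[OF that] increment(1)[OF st]])
  note cylinder_Int_stable[of s]
  moreover have "{cylinder J E | J E. finite J \<and> J \<subseteq> {0..s} \<and> (\<forall>k r. E k r \<in> sets borel)} \<subseteq> Pow (space \<Omega>)"
    by (auto simp: cylinder_def)
  moreover from A have "A \<in> sigma_sets (space \<Omega>)
      {cylinder J E | J E. finite J \<and> J \<subseteq> {0..s} \<and> (\<forall>k r. E k r \<in> sets borel)}"
    by (simp add: sets_past_cylinders)
  ultimately show ?thesis
  proof (induction A rule: sigma_sets_induct_disjoint)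
    case (basic A)
    then obtain J E where A: "A = cylinder J E" "finite J" "J \<subseteq> {0..s}" "\<And>k r. E k r \<in> sets borel"
      by blast
    show ?case
      unfolding A(1) set_lebesgue_integral_def using increment_cylinder[OF st A(2-4)] by simp
  next
    case (compl A)
    have A: "A \<in> sets (past s)" using compl(1) by (simp only: sets_past_cylinders)
    have "(LINT \<omega>:A \<union> (space \<Omega> - A)|\<Omega>. W k t \<omega> - W k s \<omega>)
        = (LINT \<omega>:A|\<Omega>. W k t \<omega> - W k s \<omega>) + (LINT \<omega>:space \<Omega> - A|\<Omega>. W k t \<omega> - W k s \<omega>)"
    proof (rule set_integral_Un[OF _ int[OF A] int])
      show "space \<Omega> - A \<in> sets (past s)" using sets.compl_sets[OF A] by simp
    qed blast
    moreover have "A \<union> (space \<Omega> - A) = space \<Omega>" using sub[OF A] sets.sets_into_space by blast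
    moreover have "(LINT \<omega>:space \<Omega>|\<Omega>. W k t \<omega> - W k s \<omega>) = 0"
      using increment(2)[OF st] by (simp add: set_integral_space increment(1)[OF st])
    ultimately show ?case by (simp add: compl(2))
  next
    case (union A)
    have A: "A i \<in> sets (past s)" for i using union(2) unfolding sets_past_cylinders by blast
    then have "(\<Union>i. A i) \<in> sets (past s)" by (intro sets.countable_UN) blast
    then have "(LINT \<omega>:(\<Union>i. A i)|\<Omega>. W k t \<omega> - W k s \<omega>) = (\<Sum>i. LINT \<omega>:A i|\<Omega>. W k t \<omega> - W k s \<omega>)"
    proof (intro lebesgue_integral_countable_add int sub A)
      show "A i \<inter> A j = {}" if "i \<noteq> j" for i j
        using union(1) that unfolding disjoint_family_on_def by blast
    qed
    then show ?case by (simp add: union(3))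
  next
    case empty
    show ?case by (simp add: set_lebesgue_integral_def)
  qed
qed

text \<open>The conditional expectation of the increment given the past vanishes.\<close>

lemma increment_orthogonal_past:
  assumes st: "0 \<le> s" "s \<le> t" and h: "h \<in> borel_measurable (past s)"
    and int: "integrable \<Omega> (\<lambda>\<omega>. h \<omega> * (W k t \<omega> - W k s \<omega>))"
  shows "(\<integral>\<omega>. h \<omega> * (W k t \<omega> - W k s \<omega>) \<partial>\<Omega>) = 0"
proof -
  have sub: "sigma_finite_subalgebra \<Omega> (past s)"
    by (intro finite_measure_subalgebra_is_sigma_finite finite_measure_subalgebra.intro
        finite_measure_axioms finite_measure_subalgebra_axioms.intro past_subalgebra)
  note intg = sigma_finite_subalgebra.real_cond_exp_intg[OF sub]
  let ?D = "\<lambda>\<omega>. W k t \<omega> - W k s \<omega>"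
  have D: "?D \<in> borel_measurable \<Omega>" by (rule borel_measurable_integrable[OF increment(1)[OF st]])
  have "AE \<omega> in \<Omega>. real_cond_exp \<Omega> (past s) ?D \<omega> = 0"
  proof (rule sigma_finite_subalgebra.real_cond_exp_charact[OF sub])
    show "(LINT \<omega>:A|\<Omega>. ?D \<omega>) = (LINT \<omega>:A|\<Omega>. 0)" if "A \<in> sets (past s)" for A
      using increment_past_event[OF st that] by (simp add: set_lebesgue_integral_def)
  qed (simp_all add: increment(1)[OF st])
  then have "(\<integral>\<omega>. h \<omega> * real_cond_exp \<Omega> (past s) ?D \<omega> \<partial>\<Omega>) = (\<integral>\<omega>. 0 \<partial>\<Omega>)"
    using intg(1)[OF int h D] by (intro integral_cong_AE) auto
  then show ?thesis using intg(2)[OF int h D] by simp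
qed

lemma increment_square_integrable_mult:
  assumes "integrable \<Omega> (\<lambda>\<omega>. (h \<omega>)\<^sup>2)" "h \<in> borel_measurable \<Omega>" "0 \<le> s" "s \<le> t"
  shows "integrable \<Omega> (\<lambda>\<omega>. h \<omega> * (W k t \<omega> - W k s \<omega>))"
proof (rule Bochner_Integration.integrable_bound)
  show "integrable \<Omega> (\<lambda>\<omega>. (h \<omega>)\<^sup>2 + (W k t \<omega> - W k s \<omega>)\<^sup>2)"
    by (intro Bochner_Integration.integrable_add assms(1) increment(3)[OF assms(3,4)])
  show "(\<lambda>\<omega>. h \<omega> * (W k t \<omega> - W k s \<omega>)) \<in> borel_measurable \<Omega>"
    by (intro borel_measurable_times assms(2) borel_measurable_integrable[OF increment(1)[OF assms(3,4)]])
  show "AE \<omega> in \<Omega>. norm (h \<omega> * (W k t \<omega> - W k s \<omega>)) \<le> norm ((h \<omega>)\<^sup>2 + (W k t \<omega> - W k s \<omega>)\<^sup>2)"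
    using abs_mult_le_squares by (intro AE_I2) (simp only: real_norm_def abs_of_nonneg[OF sum_power2_ge_zero])
qed

lemma increment_covariance_0:
  assumes "0 \<le> s" "0 \<le> t"
  shows "(\<integral>\<omega>. (W k s \<omega> - W k 0 \<omega>) * (W k t \<omega> - W k 0 \<omega>) \<partial>\<Omega>) = min s t"
  using assms
proof (induction s t rule: linorder_wlog)
  case (le s t)
  let ?V = "\<lambda>r \<omega>. W k r \<omega> - W k 0 \<omega>"
  have sq: "integrable \<Omega> (\<lambda>\<omega>. (?V s \<omega>)\<^sup>2)" using le increment(3)[of 0 s] by simp
  have m: "?V s \<in> borel_measurable (past s)"
    using le by (intro borel_measurable_diff W_past_measurable) auto
  have i: "integrable \<Omega> (\<lambda>\<omega>. ?V s \<omega> * (W k t \<omega> - W k s \<omega>))"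
    using le by (intro increment_square_integrable_mult sq) auto
  have "(\<integral>\<omega>. ?V s \<omega> * ?V t \<omega> \<partial>\<Omega>) = (\<integral>\<omega>. (?V s \<omega>)\<^sup>2 + ?V s \<omega> * (W k t \<omega> - W k s \<omega>) \<partial>\<Omega>)"
    by (intro Bochner_Integration.integral_cong refl) (simp add: power2_eq_square algebra_simps)
  also have "\<dots> = s"
    using increment(4)[of 0 s k] increment_orthogonal_past[OF _ _ m i] sq i le by simp
  finally show ?case using le by simp
next
  case (sym s t)
  then show ?case by (simp add: mult.commute min.commute)
qed

lemma increment_covariance:
  assumes "0 \<le> s" "s \<le> t" "0 \<le> s'" "s' \<le> t'"
  shows "integrable \<Omega> (\<lambda>\<omega>. (W k t \<omega> - W k s \<omega>) * (W l t' \<omega> - W l s' \<omega>))"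
    and "(\<integral>\<omega>. (W k t \<omega> - W k s \<omega>) * (W l t' \<omega> - W l s' \<omega>) \<partial>\<Omega>)
      = (if k = l then measure lborel ({s<..t} \<inter> {s'<..t'}) else 0)"
proof -
  have int: "integrable \<Omega> (\<lambda>\<omega>. (W k t \<omega> - W k s \<omega>) * (W l t' \<omega> - W l s' \<omega>))"
    if "0 \<le> s" "s \<le> t" "0 \<le> s'" "s' \<le> t'" for s t s' t' k l
    using that by (intro increment_square_integrable_mult increment(3) borel_measurable_integrable[OF increment(1)])
  show "integrable \<Omega> (\<lambda>\<omega>. (W k t \<omega> - W k s \<omega>) * (W l t' \<omega> - W l s' \<omega>))"
    using assms by (rule int)
  show "(\<integral>\<omega>. (W k t \<omega> - W k s \<omega>) * (W l t' \<omega> - W l s' \<omega>) \<partial>\<Omega>)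
      = (if k = l then measure lborel ({s<..t} \<inter> {s'<..t'}) else 0)"
  proof (cases "k = l")
    case True
    let ?V = "\<lambda>r \<omega>. W k r \<omega> - W k 0 \<omega>"
    have i: "integrable \<Omega> (\<lambda>\<omega>. ?V r \<omega> * ?V r' \<omega>)" if "0 \<le> r" "0 \<le> r'" for r r'
      using int[of 0 r 0 r' k k] that by simp
    have "(\<integral>\<omega>. (W k t \<omega> - W k s \<omega>) * (W l t' \<omega> - W l s' \<omega>) \<partial>\<Omega>)
        = (\<integral>\<omega>. ?V t \<omega> * ?V t' \<omega> - ?V s \<omega> * ?V t' \<omega> - ?V t \<omega> * ?V s' \<omega> + ?V s \<omega> * ?V s' \<omega> \<partial>\<Omega>)"
      by (intro Bochner_Integration.integral_cong refl) (simp add: True algebra_simps)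
    also have "\<dots> = min t t' - min s t' - min t s' + min s s'"
      using assms i by (simp add: increment_covariance_0)
    also have "\<dots> = measure lborel ({s<..t} \<inter> {s'<..t'})"
      using assms by (auto simp: max_def min_def)
    finally show ?thesis using True by simp
  next
    case False
    let ?P = "PiM {0..} (\<lambda>_. borel :: real measure)"
    have m: "(\<lambda>x. x i v - x i u) \<in> borel_measurable (PiM {i} (\<lambda>_. ?P))" if "0 \<le> u" "0 \<le> v" for i :: 'n and u v
    proof (rule borel_measurable_diff)
      show "(\<lambda>x. x i v) \<in> borel_measurable (PiM {i} (\<lambda>_. ?P))"
        by (rule measurable_compose[where f="\<lambda>x. x i" and g="\<lambda>x. x v",
              OF measurable_component_singleton path_component_measurable]) (use that in auto)
      show "(\<lambda>x. x i u) \<in> borel_measurable (PiM {i} (\<lambda>_. ?P))"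
        by (rule measurable_compose[where f="\<lambda>x. x i" and g="\<lambda>x. x u",
              OF measurable_component_singleton path_component_measurable]) (use that in auto)
    qed
    have "indep_var (PiM {k} (\<lambda>_. ?P)) (\<lambda>\<omega>. \<lambda>i\<in>{k}. \<lambda>t\<in>{0..}. W i t \<omega>)
        (PiM {l} (\<lambda>_. ?P)) (\<lambda>\<omega>. \<lambda>i\<in>{l}. \<lambda>t\<in>{0..}. W i t \<omega>)"
      using independent unfolding independent_processes_def by (rule indep_var_restrict) (use False in auto)
    from indep_var_compose[OF this m[of s t] m[of s' t']]
    have "indep_var borel (\<lambda>\<omega>. W k t \<omega> - W k s \<omega>) borel (\<lambda>\<omega>. W l t' \<omega> - W l s' \<omega>)"
      using assms by (simp add: o_def)
    from indep_var_lebesgue_integral[OF this] show ?thesis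
      using assms False by (simp add: increment)
  qed
qed

end

section \<open>Wiener integrals of deterministic operators\<close>

locale q_noise = brownian_family \<Omega> W
  for \<Omega> :: "'w measure" and W :: "'n::finite \<Rightarrow> real \<Rightarrow> 'w \<Rightarrow> real" +
  fixes f :: "'n \<Rightarrow> L2_01" and lam :: "'n \<Rightarrow> real" and w :: "real \<Rightarrow> 'w \<Rightarrow> L2_01"
  assumes lam_nonneg: "0 \<le> lam k"
    and noise: "0 \<le> t \<Longrightarrow> \<omega> \<in> space \<Omega> \<Longrightarrow> w t \<omega> = (\<Sum>k\<in>UNIV. (sqrt (lam k) * W k t \<omega>) *\<^sub>R f k)"
begin

lemma w_past_measurable: "0 \<le> r \<Longrightarrow> r \<le> s \<Longrightarrow> w r \<in> borel_measurable (past s)"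
proof -
  assume r: "0 \<le> r" "r \<le> s"
  have "(\<lambda>\<omega>. \<Sum>k\<in>UNIV. (sqrt (lam k) * W k r \<omega>) *\<^sub>R f k) \<in> borel_measurable (past s)"
    by (intro borel_measurable_sum borel_measurable_scaleR borel_measurable_times W_past_measurable r
        borel_measurable_const)
  then show "w r \<in> borel_measurable (past s)"
    by (subst measurable_cong[OF noise[OF r(1)]]) auto
qed

lemma w_measurable [measurable]: "0 \<le> r \<Longrightarrow> w r \<in> borel_measurable \<Omega>"
  using measurable_from_subalg[OF past_subalgebra w_past_measurable[of r r]] by simp

lemma w_continuous:
  assumes "\<omega> \<in> space \<Omega>" shows "continuous_on {0..} (\<lambda>t. w t \<omega>)"
proof -
  have "continuous_on {0..} (\<lambda>t. W k t \<omega>)" for k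
    using brownian[of k] assms by (auto simp: standard_brownian_motion_def)
  then have "continuous_on {0..} (\<lambda>t. \<Sum>k\<in>UNIV. (sqrt (lam k) * W k t \<omega>) *\<^sub>R f k)"
    by (intro continuous_intros)
  then show ?thesis using noise assms by (subst continuous_on_cong[OF refl]) auto
qed

lemma natural_filtration_gen:
  "{w r -` E \<inter> space \<Omega> | r E. 0 \<le> r \<and> r \<le> s \<and> E \<in> sets borel} \<subseteq> sets (past s)"
proof clarify
  fix r and E :: "L2_01 set" assume "0 \<le> r" "r \<le> s" "E \<in> sets borel"
  then show "w r -` E \<inter> space \<Omega> \<in> sets (past s)"
    using measurable_sets[OF w_past_measurable, of r s E] by simp
qed

lemma space_natural_filtration [simp]: "space (natural_filtration \<Omega> w s) = space \<Omega>"
  unfolding natural_filtration_def by (intro space_measure_of) auto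

lemma sets_natural_filtration: "sets (natural_filtration \<Omega> w s)
    = sigma_sets (space \<Omega>) {w r -` E \<inter> space \<Omega> | r E. 0 \<le> r \<and> r \<le> s \<and> E \<in> sets borel}"
  unfolding natural_filtration_def by (intro sets_measure_of) auto

lemma natural_filtration_subalgebra_past: "subalgebra (past s) (natural_filtration \<Omega> w s)"
  unfolding subalgebra_def sets_natural_filtration
  using sets.sigma_sets_subset[OF natural_filtration_gen[of s]] by simp

lemma natural_filtration_subalgebra: "subalgebra \<Omega> (natural_filtration \<Omega> w s)"
  using natural_filtration_subalgebra_past[of s] past_subalgebra[of s]
  unfolding subalgebra_def by auto

lemma w_adapted: "0 \<le> r \<Longrightarrow> r \<le> s \<Longrightarrow> w r \<in> borel_measurable (natural_filtration \<Omega> w s)"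
  by (rule measurableI) (auto simp: sets_natural_filtration intro!: sigma_sets.Basic)

lemma w_increment:
  assumes "0 \<le> s" "0 \<le> t" "\<omega> \<in> space \<Omega>"
  shows "w t \<omega> - w s \<omega> = (\<Sum>k\<in>UNIV. (sqrt (lam k) * (W k t \<omega> - W k s \<omega>)) *\<^sub>R f k)"
  using assms by (simp add: noise sum_subtractf algebra_simps)

text \<open>The filtration of the noise is contained in the past of the Brownian motions, whose increments are orthogonal to the past in each coordinate.\<close>

lemma noise_increment_orthogonal:
  fixes C :: "L2_01 \<Rightarrow>\<^sub>L L2_01"
  assumes st: "0 \<le> s" "s \<le> t" and h: "h \<in> borel_measurable (natural_filtration \<Omega> w s)"
    and sq: "integrable \<Omega> (\<lambda>\<omega>. (norm (h \<omega>))\<^sup>2)"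
  shows "integrable \<Omega> (\<lambda>\<omega>. h \<omega> \<bullet> blinfun_apply C (w t \<omega> - w s \<omega>))"
    and "(\<integral>\<omega>. h \<omega> \<bullet> blinfun_apply C (w t \<omega> - w s \<omega>) \<partial>\<Omega>) = 0"
proof -
  let ?g = "\<lambda>k \<omega>. h \<omega> \<bullet> C (f k)"
  have hp: "h \<in> borel_measurable (past s)"
    by (rule measurable_from_subalg[OF natural_filtration_subalgebra_past h])
  have h\<Omega>: "h \<in> borel_measurable \<Omega>" by (rule measurable_from_subalg[OF past_subalgebra hp])
  have g: "?g k \<in> borel_measurable (past s)" for k
    by (rule borel_measurable_inner[OF hp borel_measurable_const])
  have g': "?g k \<in> borel_measurable \<Omega>" for k
    by (rule borel_measurable_inner[OF h\<Omega> borel_measurable_const])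
  have gsq: "integrable \<Omega> (\<lambda>\<omega>. (?g k \<omega>)\<^sup>2)" for k
  proof (rule Bochner_Integration.integrable_bound)
    show "integrable \<Omega> (\<lambda>\<omega>. (norm (C (f k)))\<^sup>2 * (norm (h \<omega>))\<^sup>2)" using sq by simp
    show "(\<lambda>\<omega>. (?g k \<omega>)\<^sup>2) \<in> borel_measurable \<Omega>" by (intro borel_measurable_power g')
    have "\<bar>?g k \<omega>\<bar>\<^sup>2 \<le> (norm (h \<omega>) * norm (C (f k)))\<^sup>2" for \<omega>
      by (intro power_mono Cauchy_Schwarz_ineq2) simp
    then show "AE \<omega> in \<Omega>. norm ((?g k \<omega>)\<^sup>2) \<le> norm ((norm (C (f k)))\<^sup>2 * (norm (h \<omega>))\<^sup>2)"
      by (intro AE_I2) (simp add: power_mult_distrib mult.commute)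
  qed
  have eq: "h \<omega> \<bullet> blinfun_apply C (w t \<omega> - w s \<omega>)
      = (\<Sum>k\<in>UNIV. sqrt (lam k) * (?g k \<omega> * (W k t \<omega> - W k s \<omega>)))" if "\<omega> \<in> space \<Omega>" for \<omega>
    using that st by (simp add: w_increment blinfun.sum_right blinfun.scaleR_right inner_sum_right mult_ac)
  have int: "integrable \<Omega> (\<lambda>\<omega>. ?g k \<omega> * (W k t \<omega> - W k s \<omega>))" for k
    by (rule increment_square_integrable_mult[OF gsq g' st])
  show "integrable \<Omega> (\<lambda>\<omega>. h \<omega> \<bullet> blinfun_apply C (w t \<omega> - w s \<omega>))"
    by (subst Bochner_Integration.integrable_cong[OF refl eq])
      (auto intro!: Bochner_Integration.integrable_sum integrable_mult_right int)
  have "(\<integral>\<omega>. h \<omega> \<bullet> blinfun_apply C (w t \<omega> - w s \<omega>) \<partial>\<Omega>)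
      = (\<integral>\<omega>. (\<Sum>k\<in>UNIV. sqrt (lam k) * (?g k \<omega> * (W k t \<omega> - W k s \<omega>))) \<partial>\<Omega>)"
    by (rule Bochner_Integration.integral_cong[OF refl eq])
  also have "\<dots> = (\<Sum>k\<in>UNIV. sqrt (lam k) * (\<integral>\<omega>. ?g k \<omega> * (W k t \<omega> - W k s \<omega>) \<partial>\<Omega>))"
    using int by (subst Bochner_Integration.integral_sum) auto
  also have "\<dots> = 0"
    using increment_orthogonal_past[OF st g int] by simp
  finally show "(\<integral>\<omega>. h \<omega> \<bullet> blinfun_apply C (w t \<omega> - w s \<omega>) \<partial>\<Omega>) = 0" .
qed

lemma step_integral_expand:
  assumes "0 \<le> \<tau> 0" "incseq \<tau>" "\<omega> \<in> space \<Omega>"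
  shows "step_integral n \<tau> \<Psi> w \<omega>
    = (\<Sum>i<n. \<Sum>k\<in>UNIV. (sqrt (lam k) * (W k (\<tau> (Suc i)) \<omega> - W k (\<tau> i) \<omega>)) *\<^sub>R \<Psi> i (f k))"
proof -
  have "0 \<le> \<tau> i" for i using assms(1) incseqD[OF assms(2), of 0 i] by simp
  then show ?thesis
    using assms by (simp add: step_integral_def w_increment blinfun.sum_right blinfun.scaleR_right)
qed

lemma step_integral_measurable:
  assumes "0 \<le> \<tau> 0" "incseq \<tau>"
  shows "step_integral n \<tau> \<Psi> w \<in> borel_measurable \<Omega>"
proof -
  have "0 \<le> \<tau> i" for i using assms(1) incseqD[OF assms(2), of 0 i] by simp
  then show ?thesis
    by (subst measurable_cong[OF step_integral_expand[OF assms]])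
      (auto intro!: borel_measurable_sum borel_measurable_scaleR borel_measurable_times borel_measurable_diff W_measurable)
qed

text \<open>The polarised isometry.  The common value is not stated, since it is only used to compare the two sides.\<close>

lemma step_integral_inner:
  assumes \<tau>: "0 \<le> \<tau> 0" "incseq \<tau>" and \<tau>': "0 \<le> \<tau>' 0" "incseq \<tau>'"
  shows "\<exists>c. has_bochner_integral \<Omega> (\<lambda>\<omega>. step_integral n \<tau> \<Psi> w \<omega> \<bullet> step_integral n' \<tau>' \<Psi>' w \<omega>) c
    \<and> has_bochner_integral lborel
      (\<lambda>s. \<Sum>k\<in>UNIV. lam k * (step_operator n \<tau> \<Psi> s (f k) \<bullet> step_operator n' \<tau>' \<Psi>' s (f k))) c"
proof -
  have t0: "0 \<le> \<tau> i" "\<tau> i \<le> \<tau> (Suc i)" "0 \<le> \<tau>' i" "\<tau>' i \<le> \<tau>' (Suc i)" for i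
    using \<tau>(1) incseqD[OF \<tau>(2), of 0 i] incseqD[OF \<tau>(2), of i "Suc i"]
      \<tau>'(1) incseqD[OF \<tau>'(2), of 0 i] incseqD[OF \<tau>'(2), of i "Suc i"] by simp_all
  let ?I = "\<lambda>i. {\<tau> i<..\<tau> (Suc i)}" and ?I' = "\<lambda>i. {\<tau>' i<..\<tau>' (Suc i)}"
  let ?D = "\<lambda>k i \<omega>. W k (\<tau> (Suc i)) \<omega> - W k (\<tau> i) \<omega>" and ?D' = "\<lambda>k i \<omega>. W k (\<tau>' (Suc i)) \<omega> - W k (\<tau>' i) \<omega>"
  let ?p = "\<lambda>i k j l. sqrt (lam k) * sqrt (lam l) * (\<Psi> i (f k) \<bullet> \<Psi>' j (f l))"
  define c where "c = (\<Sum>i<n. \<Sum>k\<in>UNIV. \<Sum>j<n'. \<Sum>l\<in>UNIV. ?p i k j l * (if k = l then measure lborel (?I i \<inter> ?I' j) else 0))"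
  have "has_bochner_integral \<Omega> (\<lambda>\<omega>. \<Sum>i<n. \<Sum>k\<in>UNIV. \<Sum>j<n'. \<Sum>l\<in>UNIV. ?p i k j l * (?D k i \<omega> * ?D' l j \<omega>)) c"
    unfolding c_def
    by (intro has_bochner_integral_sum has_bochner_integral_mult_right)
      (simp only: has_bochner_integral_iff increment_covariance[OF t0] simp_thms)
  moreover have "step_integral n \<tau> \<Psi> w \<omega> \<bullet> step_integral n' \<tau>' \<Psi>' w \<omega>
      = (\<Sum>i<n. \<Sum>k\<in>UNIV. \<Sum>j<n'. \<Sum>l\<in>UNIV. ?p i k j l * (?D k i \<omega> * ?D' l j \<omega>))" if "\<omega> \<in> space \<Omega>" for \<omega>
    unfolding step_integral_expand[OF \<tau> that] step_integral_expand[OF \<tau>' that] inner_sum_left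
    by (intro sum.cong refl) (simp add: inner_sum_right sum_distrib_left mult_ac)
  ultimately have 1: "has_bochner_integral \<Omega> (\<lambda>\<omega>. step_integral n \<tau> \<Psi> w \<omega> \<bullet> step_integral n' \<tau>' \<Psi>' w \<omega>) c"
    by (subst has_bochner_integral_cong[OF refl _ refl]) auto
  have ind: "has_bochner_integral lborel (\<lambda>s. indicat_real (?I i) s * indicat_real (?I' j) s) (measure lborel (?I i \<inter> ?I' j))" for i j
  proof -
    have "has_bochner_integral lborel (indicat_real (?I i \<inter> ?I' j)) (measure lborel (?I i \<inter> ?I' j))"
    proof (rule has_bochner_integral_real_indicator)
      have "emeasure lborel (?I i \<inter> ?I' j) \<le> emeasure lborel (?I i)" by (intro emeasure_mono) auto
      also have "\<dots> < \<infinity>" using t0(2) by simp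
      finally show "emeasure lborel (?I i \<inter> ?I' j) < \<infinity>" .
    qed simp
    then show ?thesis unfolding indicator_inter_arith[symmetric] .
  qed
  have "has_bochner_integral lborel (\<lambda>s. \<Sum>i<n. \<Sum>k\<in>UNIV. \<Sum>j<n'. lam k * (\<Psi> i (f k) \<bullet> \<Psi>' j (f k)) * (indicat_real (?I i) s * indicat_real (?I' j) s))
     (\<Sum>i<n. \<Sum>k\<in>UNIV. \<Sum>j<n'. lam k * (\<Psi> i (f k) \<bullet> \<Psi>' j (f k)) * measure lborel (?I i \<inter> ?I' j))"
    by (intro has_bochner_integral_sum has_bochner_integral_mult_right ind)
  moreover have "(\<Sum>i<n. \<Sum>k\<in>UNIV. \<Sum>j<n'. lam k * (\<Psi> i (f k) \<bullet> \<Psi>' j (f k)) * measure lborel (?I i \<inter> ?I' j)) = c"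
  proof -
    have "(\<Sum>l\<in>UNIV. ?p i k j l * (if k = l then measure lborel (?I i \<inter> ?I' j) else 0))
        = lam k * (\<Psi> i (f k) \<bullet> \<Psi>' j (f k)) * measure lborel (?I i \<inter> ?I' j)" for i k j
    proof -
      have "(\<Sum>l\<in>UNIV. ?p i k j l * (if k = l then measure lborel (?I i \<inter> ?I' j) else 0))
          = (\<Sum>l\<in>UNIV. if k = l then ?p i k j l * measure lborel (?I i \<inter> ?I' j) else 0)"
        by (intro sum.cong) auto
      also have "\<dots> = ?p i k j k * measure lborel (?I i \<inter> ?I' j)" by simp
      finally show ?thesis using lam_nonneg[of k] by (simp only: real_sqrt_mult_self abs_of_nonneg)
    qed
    then show ?thesis unfolding c_def by (simp only:)
  qed
  moreover have "(\<Sum>i<n. \<Sum>k\<in>UNIV. \<Sum>j<n'. lam k * (\<Psi> i (f k) \<bullet> \<Psi>' j (f k)) * (indicat_real (?I i) s * indicat_real (?I' j) s))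
      = (\<Sum>k\<in>UNIV. lam k * (step_operator n \<tau> \<Psi> s (f k) \<bullet> step_operator n' \<tau>' \<Psi>' s (f k)))" for s
  proof -
    have "(\<Sum>k\<in>UNIV. lam k * (step_operator n \<tau> \<Psi> s (f k) \<bullet> step_operator n' \<tau>' \<Psi>' s (f k)))
        = (\<Sum>k\<in>UNIV. \<Sum>i<n. \<Sum>j<n'. lam k * (\<Psi> i (f k) \<bullet> \<Psi>' j (f k)) * (indicat_real (?I i) s * indicat_real (?I' j) s))"
      unfolding step_operator_def blinfun.sum_left inner_sum_left sum_distrib_left
      by (intro sum.cong refl) (simp only: inner_sum_right sum_distrib_left blinfun.scaleR_left
          inner_scaleR_left inner_scaleR_right mult_ac)
    also have "\<dots> = (\<Sum>i<n. \<Sum>k\<in>UNIV. \<Sum>j<n'. lam k * (\<Psi> i (f k) \<bullet> \<Psi>' j (f k)) * (indicat_real (?I i) s * indicat_real (?I' j) s))"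
      by (rule sum.swap)
    finally show ?thesis ..
  qed
  ultimately show ?thesis using 1 by auto
qed

text \<open>The density at time \<open>s\<close> of the squared distance between two integrands in the norm of the isometry.\<close>

abbreviation isometry_dist :: "(real \<Rightarrow> L2_01 \<Rightarrow>\<^sub>L L2_01) \<Rightarrow> (real \<Rightarrow> L2_01 \<Rightarrow>\<^sub>L L2_01) \<Rightarrow> real \<Rightarrow> real" where
  "isometry_dist S S' s \<equiv> (\<Sum>k\<in>UNIV. lam k * (norm ((S s - S' s) (f k)))\<^sup>2)"

lemma isometry_dist_nonneg: "0 \<le> isometry_dist S S' s"
  by (intro sum_nonneg mult_nonneg_nonneg lam_nonneg) simp

lemma isometry_dist_triangle:
  "isometry_dist S S'' s \<le> 2 * isometry_dist S S' s + 2 * isometry_dist S' S'' s"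
proof -
  have "lam k * (norm ((S s - S'' s) (f k)))\<^sup>2
      \<le> 2 * (lam k * (norm ((S s - S' s) (f k)))\<^sup>2) + 2 * (lam k * (norm ((S' s - S'' s) (f k)))\<^sup>2)" for k
  proof -
    have "norm ((S s - S'' s) (f k)) \<le> norm ((S s - S' s) (f k)) + norm ((S' s - S'' s) (f k))"
      using norm_triangle_ineq[of "(S s - S' s) (f k)" "(S' s - S'' s) (f k)"] by (simp add: blinfun.diff_left)
    then have "(norm ((S s - S'' s) (f k)))\<^sup>2 \<le> (norm ((S s - S' s) (f k)) + norm ((S' s - S'' s) (f k)))\<^sup>2"
      by (intro power_mono) auto
    also have "\<dots> \<le> 2 * (norm ((S s - S' s) (f k)))\<^sup>2 + 2 * (norm ((S' s - S'' s) (f k)))\<^sup>2"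
      using sum_squares_bound[of "norm ((S s - S' s) (f k))" "norm ((S' s - S'' s) (f k))"]
      by (simp add: power2_sum)
    finally have "lam k * (norm ((S s - S'' s) (f k)))\<^sup>2 \<le> lam k * (2 * (norm ((S s - S' s) (f k)))\<^sup>2 + 2 * (norm ((S' s - S'' s) (f k)))\<^sup>2)"
      by (intro mult_left_mono lam_nonneg)
    then show ?thesis by (simp add: algebra_simps)
  qed
  then show ?thesis unfolding sum_distrib_left sum.distrib[symmetric] by (intro sum_mono)
qed

lemma step_integral_isometry:
  assumes \<tau>: "0 \<le> \<tau> 0" "incseq \<tau>" and \<tau>': "0 \<le> \<tau>' 0" "incseq \<tau>'"
  shows "(\<integral>\<^sup>+\<omega>. ennreal ((norm (step_integral n \<tau> \<Psi> w \<omega> - step_integral n' \<tau>' \<Psi>' w \<omega>))\<^sup>2) \<partial>\<Omega>)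
    = (\<integral>\<^sup>+s. ennreal (isometry_dist (step_operator n \<tau> \<Psi>) (step_operator n' \<tau>' \<Psi>') s) \<partial>lborel)"
proof -
  let ?Z = "step_integral n \<tau> \<Psi> w" and ?Z' = "step_integral n' \<tau>' \<Psi>' w"
  let ?S = "step_operator n \<tau> \<Psi>" and ?S' = "step_operator n' \<tau>' \<Psi>'"
  let ?b = "\<lambda>S S' s. \<Sum>k\<in>UNIV. lam k * (blinfun_apply (S s) (f k) \<bullet> blinfun_apply (S' s) (f k))"
  obtain c1 where c1: "has_bochner_integral \<Omega> (\<lambda>\<omega>. ?Z \<omega> \<bullet> ?Z \<omega>) c1" "has_bochner_integral lborel (?b ?S ?S) c1"
    using step_integral_inner[OF \<tau> \<tau>, of n \<Psi> n \<Psi>] by (elim exE conjE)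
  obtain c2 where c2: "has_bochner_integral \<Omega> (\<lambda>\<omega>. ?Z \<omega> \<bullet> ?Z' \<omega>) c2" "has_bochner_integral lborel (?b ?S ?S') c2"
    using step_integral_inner[OF \<tau> \<tau>', of n \<Psi> n' \<Psi>'] by (elim exE conjE)
  obtain c3 where c3: "has_bochner_integral \<Omega> (\<lambda>\<omega>. ?Z' \<omega> \<bullet> ?Z' \<omega>) c3" "has_bochner_integral lborel (?b ?S' ?S') c3"
    using step_integral_inner[OF \<tau>' \<tau>', of n' \<Psi>' n' \<Psi>'] by (elim exE conjE)
  have "has_bochner_integral \<Omega> (\<lambda>\<omega>. ?Z \<omega> \<bullet> ?Z \<omega> - 2 * (?Z \<omega> \<bullet> ?Z' \<omega>) + ?Z' \<omega> \<bullet> ?Z' \<omega>) (c1 - 2 * c2 + c3)"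
    by (intro has_bochner_integral_add has_bochner_integral_diff has_bochner_integral_mult_right c1 c2 c3)
  then have 1: "has_bochner_integral \<Omega> (\<lambda>\<omega>. (norm (?Z \<omega> - ?Z' \<omega>))\<^sup>2) (c1 - 2 * c2 + c3)"
    by (simp add: power2_norm_eq_inner inner_diff_left inner_diff_right inner_commute algebra_simps)
  have "has_bochner_integral lborel (\<lambda>s. ?b ?S ?S s - 2 * ?b ?S ?S' s + ?b ?S' ?S' s) (c1 - 2 * c2 + c3)"
    by (intro has_bochner_integral_add has_bochner_integral_diff has_bochner_integral_mult_right c1 c2 c3)
  moreover have "?b ?S ?S s - 2 * ?b ?S ?S' s + ?b ?S' ?S' s = isometry_dist ?S ?S' s" for s
    unfolding sum_distrib_left sum_subtractf[symmetric] sum.distrib[symmetric]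
    by (intro sum.cong refl)
      (simp add: power2_norm_eq_inner blinfun.diff_left inner_diff_left inner_diff_right inner_commute algebra_simps)
  ultimately have 2: "has_bochner_integral lborel (isometry_dist ?S ?S') (c1 - 2 * c2 + c3)" by simp
  have "(\<integral>\<^sup>+\<omega>. ennreal ((norm (?Z \<omega> - ?Z' \<omega>))\<^sup>2) \<partial>\<Omega>) = ennreal (c1 - 2 * c2 + c3)"
    using nn_integral_eq_integral[OF integrable.intros[OF 1]] has_bochner_integral_integral_eq[OF 1] by simp
  moreover have "(\<integral>\<^sup>+s. ennreal (isometry_dist ?S ?S' s) \<partial>lborel) = ennreal (c1 - 2 * c2 + c3)"
    using nn_integral_eq_integral[OF integrable.intros[OF 2]] has_bochner_integral_integral_eq[OF 2]
    by (simp add: isometry_dist_nonneg)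
  ultimately show ?thesis by simp
qed

lemma step_integral_isometry_Icc:
  assumes \<tau>: "0 \<le> \<tau> 0" "incseq \<tau>" "\<tau> n \<le> t" and \<tau>': "0 \<le> \<tau>' 0" "incseq \<tau>'" "\<tau>' n' \<le> t"
  shows "(\<integral>\<^sup>+\<omega>. ennreal ((norm (step_integral n \<tau> \<Psi> w \<omega> - step_integral n' \<tau>' \<Psi>' w \<omega>))\<^sup>2) \<partial>\<Omega>)
    = (\<integral>\<^sup>+s\<in>{0..t}. ennreal (isometry_dist (step_operator n \<tau> \<Psi>) (step_operator n' \<tau>' \<Psi>') s) \<partial>lborel)"
proof -
  have z: "step_operator n \<tau> \<Psi> s = 0" if "0 \<le> \<tau> 0" "incseq \<tau>" "\<tau> n \<le> t" "s \<notin> {0..t}" for n \<tau> \<Psi> s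
    unfolding step_operator_def
  proof (rule sum.neutral, rule ballI)
    fix i assume "i \<in> {..<n}"
    then have "0 \<le> \<tau> i" "\<tau> (Suc i) \<le> t"
      using that incseqD[OF that(2), of 0 i] incseqD[OF that(2), of "Suc i" n] by auto
    then show "indicat_real {\<tau> i<..\<tau> (Suc i)} s *\<^sub>R \<Psi> i = 0" using that(4) by auto
  qed
  show ?thesis
    unfolding step_integral_isometry[OF \<tau>(1,2) \<tau>'(1,2)]
    using z[OF \<tau>] z[OF \<tau>'] by (intro nn_integral_cong) (auto split: split_indicator)
qed

end

lemma norm_diff_square_triangle:
  fixes x y z :: "'b::real_normed_vector"
  shows "(norm (x - z))\<^sup>2 \<le> 2 * (norm (x - y))\<^sup>2 + 2 * (norm (y - z))\<^sup>2"
proof -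
  have "norm (x - z) \<le> norm (x - y) + norm (y - z)"
    using norm_triangle_ineq[of "x - y" "y - z"] by simp
  then have "(norm (x - z))\<^sup>2 \<le> (norm (x - y) + norm (y - z))\<^sup>2" by (intro power_mono) auto
  also have "\<dots> \<le> 2 * (norm (x - y))\<^sup>2 + 2 * (norm (y - z))\<^sup>2"
    using sum_squares_bound[of "norm (x - y)" "norm (y - z)"] by (simp add: power2_sum)
  finally show ?thesis .
qed

lemma nn_integral_le_2_add_2:
  assumes [measurable]: "(\<lambda>x. g x) \<in> borel_measurable M" "(\<lambda>x. h x) \<in> borel_measurable M"
    and le: "\<And>x. x \<in> space M \<Longrightarrow> k x \<le> 2 * g x + 2 * h x"
    and nonneg: "\<And>x. 0 \<le> g x" "\<And>x. 0 \<le> h x"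
  shows "(\<integral>\<^sup>+x. ennreal (k x) \<partial>M) \<le> 2 * (\<integral>\<^sup>+x. ennreal (g x) \<partial>M) + 2 * (\<integral>\<^sup>+x. ennreal (h x) \<partial>M)"
proof -
  have "ennreal (k x) \<le> 2 * ennreal (g x) + 2 * ennreal (h x)" if "x \<in> space M" for x
  proof -
    have "ennreal (k x) \<le> ennreal (2 * g x + 2 * h x)" by (rule ennreal_leI[OF le[OF that]])
    also have "\<dots> = 2 * ennreal (g x) + 2 * ennreal (h x)"
      using nonneg by (simp add: ennreal_mult)
    finally show ?thesis .
  qed
  then have "(\<integral>\<^sup>+x. ennreal (k x) \<partial>M) \<le> (\<integral>\<^sup>+x. 2 * ennreal (g x) + 2 * ennreal (h x) \<partial>M)"
    by (rule nn_integral_mono)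
  also have "\<dots> = 2 * (\<integral>\<^sup>+x. ennreal (g x) \<partial>M) + 2 * (\<integral>\<^sup>+x. ennreal (h x) \<partial>M)"
    by (simp add: nn_integral_add nn_integral_cmult)
  finally show ?thesis .
qed

lemma blinfun_measurable:
  fixes X :: "'b::real_normed_vector \<Rightarrow>\<^sub>L 'c::real_normed_vector"
  assumes "h \<in> borel_measurable M" shows "(\<lambda>x. X (h x)) \<in> borel_measurable M"
  by (rule measurable_compose[OF assms borel_measurable_continuous_onI])
    (intro continuous_intros continuous_on_id)

context q_noise begin

lemma isometry_dist_measurable:
  fixes \<Phi> :: "real \<Rightarrow> L2_01 \<Rightarrow>\<^sub>L L2_01"
  assumes "\<And>v. set_borel_measurable borel {0..t} (\<lambda>s. \<Phi> s v)"
  shows "isometry_dist (step_operator n \<tau> \<Psi>) \<Phi> \<in> borel_measurable (lebT t)"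
proof -
  have [measurable]: "(\<lambda>s. \<Phi> s v) \<in> borel_measurable (lebT t)" for v
    using assms[of v] by (subst borel_measurable_restrict_space_iff) (auto simp: set_borel_measurable_def)
  have [measurable]: "(\<lambda>s. step_operator n \<tau> \<Psi> s v) \<in> borel_measurable (lebT t)" for v
    unfolding step_operator_def blinfun.sum_left blinfun.scaleR_left
    by (intro measurable_restrict_space1) measurable
  show ?thesis unfolding blinfun.diff_left by measurable
qed

text \<open>If two sequences of step functions approximate the same integrand, then they approximate each other, and by the isometry so do their integrals.\<close>

theorem wiener_integral_unique:
  assumes "has_wiener_integral \<Omega> f lam w t \<Phi> Z" "has_wiener_integral \<Omega> f lam w t \<Phi> Z'"
  shows "AE \<omega> in \<Omega>. Z \<omega> = Z' \<omega>"
proof -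
  have \<Phi>: "\<And>v. set_borel_measurable borel {0..t} (\<lambda>s. \<Phi> s v)"
    and [measurable]: "Z \<in> borel_measurable \<Omega>" "Z' \<in> borel_measurable \<Omega>"
    using assms by (auto simp: has_wiener_integral_def)
  obtain n \<tau> \<Psi> where \<tau>: "\<And>j::nat. 0 \<le> \<tau> j 0" "\<And>j. incseq (\<tau> j)" "\<And>j. \<tau> j (n j) \<le> t"
    and a: "(\<lambda>j. \<integral>\<^sup>+s\<in>{0..t}. ennreal (isometry_dist (step_operator (n j) (\<tau> j) (\<Psi> j)) \<Phi> s) \<partial>lborel) \<longlonglongrightarrow> 0"
    and e: "(\<lambda>j. \<integral>\<^sup>+\<omega>. ennreal ((norm (step_integral (n j) (\<tau> j) (\<Psi> j) w \<omega> - Z \<omega>))\<^sup>2) \<partial>\<Omega>) \<longlonglongrightarrow> 0"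
    using assms(1) unfolding has_wiener_integral_def by blast
  obtain n' \<tau>' \<Psi>' where \<tau>': "\<And>j::nat. 0 \<le> \<tau>' j 0" "\<And>j. incseq (\<tau>' j)" "\<And>j. \<tau>' j (n' j) \<le> t"
    and a': "(\<lambda>j. \<integral>\<^sup>+s\<in>{0..t}. ennreal (isometry_dist (step_operator (n' j) (\<tau>' j) (\<Psi>' j)) \<Phi> s) \<partial>lborel) \<longlonglongrightarrow> 0"
    and e': "(\<lambda>j. \<integral>\<^sup>+\<omega>. ennreal ((norm (step_integral (n' j) (\<tau>' j) (\<Psi>' j) w \<omega> - Z' \<omega>))\<^sup>2) \<partial>\<Omega>) \<longlonglongrightarrow> 0"
    using assms(2) unfolding has_wiener_integral_def by blast
  define X where "X j = step_integral (n j) (\<tau> j) (\<Psi> j) w" for j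
  define X' where "X' j = step_integral (n' j) (\<tau>' j) (\<Psi>' j) w" for j
  define S where "S j = step_operator (n j) (\<tau> j) (\<Psi> j)" for j
  define S' where "S' j = step_operator (n' j) (\<tau>' j) (\<Psi>' j)" for j
  note a = a[folded S_def, unfolded nn_integral_lebT] and a' = a'[folded S'_def, unfolded nn_integral_lebT]
    and e = e[folded X_def] and e' = e'[folded X'_def]
  have [measurable]: "X j \<in> borel_measurable \<Omega>" "X' j \<in> borel_measurable \<Omega>" for j
    unfolding X_def X'_def by (intro step_integral_measurable \<tau> \<tau>')+
  let ?I = "\<lambda>g. \<integral>\<^sup>+\<omega>. ennreal ((norm (g \<omega>))\<^sup>2) \<partial>\<Omega>"
  let ?J = "\<lambda>S. \<integral>\<^sup>+s. ennreal (isometry_dist S \<Phi> s) \<partial>lebT t"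
  have "?I (\<lambda>\<omega>. Z \<omega> - Z' \<omega>) \<le> 2 * ?I (\<lambda>\<omega>. X j \<omega> - Z \<omega>) + 2 * (2 * (2 * ?J (S j) + 2 * ?J (S' j)) + 2 * ?I (\<lambda>\<omega>. X' j \<omega> - Z' \<omega>))" for j
  proof -
    have "?I (\<lambda>\<omega>. X j \<omega> - X' j \<omega>) = (\<integral>\<^sup>+s. ennreal (isometry_dist (S j) (S' j) s) \<partial>lebT t)"
      unfolding X_def X'_def S_def S'_def nn_integral_lebT[symmetric] by (rule step_integral_isometry_Icc[OF \<tau> \<tau>'])
    also have "\<dots> \<le> 2 * ?J (S j) + 2 * ?J (S' j)"
    proof (rule nn_integral_le_2_add_2)
      show "isometry_dist (S j) (S' j) s \<le> 2 * isometry_dist (S j) \<Phi> s + 2 * isometry_dist (S' j) \<Phi> s" for s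
      proof -
        have "isometry_dist \<Phi> (S' j) s = isometry_dist (S' j) \<Phi> s"
          by (simp add: blinfun.diff_left norm_minus_commute)
        then show ?thesis using isometry_dist_triangle[where S="S j" and S''="S' j" and s=s and S'=\<Phi>] by simp
      qed
    qed (unfold S_def S'_def, (rule isometry_dist_measurable[OF \<Phi>] isometry_dist_nonneg)+)
    finally have XX': "?I (\<lambda>\<omega>. X j \<omega> - X' j \<omega>) \<le> 2 * ?J (S j) + 2 * ?J (S' j)" .
    have "?I (\<lambda>\<omega>. X j \<omega> - Z' \<omega>) \<le> 2 * ?I (\<lambda>\<omega>. X j \<omega> - X' j \<omega>) + 2 * ?I (\<lambda>\<omega>. X' j \<omega> - Z' \<omega>)"
      by (rule nn_integral_le_2_add_2) (measurable, auto intro: norm_diff_square_triangle)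
    also have "\<dots> \<le> 2 * (2 * ?J (S j) + 2 * ?J (S' j)) + 2 * ?I (\<lambda>\<omega>. X' j \<omega> - Z' \<omega>)"
      by (intro add_mono mult_left_mono XX') auto
    finally have XZ': "?I (\<lambda>\<omega>. X j \<omega> - Z' \<omega>) \<le> \<dots>" .
    have "?I (\<lambda>\<omega>. Z \<omega> - Z' \<omega>) \<le> 2 * ?I (\<lambda>\<omega>. X j \<omega> - Z \<omega>) + 2 * ?I (\<lambda>\<omega>. X j \<omega> - Z' \<omega>)"
      by (rule nn_integral_le_2_add_2)
        (measurable, use norm_diff_square_triangle[of "Z _" "Z' _" "X j _"] in \<open>auto simp: norm_minus_commute\<close>)
    also have "\<dots> \<le> 2 * ?I (\<lambda>\<omega>. X j \<omega> - Z \<omega>) + 2 * (2 * (2 * ?J (S j) + 2 * ?J (S' j)) + 2 * ?I (\<lambda>\<omega>. X' j \<omega> - Z' \<omega>))"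
      by (intro add_mono mult_left_mono XZ') auto
    finally show ?thesis .
  qed
  moreover have "(\<lambda>j. 2 * ?I (\<lambda>\<omega>. X j \<omega> - Z \<omega>) + 2 * (2 * (2 * ?J (S j) + 2 * ?J (S' j)) + 2 * ?I (\<lambda>\<omega>. X' j \<omega> - Z' \<omega>)))
      \<longlonglongrightarrow> 2 * 0 + 2 * (2 * (2 * 0 + 2 * 0) + 2 * 0)"
    by (intro tendsto_add ennreal_tendsto_cmult e e' a a') auto
  ultimately have "?I (\<lambda>\<omega>. Z \<omega> - Z' \<omega>) \<le> 0"
    by (intro LIMSEQ_le_const[where X="\<lambda>j. 2 * ?I (\<lambda>\<omega>. X j \<omega> - Z \<omega>) + 2 * (2 * (2 * ?J (S j) + 2 * ?J (S' j)) + 2 * ?I (\<lambda>\<omega>. X' j \<omega> - Z' \<omega>))"]) auto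
  then have "AE \<omega> in \<Omega>. ennreal ((norm (Z \<omega> - Z' \<omega>))\<^sup>2) = 0"
    by (subst (asm) le_zero_eq, subst (asm) nn_integral_0_iff_AE) auto
  then show ?thesis by eventually_elim simp
qed

end

section \<open>The stochastic convolution\<close>

lemma abel_summation_blinfun:
  fixes a :: "nat \<Rightarrow> 'a::real_normed_vector \<Rightarrow>\<^sub>L 'b::real_normed_vector"
  shows "(\<Sum>i<n. a i (b (Suc i) - b i)) = a n (b n) - a 0 (b 0) - (\<Sum>i<n. (a (Suc i) - a i) (b (Suc i)))"
  by (induction n) (simp_all add: blinfun.diff_left blinfun.diff_right algebra_simps)

lemma op_exp_reverse_derivative:
  fixes G :: "'a::banach \<Rightarrow>\<^sub>L 'a"
  shows "((\<lambda>s. op_exp ((t - s) *\<^sub>R G)) has_vector_derivative - (op_exp ((t - s) *\<^sub>R G) o\<^sub>L G)) (at s within S)"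
proof -
  have "((\<lambda>s. t - s) has_vector_derivative -1) (at s)" by (auto intro!: derivative_eq_intros)
  from vector_diff_chain_at[OF this op_exp_has_vector_derivative]
  have "((\<lambda>s. op_exp ((t - s) *\<^sub>R G)) has_vector_derivative - (op_exp ((t - s) *\<^sub>R G) o\<^sub>L G)) (at s)"
    by (simp add: o_def op_exp_commute)
  then show ?thesis by (rule has_vector_derivative_at_within)
qed

lemma op_exp_reverse_continuous_on:
  fixes G :: "'a::banach \<Rightarrow>\<^sub>L 'a"
  shows "continuous_on S (\<lambda>s. op_exp ((t - s) *\<^sub>R G))"
  unfolding continuous_on_eq_continuous_within
  using op_exp_reverse_derivative has_vector_derivative_continuous by blast

lemma op_exp_reverse_increment:
  fixes G :: "'a::banach \<Rightarrow>\<^sub>L 'a" and a b t :: real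
  assumes "a \<le> b"
  shows "((\<lambda>s. - op_exp ((t - s) *\<^sub>R G) (G x)) has_integral
    (op_exp ((t - b) *\<^sub>R G) - op_exp ((t - a) *\<^sub>R G)) x) {a..b}"
  unfolding blinfun.diff_left
proof (rule fundamental_theorem_of_calculus[OF assms])
  fix s
  show "((\<lambda>s. op_exp ((t - s) *\<^sub>R G) x) has_vector_derivative - op_exp ((t - s) *\<^sub>R G) (G x)) (at s within {a..b})"
    using bounded_linear.has_vector_derivative[OF blinfun.bounded_linear_left[of x] op_exp_reverse_derivative[where t=t and G=G and s=s and S="{a..b}"]]
    by (simp add: blinfun.minus_left)
qed

lemma op_exp_bounded:
  fixes G :: "'a::banach \<Rightarrow>\<^sub>L 'a"
  obtains B where "0 < B" "\<And>\<tau>. \<tau> \<in> {0..T} \<Longrightarrow> norm (op_exp (\<tau> *\<^sub>R G)) \<le> B"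
  using continuous_bounded_Icc[OF op_exp_continuous_on, of 0 T G] by metis

lemma op_exp_reverse_lipschitz:
  fixes G :: "'a::banach \<Rightarrow>\<^sub>L 'a"
  obtains L where "0 < L" "\<And>a b. 0 \<le> a \<Longrightarrow> a \<le> b \<Longrightarrow> b \<le> t \<Longrightarrow>
    norm (op_exp ((t - a) *\<^sub>R G) - op_exp ((t - b) *\<^sub>R G)) \<le> L * (b - a)"
proof -
  obtain B where B: "0 < B" "\<And>\<tau>. \<tau> \<in> {0..t} \<Longrightarrow> norm (op_exp (\<tau> *\<^sub>R G)) \<le> B"
    using op_exp_bounded[of t G] by metis
  define L where "L = B * (norm G + 1)"
  show ?thesis
  proof (rule that[of L])
    show "0 < L" using B by (simp add: L_def add_nonneg_pos)
    fix a b assume ab: "0 \<le> a" "a \<le> b" "b \<le> t"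
    have "((\<lambda>s. - (op_exp ((t - s) *\<^sub>R G) o\<^sub>L G)) has_integral
        (op_exp ((t - b) *\<^sub>R G) - op_exp ((t - a) *\<^sub>R G))) {a..b}"
      by (rule fundamental_theorem_of_calculus[OF ab(2) op_exp_reverse_derivative])
    then have "norm (op_exp ((t - b) *\<^sub>R G) - op_exp ((t - a) *\<^sub>R G)) \<le> L * measure lborel {a..b}"
    proof (rule has_integral_bound_real[rotated -2])
      show "0 \<le> L" using \<open>0 < L\<close> by simp
      fix s assume "s \<in> {a..b} - {}"
      then have "norm (op_exp ((t - s) *\<^sub>R G) o\<^sub>L G) \<le> B * (norm G + 1)"
        using ab by (intro order_trans[OF norm_blinfun_compose] mult_mono B(2)) (use B in auto)
      then show "norm (- (op_exp ((t - s) *\<^sub>R G) o\<^sub>L G)) \<le> L" by (simp add: L_def)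
    qed auto
    then show "norm (op_exp ((t - a) *\<^sub>R G) - op_exp ((t - b) *\<^sub>R G)) \<le> L * (b - a)"
      using ab by (simp add: norm_minus_commute)
  qed
qed

text \<open>The uniform grid of $[0,t]$ with \<open>N\<close> cells, continued by the constant \<open>t\<close> to an increasing sequence,
  which is the form in which step functions are given.\<close>

definition grid :: "real \<Rightarrow> nat \<Rightarrow> nat \<Rightarrow> real" where
  "grid t N i = real (min i N) * t / real N"

lemma grid_simps:
  assumes "0 < N" "0 \<le> t"
  shows "grid t N 0 = 0" "grid t N N = t" "incseq (grid t N)" "grid t N i \<in> {0..t}"
    "i < N \<Longrightarrow> grid t N (Suc i) - grid t N i = t / real N"
proof -
  show inc: "incseq (grid t N)"
    unfolding grid_def using assms by (intro incseq_SucI divide_right_mono mult_right_mono) auto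
  show g: "grid t N 0 = 0" "grid t N N = t" using assms by (simp_all add: grid_def)
  have "grid t N i \<le> t"
  proof -
    have "real (min i N) * t \<le> real N * t" using assms by (intro mult_right_mono) auto
    then show ?thesis using assms by (simp add: grid_def divide_le_eq mult.commute)
  qed
  then show "grid t N i \<in> {0..t}" using assms by (simp add: grid_def)
  show "i < N \<Longrightarrow> grid t N (Suc i) - grid t N i = t / real N"
    by (simp add: grid_def diff_divide_distrib[symmetric] algebra_simps)
qed

lemma step_operator_grid:
  assumes N: "0 < N" "0 \<le> t" and s: "s \<in> {0<..t}"
  shows "\<exists>i<N. s \<in> {grid t N i<..grid t N (Suc i)} \<and> step_operator N (grid t N) \<Psi> s = \<Psi> i"
proof -
  note g = grid_simps[OF N]
  have "\<exists>i<k. s \<in> {grid t N i<..grid t N (Suc i)}" if "s \<in> {0<..grid t N k}" for k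
    using that
  proof (induction k)
    case (Suc k)
    show ?case
    proof (cases "s \<le> grid t N k")
      case True
      then show ?thesis using Suc by (auto simp: less_Suc_eq)
    qed (use Suc.prems in auto)
  qed (simp add: g)
  from this[of N] s g obtain i where i: "i < N" "s \<in> {grid t N i<..grid t N (Suc i)}" by auto
  have "indicat_real {grid t N j<..grid t N (Suc j)} s = (if j = i then 1 else 0)" for j
  proof (cases j i rule: linorder_cases)
    case less
    then have "grid t N (Suc j) \<le> grid t N i" by (intro incseqD[OF g(3)]) simp
    then show ?thesis using i less by auto
  next
    case greater
    then have "grid t N (Suc i) \<le> grid t N j" by (intro incseqD[OF g(3)]) simp
    then show ?thesis using i greater by auto
  qed (use i in auto)
  then have "step_operator N (grid t N) \<Psi> s = (\<Sum>j<N. if j = i then \<Psi> j else 0)"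
    unfolding step_operator_def by (intro sum.cong) auto
  then show ?thesis using i by auto
qed

context q_noise begin

text \<open>The value at time $0$ is subtracted because it vanishes only almost surely; this way every path starts at zero.\<close>

definition noise_path :: "real \<Rightarrow> 'w \<Rightarrow> L2_01" where
  "noise_path t \<omega> = w t \<omega> - w 0 \<omega>"

text \<open>A version of $\int_0^t e^{(t-s)G}\,dw_s$ that is defined path by path: integration by parts moves the differential to the semigroup.\<close>

definition noise_conv :: "(L2_01 \<Rightarrow>\<^sub>L L2_01) \<Rightarrow> real \<Rightarrow> 'w \<Rightarrow> L2_01" where
  "noise_conv G t \<omega> = noise_path t \<omega> + (\<integral>s. op_exp ((t - s) *\<^sub>R G) (G (noise_path s \<omega>)) \<partial>lebT t)"

lemma noise_path_continuous: "\<omega> \<in> space \<Omega> \<Longrightarrow> continuous_on {0..t} (\<lambda>s. noise_path s \<omega>)"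
  unfolding noise_path_def
  by (intro continuous_intros continuous_on_subset[OF w_continuous]) auto

lemma noise_path_adapted: "0 \<le> s \<Longrightarrow> s \<le> t \<Longrightarrow> noise_path s \<in> borel_measurable (natural_filtration \<Omega> w t)"
  unfolding noise_path_def[abs_def] by (intro borel_measurable_diff w_adapted) auto

lemma noise_path_measurable: "0 \<le> s \<Longrightarrow> noise_path s \<in> borel_measurable \<Omega>"
  unfolding noise_path_def[abs_def] by (intro borel_measurable_diff w_measurable) auto

lemma noise_conv_measurable: "0 \<le> t \<Longrightarrow> noise_conv G t \<in> borel_measurable \<Omega>"
  unfolding noise_conv_def[abs_def]
  by (intro borel_measurable_add noise_path_measurable time_integral_measurable continuous_process_measurable
      blinfun_measurable blinfun_apply_continuous_on op_exp_reverse_continuous_on continuous_on_const noise_path_continuous) auto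

end

lemma lebT_integral_continuous:
  fixes g :: "real \<Rightarrow> 'b::{real_inner,banach,second_countable_topology}"
  assumes g: "continuous_on {0..t} g"
  shows "integrable (lebT t) g" "(\<integral>s. g s \<partial>lebT t) = integral {0..t} g"
proof -
  show int: "integrable (lebT t) g"
    using borel_integrable_atLeastAtMost'[OF g] by (subst integrable_restrict_space) (auto simp: set_integrable_def)
  have "(\<integral>s. g s \<partial>lebT t) \<bullet> u = integral {0..t} g \<bullet> u" for u
  proof -
    have gu: "continuous_on {0..t} (\<lambda>s. g s \<bullet> u)" by (intro continuous_intros g)
    have "(\<integral>s. g s \<partial>lebT t) \<bullet> u = (\<integral>s. g s \<bullet> u \<partial>lebT t)"
      using int by (rule integral_inner_left[symmetric])
    also have "\<dots> = (LINT s:{0..t}|lborel. g s \<bullet> u)" by (rule LINT_lebT[symmetric])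
    also have "\<dots> = integral {0..t} (\<lambda>s. g s \<bullet> u)"
      by (rule set_borel_integral_eq_integral(2)[OF borel_integrable_atLeastAtMost'[OF gu]])
    also have "\<dots> = integral {0..t} g \<bullet> u"
      using integral_linear[OF integrable_continuous_interval[OF g] bounded_linear_inner_left[of u]] by (simp add: o_def)
    finally show ?thesis .
  qed
  then show "(\<integral>s. g s \<partial>lebT t) = integral {0..t} g" using vector_eq_rdot by blast
qed

lemma integral_sum_partition:
  fixes g :: "real \<Rightarrow> 'b::banach"
  assumes g: "continuous_on {\<tau> 0..\<tau> n} g" and \<tau>: "incseq \<tau>"
  shows "integral {\<tau> 0..\<tau> n} g = (\<Sum>i<n. integral {\<tau> i..\<tau> (Suc i)} g)"
  using g
proof (induction n)
  case (Suc n)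
  have le: "\<tau> 0 \<le> \<tau> n" "\<tau> n \<le> \<tau> (Suc n)" using incseqD[OF \<tau>] by auto
  have "integral {\<tau> 0..\<tau> (Suc n)} g = integral {\<tau> 0..\<tau> n} g + integral {\<tau> n..\<tau> (Suc n)} g"
    by (rule Henstock_Kurzweil_Integration.integral_combine[OF le integrable_continuous_interval[OF Suc.prems], symmetric])
  also have "integral {\<tau> 0..\<tau> n} g = (\<Sum>i<n. integral {\<tau> i..\<tau> (Suc i)} g)"
    by (rule Suc.IH[OF continuous_on_subset[OF Suc.prems]]) (use le in auto)
  finally show ?case by simp
qed simp

context q_noise begin

text \<open>Summation by parts is the discrete form of the integration by parts in \<open>noise_conv\<close>.  What remains is a Riemann sum along a uniformly continuous path.\<close>

lemma step_sum_convergence: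
  fixes G :: "L2_01 \<Rightarrow>\<^sub>L L2_01"
  assumes t: "0 \<le> t" and \<omega>: "\<omega> \<in> space \<Omega>"
  shows "(\<lambda>j. step_integral (Suc j) (grid t (Suc j)) (\<lambda>i. op_exp ((t - grid t (Suc j) i) *\<^sub>R G)) w \<omega>)
    \<longlonglongrightarrow> noise_conv G t \<omega>"
proof (rule LIMSEQ_I)
  fix e :: real assume e: "0 < e"
  let ?\<Phi> = "\<lambda>s. op_exp ((t - s) *\<^sub>R G)"
  define v where "v s = noise_path s \<omega>" for s
  have v: "continuous_on {0..t} v" unfolding v_def by (rule noise_path_continuous[OF \<omega>])
  obtain B where B: "0 < B" "\<And>\<tau>. \<tau> \<in> {0..t} \<Longrightarrow> norm (op_exp (\<tau> *\<^sub>R G)) \<le> B"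
    using op_exp_bounded[of t G] by metis
  \<comment> \<open>the summands 1 make \<open>C\<close> positive when \<open>G = 0\<close> or \<open>t = 0\<close>\<close>
  define C where "C = B * (norm G + 1) * (t + 1)"
  have C: "0 < C" using B t by (simp add: C_def add_nonneg_pos)
  have "uniformly_continuous_on {0..t} v" by (intro compact_uniformly_continuous v compact_Icc)
  then obtain d where d: "0 < d" "\<And>x y. x \<in> {0..t} \<Longrightarrow> y \<in> {0..t} \<Longrightarrow> dist y x < d \<Longrightarrow> dist (v y) (v x) < e / C"
    using e C unfolding uniformly_continuous_on_def by (metis zero_less_divide_iff)
  obtain J where J: "t / real (Suc J) < d"
  proof -
    obtain J where "t / d < real (Suc J)" using reals_Archimedean2[of "t / d"] by (metis less_trans lessI of_nat_less_iff)
    then show ?thesis using that[of J] d(1) by (simp add: divide_less_eq mult.commute del: of_nat_Suc)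
  qed
  show "\<exists>J. \<forall>j\<ge>J. norm (step_integral (Suc j) (grid t (Suc j)) (\<lambda>i. ?\<Phi> (grid t (Suc j) i)) w \<omega> - noise_conv G t \<omega>) < e"
  proof (intro exI[of _ J] allI impI)
    fix j assume "J \<le> j"
    define N where "N = Suc j"
    have N: "0 < N" by (simp add: N_def)
    let ?g = "grid t N"
    note g = grid_simps[OF N t]
    have "t / real N \<le> t / real (Suc J)" using \<open>J \<le> j\<close> t by (intro divide_left_mono) (auto simp: N_def)
    then have mesh: "t / real N < d" using J by simp
    have sub: "{?g i..?g (Suc i)} \<subseteq> {0..t}" for i using g(4)[of i] g(4)[of "Suc i"] by auto
    have cv: "continuous_on {?g i..?g (Suc i)} (\<lambda>s. ?\<Phi> s (G (h s)))" if "continuous_on {0..t} h" for i h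
      by (intro blinfun_apply_continuous_on op_exp_reverse_continuous_on continuous_on_const continuous_on_subset[OF that sub])
    let ?K = "\<lambda>h i. integral {?g i..?g (Suc i)} (\<lambda>s. ?\<Phi> s (G (h s)))"
    have "step_integral N ?g (\<lambda>i. ?\<Phi> (?g i)) w \<omega> = (\<Sum>i<N. ?\<Phi> (?g i) (v (?g (Suc i)) - v (?g i)))"
      by (simp add: step_integral_def v_def noise_path_def)
    also have "\<dots> = ?\<Phi> (?g N) (v (?g N)) - ?\<Phi> (?g 0) (v (?g 0)) - (\<Sum>i<N. (?\<Phi> (?g (Suc i)) - ?\<Phi> (?g i)) (v (?g (Suc i))))"
      by (rule abel_summation_blinfun[where a="\<lambda>i. ?\<Phi> (?g i)" and b="\<lambda>i. v (?g i)"])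
    also have "v (?g 0) = 0" by (simp add: g v_def noise_path_def)
    also have "?\<Phi> (?g N) (v (?g N)) = v t" by (simp add: g op_exp_0[of G, simplified])
    also have "(\<Sum>i<N. (?\<Phi> (?g (Suc i)) - ?\<Phi> (?g i)) (v (?g (Suc i)))) = - (\<Sum>i<N. ?K (\<lambda>_. v (?g (Suc i))) i)"
    proof -
      have "(?\<Phi> (?g (Suc i)) - ?\<Phi> (?g i)) (v (?g (Suc i))) = - ?K (\<lambda>_. v (?g (Suc i))) i" for i
        using integral_unique[OF op_exp_reverse_increment[of "?g i" "?g (Suc i)" t G "v (?g (Suc i))"]] incseqD[OF g(3), of i "Suc i"]
        by (simp add: integral_neg)
      then show ?thesis by (simp add: sum_negf)
    qed
    finally have 1: "step_integral N ?g (\<lambda>i. ?\<Phi> (?g i)) w \<omega> = v t + (\<Sum>i<N. ?K (\<lambda>_. v (?g (Suc i))) i)" by simp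
    have ct: "continuous_on {0..t} (\<lambda>s. ?\<Phi> s (G (v s)))"
      by (intro blinfun_apply_continuous_on op_exp_reverse_continuous_on continuous_on_const v)
    have "noise_conv G t \<omega> = v t + integral {0..t} (\<lambda>s. ?\<Phi> s (G (v s)))"
      using lebT_integral_continuous(2)[OF ct] by (simp add: noise_conv_def v_def)
    also have "integral {0..t} (\<lambda>s. ?\<Phi> s (G (v s))) = (\<Sum>i<N. ?K v i)"
      using integral_sum_partition[of ?g N "\<lambda>s. ?\<Phi> s (G (v s))"] g ct by simp
    finally have eq: "step_integral N ?g (\<lambda>i. ?\<Phi> (?g i)) w \<omega> - noise_conv G t \<omega> = (\<Sum>i<N. ?K (\<lambda>_. v (?g (Suc i))) i - ?K v i)"
      using 1 by (simp add: sum_subtractf)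
    have "norm (\<Sum>i<N. ?K (\<lambda>_. v (?g (Suc i))) i - ?K v i) \<le> (\<Sum>i<N. B * (norm G + 1) * (e / C) * (t / real N))"
    proof (rule sum_norm_le)
      fix i assume i: "i \<in> {..<N}"
      have diff: "?K (\<lambda>_. v (?g (Suc i))) i - ?K v i = integral {?g i..?g (Suc i)} (\<lambda>s. ?\<Phi> s (G (v (?g (Suc i)) - v s)))"
        by (subst Henstock_Kurzweil_Integration.integral_diff[symmetric])
          (auto intro!: integrable_continuous_interval cv v continuous_on_const simp: blinfun.diff_right)
      have "norm (integral {?g i..?g (Suc i)} (\<lambda>s. ?\<Phi> s (G (v (?g (Suc i)) - v s)))) \<le> B * (norm G + 1) * (e / C) * (?g (Suc i) - ?g i)"
      proof (rule integral_bound)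
        show "?g i \<le> ?g (Suc i)" using incseqD[OF g(3)] by simp
        show "continuous_on {?g i..?g (Suc i)} (\<lambda>s. ?\<Phi> s (G (v (?g (Suc i)) - v s)))"
          by (intro cv continuous_intros v)
        fix s assume s: "s \<in> {?g i..?g (Suc i)}"
        have s': "s \<in> {0..t}" using s sub by blast
        have "dist (v (?g (Suc i))) (v s) < e / C"
          using s g(5)[of i] i mesh by (intro d(2) s' g(4)) (auto simp: dist_real_def)
        then have "norm (v (?g (Suc i)) - v s) \<le> e / C" by (simp add: dist_norm)
        then have "norm (G (v (?g (Suc i)) - v s)) \<le> (norm G + 1) * (e / C)"
          by (intro order_trans[OF norm_blinfun] mult_mono) auto
        moreover have "norm (?\<Phi> s) \<le> B" using s' by (intro B(2)) auto
        ultimately have "norm (?\<Phi> s (G (v (?g (Suc i)) - v s))) \<le> B * ((norm G + 1) * (e / C))"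
          by - (rule order_trans[OF norm_blinfun mult_mono], use B(1) in auto)
        then show "norm (?\<Phi> s (G (v (?g (Suc i)) - v s))) \<le> B * (norm G + 1) * (e / C)" by (simp add: mult_ac)
      qed
      then show "norm (?K (\<lambda>_. v (?g (Suc i))) i - ?K v i) \<le> B * (norm G + 1) * (e / C) * (t / real N)"
        using i unfolding diff by (simp only: g(5) lessThan_iff)
    qed
    also have "\<dots> = real N * (B * (norm G + 1) * (e / C) * (t / real N))"
      by (simp only: sum_constant card_lessThan)
    also have "\<dots> = B * (norm G + 1) * (e / C) * t"
    proof -
      have "real N * (t / real N) = t" using N by simp
      then show ?thesis by (subst mult.left_commute) (simp only:)
    qed
    also have "\<dots> < B * (norm G + 1) * (e / C) * (t + 1)"
    proof (rule mult_strict_left_mono)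
      show "0 < B * (norm G + 1) * (e / C)"
        using B(1) e C by (intro mult_pos_pos divide_pos_pos) (auto simp: add_nonneg_pos)
    qed simp
    also have "\<dots> = e"
    proof -
      have "B * (norm G + 1) * (e / C) * (t + 1) = C * (e / C)" unfolding C_def by (simp only: mult_ac)
      also have "\<dots> = e" using C by simp
      finally show ?thesis .
    qed
    finally show "norm (step_integral (Suc j) (grid t (Suc j)) (\<lambda>i. ?\<Phi> (grid t (Suc j) i)) w \<omega> - noise_conv G t \<omega>) < e"
      using eq by (simp only: N_def)
  qed
qed

lemma step_operator_convergence:
  fixes G :: "L2_01 \<Rightarrow>\<^sub>L L2_01"
  assumes t: "0 \<le> t"
  shows "\<exists>K\<ge>0. \<forall>j. (\<integral>\<^sup>+s\<in>{0..t}. ennreal (isometry_dist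
      (step_operator (Suc j) (grid t (Suc j)) (\<lambda>i. op_exp ((t - grid t (Suc j) i) *\<^sub>R G)))
      (\<lambda>s. op_exp ((t - s) *\<^sub>R G)) s) \<partial>lborel) \<le> ennreal (K / real (Suc j))"
proof -
  let ?\<Phi> = "\<lambda>s. op_exp ((t - s) *\<^sub>R G)"
  obtain L where L: "0 < L" "\<And>a b. 0 \<le> a \<Longrightarrow> a \<le> b \<Longrightarrow> b \<le> t \<Longrightarrow> norm (?\<Phi> a - ?\<Phi> b) \<le> L * (b - a)"
    using op_exp_reverse_lipschitz[of t G] by metis
  define K where "K = (\<Sum>k\<in>UNIV. lam k * (norm (f k))\<^sup>2) * L\<^sup>2 * t\<^sup>2 * t"
  have K: "0 \<le> K" using t lam_nonneg by (auto simp: K_def intro!: mult_nonneg_nonneg sum_nonneg)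
  show ?thesis
  proof (intro exI[of _ K] conjI allI K)
    fix j
    define N where "N = Suc j"
    have N: "0 < N" by (simp add: N_def)
    let ?g = "grid t N" and ?S = "step_operator N (grid t N) (\<lambda>i. ?\<Phi> (grid t N i))"
    note g = grid_simps[OF N t]
    let ?c = "(\<Sum>k\<in>UNIV. lam k * (norm (f k))\<^sup>2) * (L * (t / real N))\<^sup>2"
    have bd: "isometry_dist ?S ?\<Phi> s \<le> ?c" if s: "s \<in> {0<..t}" for s
    proof -
      obtain i where i: "i < N" "s \<in> {?g i<..?g (Suc i)}" "?S s = ?\<Phi> (?g i)"
        using step_operator_grid[OF N t s, of "\<lambda>i. ?\<Phi> (?g i)"] by auto
      have "norm (?S s - ?\<Phi> s) \<le> L * (s - ?g i)"
        unfolding i(3) using i(2) s g(4)[of i] by (intro L(2)) auto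
      also have "\<dots> \<le> L * (t / real N)"
        using i(2) g(5)[OF i(1)] L(1) by (intro mult_left_mono) auto
      finally have d: "norm (?S s - ?\<Phi> s) \<le> L * (t / real N)" .
      have "lam k * (norm ((?S s - ?\<Phi> s) (f k)))\<^sup>2 \<le> lam k * ((L * (t / real N)) * norm (f k))\<^sup>2" for k
        by (intro mult_left_mono power_mono order_trans[OF norm_blinfun] mult_right_mono d lam_nonneg) auto
      then have "isometry_dist ?S ?\<Phi> s \<le> (\<Sum>k\<in>UNIV. lam k * ((L * (t / real N)) * norm (f k))\<^sup>2)"
        by (intro sum_mono)
      also have "\<dots> = ?c"
        unfolding sum_distrib_right by (intro sum.cong refl) (simp only: power_mult_distrib mult_ac)
      finally show ?thesis .
    qed
    have "(\<integral>\<^sup>+s\<in>{0..t}. ennreal (isometry_dist ?S ?\<Phi> s) \<partial>lborel) \<le> (\<integral>\<^sup>+s. ennreal ?c * indicator {0..t} s \<partial>lborel)"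
    proof (rule nn_integral_mono_AE)
      show "AE s in lborel. ennreal (isometry_dist ?S ?\<Phi> s) * indicator {0..t} s \<le> ennreal ?c * indicator {0..t} s"
        using AE_lborel_singleton[of "0::real"]
      proof eventually_elim
        case (elim s)
        show ?case
        proof (cases "s \<in> {0<..t}")
          case True
          then show ?thesis by (intro mult_right_mono ennreal_leI bd) auto
        next
          case False
          then have "s \<notin> {0..t}" using elim by auto
          then show ?thesis by simp
        qed
      qed
    qed
    also have "\<dots> = ennreal ?c * ennreal t" using t by (simp add: nn_integral_cmult)
    also have "\<dots> = ennreal (?c * t)" using t by (simp add: ennreal_mult'')
    also have "?c * t \<le> K / real N"
    proof -
      have "K * (1 / (real N)\<^sup>2) \<le> K * (1 / real N)"
        using N K by (intro mult_left_mono divide_left_mono) (auto simp: power2_eq_square)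
      moreover have "?c * t = K * (1 / (real N)\<^sup>2)"
        by (simp add: K_def power_mult_distrib power_divide mult_ac)
      ultimately show ?thesis by simp
    qed
    finally show "(\<integral>\<^sup>+s\<in>{0..t}. ennreal (isometry_dist (step_operator (Suc j) (grid t (Suc j)) (\<lambda>i. ?\<Phi> (grid t (Suc j) i)))
      ?\<Phi> s) \<partial>lborel) \<le> ennreal (K / real (Suc j))" by (simp add: N_def ennreal_leI)
  qed
qed

text \<open>The step integrals converge path by path, and by the isometry they form a Cauchy sequence in mean square.  Fatou's lemma shows that the two limits agree.\<close>

theorem noise_conv_wiener_integral:
  fixes G :: "L2_01 \<Rightarrow>\<^sub>L L2_01"
  assumes t: "0 \<le> t"
  shows "has_wiener_integral \<Omega> f lam w t (\<lambda>s. op_exp ((t - s) *\<^sub>R G)) (noise_conv G t)"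
proof -
  let ?\<Phi> = "\<lambda>s. op_exp ((t - s) *\<^sub>R G)"
  let ?\<tau> = "\<lambda>j. grid t (Suc j)" and ?\<Psi> = "\<lambda>j i. ?\<Phi> (grid t (Suc j) i)"
  define X where "X j = step_integral (Suc j) (?\<tau> j) (?\<Psi> j) w" for j
  define S where "S j = step_operator (Suc j) (?\<tau> j) (?\<Psi> j)" for j
  note g = grid_simps[OF zero_less_Suc t]
  have \<Phi>: "set_borel_measurable borel {0..t} (\<lambda>s. ?\<Phi> s v)" for v
    unfolding set_borel_measurable_def
    by (intro borel_measurable_continuous_on_indicator blinfun_apply_continuous_on
        op_exp_reverse_continuous_on continuous_on_const) auto
  obtain K where K: "0 \<le> K" "\<And>j. (\<integral>\<^sup>+s\<in>{0..t}. ennreal (isometry_dist (S j) ?\<Phi> s) \<partial>lborel) \<le> ennreal (K / real (Suc j))"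
    using step_operator_convergence[OF t, of G, folded S_def] by (elim exE conjE) blast
  have K0: "(\<lambda>j. ennreal (K / real (Suc j))) \<longlonglongrightarrow> 0"
    using tendsto_ennrealI[OF tendsto_mult[OF tendsto_const LIMSEQ_Suc[OF lim_1_over_n], of K]] by simp
  have Xm [measurable]: "X j \<in> borel_measurable \<Omega>" for j
    unfolding X_def by (intro step_integral_measurable g) (simp add: g)
  note [measurable] = noise_conv_measurable[OF t, of G]
  have XX: "(\<integral>\<^sup>+\<omega>. ennreal ((norm (X j \<omega> - X i \<omega>))\<^sup>2) \<partial>\<Omega>) \<le> ennreal (4 * (K / real (Suc j)))" if "j \<le> i" for i j
  proof -
    let ?J = "\<lambda>j. \<integral>\<^sup>+s. ennreal (isometry_dist (S j) ?\<Phi> s) \<partial>lebT t"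
    have KJ: "?J i \<le> ennreal (K / real (Suc i))" for i using K(2)[of i] by (simp add: nn_integral_lebT)
    have "(\<integral>\<^sup>+\<omega>. ennreal ((norm (X j \<omega> - X i \<omega>))\<^sup>2) \<partial>\<Omega>) = (\<integral>\<^sup>+s. ennreal (isometry_dist (S j) (S i) s) \<partial>lebT t)"
      unfolding X_def S_def nn_integral_lebT[symmetric]
      by (rule step_integral_isometry_Icc) (simp_all add: g)
    also have "\<dots> \<le> 2 * ?J j + 2 * ?J i"
    proof (rule nn_integral_le_2_add_2)
      show "isometry_dist (S j) (S i) s \<le> 2 * isometry_dist (S j) ?\<Phi> s + 2 * isometry_dist (S i) ?\<Phi> s" for s
      proof -
        have "isometry_dist ?\<Phi> (S i) s = isometry_dist (S i) ?\<Phi> s"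
          by (simp add: blinfun.diff_left norm_minus_commute)
        then show ?thesis using isometry_dist_triangle[where S="S j" and S''="S i" and s=s and S'="?\<Phi>"] by simp
      qed
    qed (unfold S_def, (rule isometry_dist_measurable[OF \<Phi>] isometry_dist_nonneg)+)
    also have "\<dots> \<le> 2 * ennreal (K / real (Suc j)) + 2 * ennreal (K / real (Suc j))"
    proof (intro add_mono mult_left_mono KJ)
      have "K / real (Suc i) \<le> K / real (Suc j)" using that K(1) by (intro divide_left_mono) auto
      then show "?J i \<le> ennreal (K / real (Suc j))" using KJ[of i] ennreal_leI order_trans by blast
    qed auto
    also have "\<dots> = ennreal (4 * (K / real (Suc j)))"
    proof -
      have "2 * ennreal c + 2 * ennreal c = ennreal (4 * c)" if c: "0 \<le> c" for c
      proof -
        have "ennreal (4 * c) = ennreal (2 * c + 2 * c)" by simp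
        also have "\<dots> = ennreal (2 * c) + ennreal (2 * c)" using c by (intro ennreal_plus) auto
        also have "ennreal (2 * c) = 2 * ennreal c" using c by (simp add: ennreal_mult)
        finally show ?thesis ..
      qed
      from this[of "K / real (Suc j)"] K(1) show ?thesis by simp
    qed
    finally show ?thesis .
  qed
  have XZ: "(\<integral>\<^sup>+\<omega>. ennreal ((norm (X j \<omega> - noise_conv G t \<omega>))\<^sup>2) \<partial>\<Omega>) \<le> ennreal (4 * (K / real (Suc j)))" for j
  proof -
    have "(\<integral>\<^sup>+\<omega>. ennreal ((norm (X j \<omega> - noise_conv G t \<omega>))\<^sup>2) \<partial>\<Omega>)
        = (\<integral>\<^sup>+\<omega>. liminf (\<lambda>i. ennreal ((norm (X j \<omega> - X i \<omega>))\<^sup>2)) \<partial>\<Omega>)"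
    proof (rule nn_integral_cong)
      fix \<omega> assume \<omega>: "\<omega> \<in> space \<Omega>"
      have "(\<lambda>i. ennreal ((norm (X j \<omega> - X i \<omega>))\<^sup>2)) \<longlonglongrightarrow> ennreal ((norm (X j \<omega> - noise_conv G t \<omega>))\<^sup>2)"
        using step_sum_convergence[OF t \<omega>, of G] unfolding X_def by (intro tendsto_intros)
      then show "ennreal ((norm (X j \<omega> - noise_conv G t \<omega>))\<^sup>2) = liminf (\<lambda>i. ennreal ((norm (X j \<omega> - X i \<omega>))\<^sup>2))"
        by (rule lim_imp_Liminf[symmetric, rotated]) simp
    qed
    also have "\<dots> \<le> liminf (\<lambda>i. \<integral>\<^sup>+\<omega>. ennreal ((norm (X j \<omega> - X i \<omega>))\<^sup>2) \<partial>\<Omega>)"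
      by (rule nn_integral_liminf) measurable
    also have "\<dots> \<le> liminf (\<lambda>i. ennreal (4 * (K / real (Suc j))))"
    proof (rule Liminf_mono)
      show "\<forall>\<^sub>F i in sequentially. (\<integral>\<^sup>+\<omega>. ennreal ((norm (X j \<omega> - X i \<omega>))\<^sup>2) \<partial>\<Omega>) \<le> ennreal (4 * (K / real (Suc j)))"
        using eventually_ge_at_top[of j] by eventually_elim (rule XX)
    qed
    also have "\<dots> = ennreal (4 * (K / real (Suc j)))" by (simp add: Liminf_const)
    finally show ?thesis .
  qed
  have K40: "(\<lambda>j. ennreal (4 * (K / real (Suc j)))) \<longlonglongrightarrow> 0"
    using tendsto_ennrealI[OF tendsto_mult[OF tendsto_const LIMSEQ_Suc[OF lim_1_over_n], of "4 * K"]] by simp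
  have "(\<lambda>j. \<integral>\<^sup>+s\<in>{0..t}. ennreal (isometry_dist (S j) ?\<Phi> s) \<partial>lborel) \<longlonglongrightarrow> 0"
  proof (rule tendsto_sandwich[OF _ _ tendsto_const K0])
    show "\<forall>\<^sub>F j in sequentially. (\<integral>\<^sup>+s\<in>{0..t}. ennreal (isometry_dist (S j) ?\<Phi> s) \<partial>lborel) \<le> ennreal (K / real (Suc j))"
      by (intro always_eventually allI K(2))
  qed simp
  moreover have "(\<lambda>j. \<integral>\<^sup>+\<omega>. ennreal ((norm (X j \<omega> - noise_conv G t \<omega>))\<^sup>2) \<partial>\<Omega>) \<longlonglongrightarrow> 0"
  proof (rule tendsto_sandwich[OF _ _ tendsto_const K40])
    show "\<forall>\<^sub>F j in sequentially. (\<integral>\<^sup>+\<omega>. ennreal ((norm (X j \<omega> - noise_conv G t \<omega>))\<^sup>2) \<partial>\<Omega>) \<le> ennreal (4 * (K / real (Suc j)))"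
      by (intro always_eventually allI XZ)
  qed simp
  moreover have "0 \<le> ?\<tau> j 0 \<and> incseq (?\<tau> j) \<and> ?\<tau> j (Suc j) \<le> t" for j by (simp add: g)
  ultimately show ?thesis
    unfolding has_wiener_integral_def S_def X_def
    by (intro conjI allI noise_conv_measurable[OF t] \<Phi> exI[of _ Suc] exI[of _ ?\<tau>] exI[of _ ?\<Psi>]) blast+
qed

end

section \<open>Fundamental solutions\<close>

lemma has_vector_derivative_blinfun_compose:
  fixes X :: "real \<Rightarrow> 'b::real_normed_vector \<Rightarrow>\<^sub>L 'c::real_normed_vector" and Y :: "real \<Rightarrow> 'a::real_normed_vector \<Rightarrow>\<^sub>L 'b"
  assumes "(X has_vector_derivative X') (at t within S)" "(Y has_vector_derivative Y') (at t within S)"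
  shows "((\<lambda>t. X t o\<^sub>L Y t) has_vector_derivative (X t o\<^sub>L Y') + (X' o\<^sub>L Y t)) (at t within S)"
  by (rule bounded_bilinear.has_vector_derivative[OF bounded_bilinear_blinfun_compose assms])

lemma has_vector_derivative_blinfun_apply:
  fixes X :: "real \<Rightarrow> 'b::real_normed_vector \<Rightarrow>\<^sub>L 'c::real_normed_vector" and y :: "real \<Rightarrow> 'b"
  assumes "(X has_vector_derivative X') (at t within S)" "(y has_vector_derivative y') (at t within S)"
  shows "((\<lambda>t. X t (y t)) has_vector_derivative X t y' + X' (y t)) (at t within S)"
  by (rule bounded_bilinear.has_vector_derivative[OF bounded_bilinear_blinfun_apply assms])

lemma blinfun_compose_id: "id_blinfun o\<^sub>L X = X" "X o\<^sub>L id_blinfun = X"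
  by (rule blinfun_eqI, simp)+

lemma operator_ode_solution_exists:
  fixes \<L> :: "real \<Rightarrow> ('a::banach \<Rightarrow>\<^sub>L 'a) \<Rightarrow> ('a \<Rightarrow>\<^sub>L 'a)"
  assumes lin: "\<And>t. bounded_linear (\<L> t)" and cont: "continuous_on {0..T} (\<lambda>t. Blinfun (\<L> t))"
  obtains \<Phi> where "\<Phi> 0 = id_blinfun"
    "\<And>t. t \<in> {0..T} \<Longrightarrow> (\<Phi> has_vector_derivative \<L> t (\<Phi> t)) (at t within {0..T})"
proof (rule linear_ode_solution_exists[OF cont, of id_blinfun])
  fix x assume "x 0 = id_blinfun"
    "\<And>t. t \<in> {0..T} \<Longrightarrow> (x has_vector_derivative (Blinfun (\<L> t)) (x t)) (at t within {0..T})"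
  then show thesis using that[of x] by (simp add: bounded_linear_Blinfun_apply[OF lin])
qed

text \<open>$\Psi$ is the candidate for the inverse of $\Phi$: the defect $D = \Phi \Psi - 1$ solves $D' = F D - D F$ with $D_0 = 0$ and vanishes by Gronwall's lemma.\<close>

lemma fundamental_solution:
  fixes F :: "real \<Rightarrow> 'a::banach \<Rightarrow>\<^sub>L 'a"
  assumes F: "continuous_on {0..T} F"
  obtains \<Phi> \<Psi> where
    "\<And>t. t \<in> {0..T} \<Longrightarrow> (\<Phi> has_vector_derivative F t o\<^sub>L \<Phi> t) (at t within {0..T})"
    "\<And>t. t \<in> {0..T} \<Longrightarrow> (\<Psi> has_vector_derivative - (\<Psi> t o\<^sub>L F t)) (at t within {0..T})"
    "\<Phi> 0 = id_blinfun" "\<Psi> 0 = id_blinfun"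
    "\<And>t. t \<in> {0..T} \<Longrightarrow> \<Phi> t o\<^sub>L \<Psi> t = id_blinfun"
proof -
  interpret comp: bounded_bilinear "(o\<^sub>L) :: ('a \<Rightarrow>\<^sub>L 'a) \<Rightarrow> ('a \<Rightarrow>\<^sub>L 'a) \<Rightarrow> 'a \<Rightarrow>\<^sub>L 'a"
    by (rule bounded_bilinear_blinfun_compose)
  have left: "Blinfun (\<lambda>Y. X o\<^sub>L Y) = comp.prod_right X" for X :: "'a \<Rightarrow>\<^sub>L 'a"
    by (rule blinfun_eqI) (simp add: bounded_linear_Blinfun_apply[OF comp.bounded_linear_right] comp.prod_right.rep_eq)
  have right: "Blinfun (\<lambda>Y. - (Y o\<^sub>L X)) = - comp.prod_left X" for X :: "'a \<Rightarrow>\<^sub>L 'a"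
    by (rule blinfun_eqI) (simp add: bounded_linear_Blinfun_apply[OF bounded_linear_minus[OF comp.bounded_linear_left]]
        comp.prod_left.rep_eq blinfun.minus_left)
  obtain \<Phi> where \<Phi>: "\<Phi> 0 = id_blinfun"
    "\<And>t. t \<in> {0..T} \<Longrightarrow> (\<Phi> has_vector_derivative F t o\<^sub>L \<Phi> t) (at t within {0..T})"
    by (rule operator_ode_solution_exists[of "\<lambda>t Y. F t o\<^sub>L Y" T])
      (auto simp: left intro!: comp.bounded_linear_right bounded_linear.continuous_on[OF comp.bounded_linear_prod_right] F)
  obtain \<Psi> where \<Psi>: "\<Psi> 0 = id_blinfun"
    "\<And>t. t \<in> {0..T} \<Longrightarrow> (\<Psi> has_vector_derivative - (\<Psi> t o\<^sub>L F t)) (at t within {0..T})"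
    by (rule operator_ode_solution_exists[of "\<lambda>t Y. - (Y o\<^sub>L F t)" T])
      (auto simp: right intro!: bounded_linear_minus comp.bounded_linear_left continuous_on_minus
        bounded_linear.continuous_on[OF comp.bounded_linear_prod_left] F)
  have "\<Phi> t o\<^sub>L \<Psi> t = id_blinfun" if t: "t \<in> {0..T}" for t
  proof -
    define D where "D t = (\<Phi> t o\<^sub>L \<Psi> t) - id_blinfun" for t
    define D' where "D' t = (F t o\<^sub>L D t) - (D t o\<^sub>L F t)" for t
    have D: "(D has_vector_derivative D' t) (at t within {0..T})" if "t \<in> {0..T}" for t
    proof -
      have "(D has_vector_derivative (\<Phi> t o\<^sub>L - (\<Psi> t o\<^sub>L F t)) + ((F t o\<^sub>L \<Phi> t) o\<^sub>L \<Psi> t) - 0) (at t within {0..T})"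
        unfolding D_def[abs_def]
        by (intro has_vector_derivative_diff has_vector_derivative_blinfun_compose \<Phi>(2) \<Psi>(2) that has_vector_derivative_const)
      moreover have "(\<Phi> t o\<^sub>L - (\<Psi> t o\<^sub>L F t)) + ((F t o\<^sub>L \<Phi> t) o\<^sub>L \<Psi> t) - 0 = D' t"
        by (simp add: D_def D'_def comp.diff_left comp.diff_right comp.minus_right blinfun_compose_assoc blinfun_compose_id)
      ultimately show ?thesis by simp
    qed
    obtain L where L: "0 < L" "\<And>t. t \<in> {0..T} \<Longrightarrow> norm (F t) \<le> L"
      using continuous_bounded_Icc[OF F] by blast
    have cD: "continuous_on {0..T} D"
      unfolding continuous_on_eq_continuous_within using D has_vector_derivative_continuous by blast
    have "norm (D t) \<le> 0 + (2 * L) * integral {0..t} (\<lambda>s. norm (D s))" if t: "t \<in> {0..T}" for t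
    proof -
      have sub: "{0..t} \<subseteq> {0..T}" using t by auto
      have "(D' has_integral D t - D 0) {0..t}"
        using t sub by (intro fundamental_theorem_of_calculus has_vector_derivative_within_subset[OF D sub]) auto
      then have i: "(D' has_integral D t) {0..t}" by (simp add: D_def[of 0] \<Phi>(1) \<Psi>(1) blinfun_compose_id)
      have n: "(\<lambda>s. 2 * L * norm (D s)) integrable_on {0..t}"
        by (intro integrable_continuous_interval continuous_intros continuous_on_subset[OF cD sub])
      have "norm (integral {0..t} D') \<le> integral {0..t} (\<lambda>s. 2 * L * norm (D s))"
      proof (rule integral_norm_bound_integral[OF _ n])
        show "D' integrable_on {0..t}" using i by blast
        fix s assume "s \<in> {0..t}"
        then have Fs: "norm (F s) \<le> L" using sub L by blast
        have "norm (D' s) \<le> norm (F s o\<^sub>L D s) + norm (D s o\<^sub>L F s)"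
          unfolding D'_def by (rule norm_triangle_ineq4)
        also have "\<dots> \<le> norm (F s) * norm (D s) + norm (D s) * norm (F s)"
          by (intro add_mono norm_blinfun_compose)
        also have "\<dots> \<le> L * norm (D s) + norm (D s) * L"
          using Fs by (intro add_mono mult_mono) (use L in auto)
        finally show "norm (D' s) \<le> 2 * L * norm (D s)" by (simp add: mult_ac)
      qed
      then show ?thesis using integral_unique[OF i] by simp
    qed
    from gronwall[OF _ _ this t] cD L have "norm (D t) \<le> 0" by (simp add: continuous_on_norm)
    then show ?thesis by (simp add: D_def)
  qed
  then show ?thesis using that \<Phi> \<Psi> by blast
qed

section \<open>Square integrable paths and convolution with the semigroup\<close>

lemma measure_lebT: "0 \<le> t \<Longrightarrow> measure (lebT t) {0..t} = t"
  by (simp add: measure_restrict_space)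

lemma lebT_Cauchy_Schwarz:
  fixes g :: "real \<Rightarrow> 'b::{real_normed_vector,second_countable_topology,banach}"
  assumes t: "0 \<le> t" and [measurable]: "g \<in> borel_measurable (lebT t)" and sq: "integrable (lebT t) (\<lambda>s. (norm (g s))\<^sup>2)"
  shows "integrable (lebT t) g" "(\<integral>s. norm (g s) \<partial>lebT t)\<^sup>2 \<le> t * (\<integral>s. (norm (g s))\<^sup>2 \<partial>lebT t)"
proof -
  interpret finite_measure "lebT t" by (rule finite_lebT)
  show g: "integrable (lebT t) g"
  proof (rule Bochner_Integration.integrable_bound)
    show "integrable (lebT t) (\<lambda>s. 1 + (norm (g s))\<^sup>2)" using sq by simp
    have "norm (g s) \<le> 1 + (norm (g s))\<^sup>2" for s
      using abs_mult_le_squares[of "norm (g s)" 1] by simp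
    then show "AE s in lebT t. norm (g s) \<le> norm (1 + (norm (g s))\<^sup>2)"
      by (intro AE_I2) (simp add: add_nonneg_nonneg)
  qed measurable
  define a where "a = (\<integral>s. norm (g s) \<partial>lebT t)"
  have "0 \<le> (\<integral>s. (t * norm (g s) - a)\<^sup>2 \<partial>lebT t)" by simp
  also have "\<dots> = (\<integral>s. t\<^sup>2 * (norm (g s))\<^sup>2 - 2 * t * a * norm (g s) + a\<^sup>2 \<partial>lebT t)"
    by (intro Bochner_Integration.integral_cong refl) (simp add: power2_diff power_mult_distrib mult_ac)
  also have "\<dots> = t\<^sup>2 * (\<integral>s. (norm (g s))\<^sup>2 \<partial>lebT t) - 2 * t * a * a + a\<^sup>2 * t"
    using sq g t by (simp add: a_def measure_lebT)
  finally have "0 \<le> t * (t * (\<integral>s. (norm (g s))\<^sup>2 \<partial>lebT t) - a\<^sup>2)"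
    by (simp add: power2_eq_square algebra_simps)
  then have "t = 0 \<or> a\<^sup>2 \<le> t * (\<integral>s. (norm (g s))\<^sup>2 \<partial>lebT t)"
    using t by (auto simp: zero_le_mult_iff)
  moreover have "a\<^sup>2 \<le> t * (\<integral>s. (norm (g s))\<^sup>2 \<partial>lebT t)" if "t = 0"
  proof -
    have "{0..t} \<in> null_sets (lebT t)"
      using sets.top[of "lebT t"] by (intro null_setsI) (auto simp: that emeasure_restrict_space)
    then have "AE s in lebT t. norm (g s) = 0" by (rule AE_I') auto
    then have "a = (\<integral>s. 0 \<partial>lebT t)" unfolding a_def by (intro integral_cong_AE) auto
    then show ?thesis using that by simp
  qed
  ultimately show "(\<integral>s. norm (g s) \<partial>lebT t)\<^sup>2 \<le> t * (\<integral>s. (norm (g s))\<^sup>2 \<partial>lebT t)" by (auto simp: a_def)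
qed

text \<open>With $\{(t, s).\; s \le t\}$ for \<open>A\<close> this is the response $\int_0^t e^{(t-s)G} C y_s\,ds$ to an input, with the transposed
  set it is the backward integral $\int_t^T e^{(s-t)G} C y_s\,ds$ of the adjoint state.  Because the two differ only in \<open>A\<close>,
  their duality is Fubini's theorem.\<close>

definition conv :: "(L2_01 \<Rightarrow>\<^sub>L L2_01) \<Rightarrow> real \<Rightarrow> (real \<times> real) set \<Rightarrow> (L2_01 \<Rightarrow>\<^sub>L L2_01) \<Rightarrow> (real \<Rightarrow> L2_01) \<Rightarrow> real \<Rightarrow> L2_01" where
  "conv G T A C y t = (\<integral>s. indicat_real A (t, s) *\<^sub>R op_exp (\<bar>t - s\<bar> *\<^sub>R G) (C (y s)) \<partial>lebT T)"

lemma op_exp_apply_measurable: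
  assumes "g \<in> borel_measurable M" "h \<in> borel_measurable M"
  shows "(\<lambda>x. op_exp (g x *\<^sub>R G) (h x :: L2_01)) \<in> borel_measurable M"
proof -
  have "continuous_on UNIV (\<lambda>p. op_exp (fst p *\<^sub>R G) (snd p :: L2_01))"
    by (intro blinfun_apply_continuous_on continuous_on_compose2[OF op_exp_continuous_on[of UNIV G]] continuous_intros) auto
  then have "(\<lambda>p. op_exp (fst p *\<^sub>R G) (snd p :: L2_01)) \<in> borel_measurable borel"
    by (rule borel_measurable_continuous_onI)
  from measurable_compose[OF borel_measurable_Pair[OF assms] this] show ?thesis by simp
qed

lemma conv_process_measurable:
  assumes Y: "(\<lambda>(t, \<omega>). Y t \<omega>) \<in> borel_measurable (lebT T \<Otimes>\<^sub>M M)" and A: "A \<in> sets borel"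
  shows "(\<lambda>(t, \<omega>). conv G T A C (\<lambda>s. Y s \<omega>) t) \<in> borel_measurable (lebT T \<Otimes>\<^sub>M M)"
proof -
  interpret sigma_finite_measure "lebT T" by (rule sigma_finite_lebT)
  let ?N = "(lebT T \<Otimes>\<^sub>M M) \<Otimes>\<^sub>M lebT T"
  have id: "(\<lambda>x. x) \<in> borel_measurable (lebT T)" by (intro measurable_restrict_space1) auto
  have t [measurable]: "(\<lambda>p. fst (fst p)) \<in> borel_measurable ?N"
    by (rule measurable_compose[OF measurable_compose[OF measurable_fst measurable_fst] id])
  have s [measurable]: "(\<lambda>p. snd p) \<in> borel_measurable ?N"
    by (rule measurable_compose[OF measurable_snd id])
  have "(\<lambda>p. (snd p, snd (fst p))) \<in> measurable ?N (lebT T \<Otimes>\<^sub>M M)"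
    by (intro measurable_Pair measurable_snd measurable_compose[OF measurable_fst measurable_snd])
  from measurable_compose[OF this Y]
  have y: "(\<lambda>p. Y (snd p) (snd (fst p))) \<in> borel_measurable ?N" by simp
  have ind: "(\<lambda>p. indicat_real A (fst (fst p), snd p)) \<in> borel_measurable ?N"
    by (rule measurable_compose[OF borel_measurable_Pair[OF t s] borel_measurable_indicator[OF A]])
  have "(\<lambda>p. indicat_real A (fst (fst p), snd p) *\<^sub>R op_exp (\<bar>fst (fst p) - snd p\<bar> *\<^sub>R G) (C (Y (snd p) (snd (fst p))))) \<in> borel_measurable ?N"
    by (intro borel_measurable_scaleR ind op_exp_apply_measurable blinfun_measurable y) measurable
  then have "(\<lambda>q. \<integral>s. indicat_real A (fst q, s) *\<^sub>R op_exp (\<bar>fst q - s\<bar> *\<^sub>R G) (C (Y s (snd q))) \<partial>lebT T) \<in> borel_measurable (lebT T \<Otimes>\<^sub>M M)"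
    by (intro borel_measurable_lebesgue_integral) (simp add: case_prod_beta')
  then show ?thesis by (simp add: conv_def case_prod_beta')
qed

lemma conv_integrable:
  fixes C G :: "L2_01 \<Rightarrow>\<^sub>L L2_01"
  assumes T: "0 \<le> T" and y: "y \<in> borel_measurable (lebT T)" "integrable (lebT T) (\<lambda>s. (norm (y s))\<^sup>2)"
    and A: "A \<in> sets borel"
  shows "integrable (lebT T) (\<lambda>s. indicat_real A (t, s) *\<^sub>R op_exp (\<bar>t - s\<bar> *\<^sub>R G) (C (y s)))"
proof -
  have id: "(\<lambda>x. x) \<in> borel_measurable (lebT T)" by (intro measurable_restrict_space1) auto
  obtain B where B: "0 < B" "\<And>\<tau>. \<tau> \<in> {0..T + \<bar>t\<bar>} \<Longrightarrow> norm (op_exp (\<tau> *\<^sub>R G)) \<le> B"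
    using op_exp_bounded[of "T + \<bar>t\<bar>" G] by blast
  show ?thesis
  proof (rule Bochner_Integration.integrable_bound)
    show "integrable (lebT T) (\<lambda>s. B * (norm C * norm (y s)))"
      using lebT_Cauchy_Schwarz(1)[OF T y] by simp
    show "(\<lambda>s. indicat_real A (t, s) *\<^sub>R op_exp (\<bar>t - s\<bar> *\<^sub>R G) (C (y s))) \<in> borel_measurable (lebT T)"
    proof (rule borel_measurable_scaleR)
      show "(\<lambda>s. indicat_real A (t, s)) \<in> borel_measurable (lebT T)"
        by (rule measurable_compose[OF borel_measurable_Pair[OF borel_measurable_const id] borel_measurable_indicator[OF A]])
      have "(\<lambda>s. \<bar>t - s\<bar>) \<in> borel_measurable (lebT T)"
        by (intro borel_measurable_abs borel_measurable_diff borel_measurable_const id)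
      then show "(\<lambda>s. op_exp (\<bar>t - s\<bar> *\<^sub>R G) (C (y s))) \<in> borel_measurable (lebT T)"
        by (rule op_exp_apply_measurable[OF _ blinfun_measurable[OF y(1)]])
    qed
    have "norm (indicat_real A (t, s) *\<^sub>R op_exp (\<bar>t - s\<bar> *\<^sub>R G) (C (y s))) \<le> B * (norm C * norm (y s))"
      if s: "s \<in> {0..T}" for s
    proof -
      have "norm (op_exp (\<bar>t - s\<bar> *\<^sub>R G)) \<le> B" using s by (intro B(2)) auto
      then have "norm (op_exp (\<bar>t - s\<bar> *\<^sub>R G) (C (y s))) \<le> B * (norm C * norm (y s))"
        by - (rule order_trans[OF norm_blinfun mult_mono], use B(1) in \<open>auto intro: norm_blinfun\<close>)
      then show ?thesis using B(1) by (auto split: split_indicator)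
    qed
    then show "AE s in lebT T. norm (indicat_real A (t, s) *\<^sub>R op_exp (\<bar>t - s\<bar> *\<^sub>R G) (C (y s))) \<le> norm (B * (norm C * norm (y s)))"
      using B(1) by (intro AE_I2) auto
  qed
qed

lemma conv_norm_bound:
  assumes T: "0 \<le> T" and A: "A \<in> sets borel"
  obtains \<kappa> where "0 < \<kappa>"
    "\<And>y t. y \<in> borel_measurable (lebT T) \<Longrightarrow> integrable (lebT T) (\<lambda>s. (norm (y s))\<^sup>2) \<Longrightarrow> t \<in> {0..T} \<Longrightarrow>
      norm (conv G T A C y t) \<le> \<kappa> * (\<integral>s. indicat_real A (t, s) * norm (y s) \<partial>lebT T)"
proof -
  have id: "(\<lambda>x. x) \<in> borel_measurable (lebT T)" by (intro measurable_restrict_space1) auto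
  obtain B where B: "0 < B" "\<And>\<tau>. \<tau> \<in> {0..T} \<Longrightarrow> norm (op_exp (\<tau> *\<^sub>R G)) \<le> B"
    using op_exp_bounded[of T G] by blast
  have "norm (conv G T A C y t) \<le> (B * (norm C + 1)) * (\<integral>s. indicat_real A (t, s) * norm (y s) \<partial>lebT T)"
    if y: "y \<in> borel_measurable (lebT T)" "integrable (lebT T) (\<lambda>s. (norm (y s))\<^sup>2)" and t: "t \<in> {0..T}" for y t
  proof -
    have i: "integrable (lebT T) (\<lambda>s. indicat_real A (t, s) * norm (y s))"
    proof (rule Bochner_Integration.integrable_bound)
      show "integrable (lebT T) y" by (rule lebT_Cauchy_Schwarz(1)[OF T y])
      have "(\<lambda>s. indicat_real A (t, s)) \<in> borel_measurable (lebT T)"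
        by (rule measurable_compose[OF borel_measurable_Pair[OF borel_measurable_const id] borel_measurable_indicator[OF A]])
      then show "(\<lambda>s. indicat_real A (t, s) * norm (y s)) \<in> borel_measurable (lebT T)"
        by (rule borel_measurable_times[OF _ measurable_compose[OF y(1) borel_measurable_norm]])
    qed (auto intro!: AE_I2 split: split_indicator)
    have "norm (conv G T A C y t) \<le> (\<integral>s. (B * (norm C + 1)) * (indicat_real A (t, s) * norm (y s)) \<partial>lebT T)"
      unfolding conv_def
    proof (rule order_trans[OF integral_norm_bound Bochner_Integration.integral_mono[OF integrable_norm[OF conv_integrable[OF T y A]]]])
      show "integrable (lebT T) (\<lambda>s. (B * (norm C + 1)) * (indicat_real A (t, s) * norm (y s)))" using i by simp
      fix s assume "s \<in> space (lebT T)"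
      then have "norm (op_exp (\<bar>t - s\<bar> *\<^sub>R G)) \<le> B" using t by (intro B(2)) auto
      moreover have "norm (C (y s)) \<le> (norm C + 1) * norm (y s)"
        by (rule order_trans[OF norm_blinfun mult_right_mono]) auto
      ultimately have "norm (op_exp (\<bar>t - s\<bar> *\<^sub>R G) (C (y s))) \<le> B * ((norm C + 1) * norm (y s))"
        by - (rule order_trans[OF norm_blinfun mult_mono], use B(1) in auto)
      then show "norm (indicat_real A (t, s) *\<^sub>R op_exp (\<bar>t - s\<bar> *\<^sub>R G) (C (y s))) \<le> (B * (norm C + 1)) * (indicat_real A (t, s) * norm (y s))"
        by (auto split: split_indicator simp: mult_ac)
    qed
    then show ?thesis by simp
  qed
  moreover have "0 < B * (norm C + 1)" using B(1) by (simp add: add_nonneg_pos)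
  ultimately show ?thesis using that by blast
qed

lemma conv_duality:
  fixes C D G :: "L2_01 \<Rightarrow>\<^sub>L L2_01"
  assumes T: "0 \<le> T" and A: "A \<in> sets borel"
    and G: "self_adjoint G" and C: "self_adjoint C"
    and y: "y \<in> borel_measurable (lebT T)" "integrable (lebT T) (\<lambda>s. (norm (y s))\<^sup>2)"
    and x: "x \<in> borel_measurable (lebT T)" "integrable (lebT T) (\<lambda>s. (norm (x s))\<^sup>2)"
  shows "(\<integral>t. conv G T A C y t \<bullet> D (x t) \<partial>lebT T) = (\<integral>s. y s \<bullet> C (conv G T {(s, t). (t, s) \<in> A} D x s) \<partial>lebT T)"
proof -
  interpret M: finite_measure "lebT T" by (rule finite_lebT)
  interpret P: pair_sigma_finite "lebT T" "lebT T"
    by (intro pair_sigma_finite.intro sigma_finite_lebT)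
  let ?A' = "{(s, t). (t, s) \<in> A}"
  have A': "?A' \<in> sets borel"
  proof -
    have "(\<lambda>p. (snd p, fst p)) -` A \<inter> space borel \<in> sets (borel :: (real \<times> real) measure)"
      by (intro measurable_sets[OF _ A] borel_measurable_continuous_onI continuous_intros)
    moreover have "(\<lambda>p. (snd p, fst p)) -` A \<inter> space borel = ?A'" by auto
    ultimately show ?thesis by simp
  qed
  obtain B where B: "0 < B" "\<And>\<tau>. \<tau> \<in> {0..T} \<Longrightarrow> norm (op_exp (\<tau> *\<^sub>R G)) \<le> B"
    using op_exp_bounded[of T G] by blast
  define h where "h t s = indicat_real A (t, s) * (op_exp (\<bar>t - s\<bar> *\<^sub>R G) (C (y s)) \<bullet> D (x t))" for t s
  have id: "(\<lambda>x. x) \<in> borel_measurable (lebT T)" by (intro measurable_restrict_space1) auto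
  have m1 [measurable]: "fst \<in> borel_measurable (lebT T \<Otimes>\<^sub>M lebT T)" and m2 [measurable]: "snd \<in> borel_measurable (lebT T \<Otimes>\<^sub>M lebT T)"
    by (rule measurable_compose[OF measurable_fst id], rule measurable_compose[OF measurable_snd id])
  have ind: "(\<lambda>p. indicat_real A (fst p, snd p)) \<in> borel_measurable (lebT T \<Otimes>\<^sub>M lebT T)"
    by (rule measurable_compose[OF borel_measurable_Pair[OF m1 m2] borel_measurable_indicator[OF A]])
  have hm: "case_prod h \<in> borel_measurable (lebT T \<Otimes>\<^sub>M lebT T)"
    unfolding h_def case_prod_beta'
    by (intro borel_measurable_times ind borel_measurable_inner op_exp_apply_measurable blinfun_measurable
        measurable_compose[OF measurable_snd y(1)] measurable_compose[OF measurable_fst x(1)]) measurable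
  have hb: "norm (h t s) \<le> B * norm C * norm D * ((norm (x t))\<^sup>2 + (norm (y s))\<^sup>2)" if "t \<in> {0..T}" "s \<in> {0..T}" for t s
  proof -
    have "norm (op_exp (\<bar>t - s\<bar> *\<^sub>R G)) \<le> B" using that by (intro B(2)) auto
    then have 1: "norm (op_exp (\<bar>t - s\<bar> *\<^sub>R G) (C (y s))) \<le> B * (norm C * norm (y s))"
      by - (rule order_trans[OF norm_blinfun mult_mono], use B(1) in \<open>auto intro: norm_blinfun\<close>)
    have "\<bar>op_exp (\<bar>t - s\<bar> *\<^sub>R G) (C (y s)) \<bullet> D (x t)\<bar> \<le> norm (op_exp (\<bar>t - s\<bar> *\<^sub>R G) (C (y s))) * norm (D (x t))"
      by (rule Cauchy_Schwarz_ineq2)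
    also have "\<dots> \<le> (B * (norm C * norm (y s))) * (norm D * norm (x t))"
      using B(1) by (intro mult_mono 1 norm_blinfun) auto
    also have "\<dots> = B * norm C * norm D * (norm (x t) * norm (y s))" by (simp only: mult_ac)
    also have "\<dots> \<le> B * norm C * norm D * ((norm (x t))\<^sup>2 + (norm (y s))\<^sup>2)"
      using abs_mult_le_squares[of "norm (x t)" "norm (y s)"] B(1) by (intro mult_left_mono) auto
    finally show ?thesis using B(1) by (auto simp: h_def split: split_indicator)
  qed
  have hi: "integrable (lebT T \<Otimes>\<^sub>M lebT T) (case_prod h)"
  proof (rule Bochner_Integration.integrable_bound[OF _ hm])
    have 1: "integrable (lebT T \<Otimes>\<^sub>M lebT T) (\<lambda>p. (norm (x (fst p)))\<^sup>2)"
    proof (rule P.Fubini_integrable)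
      show "(\<lambda>p. (norm (x (fst p)))\<^sup>2) \<in> borel_measurable (lebT T \<Otimes>\<^sub>M lebT T)"
        by (intro borel_measurable_power measurable_compose[OF measurable_compose[OF measurable_fst x(1)] borel_measurable_norm])
    qed (use x in simp_all)
    have 2: "integrable (lebT T \<Otimes>\<^sub>M lebT T) (\<lambda>p. (norm (y (snd p)))\<^sup>2)"
    proof (rule P.Fubini_integrable)
      show "(\<lambda>p. (norm (y (snd p)))\<^sup>2) \<in> borel_measurable (lebT T \<Otimes>\<^sub>M lebT T)"
        by (intro borel_measurable_power measurable_compose[OF measurable_compose[OF measurable_snd y(1)] borel_measurable_norm])
    qed (use y in simp_all)
    show "integrable (lebT T \<Otimes>\<^sub>M lebT T) (\<lambda>p. B * norm C * norm D * ((norm (x (fst p)))\<^sup>2 + (norm (y (snd p)))\<^sup>2))"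
      by (intro integrable_mult_right Bochner_Integration.integrable_add 1 2)
    show "AE p in lebT T \<Otimes>\<^sub>M lebT T. norm (case_prod h p) \<le> norm (B * norm C * norm D * ((norm (x (fst p)))\<^sup>2 + (norm (y (snd p)))\<^sup>2))"
    proof (rule AE_I2)
      fix p assume "p \<in> space (lebT T \<Otimes>\<^sub>M lebT T)"
      then have "fst p \<in> {0..T}" "snd p \<in> {0..T}" by (auto simp: space_pair_measure)
      from hb[OF this] show "norm (case_prod h p) \<le> norm (B * norm C * norm D * ((norm (x (fst p)))\<^sup>2 + (norm (y (snd p)))\<^sup>2))"
        by (simp add: case_prod_beta')
    qed
  qed
  have "(\<integral>t. conv G T A C y t \<bullet> D (x t) \<partial>lebT T) = (\<integral>t. \<integral>s. h t s \<partial>lebT T \<partial>lebT T)"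
    unfolding conv_def h_def
    by (intro Bochner_Integration.integral_cong refl)
      (simp add: integral_inner_left[OF conv_integrable[OF T y A], symmetric])
  also have "\<dots> = (\<integral>s. \<integral>t. h t s \<partial>lebT T \<partial>lebT T)"
    by (rule P.Fubini_integral[OF hi, symmetric])
  also have "\<dots> = (\<integral>s. y s \<bullet> C (conv G T ?A' D x s) \<partial>lebT T)"
  proof (intro Bochner_Integration.integral_cong refl)
    fix s
    have "y s \<bullet> C (conv G T ?A' D x s) = C (y s) \<bullet> conv G T ?A' D x s"
      using C by (simp add: self_adjoint_def)
    also have "\<dots> = (\<integral>t. C (y s) \<bullet> (indicat_real ?A' (s, t) *\<^sub>R op_exp (\<bar>s - t\<bar> *\<^sub>R G) (D (x t))) \<partial>lebT T)"
      unfolding conv_def by (rule integral_inner_right[OF conv_integrable[OF T x A'], symmetric])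
    also have "\<dots> = (\<integral>t. h t s \<partial>lebT T)"
    proof (intro Bochner_Integration.integral_cong refl)
      fix t
      have "C (y s) \<bullet> op_exp (\<bar>s - t\<bar> *\<^sub>R G) (D (x t)) = op_exp (\<bar>t - s\<bar> *\<^sub>R G) (C (y s)) \<bullet> D (x t)"
        using op_exp_self_adjoint[OF G, of "\<bar>s - t\<bar>"] by (simp add: self_adjoint_def abs_minus_commute)
      then show "C (y s) \<bullet> (indicat_real ?A' (s, t) *\<^sub>R op_exp (\<bar>s - t\<bar> *\<^sub>R G) (D (x t))) = h t s"
        by (auto simp: h_def indicator_def)
    qed
    finally show "(\<integral>t. h t s \<partial>lebT T) = y s \<bullet> C (conv G T ?A' D x s)" by (rule sym)
  qed
  finally show ?thesis .
qed

section \<open>The closed-loop state\<close>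

text \<open>As an argument of \<open>conv\<close>, the pair consists of the time of evaluation and the variable of integration.\<close>

definition causal :: "(real \<times> real) set" where "causal = {(t, s). s \<le> t}"
definition anticausal :: "(real \<times> real) set" where "anticausal = {(s, t). s \<le> t}"

lemma causal_measurable: "causal \<in> sets borel" "anticausal \<in> sets borel"
proof -
  have "closed {p::real \<times> real. snd p \<le> fst p}" "closed {p::real \<times> real. fst p \<le> snd p}"
    by (intro closed_Collect_le continuous_intros)+
  moreover have "causal = {p. snd p \<le> fst p}" "anticausal = {p. fst p \<le> snd p}"
    by (auto simp: causal_def anticausal_def)
  ultimately show "causal \<in> sets borel" "anticausal \<in> sets borel" by (simp_all add: borel_closed)
qed

lemma conv_causal:
  fixes G C :: "L2_01 \<Rightarrow>\<^sub>L L2_01"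
  assumes "t \<le> T"
  shows "(\<integral>s. op_exp ((t - s) *\<^sub>R G) (C (y s)) \<partial>lebT t) = conv G T causal C y t"
  unfolding conv_def
  using assms by (subst (1 2) integral_restrict_space)
    (auto intro!: Bochner_Integration.integral_cong split: split_indicator simp: causal_def indicator_def)

lemma conv_anticausal:
  fixes G C :: "L2_01 \<Rightarrow>\<^sub>L L2_01"
  assumes "0 \<le> s" "s \<le> T" and x: "continuous_on {0..T} x"
  shows "conv G T anticausal C x s = integral {s..T} (\<lambda>t. op_exp ((t - s) *\<^sub>R G) (C (x t)))"
proof -
  let ?g = "\<lambda>t. op_exp ((t - s) *\<^sub>R G) (C (x t))"
  have g: "continuous_on {s..T} ?g"
    by (intro blinfun_apply_continuous_on continuous_on_compose2[OF op_exp_continuous_on[of UNIV G]]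
        continuous_intros continuous_on_const continuous_on_subset[OF x]) (use assms in auto)
  have "conv G T anticausal C x s = (LINT t:{s..T}|lborel. ?g t)"
    unfolding conv_def set_lebesgue_integral_def using assms
    by (subst integral_restrict_space)
      (auto intro!: Bochner_Integration.integral_cong split: split_indicator simp: anticausal_def indicator_def)
  also have "\<dots> = integral {s..T} ?g"
  proof -
    have "(LINT t:{s..T}|lborel. ?g t) \<bullet> u = integral {s..T} ?g \<bullet> u" for u
    proof -
      have gu: "continuous_on {s..T} (\<lambda>t. ?g t \<bullet> u)" by (intro continuous_intros g)
      have "(LINT t:{s..T}|lborel. ?g t) \<bullet> u = (LINT t:{s..T}|lborel. ?g t \<bullet> u)"
        using borel_integrable_atLeastAtMost'[OF g]
        unfolding set_lebesgue_integral_def set_integrable_def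
        by (subst integral_inner_left[symmetric]) auto
      also have "\<dots> = integral {s..T} (\<lambda>t. ?g t \<bullet> u)"
        by (rule set_borel_integral_eq_integral(2)[OF borel_integrable_atLeastAtMost'[OF gu]])
      also have "\<dots> = integral {s..T} ?g \<bullet> u"
        using integral_linear[OF integrable_continuous_interval[OF g] bounded_linear_inner_left[of u]] by (simp add: o_def)
      finally show ?thesis .
    qed
    then show ?thesis using vector_eq_rdot by blast
  qed
  finally show ?thesis .
qed

context q_noise begin

text \<open>With Tonelli's theorem this makes the noise square integrable on \<open>[0,T] \<times> \<Omega>\<close>.\<close>

lemma noise_path_moment:
  assumes t: "0 \<le> t"
  shows "has_bochner_integral \<Omega> (\<lambda>\<omega>. (norm (noise_path t \<omega>))\<^sup>2) ((\<Sum>k\<in>UNIV. lam k * (norm (f k))\<^sup>2) * t)"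
proof -
  let ?D = "\<lambda>k \<omega>. W k t \<omega> - W k 0 \<omega>" and ?p = "\<lambda>k l. sqrt (lam k) * sqrt (lam l) * (f k \<bullet> f l)"
  define c where "c = (\<Sum>k\<in>UNIV. \<Sum>l\<in>UNIV. ?p k l * (if k = l then measure lborel ({0<..t} \<inter> {0<..t}) else 0))"
  have cov: "has_bochner_integral \<Omega> (\<lambda>\<omega>. ?D k \<omega> * ?D l \<omega>) (if k = l then measure lborel ({0<..t} \<inter> {0<..t}) else 0)" for k l
    using increment_covariance[of 0 t 0 t k l] t unfolding has_bochner_integral_iff by blast
  have "has_bochner_integral \<Omega> (\<lambda>\<omega>. \<Sum>k\<in>UNIV. \<Sum>l\<in>UNIV. ?p k l * (?D k \<omega> * ?D l \<omega>)) c"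
    unfolding c_def by (intro has_bochner_integral_sum has_bochner_integral_mult_right cov)
  moreover have "(\<Sum>k\<in>UNIV. \<Sum>l\<in>UNIV. ?p k l * (?D k \<omega> * ?D l \<omega>)) = (norm (noise_path t \<omega>))\<^sup>2" if "\<omega> \<in> space \<Omega>" for \<omega>
    using that t
    by (simp add: noise_path_def w_increment power2_norm_eq_inner inner_sum_left inner_sum_right sum_distrib_left inner_commute mult_ac)
  moreover have "c = (\<Sum>k\<in>UNIV. lam k * (norm (f k))\<^sup>2) * t"
  proof -
    have "(\<Sum>l\<in>UNIV. ?p k l * (if k = l then measure lborel ({0<..t} \<inter> {0<..t}) else 0)) = lam k * (norm (f k))\<^sup>2 * t" for k
    proof -
      have "(\<Sum>l\<in>UNIV. ?p k l * (if k = l then measure lborel ({0<..t} \<inter> {0<..t}) else 0)) = (\<Sum>l\<in>UNIV. if k = l then ?p k l * t else 0)"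
        using t by (intro sum.cong) auto
      also have "\<dots> = ?p k k * t" by simp
      finally show ?thesis using lam_nonneg[of k] by (simp add: power2_norm_eq_inner)
    qed
    then show ?thesis by (simp add: c_def sum_distrib_right)
  qed
  ultimately show ?thesis by (subst has_bochner_integral_cong[OF refl _ refl, symmetric]) auto
qed

end

text \<open>A linear quadratic problem for general operators, with a gain \<open>K\<close> and a solution \<open>\<P>\<close> of the operator
  Riccati equation.  The quadratic term of that equation is written as $P H K$; by the feedback condition
  it equals the usual $- P H C_R^{-1} H P$, and no inverse occurs.\<close>

locale lq_setting = q_noise \<Omega> W f lam w
  for \<Omega> :: "'w measure" and W :: "'n::finite \<Rightarrow> real \<Rightarrow> 'w \<Rightarrow> real" and f lam w +
  fixes T r :: real and G H CM CR CMT :: "L2_01 \<Rightarrow>\<^sub>L L2_01" and x0 :: L2_01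
    and K \<P> :: "real \<Rightarrow> L2_01 \<Rightarrow>\<^sub>L L2_01"
  assumes T: "0 < T" and r: "0 < r"
    and self_adjoint: "self_adjoint G" "self_adjoint H" "self_adjoint CM" "self_adjoint CR" "self_adjoint CMT"
    and CM_nonneg: "\<And>v. 0 \<le> v \<bullet> CM v" and CMT_nonneg: "\<And>v. 0 \<le> v \<bullet> CMT v"
    and CR_coercive: "\<And>v. r * (norm v)\<^sup>2 \<le> v \<bullet> CR v"
    and K_continuous: "continuous_on {0..T} K"
    and \<P>_derivative: "\<And>t. t \<in> {0..T} \<Longrightarrow>
      (\<P> has_vector_derivative - ((G o\<^sub>L \<P> t) + (\<P> t o\<^sub>L (G + (H o\<^sub>L K t))) + CM)) (at t within {0..T})"
    and \<P>_T: "\<P> T = CMT"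
    and feedback: "\<And>t. t \<in> {0..T} \<Longrightarrow> CR o\<^sub>L K t = - (H o\<^sub>L \<P> t)"
begin

definition drift :: "real \<Rightarrow> L2_01 \<Rightarrow>\<^sub>L L2_01" where "drift t = G + (H o\<^sub>L K t)"

lemma drift_continuous: "continuous_on {0..T} drift"
  unfolding drift_def[abs_def]
  by (intro continuous_on_add continuous_on_const bounded_bilinear.continuous_on[OF bounded_bilinear_blinfun_compose] K_continuous)

text \<open>Variation of constants: $X_t - w_t$ solves a linear equation with inhomogeneity \<open>drift t\<close> applied to the noise, path by path.  The
  explicit formula shows adaptedness; the bound is what square integrability of the state needs.\<close>

lemma state_exists:
  "\<exists>X. (\<forall>t\<in>{0..T}. X t \<in> borel_measurable (natural_filtration \<Omega> w t)) \<and>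
    (\<forall>\<omega>\<in>space \<Omega>. X 0 \<omega> = x0 \<and> continuous_on {0..T} (\<lambda>t. X t \<omega>) \<and>
      (\<forall>t\<in>{0..T}. ((\<lambda>t. X t \<omega> - noise_path t \<omega>) has_vector_derivative drift t (X t \<omega>)) (at t within {0..T}))) \<and>
    (\<exists>c\<ge>0. \<forall>t\<in>{0..T}. \<forall>\<omega>\<in>space \<Omega>.
      (norm (X t \<omega>))\<^sup>2 \<le> c * (1 + (norm (noise_path t \<omega>))\<^sup>2 + (\<integral>s. (norm (noise_path s \<omega>))\<^sup>2 \<partial>lebT T)))"
proof -
  have T0: "0 \<le> T" using T by simp
  obtain \<Phi> \<Psi> where
    \<Phi>: "\<And>t. t \<in> {0..T} \<Longrightarrow> (\<Phi> has_vector_derivative drift t o\<^sub>L \<Phi> t) (at t within {0..T})"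
    and \<Psi>: "\<And>t. t \<in> {0..T} \<Longrightarrow> (\<Psi> has_vector_derivative - (\<Psi> t o\<^sub>L drift t)) (at t within {0..T})"
    and id: "\<Phi> 0 = id_blinfun" "\<Psi> 0 = id_blinfun" and inv: "\<And>t. t \<in> {0..T} \<Longrightarrow> \<Phi> t o\<^sub>L \<Psi> t = id_blinfun"
    using fundamental_solution[OF drift_continuous] by blast
  have c\<Phi>: "continuous_on {0..T} \<Phi>" and c\<Psi>: "continuous_on {0..T} \<Psi>"
    unfolding continuous_on_eq_continuous_within
    using \<Phi> \<Psi> has_vector_derivative_continuous by blast+
  define g where "g s \<omega> = \<Psi> s (drift s (noise_path s \<omega>))" for s \<omega>
  define X where "X t \<omega> = noise_path t \<omega> + \<Phi> t (x0 + (\<integral>s. g s \<omega> \<partial>lebT t))" for t \<omega>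
  have cg: "continuous_on {0..T} (\<lambda>s. g s \<omega>)" if "\<omega> \<in> space \<Omega>" for \<omega>
    unfolding g_def by (intro blinfun_apply_continuous_on c\<Psi> drift_continuous noise_path_continuous that)
  have ig: "(\<integral>s. g s \<omega> \<partial>lebT t) = integral {0..t} (\<lambda>s. g s \<omega>)" if "\<omega> \<in> space \<Omega>" "t \<in> {0..T}" for t \<omega>
    using that by (intro lebT_integral_continuous continuous_on_subset[OF cg]) auto
  have adapted: "X t \<in> borel_measurable (natural_filtration \<Omega> w t)" if t: "t \<in> {0..T}" for t
  proof -
    have "(\<lambda>(s, \<omega>). g s \<omega>) \<in> borel_measurable (lebT t \<Otimes>\<^sub>M natural_filtration \<Omega> w t)"
    proof (rule continuous_process_measurable)
      fix s assume s: "s \<in> {0..t}"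
      show "g s \<in> borel_measurable (natural_filtration \<Omega> w t)"
        unfolding g_def[abs_def] using s by (intro blinfun_measurable noise_path_adapted) auto
    next
      fix \<omega> assume "\<omega> \<in> space (natural_filtration \<Omega> w t)"
      then show "continuous_on {0..t} (\<lambda>s. g s \<omega>)" using t by (intro continuous_on_subset[OF cg]) auto
    qed
    then have "(\<lambda>\<omega>. \<integral>s. g s \<omega> \<partial>lebT t) \<in> borel_measurable (natural_filtration \<Omega> w t)"
      by (rule time_integral_measurable)
    then show ?thesis
      unfolding X_def[abs_def] using t
      by (intro borel_measurable_add noise_path_adapted blinfun_measurable borel_measurable_const) auto
  qed
  have path: "X 0 \<omega> = x0" "continuous_on {0..T} (\<lambda>t. X t \<omega>)"
      "\<And>t. t \<in> {0..T} \<Longrightarrow> ((\<lambda>t. X t \<omega> - noise_path t \<omega>) has_vector_derivative drift t (X t \<omega>)) (at t within {0..T})"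
    if \<omega>: "\<omega> \<in> space \<Omega>" for \<omega>
  proof -
    show "X 0 \<omega> = x0" using ig[OF \<omega>, of 0] T by (simp add: X_def id noise_path_def)
    show der: "((\<lambda>t. X t \<omega> - noise_path t \<omega>) has_vector_derivative drift t (X t \<omega>)) (at t within {0..T})"
      if t: "t \<in> {0..T}" for t
    proof -
      let ?I = "\<lambda>t. x0 + integral {0..t} (\<lambda>s. g s \<omega>)"
      have "(?I has_vector_derivative 0 + g t \<omega>) (at t within {0..T})"
        by (intro has_vector_derivative_add has_vector_derivative_const integral_has_vector_derivative[OF cg[OF \<omega>] t])
      then have "((\<lambda>t. \<Phi> t (?I t)) has_vector_derivative \<Phi> t (0 + g t \<omega>) + (drift t o\<^sub>L \<Phi> t) (?I t)) (at t within {0..T})"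
        by (rule has_vector_derivative_blinfun_apply[OF \<Phi>[OF t]])
      moreover have "\<Phi> t (0 + g t \<omega>) + (drift t o\<^sub>L \<Phi> t) (?I t) = drift t (X t \<omega>)"
      proof -
        have "\<Phi> t (g t \<omega>) = (\<Phi> t o\<^sub>L \<Psi> t) (drift t (noise_path t \<omega>))" by (simp add: g_def)
        then show ?thesis by (simp add: inv[OF t] X_def ig[OF \<omega> t] blinfun.add_right)
      qed
      ultimately have "((\<lambda>t. \<Phi> t (?I t)) has_vector_derivative drift t (X t \<omega>)) (at t within {0..T})" by simp
      then show ?thesis
        by (rule has_vector_derivative_transform[OF t, rotated]) (simp add: X_def ig[OF \<omega>])
    qed
    have "continuous_on {0..T} (\<lambda>t. X t \<omega> - noise_path t \<omega>)"
      unfolding continuous_on_eq_continuous_within using der has_vector_derivative_continuous by blast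
    from continuous_on_add[OF this noise_path_continuous[OF \<omega>]] show "continuous_on {0..T} (\<lambda>t. X t \<omega>)" by simp
  qed
  obtain b where b: "0 < b" "\<And>t. t \<in> {0..T} \<Longrightarrow> norm (\<Phi> t) \<le> b"
    using continuous_bounded_Icc[OF c\<Phi>] by blast
  have "continuous_on {0..T} (\<lambda>s. \<Psi> s o\<^sub>L drift s)"
    by (intro bounded_bilinear.continuous_on[OF bounded_bilinear_blinfun_compose] c\<Psi> drift_continuous)
  then obtain d where d: "0 < d" "\<And>t. t \<in> {0..T} \<Longrightarrow> norm (\<Psi> t o\<^sub>L drift t) \<le> d"
    using continuous_bounded_Icc by blast
  define \<beta> where "\<beta> = 1 + b * norm x0 + b * d"
  have \<beta>: "1 \<le> \<beta>" "b * norm x0 \<le> \<beta>" "b * d \<le> \<beta>" "0 \<le> \<beta>"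
    using b(1) d(1) by (simp_all add: \<beta>_def)
  have bound: "(norm (X t \<omega>))\<^sup>2 \<le> 3 * \<beta>\<^sup>2 * (1 + T) * (1 + (norm (noise_path t \<omega>))\<^sup>2 + (\<integral>s. (norm (noise_path s \<omega>))\<^sup>2 \<partial>lebT T))"
    if t: "t \<in> {0..T}" and \<omega>: "\<omega> \<in> space \<Omega>" for t \<omega>
  proof -
    let ?v = "\<lambda>s. noise_path s \<omega>"
    have sub: "{0..t} \<subseteq> {0..T}" using t by auto
    have cn: "continuous_on {0..T} (\<lambda>s. norm (?v s))" by (intro continuous_on_norm noise_path_continuous \<omega>)
    define a where "a = (\<integral>s. norm (?v s) \<partial>lebT T)"
    define q where "q = (\<integral>s. (norm (?v s))\<^sup>2 \<partial>lebT T)"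
    have a: "a = integral {0..T} (\<lambda>s. norm (?v s))" unfolding a_def by (rule lebT_integral_continuous(2)[OF cn])
    have a0: "0 \<le> a" by (simp add: a_def)
    have aq: "a\<^sup>2 \<le> T * q"
      unfolding a_def q_def
    proof (rule lebT_Cauchy_Schwarz(2)[OF T0])
      show "?v \<in> borel_measurable (lebT T)"
        using lebT_integral_continuous(1)[OF noise_path_continuous[OF \<omega>]] by (rule borel_measurable_integrable)
      show "integrable (lebT T) (\<lambda>s. (norm (?v s))\<^sup>2)"
        by (intro lebT_integral_continuous(1) continuous_on_power cn)
    qed
    have "norm (integral {0..t} (\<lambda>s. g s \<omega>)) \<le> integral {0..t} (\<lambda>s. d * norm (?v s))"
    proof (rule integral_norm_bound_integral)
      show "(\<lambda>s. g s \<omega>) integrable_on {0..t}"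
        by (intro integrable_continuous_interval continuous_on_subset[OF cg[OF \<omega>] sub])
      show "(\<lambda>s. d * norm (?v s)) integrable_on {0..t}"
        by (intro integrable_continuous_interval continuous_on_mult continuous_on_const continuous_on_subset[OF cn sub])
      fix s assume "s \<in> {0..t}"
      then have "norm (\<Psi> s o\<^sub>L drift s) \<le> d" using sub d by blast
      then have "norm ((\<Psi> s o\<^sub>L drift s) (?v s)) \<le> d * norm (?v s)"
        by (rule order_trans[OF norm_blinfun mult_right_mono]) simp
      then show "norm (g s \<omega>) \<le> d * norm (?v s)" by (simp add: g_def)
    qed
    also have "\<dots> = d * integral {0..t} (\<lambda>s. norm (?v s))" by simp
    also have "\<dots> \<le> d * a"
      unfolding a using d(1)
      by (intro mult_left_mono integral_subset_le[OF sub] integrable_continuous_interval cn continuous_on_subset[OF cn sub]) auto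
    finally have ng: "norm (integral {0..t} (\<lambda>s. g s \<omega>)) \<le> d * a" .
    have "norm (\<Phi> t (x0 + integral {0..t} (\<lambda>s. g s \<omega>))) \<le> b * (norm x0 + d * a)"
    proof (rule order_trans[OF norm_blinfun mult_mono])
      show "norm (x0 + integral {0..t} (\<lambda>s. g s \<omega>)) \<le> norm x0 + d * a"
        using norm_triangle_ineq[of x0 "integral {0..t} (\<lambda>s. g s \<omega>)"] ng by linarith
    qed (use b t in auto)
    then have "norm (X t \<omega>) \<le> norm (?v t) + b * (norm x0 + d * a)"
      unfolding X_def ig[OF \<omega> t]
      using norm_triangle_ineq[of "?v t" "\<Phi> t (x0 + integral {0..t} (\<lambda>s. g s \<omega>))"] by linarith
    also have "\<dots> = 1 * norm (?v t) + b * norm x0 * 1 + b * d * a" by (simp add: algebra_simps)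
    also have "\<dots> \<le> \<beta> * norm (?v t) + \<beta> * 1 + \<beta> * a"
      using \<beta> a0 by (intro add_mono mult_right_mono) auto
    finally have "norm (X t \<omega>) \<le> \<beta> * (1 + norm (?v t) + a)" by (simp add: algebra_simps)
    then have "(norm (X t \<omega>))\<^sup>2 \<le> (\<beta> * (1 + norm (?v t) + a))\<^sup>2" by (intro power_mono) auto
    also have "\<dots> = \<beta>\<^sup>2 * (1 + norm (?v t) + a)\<^sup>2" by (simp add: power_mult_distrib)
    also have "\<dots> \<le> \<beta>\<^sup>2 * (3 * (1 + T) * (1 + (norm (?v t))\<^sup>2 + q))"
    proof (rule mult_left_mono)
      have q0: "0 \<le> q" by (simp add: q_def)
      have "(1 + norm (?v t) + a)\<^sup>2 \<le> 3 * (1 + (norm (?v t))\<^sup>2 + a\<^sup>2)"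
        using sum_squares_bound[of 1 "norm (?v t)"] sum_squares_bound[of 1 a] sum_squares_bound[of "norm (?v t)" a]
        by (simp add: power2_eq_square algebra_simps)
      also have "\<dots> \<le> 3 * ((1 + T) * (1 + (norm (?v t))\<^sup>2 + q))"
      proof -
        have "0 \<le> T * (1 + (norm (?v t))\<^sup>2)" using T0 by (intro mult_nonneg_nonneg add_nonneg_nonneg) auto
        then show ?thesis using aq q0 by (simp add: algebra_simps)
      qed
      finally show "(1 + norm (?v t) + a)\<^sup>2 \<le> 3 * (1 + T) * (1 + (norm (?v t))\<^sup>2 + q)" by (simp only: mult.assoc)
    qed simp
    finally show ?thesis unfolding q_def by (simp only: mult_ac)
  qed
  show ?thesis
    using T0 by (intro exI[of _ X] conjI ballI adapted path exI[of _ "3 * \<beta>\<^sup>2 * (1 + T)"] bound) auto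
qed

end

section \<open>Square integrable processes\<close>

context q_noise begin

text \<open>For two such processes the inner product is integrable on \<open>[0,T] \<times> \<Omega>\<close>, so that Fubini's theorem is available.\<close>

definition L2proc :: "real \<Rightarrow> (real \<Rightarrow> 'w \<Rightarrow> L2_01) \<Rightarrow> bool" where
  "L2proc T Y \<longleftrightarrow> (\<lambda>(t, \<omega>). Y t \<omega>) \<in> borel_measurable (lebT T \<Otimes>\<^sub>M \<Omega>) \<and>
    integrable (lebT T \<Otimes>\<^sub>M \<Omega>) (\<lambda>(t, \<omega>). (norm (Y t \<omega>))\<^sup>2)"

lemma pair_sigma_finite_lebT: "pair_sigma_finite (lebT T) \<Omega>"
  by (intro pair_sigma_finite.intro sigma_finite_lebT sigma_finite_measure_axioms)

lemma process_path_measurable: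
  assumes "(\<lambda>(t, \<omega>). Y t \<omega>) \<in> borel_measurable (lebT T \<Otimes>\<^sub>M \<Omega>)" "\<omega> \<in> space \<Omega>"
  shows "(\<lambda>s. Y s \<omega>) \<in> borel_measurable (lebT T)"
  using measurable_compose[OF measurable_Pair2'[OF assms(2)] assms(1)] by simp

lemma process_section_measurable:
  assumes "(\<lambda>(t, \<omega>). Y t \<omega>) \<in> borel_measurable (lebT T \<Otimes>\<^sub>M \<Omega>)" "t \<in> {0..T}"
  shows "Y t \<in> borel_measurable \<Omega>"
  using measurable_compose[OF measurable_Pair1'[of t "lebT T"] assms(1)] assms(2) by simp

lemma AE_time_prod_snd:
  assumes "AE \<omega> in \<Omega>. P \<omega>"
  shows "AE z in lebT T \<Otimes>\<^sub>M \<Omega>. P (snd z)"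
proof -
  obtain N where N: "{\<omega> \<in> space \<Omega>. \<not> P \<omega>} \<subseteq> N" "N \<in> null_sets \<Omega>"
    using assms by (auto simp: eventually_ae_filter)
  show ?thesis
  proof (rule AE_I')
    have I: "{0..T} \<in> sets (lebT T)" using sets.top[of "lebT T"] by simp
    have N': "N \<in> sets \<Omega>" using N(2) by (rule null_setsD2)
    have "emeasure (lebT T \<Otimes>\<^sub>M \<Omega>) ({0..T} \<times> N) = emeasure (lebT T) {0..T} * emeasure \<Omega> N"
      by (rule emeasure_pair_measure_Times[OF I N'])
    also have "\<dots> = 0" using null_setsD1[OF N(2)] by simp
    finally show "{0..T} \<times> N \<in> null_sets (lebT T \<Otimes>\<^sub>M \<Omega>)"
      using I N' by (intro null_setsI pair_measureI)
    show "{z \<in> space (lebT T \<Otimes>\<^sub>M \<Omega>). \<not> P (snd z)} \<subseteq> {0..T} \<times> N"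
      using N(1) by (auto simp: space_pair_measure)
  qed
qed

lemma L2proc_path:
  assumes "L2proc T Y"
  shows "AE \<omega> in \<Omega>. integrable (lebT T) (\<lambda>s. (norm (Y s \<omega>))\<^sup>2)"
    "integrable \<Omega> (\<lambda>\<omega>. \<integral>s. (norm (Y s \<omega>))\<^sup>2 \<partial>lebT T)"
    "AE t in lebT T. integrable \<Omega> (\<lambda>\<omega>. (norm (Y t \<omega>))\<^sup>2)"
proof -
  interpret pair_sigma_finite "lebT T" \<Omega> by (rule pair_sigma_finite_lebT)
  have i: "integrable (lebT T \<Otimes>\<^sub>M \<Omega>) (\<lambda>(t, \<omega>). (norm (Y t \<omega>))\<^sup>2)" using assms by (simp add: L2proc_def)
  show "AE \<omega> in \<Omega>. integrable (lebT T) (\<lambda>s. (norm (Y s \<omega>))\<^sup>2)" by (rule AE_integrable_snd[OF i])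
  show "integrable \<Omega> (\<lambda>\<omega>. \<integral>s. (norm (Y s \<omega>))\<^sup>2 \<partial>lebT T)" by (rule integrable_snd[OF i])
  show "AE t in lebT T. integrable \<Omega> (\<lambda>\<omega>. (norm (Y t \<omega>))\<^sup>2)" by (rule AE_integrable_fst[OF i])
qed

lemma L2proc_bound:
  assumes m: "(\<lambda>(t, \<omega>). Y t \<omega>) \<in> borel_measurable (lebT T \<Otimes>\<^sub>M \<Omega>)"
    and h: "integrable (lebT T \<Otimes>\<^sub>M \<Omega>) h"
    and le: "AE z in lebT T \<Otimes>\<^sub>M \<Omega>. (norm (Y (fst z) (snd z)))\<^sup>2 \<le> h z"
  shows "L2proc T Y"
  unfolding L2proc_def
proof (intro conjI m)
  show "integrable (lebT T \<Otimes>\<^sub>M \<Omega>) (\<lambda>(t, \<omega>). (norm (Y t \<omega>))\<^sup>2)"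
  proof (rule Bochner_Integration.integrable_bound[OF h])
    show "(\<lambda>(t, \<omega>). (norm (Y t \<omega>))\<^sup>2) \<in> borel_measurable (lebT T \<Otimes>\<^sub>M \<Omega>)"
      using borel_measurable_power[OF measurable_compose[OF m borel_measurable_norm]]
      by (simp add: case_prod_beta')
    show "AE z in lebT T \<Otimes>\<^sub>M \<Omega>. norm (case z of (t, \<omega>) \<Rightarrow> (norm (Y t \<omega>))\<^sup>2) \<le> norm (h z)"
      using le by eventually_elim (auto simp: case_prod_beta')
  qed
qed

lemma L2proc_inner:
  assumes "L2proc T Y" "L2proc T Z"
  shows "integrable (lebT T \<Otimes>\<^sub>M \<Omega>) (\<lambda>(t, \<omega>). Y t \<omega> \<bullet> Z t \<omega>)"
proof (rule Bochner_Integration.integrable_bound)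
  show "integrable (lebT T \<Otimes>\<^sub>M \<Omega>) (\<lambda>z. (norm (Y (fst z) (snd z)))\<^sup>2 + (norm (Z (fst z) (snd z)))\<^sup>2)"
    using assms by (intro Bochner_Integration.integrable_add) (auto simp: L2proc_def case_prod_beta')
  show "(\<lambda>(t, \<omega>). Y t \<omega> \<bullet> Z t \<omega>) \<in> borel_measurable (lebT T \<Otimes>\<^sub>M \<Omega>)"
    using assms by (auto simp: L2proc_def case_prod_beta' intro!: borel_measurable_inner)
  have "\<bar>u \<bullet> v\<bar> \<le> (norm u)\<^sup>2 + (norm v)\<^sup>2" for u v :: L2_01
    using order_trans[OF Cauchy_Schwarz_ineq2[of u v]] abs_mult_le_squares[of "norm u" "norm v"] by simp
  then show "AE z in lebT T \<Otimes>\<^sub>M \<Omega>. norm (case z of (t, \<omega>) \<Rightarrow> Y t \<omega> \<bullet> Z t \<omega>)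
      \<le> norm ((norm (Y (fst z) (snd z)))\<^sup>2 + (norm (Z (fst z) (snd z)))\<^sup>2)"
    by (intro AE_I2) (simp add: case_prod_beta')
qed

lemma L2proc_add:
  assumes "L2proc T Y" "L2proc T Z"
  shows "L2proc T (\<lambda>t \<omega>. Y t \<omega> + Z t \<omega>)"
proof (rule L2proc_bound)
  show "(\<lambda>(t, \<omega>). Y t \<omega> + Z t \<omega>) \<in> borel_measurable (lebT T \<Otimes>\<^sub>M \<Omega>)"
    using assms by (auto simp: L2proc_def case_prod_beta' intro!: borel_measurable_add)
  show "integrable (lebT T \<Otimes>\<^sub>M \<Omega>) (\<lambda>z. 2 * (norm (Y (fst z) (snd z)))\<^sup>2 + 2 * (norm (Z (fst z) (snd z)))\<^sup>2)"
    using assms by (intro Bochner_Integration.integrable_add integrable_mult_right) (auto simp: L2proc_def case_prod_beta')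
  show "AE z in lebT T \<Otimes>\<^sub>M \<Omega>. (norm (Y (fst z) (snd z) + Z (fst z) (snd z)))\<^sup>2
      \<le> 2 * (norm (Y (fst z) (snd z)))\<^sup>2 + 2 * (norm (Z (fst z) (snd z)))\<^sup>2"
    using norm_diff_square_triangle[of "Y _ _" "- Z _ _" 0] by (intro AE_I2) simp
qed

lemma L2proc_blinfun:
  assumes "L2proc T Y"
  shows "L2proc T (\<lambda>t \<omega>. blinfun_apply C (Y t \<omega>))"
proof (rule L2proc_bound)
  show "(\<lambda>(t, \<omega>). blinfun_apply C (Y t \<omega>)) \<in> borel_measurable (lebT T \<Otimes>\<^sub>M \<Omega>)"
    using assms by (auto simp: L2proc_def case_prod_beta' intro!: blinfun_measurable)
  show "integrable (lebT T \<Otimes>\<^sub>M \<Omega>) (\<lambda>z. (norm C)\<^sup>2 * (norm (Y (fst z) (snd z)))\<^sup>2)"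
    using assms by (intro integrable_mult_right) (auto simp: L2proc_def case_prod_beta')
  have "(norm (blinfun_apply C v))\<^sup>2 \<le> (norm C)\<^sup>2 * (norm v)\<^sup>2" for v
    using power_mono[OF norm_blinfun[of C v], of 2] by (simp add: power_mult_distrib)
  then show "AE z in lebT T \<Otimes>\<^sub>M \<Omega>. (norm (blinfun_apply C (Y (fst z) (snd z))))\<^sup>2 \<le> (norm C)\<^sup>2 * (norm (Y (fst z) (snd z)))\<^sup>2"
    by (intro AE_I2)
qed

lemma L2proc_minus: "L2proc T Y \<Longrightarrow> L2proc T (\<lambda>t \<omega>. - Y t \<omega>)"
  using L2proc_blinfun[of T Y "- id_blinfun"] by (simp add: blinfun.minus_left)

lemma L2proc_diff: "L2proc T Y \<Longrightarrow> L2proc T Z \<Longrightarrow> L2proc T (\<lambda>t \<omega>. Y t \<omega> - Z t \<omega>)"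
  using L2proc_add[OF _ L2proc_minus[of T Z], of Y] by simp

lemma random_integrable_time_prod:
  assumes "integrable \<Omega> g"
  shows "integrable (lebT T \<Otimes>\<^sub>M \<Omega>) (\<lambda>z. g (snd z) :: real)"
proof -
  interpret pair_sigma_finite "lebT T" \<Omega> by (rule pair_sigma_finite_lebT)
  interpret L: finite_measure "lebT T" by (rule finite_lebT)
  show ?thesis
  proof (rule Fubini_integrable)
    show "(\<lambda>z. g (snd z)) \<in> borel_measurable (lebT T \<Otimes>\<^sub>M \<Omega>)"
      by (rule measurable_compose[OF measurable_snd borel_measurable_integrable[OF assms]])
  qed (use assms in simp_all)
qed

lemma conv_square_bound:
  fixes C G :: "L2_01 \<Rightarrow>\<^sub>L L2_01"
  assumes T: "0 \<le> T" and A: "A \<in> sets borel"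
  obtains \<kappa> where "0 \<le> \<kappa>"
    "\<And>y t. y \<in> borel_measurable (lebT T) \<Longrightarrow> integrable (lebT T) (\<lambda>s. (norm (y s))\<^sup>2) \<Longrightarrow> t \<in> {0..T} \<Longrightarrow>
      (norm (conv G T A C y t))\<^sup>2 \<le> \<kappa> * (\<integral>s. (norm (y s))\<^sup>2 \<partial>lebT T)"
proof -
  obtain \<kappa> where \<kappa>: "0 < \<kappa>"
    "\<And>y t. y \<in> borel_measurable (lebT T) \<Longrightarrow> integrable (lebT T) (\<lambda>s. (norm (y s))\<^sup>2) \<Longrightarrow> t \<in> {0..T} \<Longrightarrow>
      norm (conv G T A C y t) \<le> \<kappa> * (\<integral>s. indicat_real A (t, s) * norm (y s) \<partial>lebT T)"
    using conv_norm_bound[OF T A, of G C] by blast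
  have "(norm (conv G T A C y t))\<^sup>2 \<le> (\<kappa>\<^sup>2 * T) * (\<integral>s. (norm (y s))\<^sup>2 \<partial>lebT T)"
    if y: "y \<in> borel_measurable (lebT T)" "integrable (lebT T) (\<lambda>s. (norm (y s))\<^sup>2)" and t: "t \<in> {0..T}" for y t
  proof -
    have "(\<integral>s. indicat_real A (t, s) * norm (y s) \<partial>lebT T) \<le> (\<integral>s. norm (y s) \<partial>lebT T)"
      by (rule integral_mono_AE'[OF integrable_norm[OF lebT_Cauchy_Schwarz(1)[OF T y]]])
        (auto intro!: AE_I2 split: split_indicator)
    then have "norm (conv G T A C y t) \<le> \<kappa> * (\<integral>s. norm (y s) \<partial>lebT T)"
      using \<kappa>(1) by (intro order_trans[OF \<kappa>(2)[OF y t]] mult_left_mono) auto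
    then have "(norm (conv G T A C y t))\<^sup>2 \<le> (\<kappa> * (\<integral>s. norm (y s) \<partial>lebT T))\<^sup>2" by (rule power_mono) simp
    also have "\<dots> = \<kappa>\<^sup>2 * (\<integral>s. norm (y s) \<partial>lebT T)\<^sup>2" by (rule power_mult_distrib)
    also have "\<dots> \<le> \<kappa>\<^sup>2 * (T * (\<integral>s. (norm (y s))\<^sup>2 \<partial>lebT T))"
      by (intro mult_left_mono lebT_Cauchy_Schwarz(2)[OF T y]) simp
    finally show ?thesis by (simp only: mult_ac)
  qed
  then show ?thesis using T by (intro that[of "\<kappa>\<^sup>2 * T"]) auto
qed

lemma L2proc_conv:
  fixes C G :: "L2_01 \<Rightarrow>\<^sub>L L2_01"
  assumes T: "0 \<le> T" and A: "A \<in> sets borel" and Y: "L2proc T Y"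
  shows "L2proc T (\<lambda>t \<omega>. conv G T A C (\<lambda>s. Y s \<omega>) t)"
    and "t \<in> {0..T} \<Longrightarrow> integrable \<Omega> (\<lambda>\<omega>. (norm (conv G T A C (\<lambda>s. Y s \<omega>) t))\<^sup>2)"
proof -
  have Ym: "(\<lambda>(t, \<omega>). Y t \<omega>) \<in> borel_measurable (lebT T \<Otimes>\<^sub>M \<Omega>)" using Y by (simp add: L2proc_def)
  have m: "(\<lambda>(t, \<omega>). conv G T A C (\<lambda>s. Y s \<omega>) t) \<in> borel_measurable (lebT T \<Otimes>\<^sub>M \<Omega>)"
    by (rule conv_process_measurable[OF Ym A])
  obtain \<kappa> where \<kappa>: "0 \<le> \<kappa>"
    "\<And>y t. y \<in> borel_measurable (lebT T) \<Longrightarrow> integrable (lebT T) (\<lambda>s. (norm (y s))\<^sup>2) \<Longrightarrow> t \<in> {0..T} \<Longrightarrow>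
      (norm (conv G T A C y t))\<^sup>2 \<le> \<kappa> * (\<integral>s. (norm (y s))\<^sup>2 \<partial>lebT T)"
    using conv_square_bound[OF T A, of G C] by blast
  have ae: "AE \<omega> in \<Omega>. \<forall>t\<in>{0..T}. (norm (conv G T A C (\<lambda>s. Y s \<omega>) t))\<^sup>2 \<le> \<kappa> * (\<integral>s. (norm (Y s \<omega>))\<^sup>2 \<partial>lebT T)"
    using L2proc_path(1)[OF Y] AE_space
    by eventually_elim (intro ballI \<kappa>(2) process_path_measurable[OF Ym])
  have i: "integrable \<Omega> (\<lambda>\<omega>. \<kappa> * (\<integral>s. (norm (Y s \<omega>))\<^sup>2 \<partial>lebT T))"
    by (intro integrable_mult_right L2proc_path(2)[OF Y])
  show "L2proc T (\<lambda>t \<omega>. conv G T A C (\<lambda>s. Y s \<omega>) t)"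
  proof (rule L2proc_bound[OF m random_integrable_time_prod[OF i]])
    show "AE z in lebT T \<Otimes>\<^sub>M \<Omega>. (norm (conv G T A C (\<lambda>s. Y s (snd z)) (fst z)))\<^sup>2
        \<le> \<kappa> * (\<integral>s. (norm (Y s (snd z)))\<^sup>2 \<partial>lebT T)"
      using AE_time_prod_snd[OF ae, of T] AE_space by eventually_elim (auto simp: space_pair_measure)
  qed
  show "integrable \<Omega> (\<lambda>\<omega>. (norm (conv G T A C (\<lambda>s. Y s \<omega>) t))\<^sup>2)" if t: "t \<in> {0..T}"
  proof (rule Bochner_Integration.integrable_bound[OF i])
    show "(\<lambda>\<omega>. (norm (conv G T A C (\<lambda>s. Y s \<omega>) t))\<^sup>2) \<in> borel_measurable \<Omega>"
      by (intro borel_measurable_power measurable_compose[OF process_section_measurable[OF m t] borel_measurable_norm])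
    show "AE \<omega> in \<Omega>. norm ((norm (conv G T A C (\<lambda>s. Y s \<omega>) t))\<^sup>2) \<le> norm (\<kappa> * (\<integral>s. (norm (Y s \<omega>))\<^sup>2 \<partial>lebT T))"
      using ae by eventually_elim (use t \<kappa>(1) in auto)
  qed
qed

lemma noise_path_process_measurable: "(\<lambda>(t, \<omega>). noise_path t \<omega>) \<in> borel_measurable (lebT T \<Otimes>\<^sub>M \<Omega>)"
  by (rule continuous_process_measurable) (auto intro: noise_path_measurable noise_path_continuous)

lemma L2proc_noise_path: "L2proc T noise_path"
  unfolding L2proc_def
proof (intro conjI noise_path_process_measurable)
  interpret pair_sigma_finite "lebT T" \<Omega> by (rule pair_sigma_finite_lebT)
  let ?\<Lambda> = "\<Sum>k\<in>UNIV. lam k * (norm (f k))\<^sup>2"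
  have m: "(\<lambda>(t, \<omega>). (norm (noise_path t \<omega>))\<^sup>2) \<in> borel_measurable (lebT T \<Otimes>\<^sub>M \<Omega>)"
    using borel_measurable_power[OF measurable_compose[OF noise_path_process_measurable borel_measurable_norm]]
    by (simp add: case_prod_beta')
  show "integrable (lebT T \<Otimes>\<^sub>M \<Omega>) (\<lambda>(t, \<omega>). (norm (noise_path t \<omega>))\<^sup>2)"
  proof (rule Fubini_integrable[OF m])
    have "integrable (lebT T) (\<lambda>t. ?\<Lambda> * t)" by (intro lebT_integral_continuous(1) continuous_intros)
    moreover have "(\<integral>\<omega>. norm (case (t, \<omega>) of (t, \<omega>) \<Rightarrow> (norm (noise_path t \<omega>))\<^sup>2) \<partial>\<Omega>) = ?\<Lambda> * t"
      if "t \<in> space (lebT T)" for t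
      using that has_bochner_integral_integral_eq[OF noise_path_moment[of t]] by simp
    ultimately show "integrable (lebT T) (\<lambda>t. \<integral>\<omega>. norm (case (t, \<omega>) of (t, \<omega>) \<Rightarrow> (norm (noise_path t \<omega>))\<^sup>2) \<partial>\<Omega>)"
      by (subst Bochner_Integration.integrable_cong[OF refl]) auto
    show "AE t in lebT T. integrable \<Omega> (\<lambda>\<omega>. case (t, \<omega>) of (t, \<omega>) \<Rightarrow> (norm (noise_path t \<omega>))\<^sup>2)"
      using integrable.intros[OF noise_path_moment] by (intro AE_I2) simp
  qed
qed

end

section \<open>The adjoint state and the first variation of the cost\<close>

lemma op_exp_shift_derivative:
  fixes G :: "'a::banach \<Rightarrow>\<^sub>L 'a"
  shows "((\<lambda>t. op_exp ((t - s) *\<^sub>R G)) has_vector_derivative (op_exp ((t - s) *\<^sub>R G) o\<^sub>L G)) (at t within S)"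
proof -
  have "((\<lambda>t. t - s) has_vector_derivative 1) (at t)" by (auto intro!: derivative_eq_intros)
  from vector_diff_chain_at[OF this op_exp_has_vector_derivative]
  have "((\<lambda>t. op_exp ((t - s) *\<^sub>R G)) has_vector_derivative (op_exp ((t - s) *\<^sub>R G) o\<^sub>L G)) (at t)"
    by (simp add: o_def op_exp_commute)
  then show ?thesis by (rule has_vector_derivative_at_within)
qed

text \<open>The assumptions on \<open>X\<close> are the properties of the process that solves the closed-loop equation.\<close>

locale lq_state = lq_setting \<Omega> W f lam w T r G H CM CR CMT x0 K \<P>
  for \<Omega> :: "'w measure" and W :: "'n::finite \<Rightarrow> real \<Rightarrow> 'w \<Rightarrow> real" and f lam w T r G H CM CR CMT x0 K \<P> +
  fixes X :: "real \<Rightarrow> 'w \<Rightarrow> L2_01" and c :: real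
  assumes X_adapted: "\<And>t. t \<in> {0..T} \<Longrightarrow> X t \<in> borel_measurable (natural_filtration \<Omega> w t)"
    and X_0: "\<And>\<omega>. \<omega> \<in> space \<Omega> \<Longrightarrow> X 0 \<omega> = x0"
    and X_continuous: "\<And>\<omega>. \<omega> \<in> space \<Omega> \<Longrightarrow> continuous_on {0..T} (\<lambda>t. X t \<omega>)"
    and X_derivative: "\<And>t \<omega>. \<omega> \<in> space \<Omega> \<Longrightarrow> t \<in> {0..T} \<Longrightarrow>
      ((\<lambda>t. X t \<omega> - noise_path t \<omega>) has_vector_derivative drift t (X t \<omega>)) (at t within {0..T})"
    and X_bound: "0 \<le> c" "\<And>t \<omega>. t \<in> {0..T} \<Longrightarrow> \<omega> \<in> space \<Omega> \<Longrightarrow>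
      (norm (X t \<omega>))\<^sup>2 \<le> c * (1 + (norm (noise_path t \<omega>))\<^sup>2 + (\<integral>s. (norm (noise_path s \<omega>))\<^sup>2 \<partial>lebT T))"
begin

lemma T0: "0 \<le> T" using T by simp

lemma X_measurable: "t \<in> {0..T} \<Longrightarrow> X t \<in> borel_measurable \<Omega>"
  by (rule measurable_from_subalg[OF natural_filtration_subalgebra X_adapted])

lemma X_process_measurable: "(\<lambda>(t, \<omega>). X t \<omega>) \<in> borel_measurable (lebT T \<Otimes>\<^sub>M \<Omega>)"
  by (rule continuous_process_measurable[OF X_measurable X_continuous])

lemma L2proc_X: "L2proc T X"
proof (rule L2proc_bound[OF X_process_measurable])
  let ?h = "\<lambda>z. c * (1 + (norm (noise_path (fst z) (snd z)))\<^sup>2 + (\<integral>s. (norm (noise_path s (snd z)))\<^sup>2 \<partial>lebT T))"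
  have n: "integrable (lebT T \<Otimes>\<^sub>M \<Omega>) (\<lambda>z. (norm (noise_path (fst z) (snd z)))\<^sup>2)"
    using L2proc_noise_path[of T] by (simp add: L2proc_def case_prod_beta')
  show "integrable (lebT T \<Otimes>\<^sub>M \<Omega>) ?h"
    by (intro integrable_mult_right Bochner_Integration.integrable_add n
        random_integrable_time_prod[OF L2proc_path(2)[OF L2proc_noise_path]]
        random_integrable_time_prod[of "\<lambda>_. 1"]) simp
  show "AE z in lebT T \<Otimes>\<^sub>M \<Omega>. (norm (X (fst z) (snd z)))\<^sup>2 \<le> ?h z"
    by (intro AE_I2 X_bound) (auto simp: space_pair_measure)
qed

lemma X_square_integrable:
  assumes t: "t \<in> {0..T}"
  shows "integrable \<Omega> (\<lambda>\<omega>. (norm (X t \<omega>))\<^sup>2)"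
proof (rule Bochner_Integration.integrable_bound)
  show "integrable \<Omega> (\<lambda>\<omega>. c * (1 + (norm (noise_path t \<omega>))\<^sup>2 + (\<integral>s. (norm (noise_path s \<omega>))\<^sup>2 \<partial>lebT T)))"
    using t by (intro integrable_mult_right Bochner_Integration.integrable_add
        integrable.intros[OF noise_path_moment] L2proc_path(2)[OF L2proc_noise_path]) auto
  show "(\<lambda>\<omega>. (norm (X t \<omega>))\<^sup>2) \<in> borel_measurable \<Omega>"
    by (intro borel_measurable_power measurable_compose[OF X_measurable[OF t] borel_measurable_norm])
  show "AE \<omega> in \<Omega>. norm ((norm (X t \<omega>))\<^sup>2)
      \<le> norm (c * (1 + (norm (noise_path t \<omega>))\<^sup>2 + (\<integral>s. (norm (noise_path s \<omega>))\<^sup>2 \<partial>lebT T)))"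
    using order_trans[OF X_bound(2)[OF t] abs_ge_self] by (intro AE_I2) simp
qed

definition ctrl :: "real \<Rightarrow> 'w \<Rightarrow> L2_01" where "ctrl t \<omega> = K t (X t \<omega>)"

lemma ctrl_continuous: "\<omega> \<in> space \<Omega> \<Longrightarrow> continuous_on {0..T} (\<lambda>t. ctrl t \<omega>)"
  unfolding ctrl_def by (intro blinfun_apply_continuous_on K_continuous X_continuous)

lemma ctrl_adapted: "t \<in> {0..T} \<Longrightarrow> ctrl t \<in> borel_measurable (natural_filtration \<Omega> w t)"
  unfolding ctrl_def[abs_def] by (rule blinfun_measurable[OF X_adapted])

lemma ctrl_process_measurable: "(\<lambda>(t, \<omega>). ctrl t \<omega>) \<in> borel_measurable (lebT T \<Otimes>\<^sub>M \<Omega>)"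
  by (rule continuous_process_measurable[OF measurable_from_subalg[OF natural_filtration_subalgebra ctrl_adapted] ctrl_continuous])

lemma L2proc_ctrl: "L2proc T ctrl"
proof -
  obtain k where k: "0 < k" "\<And>t. t \<in> {0..T} \<Longrightarrow> norm (K t) \<le> k"
    using continuous_bounded_Icc[OF K_continuous] by blast
  show ?thesis
  proof (rule L2proc_bound[OF ctrl_process_measurable])
    show "integrable (lebT T \<Otimes>\<^sub>M \<Omega>) (\<lambda>z. k\<^sup>2 * (norm (X (fst z) (snd z)))\<^sup>2)"
      using L2proc_X by (intro integrable_mult_right) (simp add: L2proc_def case_prod_beta')
    have "(norm (ctrl t \<omega>))\<^sup>2 \<le> k\<^sup>2 * (norm (X t \<omega>))\<^sup>2" if "t \<in> {0..T}" for t \<omega>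
    proof -
      have "norm (ctrl t \<omega>) \<le> k * norm (X t \<omega>)"
        unfolding ctrl_def by (rule order_trans[OF norm_blinfun mult_right_mono[OF k(2)[OF that]]]) simp
      from power_mono[OF this, of 2] show ?thesis by (simp add: power_mult_distrib)
    qed
    then show "AE z in lebT T \<Otimes>\<^sub>M \<Omega>. (norm (ctrl (fst z) (snd z)))\<^sup>2 \<le> k\<^sup>2 * (norm (X (fst z) (snd z)))\<^sup>2"
      by (intro AE_I2) (auto simp: space_pair_measure)
  qed
qed

text \<open>Differentiating $e^{(t-s)G} (X_s - w_s)$ with respect to $s$ turns the differential equation into the integral equation.\<close>

lemma X_mild:
  assumes t: "t \<in> {0..T}" and \<omega>: "\<omega> \<in> space \<Omega>"
  shows "X t \<omega> = op_exp (t *\<^sub>R G) x0 + conv G T causal H (\<lambda>s. ctrl s \<omega>) t + noise_conv G t \<omega>"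
proof -
  let ?e = "\<lambda>s. op_exp ((t - s) *\<^sub>R G)"
  let ?z = "\<lambda>s. X s \<omega> - noise_path s \<omega>"
  have sub: "{0..t} \<subseteq> {0..T}" using t by auto
  have c1: "continuous_on {0..t} (\<lambda>s. ?e s (G (noise_path s \<omega>)))"
    by (intro blinfun_apply_continuous_on op_exp_reverse_continuous_on continuous_on_const noise_path_continuous \<omega>)
  have c2: "continuous_on {0..t} (\<lambda>s. ?e s (H (ctrl s \<omega>)))"
    by (intro blinfun_apply_continuous_on op_exp_reverse_continuous_on continuous_on_const
        continuous_on_subset[OF ctrl_continuous[OF \<omega>] sub])
  have "((\<lambda>s. ?e s (?z s)) has_vector_derivative ?e s (G (noise_path s \<omega>)) + ?e s (H (ctrl s \<omega>))) (at s within {0..t})"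
    if s: "s \<in> {0..t}" for s
  proof -
    have "(?z has_vector_derivative drift s (X s \<omega>)) (at s within {0..t})"
      using s sub by (intro has_vector_derivative_within_subset[OF X_derivative[OF \<omega>] sub]) auto
    from has_vector_derivative_blinfun_apply[OF op_exp_reverse_derivative this]
    have "((\<lambda>s. ?e s (?z s)) has_vector_derivative ?e s (drift s (X s \<omega>)) + (- (?e s o\<^sub>L G)) (?z s)) (at s within {0..t})" .
    moreover have "?e s (drift s (X s \<omega>)) + (- (?e s o\<^sub>L G)) (?z s) = ?e s (G (noise_path s \<omega>)) + ?e s (H (ctrl s \<omega>))"
      by (simp add: drift_def ctrl_def blinfun.add_left blinfun.minus_left blinfun.add_right blinfun.diff_right)
    ultimately show ?thesis by simp
  qed
  then have "((\<lambda>s. ?e s (G (noise_path s \<omega>)) + ?e s (H (ctrl s \<omega>))) has_integral ?e t (?z t) - ?e 0 (?z 0)) {0..t}"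
    using t by (intro fundamental_theorem_of_calculus) auto
  from integral_unique[OF this]
  have "integral {0..t} (\<lambda>s. ?e s (G (noise_path s \<omega>))) + integral {0..t} (\<lambda>s. ?e s (H (ctrl s \<omega>))) = ?e t (?z t) - ?e 0 (?z 0)"
    by (subst (asm) Henstock_Kurzweil_Integration.integral_add[OF integrable_continuous_interval[OF c1] integrable_continuous_interval[OF c2]])
  then have "integral {0..t} (\<lambda>s. ?e s (G (noise_path s \<omega>))) + integral {0..t} (\<lambda>s. ?e s (H (ctrl s \<omega>))) = X t \<omega> - noise_path t \<omega> - op_exp (t *\<^sub>R G) x0"
    by (simp add: X_0[OF \<omega>] noise_path_def op_exp_0[of G, simplified])
  moreover have "conv G T causal H (\<lambda>s. ctrl s \<omega>) t = integral {0..t} (\<lambda>s. ?e s (H (ctrl s \<omega>)))"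
    using t conv_causal[of t T G H "\<lambda>s. ctrl s \<omega>"] lebT_integral_continuous(2)[OF c2] by simp
  moreover have "noise_conv G t \<omega> = noise_path t \<omega> + integral {0..t} (\<lambda>s. ?e s (G (noise_path s \<omega>)))"
    unfolding noise_conv_def lebT_integral_continuous(2)[OF c1] ..
  ultimately show ?thesis by (simp add: algebra_simps)
qed

text \<open>The gap between the adjoint state of the closed loop and its feedback form \<open>\<P>\<^sub>s x\<^sub>s\<close>.\<close>

definition adjoint_gap :: "real \<Rightarrow> 'w \<Rightarrow> L2_01" where
  "adjoint_gap s \<omega> = conv G T anticausal CM (\<lambda>t. X t \<omega>) s + op_exp ((T - s) *\<^sub>R G) (CMT (X T \<omega>)) - \<P> s (X s \<omega>)"

text \<open>The coefficient of the noise increment at time \<open>t\<close> in the adjoint gap.\<close>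

definition gap_kernel :: "real \<Rightarrow> L2_01 \<Rightarrow>\<^sub>L L2_01" where
  "gap_kernel t = (\<P> t o\<^sub>L drift t) + CM"

lemma \<P>_continuous: "continuous_on {0..T} \<P>"
  unfolding continuous_on_eq_continuous_within using \<P>_derivative has_vector_derivative_continuous by blast

lemma gap_kernel_continuous: "continuous_on {0..T} gap_kernel"
  unfolding gap_kernel_def[abs_def]
  by (intro continuous_on_add continuous_on_const bounded_bilinear.continuous_on[OF bounded_bilinear_blinfun_compose]
      \<P>_continuous drift_continuous)

lemma op_exp_shift_continuous: "continuous_on S (\<lambda>t. op_exp ((t - s) *\<^sub>R G))"
  by (intro continuous_on_compose2[OF op_exp_continuous_on[of UNIV G]] continuous_intros) auto

text \<open>In $y_t = X_t - w_t + w_s$ the noise is frozen at time \<open>s\<close>, so $y$ is differentiable and agrees with $X$ at time \<open>s\<close>.  By the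
  Riccati equation all terms in $e^{(t-s)G} P_t y_t$ cancel under differentiation, except for $- e^{(t-s)G} C_M X_t$,
  which together with the terminal value gives the adjoint state, and terms in $w_t - w_s$.\<close>

lemma adjoint_gap_eq:
  assumes s: "s \<in> {0..T}" and \<omega>: "\<omega> \<in> space \<Omega>"
  shows "adjoint_gap s \<omega> = op_exp ((T - s) *\<^sub>R G) (CMT (noise_path T \<omega> - noise_path s \<omega>))
    + integral {s..T} (\<lambda>t. op_exp ((t - s) *\<^sub>R G) (gap_kernel t (noise_path t \<omega> - noise_path s \<omega>)))"
proof -
  let ?e = "\<lambda>t. op_exp ((t - s) *\<^sub>R G)"
  let ?v = "\<lambda>t. noise_path t \<omega>"
  let ?y = "\<lambda>t. X t \<omega> - ?v t + ?v s"
  have sub: "{s..T} \<subseteq> {0..T}" using s by auto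
  have c1: "continuous_on {s..T} (\<lambda>t. ?e t (CM (X t \<omega>)))"
    by (intro blinfun_apply_continuous_on op_exp_shift_continuous continuous_on_const
        continuous_on_subset[OF X_continuous[OF \<omega>] sub])
  have c2: "continuous_on {s..T} (\<lambda>t. ?e t (gap_kernel t (?v t - ?v s)))"
    by (intro blinfun_apply_continuous_on op_exp_shift_continuous continuous_on_subset[OF gap_kernel_continuous sub]
        continuous_on_diff continuous_on_const continuous_on_subset[OF noise_path_continuous[OF \<omega>, of T] sub])
  have der: "((\<lambda>t. ?e t (\<P> t (?y t))) has_vector_derivative
      ?e t (gap_kernel t (?v t - ?v s)) - ?e t (CM (X t \<omega>))) (at t within {s..T})"
    if t: "t \<in> {s..T}" for t
  proof -
    have t': "t \<in> {0..T}" using t sub by blast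
    have "((\<lambda>t. X t \<omega> - ?v t + ?v s) has_vector_derivative drift t (X t \<omega>) + 0) (at t within {s..T})"
      by (intro has_vector_derivative_add has_vector_derivative_const
          has_vector_derivative_within_subset[OF X_derivative[OF \<omega> t'] sub])
    then have y: "(?y has_vector_derivative drift t (X t \<omega>)) (at t within {s..T})" by simp
    note e = op_exp_shift_derivative[of s G t "{s..T}"]
    let ?P' = "- ((G o\<^sub>L \<P> t) + (\<P> t o\<^sub>L drift t) + CM)"
    have P: "(\<P> has_vector_derivative ?P') (at t within {s..T})"
      using has_vector_derivative_within_subset[OF \<P>_derivative[OF t'] sub] by (simp add: drift_def)
    from has_vector_derivative_blinfun_apply[OF e has_vector_derivative_blinfun_apply[OF P y]]
    have "((\<lambda>t. ?e t (\<P> t (?y t))) has_vector_derivative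
      ?e t (\<P> t (drift t (X t \<omega>)) + ?P' (?y t)) + (?e t o\<^sub>L G) (\<P> t (?y t))) (at t within {s..T})" .
    moreover have "?e t (\<P> t (drift t (X t \<omega>)) + ?P' (?y t)) + (?e t o\<^sub>L G) (\<P> t (?y t))
        = ?e t (gap_kernel t (?v t - ?v s)) - ?e t (CM (X t \<omega>))"
      by (simp add: gap_kernel_def blinfun.add_left blinfun.minus_left blinfun.diff_left blinfun.add_right
          blinfun.diff_right blinfun.minus_right algebra_simps)
    ultimately show ?thesis by simp
  qed
  have "((\<lambda>t. ?e t (gap_kernel t (?v t - ?v s)) - ?e t (CM (X t \<omega>))) has_integral ?e T (\<P> T (?y T)) - ?e s (\<P> s (?y s))) {s..T}"
    using s by (intro fundamental_theorem_of_calculus der) auto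
  from integral_unique[OF this]
  have "integral {s..T} (\<lambda>t. ?e t (gap_kernel t (?v t - ?v s))) - integral {s..T} (\<lambda>t. ?e t (CM (X t \<omega>)))
      = ?e T (\<P> T (?y T)) - ?e s (\<P> s (?y s))"
    by (subst (asm) Henstock_Kurzweil_Integration.integral_diff[OF integrable_continuous_interval[OF c2] integrable_continuous_interval[OF c1]])
  moreover have "conv G T anticausal CM (\<lambda>t. X t \<omega>) s = integral {s..T} (\<lambda>t. ?e t (CM (X t \<omega>)))"
    using s by (intro conv_anticausal X_continuous \<omega>) auto
  ultimately show ?thesis
    by (simp add: adjoint_gap_def \<P>_T op_exp_0[of G, simplified] blinfun.diff_right blinfun.add_right algebra_simps)
qed

text \<open>By the preceding formula the gap depends linearly on the noise increments after \<open>s\<close>, each of which is orthogonal to \<open>h\<close>; Fubini exchanges expectation and time integral.\<close>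

lemma adjoint_gap_orthogonal:
  assumes s: "s \<in> {0..T}" and h: "h \<in> borel_measurable (natural_filtration \<Omega> w s)"
    and sq: "integrable \<Omega> (\<lambda>\<omega>. (norm (h \<omega>))\<^sup>2)"
  shows "(\<integral>\<omega>. h \<omega> \<bullet> adjoint_gap s \<omega> \<partial>\<Omega>) = 0"
proof -
  let ?e = "\<lambda>t. op_exp ((t - s) *\<^sub>R G)"
  let ?\<Gamma> = "\<lambda>t \<omega>. ?e t (gap_kernel t (noise_path t \<omega> - noise_path s \<omega>))"
  interpret pair_sigma_finite "lebT T" \<Omega> by (rule pair_sigma_finite_lebT)
  have h\<Omega>: "h \<in> borel_measurable \<Omega>" by (rule measurable_from_subalg[OF natural_filtration_subalgebra h])
  have orth: "integrable \<Omega> (\<lambda>\<omega>. h \<omega> \<bullet> blinfun_apply C (noise_path t \<omega> - noise_path s \<omega>))"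
    "(\<integral>\<omega>. h \<omega> \<bullet> blinfun_apply C (noise_path t \<omega> - noise_path s \<omega>) \<partial>\<Omega>) = 0" if "s \<le> t" for C t
    using noise_increment_orthogonal[OF _ that h sq, of C] s by (simp_all add: noise_path_def)
  \<comment> \<open>freezing the time before \<open>s\<close> extends the integrand to all of \<open>[0,T]\<close> by zero\<close>
  define k where "k t \<omega> = h \<omega> \<bullet> ?\<Gamma> (max s t) \<omega>" for t \<omega>
  have comb: "?\<Gamma> t \<omega> = (?e t o\<^sub>L gap_kernel t) (noise_path t \<omega> - noise_path s \<omega>)" for t \<omega> by simp
  have \<Gamma>_cont: "continuous_on {0..T} (\<lambda>t. ?\<Gamma> (max s t) \<omega>)" if \<omega>: "\<omega> \<in> space \<Omega>" for \<omega>
  proof -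
    have m: "continuous_on {0..T} (\<lambda>t. max s t)" by (intro continuous_intros)
    have im: "(\<lambda>t. max s t) ` {0..T} \<subseteq> {0..T}" using s by auto
    have c: "continuous_on {0..T} (\<lambda>t. ?\<Gamma> t \<omega>)"
      by (intro blinfun_apply_continuous_on op_exp_shift_continuous gap_kernel_continuous
          continuous_on_diff continuous_on_const noise_path_continuous[OF \<omega>])
    show ?thesis by (rule continuous_on_compose2[OF c m im])
  qed
  have km: "(\<lambda>(t, \<omega>). k t \<omega>) \<in> borel_measurable (lebT T \<Otimes>\<^sub>M \<Omega>)"
  proof (rule continuous_process_measurable)
    fix t assume t: "t \<in> {0..T}"
    show "k t \<in> borel_measurable \<Omega>"
      unfolding k_def[abs_def] using s t
      by (intro borel_measurable_inner h\<Omega> blinfun_measurable borel_measurable_diff noise_path_measurable) auto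
  next
    fix \<omega> assume "\<omega> \<in> space \<Omega>"
    then show "continuous_on {0..T} (\<lambda>t. k t \<omega>)"
      unfolding k_def by (intro continuous_on_inner continuous_on_const \<Gamma>_cont)
  qed
  have "continuous_on {0..T} (\<lambda>t. ?e t o\<^sub>L gap_kernel t)"
    by (intro bounded_bilinear.continuous_on[OF bounded_bilinear_blinfun_compose] op_exp_shift_continuous gap_kernel_continuous)
  then obtain b where b: "0 < b" "\<And>t. t \<in> {0..T} \<Longrightarrow> norm (?e t o\<^sub>L gap_kernel t) \<le> b"
    using continuous_bounded_Icc by blast
  have kz: "(\<integral>\<omega>. k t \<omega> \<partial>\<Omega>) = 0" "integrable \<Omega> (k t)" if t: "t \<in> {0..T}" for t
    using orth[of "max s t" "?e (max s t) o\<^sub>L gap_kernel (max s t)"] by (simp_all add: k_def[abs_def])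
  have ki: "integrable (lebT T \<Otimes>\<^sub>M \<Omega>) (\<lambda>(t, \<omega>). k t \<omega>)"
  proof (rule Bochner_Integration.integrable_bound[OF _ km])
    let ?q = "\<lambda>z. (norm (h (snd z)))\<^sup>2 + b\<^sup>2 * (2 * (norm (noise_path (fst z) (snd z)))\<^sup>2 + 2 * (norm (noise_path s (snd z)))\<^sup>2)"
    have n: "integrable (lebT T \<Otimes>\<^sub>M \<Omega>) (\<lambda>z. (norm (noise_path (fst z) (snd z)))\<^sup>2)"
      using L2proc_noise_path[of T] by (simp add: L2proc_def case_prod_beta')
    show "integrable (lebT T \<Otimes>\<^sub>M \<Omega>) ?q"
      using s by (intro Bochner_Integration.integrable_add integrable_mult_right n random_integrable_time_prod[OF sq]
          random_integrable_time_prod[OF integrable.intros[OF noise_path_moment]]) auto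
    have "norm (k t \<omega>) \<le> ?q (t, \<omega>)" if t: "t \<in> {0..T}" for t \<omega>
    proof (cases "s \<le> t")
      case True
      let ?x = "noise_path t \<omega> - noise_path s \<omega>"
      have "norm (?\<Gamma> t \<omega>) \<le> b * norm ?x"
        unfolding comb by (rule order_trans[OF norm_blinfun mult_right_mono[OF b(2)[OF t]]]) simp
      then have "(norm (?\<Gamma> t \<omega>))\<^sup>2 \<le> (b * norm ?x)\<^sup>2" by (rule power_mono[OF _ norm_ge_zero])
      then have g: "(norm (?\<Gamma> t \<omega>))\<^sup>2 \<le> b\<^sup>2 * (norm ?x)\<^sup>2" by (simp only: power_mult_distrib)
      have "\<bar>h \<omega> \<bullet> ?\<Gamma> t \<omega>\<bar> \<le> norm (h \<omega>) * norm (?\<Gamma> t \<omega>)" by (rule Cauchy_Schwarz_ineq2)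
      also have "\<dots> \<le> (norm (h \<omega>))\<^sup>2 + (norm (?\<Gamma> t \<omega>))\<^sup>2"
        using abs_mult_le_squares[of "norm (h \<omega>)" "norm (?\<Gamma> t \<omega>)"] by simp
      also have "\<dots> \<le> (norm (h \<omega>))\<^sup>2 + b\<^sup>2 * (norm ?x)\<^sup>2" using g by simp
      also have "\<dots> \<le> (norm (h \<omega>))\<^sup>2 + b\<^sup>2 * (2 * (norm (noise_path t \<omega>))\<^sup>2 + 2 * (norm (noise_path s \<omega>))\<^sup>2)"
        using norm_diff_square_triangle[of "noise_path t \<omega>" "noise_path s \<omega>" 0] by (intro add_left_mono mult_left_mono) auto
      finally show ?thesis using True by (simp add: k_def max_def)
    next
      case False
      then have "k t \<omega> = 0" by (simp add: k_def max_def)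
      then show ?thesis by simp
    qed
    then show "AE z in lebT T \<Otimes>\<^sub>M \<Omega>. norm (case z of (t, \<omega>) \<Rightarrow> k t \<omega>) \<le> norm (?q z)"
      by (intro AE_I2) (auto simp: space_pair_measure intro: order_trans[OF _ abs_ge_self])
  qed
  have gap: "h \<omega> \<bullet> adjoint_gap s \<omega> = h \<omega> \<bullet> blinfun_apply (?e T o\<^sub>L CMT) (noise_path T \<omega> - noise_path s \<omega>) + (\<integral>t. k t \<omega> \<partial>lebT T)"
    if \<omega>: "\<omega> \<in> space \<Omega>" for \<omega>
  proof -
    have i: "(\<lambda>t. ?\<Gamma> (max s t) \<omega>) integrable_on {0..T}" by (rule integrable_continuous_interval[OF \<Gamma>_cont[OF \<omega>]])
    have "(\<integral>t. k t \<omega> \<partial>lebT T) = h \<omega> \<bullet> (\<integral>t. ?\<Gamma> (max s t) \<omega> \<partial>lebT T)"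
      unfolding k_def by (rule integral_inner_right[OF lebT_integral_continuous(1)[OF \<Gamma>_cont[OF \<omega>]]])
    also have "(\<integral>t. ?\<Gamma> (max s t) \<omega> \<partial>lebT T) = integral {0..T} (\<lambda>t. ?\<Gamma> (max s t) \<omega>)"
      by (rule lebT_integral_continuous(2)[OF \<Gamma>_cont[OF \<omega>]])
    also have "\<dots> = integral {0..s} (\<lambda>t. ?\<Gamma> (max s t) \<omega>) + integral {s..T} (\<lambda>t. ?\<Gamma> (max s t) \<omega>)"
      using s by (intro Henstock_Kurzweil_Integration.integral_combine[symmetric] i) auto
    also have "integral {0..s} (\<lambda>t. ?\<Gamma> (max s t) \<omega>) = integral {0..s} (\<lambda>t. 0)"
      by (intro Henstock_Kurzweil_Integration.integral_cong) (simp add: max_absorb1)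
    also have "integral {s..T} (\<lambda>t. ?\<Gamma> (max s t) \<omega>) = integral {s..T} (\<lambda>t. ?\<Gamma> t \<omega>)"
      by (intro Henstock_Kurzweil_Integration.integral_cong) (simp add: max_def)
    finally have "(\<integral>t. k t \<omega> \<partial>lebT T) = h \<omega> \<bullet> integral {s..T} (\<lambda>t. ?\<Gamma> t \<omega>)" by simp
    then show ?thesis by (simp add: adjoint_gap_eq[OF s \<omega>] inner_add_right)
  qed
  have "(\<integral>\<omega>. h \<omega> \<bullet> adjoint_gap s \<omega> \<partial>\<Omega>)
      = (\<integral>\<omega>. h \<omega> \<bullet> blinfun_apply (?e T o\<^sub>L CMT) (noise_path T \<omega> - noise_path s \<omega>) + (\<integral>t. k t \<omega> \<partial>lebT T) \<partial>\<Omega>)"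
    by (rule Bochner_Integration.integral_cong[OF refl gap])
  also have "\<dots> = (\<integral>\<omega>. h \<omega> \<bullet> blinfun_apply (?e T o\<^sub>L CMT) (noise_path T \<omega> - noise_path s \<omega>) \<partial>\<Omega>) + (\<integral>\<omega>. \<integral>t. k t \<omega> \<partial>lebT T \<partial>\<Omega>)"
    using s by (intro Bochner_Integration.integral_add orth integrable_snd[OF ki]) auto
  also have "(\<integral>\<omega>. \<integral>t. k t \<omega> \<partial>lebT T \<partial>\<Omega>) = (\<integral>t. \<integral>\<omega>. k t \<omega> \<partial>\<Omega> \<partial>lebT T)"
    by (rule Fubini_integral[OF ki])
  also have "\<dots> = (\<integral>t. 0 \<partial>lebT T)" by (intro Bochner_Integration.integral_cong refl kz) simp
  finally show ?thesis using orth(2)[of T "?e T o\<^sub>L CMT"] s by simp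
qed

lemma L2proc_operator:
  assumes B: "continuous_on {0..T} B" and Y: "L2proc T Y"
    and m: "(\<lambda>(t, \<omega>). blinfun_apply (B t) (Y t \<omega>)) \<in> borel_measurable (lebT T \<Otimes>\<^sub>M \<Omega>)"
  shows "L2proc T (\<lambda>t \<omega>. blinfun_apply (B t) (Y t \<omega>))"
proof -
  obtain b where b: "0 < b" "\<And>t. t \<in> {0..T} \<Longrightarrow> norm (B t) \<le> b"
    using continuous_bounded_Icc[OF B] by blast
  show ?thesis
  proof (rule L2proc_bound[OF m])
  show "integrable (lebT T \<Otimes>\<^sub>M \<Omega>) (\<lambda>z. b\<^sup>2 * (norm (Y (fst z) (snd z)))\<^sup>2)"
    using Y by (intro integrable_mult_right) (simp add: L2proc_def case_prod_beta')
  have "(norm (B t v))\<^sup>2 \<le> b\<^sup>2 * (norm v)\<^sup>2" if "t \<in> {0..T}" for t v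
  proof -
    have "norm (B t v) \<le> b * norm v"
      by (rule order_trans[OF norm_blinfun mult_right_mono[OF b(2)[OF that]]]) simp
    from power_mono[OF this, of 2] show ?thesis by (simp add: power_mult_distrib)
  qed
  then show "AE z in lebT T \<Otimes>\<^sub>M \<Omega>. (norm (B (fst z) (Y (fst z) (snd z))))\<^sup>2 \<le> b\<^sup>2 * (norm (Y (fst z) (snd z)))\<^sup>2"
    by (intro AE_I2) (auto simp: space_pair_measure)
  qed
qed

lemma L2proc_final_state: "L2proc T (\<lambda>s \<omega>. op_exp ((T - s) *\<^sub>R G) (CMT (X T \<omega>)))"
proof (rule L2proc_operator[OF op_exp_reverse_continuous_on L2proc_blinfun])
  have XT: "X T \<in> borel_measurable \<Omega>" using T0 by (intro X_measurable) auto
  have m: "(\<lambda>(t, \<omega>). X T \<omega>) \<in> borel_measurable (lebT T \<Otimes>\<^sub>M \<Omega>)"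
    using measurable_compose[OF measurable_snd XT] by (simp add: case_prod_beta')
  show "L2proc T (\<lambda>s. X T)"
    using m random_integrable_time_prod[OF X_square_integrable[of T], of T] T0
    by (simp add: L2proc_def case_prod_beta')
  show "(\<lambda>(t, \<omega>). op_exp ((T - t) *\<^sub>R G) (CMT (X T \<omega>))) \<in> borel_measurable (lebT T \<Otimes>\<^sub>M \<Omega>)"
    by (rule continuous_process_measurable)
      (auto intro!: blinfun_measurable XT blinfun_apply_continuous_on op_exp_reverse_continuous_on continuous_on_const)
qed

lemma L2proc_P_state: "L2proc T (\<lambda>s \<omega>. \<P> s (X s \<omega>))"
  by (rule L2proc_operator[OF \<P>_continuous L2proc_X], rule continuous_process_measurable)
    (auto intro!: blinfun_measurable X_measurable blinfun_apply_continuous_on \<P>_continuous X_continuous)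

lemma L2proc_adjoint_gap: "L2proc T adjoint_gap"
  unfolding adjoint_gap_def[abs_def]
  by (intro L2proc_diff L2proc_add L2proc_conv(1)[OF T0 causal_measurable(2) L2proc_X] L2proc_final_state L2proc_P_state)

text \<open>This is the first variation of the cost in the direction \<open>\<eta>\<close>.  Duality of the convolutions rewrites all three
  terms as integrals of \<open>\<eta>\<close> against functionals of the closed loop; with the feedback condition their sum is the
  inner product of \<open>H \<eta>\<close> with the adjoint gap.\<close>

lemma cross_term_zero:
  assumes \<eta>: "L2proc T \<eta>" and ad: "\<And>t. t \<in> {0..T} \<Longrightarrow> \<eta> t \<in> borel_measurable (natural_filtration \<Omega> w t)"
  defines "\<delta> \<equiv> \<lambda>t \<omega>. conv G T causal H (\<lambda>s. \<eta> s \<omega>) t"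
  shows "(\<integral>z. \<delta> (fst z) (snd z) \<bullet> CM (X (fst z) (snd z)) \<partial>(lebT T \<Otimes>\<^sub>M \<Omega>))
    + (\<integral>z. \<eta> (fst z) (snd z) \<bullet> CR (ctrl (fst z) (snd z)) \<partial>(lebT T \<Otimes>\<^sub>M \<Omega>))
    + (\<integral>\<omega>. \<delta> T \<omega> \<bullet> CMT (X T \<omega>) \<partial>\<Omega>) = 0"
proof -
  interpret PT: pair_sigma_finite "lebT T" \<Omega> by (rule pair_sigma_finite_lebT)
  let ?\<mu> = "lebT T \<Otimes>\<^sub>M \<Omega>"
  have \<eta>m: "(\<lambda>(t, \<omega>). \<eta> t \<omega>) \<in> borel_measurable ?\<mu>" using \<eta> by (simp add: L2proc_def)
  have \<delta>: "L2proc T \<delta>" unfolding \<delta>_def by (rule L2proc_conv(1)[OF T0 causal_measurable(1) \<eta>])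
  define Y1 where "Y1 s \<omega> = H (conv G T anticausal CM (\<lambda>t. X t \<omega>) s)" for s \<omega>
  define Y2 where "Y2 s \<omega> = H (op_exp ((T - s) *\<^sub>R G) (CMT (X T \<omega>)))" for s \<omega>
  define Y3 where "Y3 s \<omega> = CR (ctrl s \<omega>)" for s \<omega>
  have Y1: "L2proc T Y1" and Y2: "L2proc T Y2" and Y3: "L2proc T Y3"
    unfolding Y1_def[abs_def] Y2_def[abs_def] Y3_def[abs_def]
    by (intro L2proc_blinfun L2proc_conv(1)[OF T0 causal_measurable(2) L2proc_X] L2proc_final_state L2proc_ctrl)+
  have prod: "integrable ?\<mu> (\<lambda>(t, \<omega>). Y t \<omega> \<bullet> Z t \<omega>)" "integrable ?\<mu> (\<lambda>z. Y (fst z) (snd z) \<bullet> Z (fst z) (snd z))"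
    if "L2proc T Y" "L2proc T Z" for Y Z
    using L2proc_inner[OF that] by (simp_all add: case_prod_beta')
  have snd: "(\<integral>z. Y (fst z) (snd z) \<bullet> Z (fst z) (snd z) \<partial>?\<mu>) = (\<integral>\<omega>. \<integral>t. Y t \<omega> \<bullet> Z t \<omega> \<partial>lebT T \<partial>\<Omega>)"
    if "L2proc T Y" "L2proc T Z" for Y Z
    using PT.integral_snd[OF prod(1)[OF that]] by (simp add: case_prod_beta')
  have fst: "(\<integral>z. Y (fst z) (snd z) \<bullet> Z (fst z) (snd z) \<partial>?\<mu>) = (\<integral>t. \<integral>\<omega>. Y t \<omega> \<bullet> Z t \<omega> \<partial>\<Omega> \<partial>lebT T)"
    if "L2proc T Y" "L2proc T Z" for Y Z
    using PT.integral_fst[OF prod(1)[OF that]] by (simp add: case_prod_beta')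
  have Xpath: "(\<lambda>t. X t \<omega>) \<in> borel_measurable (lebT T)" "integrable (lebT T) (\<lambda>t. (norm (X t \<omega>))\<^sup>2)" if "\<omega> \<in> space \<Omega>" for \<omega>
    using process_path_measurable[OF X_process_measurable that]
      lebT_integral_continuous(1)[OF continuous_on_power[OF continuous_on_norm[OF X_continuous[OF that]]]] by auto
  have anti: "{(s, t). (t, s) \<in> causal} = anticausal" by (auto simp: causal_def anticausal_def)
  have sec: "(\<lambda>\<omega>. \<integral>t. Y t \<omega> \<bullet> Z t \<omega> \<partial>lebT T) \<in> borel_measurable \<Omega>" if "L2proc T Y" "L2proc T Z" for Y Z
    by (rule borel_measurable_integrable[OF PT.integrable_snd[OF prod(1)[OF that]]])
  have CMX: "L2proc T (\<lambda>t \<omega>. CM (X t \<omega>))" by (rule L2proc_blinfun[OF L2proc_X])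
  have "(\<integral>z. \<delta> (fst z) (snd z) \<bullet> CM (X (fst z) (snd z)) \<partial>?\<mu>) = (\<integral>\<omega>. \<integral>t. \<delta> t \<omega> \<bullet> CM (X t \<omega>) \<partial>lebT T \<partial>\<Omega>)"
    by (rule snd[OF \<delta> CMX])
  also have "\<dots> = (\<integral>\<omega>. \<integral>s. \<eta> s \<omega> \<bullet> Y1 s \<omega> \<partial>lebT T \<partial>\<Omega>)"
  proof (rule integral_cong_AE[OF sec[OF \<delta> CMX] sec[OF \<eta> Y1]])
    show "AE \<omega> in \<Omega>. (\<integral>t. \<delta> t \<omega> \<bullet> CM (X t \<omega>) \<partial>lebT T) = (\<integral>s. \<eta> s \<omega> \<bullet> Y1 s \<omega> \<partial>lebT T)"
      using L2proc_path(1)[OF \<eta>] AE_space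
    proof eventually_elim
      case (elim \<omega>)
      show ?case
        unfolding \<delta>_def Y1_def anti[symmetric]
        by (rule conv_duality[OF T0 causal_measurable(1) self_adjoint(1,2)
              process_path_measurable[OF \<eta>m elim(2)] elim(1) Xpath[OF elim(2)]])
    qed
  qed
  also have "\<dots> = (\<integral>z. \<eta> (fst z) (snd z) \<bullet> Y1 (fst z) (snd z) \<partial>?\<mu>)" by (rule snd[OF \<eta> Y1, symmetric])
  finally have 1: "(\<integral>z. \<delta> (fst z) (snd z) \<bullet> CM (X (fst z) (snd z)) \<partial>?\<mu>) = (\<integral>z. \<eta> (fst z) (snd z) \<bullet> Y1 (fst z) (snd z) \<partial>?\<mu>)" .
  have "(\<integral>\<omega>. \<delta> T \<omega> \<bullet> CMT (X T \<omega>) \<partial>\<Omega>) = (\<integral>\<omega>. \<integral>s. \<eta> s \<omega> \<bullet> Y2 s \<omega> \<partial>lebT T \<partial>\<Omega>)"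
  proof (rule integral_cong_AE[OF _ sec[OF \<eta> Y2]])
    have "(\<lambda>(t, \<omega>). \<delta> t \<omega>) \<in> borel_measurable ?\<mu>" using \<delta> by (simp add: L2proc_def)
    then show "(\<lambda>\<omega>. \<delta> T \<omega> \<bullet> CMT (X T \<omega>)) \<in> borel_measurable \<Omega>"
      using T0 by (intro borel_measurable_inner process_section_measurable[of \<delta>] blinfun_measurable X_measurable) auto
    show "AE \<omega> in \<Omega>. \<delta> T \<omega> \<bullet> CMT (X T \<omega>) = (\<integral>s. \<eta> s \<omega> \<bullet> Y2 s \<omega> \<partial>lebT T)"
      using L2proc_path(1)[OF \<eta>] AE_space
    proof eventually_elim
      case (elim \<omega>)
      have "\<delta> T \<omega> \<bullet> CMT (X T \<omega>) = (\<integral>s. (indicat_real causal (T, s) *\<^sub>R op_exp (\<bar>T - s\<bar> *\<^sub>R G) (H (\<eta> s \<omega>))) \<bullet> CMT (X T \<omega>) \<partial>lebT T)"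
        unfolding \<delta>_def conv_def
        by (rule integral_inner_left[OF conv_integrable[OF T0 process_path_measurable[OF \<eta>m elim(2)] elim(1) causal_measurable(1)], symmetric])
      also have "\<dots> = (\<integral>s. \<eta> s \<omega> \<bullet> Y2 s \<omega> \<partial>lebT T)"
      proof (rule Bochner_Integration.integral_cong[OF refl])
        fix s assume "s \<in> space (lebT T)"
        then have s: "indicat_real causal (T, s) = 1" "\<bar>T - s\<bar> = T - s" by (auto simp: causal_def)
        show "(indicat_real causal (T, s) *\<^sub>R op_exp (\<bar>T - s\<bar> *\<^sub>R G) (H (\<eta> s \<omega>))) \<bullet> CMT (X T \<omega>) = \<eta> s \<omega> \<bullet> Y2 s \<omega>"
          using op_exp_self_adjoint[OF self_adjoint(1), of "T - s"] self_adjoint(2)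
          by (simp add: s Y2_def self_adjoint_def)
      qed
      finally show ?case .
    qed
  qed
  also have "\<dots> = (\<integral>z. \<eta> (fst z) (snd z) \<bullet> Y2 (fst z) (snd z) \<partial>?\<mu>)" by (rule snd[OF \<eta> Y2, symmetric])
  finally have 2: "(\<integral>\<omega>. \<delta> T \<omega> \<bullet> CMT (X T \<omega>) \<partial>\<Omega>) = (\<integral>z. \<eta> (fst z) (snd z) \<bullet> Y2 (fst z) (snd z) \<partial>?\<mu>)" .
  define N where "N s \<omega> = H (adjoint_gap s \<omega>)" for s \<omega>
  have N: "L2proc T N" unfolding N_def[abs_def] by (rule L2proc_blinfun[OF L2proc_adjoint_gap])
  have sum: "Y1 s \<omega> + Y3 s \<omega> + Y2 s \<omega> = N s \<omega>" if "s \<in> {0..T}" for s \<omega>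
  proof -
    have "CR (K s (X s \<omega>)) = (CR o\<^sub>L K s) (X s \<omega>)" by simp
    also have "\<dots> = - H (\<P> s (X s \<omega>))" by (simp only: feedback[OF that] blinfun.minus_left blinfun_apply_blinfun_compose)
    finally show ?thesis
      by (simp add: Y1_def Y2_def Y3_def N_def adjoint_gap_def ctrl_def blinfun.add_right blinfun.diff_right)
  qed
  have "(\<integral>z. \<eta> (fst z) (snd z) \<bullet> Y1 (fst z) (snd z) \<partial>?\<mu>) + (\<integral>z. \<eta> (fst z) (snd z) \<bullet> Y3 (fst z) (snd z) \<partial>?\<mu>)
      + (\<integral>z. \<eta> (fst z) (snd z) \<bullet> Y2 (fst z) (snd z) \<partial>?\<mu>)
      = (\<integral>z. \<eta> (fst z) (snd z) \<bullet> Y1 (fst z) (snd z) + \<eta> (fst z) (snd z) \<bullet> Y3 (fst z) (snd z)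
          + \<eta> (fst z) (snd z) \<bullet> Y2 (fst z) (snd z) \<partial>?\<mu>)"
    using prod(2)[OF \<eta> Y1] prod(2)[OF \<eta> Y2] prod(2)[OF \<eta> Y3] by simp
  also have "\<dots> = (\<integral>z. \<eta> (fst z) (snd z) \<bullet> N (fst z) (snd z) \<partial>?\<mu>)"
    by (rule Bochner_Integration.integral_cong[OF refl])
      (auto simp: space_pair_measure inner_add_right[symmetric] sum)
  also have "\<dots> = (\<integral>t. \<integral>\<omega>. \<eta> t \<omega> \<bullet> N t \<omega> \<partial>\<Omega> \<partial>lebT T)" by (rule fst[OF \<eta> N])
  also have "\<dots> = (\<integral>t. 0 \<partial>lebT T)"
  proof (rule integral_cong_AE[OF borel_measurable_integrable[OF PT.integrable_fst[OF prod(1)[OF \<eta> N]]]])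
    show "AE t in lebT T. (\<integral>\<omega>. \<eta> t \<omega> \<bullet> N t \<omega> \<partial>\<Omega>) = 0"
      using L2proc_path(3)[OF L2proc_blinfun[OF \<eta>, of H]] AE_space
    proof eventually_elim
      case (elim t)
      then have "(\<integral>\<omega>. H (\<eta> t \<omega>) \<bullet> adjoint_gap t \<omega> \<partial>\<Omega>) = 0"
        by (intro adjoint_gap_orthogonal blinfun_measurable ad) auto
      then show ?case using self_adjoint(2) by (simp add: N_def self_adjoint_def)
    qed
  qed simp
  finally show ?thesis unfolding 1 2 Y3_def by simp
qed

lemma square_finite_integrable:
  assumes "y \<in> borel_measurable (lebT T)" "(\<integral>\<^sup>+t\<in>{0..T}. ennreal ((norm (y t))\<^sup>2) \<partial>lborel) < \<infinity>"
  shows "integrable (lebT T) (\<lambda>t. (norm (y t))\<^sup>2)"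
  using assms by (intro integrableI_nonneg) (auto simp: nn_integral_lebT)

lemma admissible_L2_paths:
  assumes "admissible \<Omega> w T V"
  shows "(\<lambda>(t, \<omega>). V t \<omega>) \<in> borel_measurable (lebT T \<Otimes>\<^sub>M \<Omega>)"
    "AE \<omega> in \<Omega>. integrable (lebT T) (\<lambda>t. (norm (V t \<omega>))\<^sup>2)"
proof -
  show m: "(\<lambda>(t, \<omega>). V t \<omega>) \<in> borel_measurable (lebT T \<Otimes>\<^sub>M \<Omega>)"
    using assms by (simp add: admissible_def time_prod_def)
  have "AE \<omega> in \<Omega>. (\<integral>\<^sup>+t\<in>{0..T}. ennreal ((norm (V t \<omega>))\<^sup>2) \<partial>lborel) < \<infinity>"
    using assms by (simp add: admissible_def)
  then show "AE \<omega> in \<Omega>. integrable (lebT T) (\<lambda>t. (norm (V t \<omega>))\<^sup>2)"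
    using AE_space by eventually_elim (intro square_finite_integrable process_path_measurable[OF m])
qed

text \<open>Wiener integrals are unique up to null sets, so the noise cancels in the difference of two mild
  solutions.\<close>

lemma mild_difference:
  assumes V: "admissible \<Omega> w T V" and Y: "mild_solution \<Omega> f lam w T G H x0 V Y" and t: "t \<in> {0..T}"
  shows "AE \<omega> in \<Omega>. Y t \<omega> = X t \<omega> + conv G T causal H (\<lambda>s. V s \<omega> - ctrl s \<omega>) t"
proof -
  obtain Z where Z: "has_wiener_integral \<Omega> f lam w t (\<lambda>s. op_exp ((t - s) *\<^sub>R G)) Z"
    and Yt: "AE \<omega> in \<Omega>. Y t \<omega> = op_exp (t *\<^sub>R G) x0
        + (LINT s:{0..t}|lborel. op_exp ((t - s) *\<^sub>R G) (H (V s \<omega>))) + Z \<omega>"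
    using Y t unfolding mild_solution_def by blast
  have ZZ: "AE \<omega> in \<Omega>. Z \<omega> = noise_conv G t \<omega>"
    using t by (intro wiener_integral_unique[OF Z noise_conv_wiener_integral]) auto
  show ?thesis
    using Yt ZZ admissible_L2_paths(2)[OF V] AE_space
  proof eventually_elim
    case (elim \<omega>)
    let ?h = "\<lambda>y s. indicat_real causal (t, s) *\<^sub>R op_exp (\<bar>t - s\<bar> *\<^sub>R G) (H (y s))"
    have cc: "continuous_on {0..T} (\<lambda>t. (norm (ctrl t \<omega>))\<^sup>2)"
      by (intro continuous_on_power continuous_on_norm ctrl_continuous elim)
    have iV: "integrable (lebT T) (?h (\<lambda>s. V s \<omega>))"
      by (rule conv_integrable[OF T0 process_path_measurable[OF admissible_L2_paths(1)[OF V] elim(4)] elim(3) causal_measurable(1)])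
    have iU: "integrable (lebT T) (?h (\<lambda>s. ctrl s \<omega>))"
      by (rule conv_integrable[OF T0 process_path_measurable[OF ctrl_process_measurable elim(4)]
            lebT_integral_continuous(1)[OF cc] causal_measurable(1)])
    have "conv G T causal H (\<lambda>s. V s \<omega> - ctrl s \<omega>) t = (\<integral>s. ?h (\<lambda>s. V s \<omega>) s - ?h (\<lambda>s. ctrl s \<omega>) s \<partial>lebT T)"
      unfolding conv_def by (intro Bochner_Integration.integral_cong refl) (simp add: blinfun.diff_right scaleR_diff_right)
    also have "\<dots> = conv G T causal H (\<lambda>s. V s \<omega>) t - conv G T causal H (\<lambda>s. ctrl s \<omega>) t"
      unfolding conv_def by (rule Bochner_Integration.integral_diff[OF iV iU])
    finally have d: "conv G T causal H (\<lambda>s. V s \<omega> - ctrl s \<omega>) t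
        = conv G T causal H (\<lambda>s. V s \<omega>) t - conv G T causal H (\<lambda>s. ctrl s \<omega>) t" .
    have "(LINT s:{0..t}|lborel. op_exp ((t - s) *\<^sub>R G) (H (V s \<omega>))) = conv G T causal H (\<lambda>s. V s \<omega>) t"
      unfolding LINT_lebT using t by (intro conv_causal) auto
    with elim(1,2) show ?case by (simp add: X_mild[OF t elim(4)] d)
  qed
qed

text \<open>Tonelli's theorem: the exceptional set has null sections at every time.\<close>

lemma AE_process_eq:
  assumes Y: "(\<lambda>(t, \<omega>). Y t \<omega> :: L2_01) \<in> borel_measurable (lebT T \<Otimes>\<^sub>M \<Omega>)"
    and Z: "(\<lambda>(t, \<omega>). Z t \<omega>) \<in> borel_measurable (lebT T \<Otimes>\<^sub>M \<Omega>)"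
    and eq: "\<And>t. t \<in> {0..T} \<Longrightarrow> AE \<omega> in \<Omega>. Y t \<omega> = Z t \<omega>"
  shows "AE z in lebT T \<Otimes>\<^sub>M \<Omega>. Y (fst z) (snd z) = Z (fst z) (snd z)"
proof -
  interpret PT: pair_sigma_finite "lebT T" \<Omega> by (rule pair_sigma_finite_lebT)
  have [measurable]: "(\<lambda>z. norm (Y (fst z) (snd z) - Z (fst z) (snd z))) \<in> borel_measurable (lebT T \<Otimes>\<^sub>M \<Omega>)"
    using measurable_compose[OF borel_measurable_diff[OF Y Z] borel_measurable_norm] by (simp add: case_prod_beta')
  have s: "{z \<in> space (lebT T \<Otimes>\<^sub>M \<Omega>). norm (Y (fst z) (snd z) - Z (fst z) (snd z)) = 0} \<in> sets (lebT T \<Otimes>\<^sub>M \<Omega>)"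
    by measurable
  have "AE t in lebT T. AE \<omega> in \<Omega>. norm (Y (fst (t, \<omega>)) (snd (t, \<omega>)) - Z (fst (t, \<omega>)) (snd (t, \<omega>))) = 0"
  proof (rule AE_I2)
    fix t assume "t \<in> space (lebT T)"
    then have "AE \<omega> in \<Omega>. Y t \<omega> = Z t \<omega>" by (intro eq) simp
    then show "AE \<omega> in \<Omega>. norm (Y (fst (t, \<omega>)) (snd (t, \<omega>)) - Z (fst (t, \<omega>)) (snd (t, \<omega>))) = 0"
      by eventually_elim simp
  qed
  from PT.AE_pair_measure[OF s this] show ?thesis by eventually_elim simp
qed

lemma lq_cost_split:
  assumes u: "(\<lambda>(t, \<omega>). u t \<omega>) \<in> borel_measurable (lebT T \<Otimes>\<^sub>M \<Omega>)"
    and x: "(\<lambda>(t, \<omega>). x t \<omega>) \<in> borel_measurable (lebT T \<Otimes>\<^sub>M \<Omega>)"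
  shows "lq_cost \<Omega> T CM CR CMT u x
    = (\<integral>\<^sup>+z. ennreal (x (fst z) (snd z) \<bullet> CM (x (fst z) (snd z)) + u (fst z) (snd z) \<bullet> CR (u (fst z) (snd z))) \<partial>(lebT T \<Otimes>\<^sub>M \<Omega>))
      + (\<integral>\<^sup>+\<omega>. ennreal (x T \<omega> \<bullet> CMT (x T \<omega>)) \<partial>\<Omega>)"
proof -
  interpret PT: pair_sigma_finite "lebT T" \<Omega> by (rule pair_sigma_finite_lebT)
  let ?q = "\<lambda>t \<omega>. ennreal (x t \<omega> \<bullet> CM (x t \<omega>) + u t \<omega> \<bullet> CR (u t \<omega>))"
  have "(\<lambda>z. ?q (fst z) (snd z)) \<in> borel_measurable (lebT T \<Otimes>\<^sub>M \<Omega>)"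
    using u x by (intro measurable_compose[OF _ measurable_ennreal] borel_measurable_add borel_measurable_inner blinfun_measurable)
      (simp_all add: case_prod_beta')
  then have q: "case_prod ?q \<in> borel_measurable (lebT T \<Otimes>\<^sub>M \<Omega>)" by (simp add: case_prod_beta')
  have xT: "x T \<in> borel_measurable \<Omega>" using T0 by (intro process_section_measurable[OF x]) auto
  have "(\<lambda>\<omega>. \<integral>\<^sup>+t. ?q t \<omega> \<partial>lebT T) \<in> borel_measurable \<Omega>"
    using sigma_finite_measure.borel_measurable_nn_integral[OF sigma_finite_lebT measurable_pair_swap[OF q]]
      sigma_finite_measure.borel_measurable_nn_integral_fst[OF sigma_finite_lebT measurable_pair_swap[OF q]]
    by (simp add: case_prod_beta')
  then have "lq_cost \<Omega> T CM CR CMT u x = (\<integral>\<^sup>+\<omega>. \<integral>\<^sup>+t. ?q t \<omega> \<partial>lebT T \<partial>\<Omega>) + (\<integral>\<^sup>+\<omega>. ennreal (x T \<omega> \<bullet> CMT (x T \<omega>)) \<partial>\<Omega>)"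
    unfolding lq_cost_def nn_integral_lebT
    by (intro nn_integral_add measurable_compose[OF _ measurable_ennreal] borel_measurable_inner blinfun_measurable xT)
  also have "(\<integral>\<^sup>+\<omega>. \<integral>\<^sup>+t. ?q t \<omega> \<partial>lebT T \<partial>\<Omega>) = (\<integral>\<^sup>+z. case_prod ?q z \<partial>(lebT T \<Otimes>\<^sub>M \<Omega>))"
    using PT.nn_integral_snd[OF q] by simp
  finally show ?thesis by (simp add: case_prod_beta')
qed

end

section \<open>Optimality of the closed loop\<close>

context lq_state begin

lemma quadratic_expand:
  fixes C :: "L2_01 \<Rightarrow>\<^sub>L L2_01"
  assumes "self_adjoint C"
  shows "(u + v) \<bullet> C (u + v) = u \<bullet> C u + 2 * (v \<bullet> C u) + v \<bullet> C v"
proof -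
  have "u \<bullet> C v = v \<bullet> C u" using assms by (metis self_adjoint_def inner_commute)
  then show ?thesis by (simp add: blinfun.add_right inner_add_left inner_add_right)
qed

text \<open>The quadratic expansion of the cost around the closed loop; the linear term is \<open>cross_term_zero\<close> and the quadratic term is bounded below by coercivity of the control weight.\<close>

lemma cost_expansion:
  assumes \<eta>: "L2proc T \<eta>" and ad: "\<And>t. t \<in> {0..T} \<Longrightarrow> \<eta> t \<in> borel_measurable (natural_filtration \<Omega> w t)"
  defines "\<delta> \<equiv> \<lambda>t \<omega>. conv G T causal H (\<lambda>s. \<eta> s \<omega>) t"
  defines "v \<equiv> \<lambda>t \<omega>. ctrl t \<omega> + \<eta> t \<omega>" and "y \<equiv> \<lambda>t \<omega>. X t \<omega> + \<delta> t \<omega>"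
  shows "lq_cost \<Omega> T CM CR CMT ctrl X + (\<integral>\<^sup>+z. ennreal (r * (norm (\<eta> (fst z) (snd z)))\<^sup>2) \<partial>(lebT T \<Otimes>\<^sub>M \<Omega>))
      \<le> lq_cost \<Omega> T CM CR CMT v y"
    and "lq_cost \<Omega> T CM CR CMT ctrl X < \<infinity>"
proof -
  let ?\<mu> = "lebT T \<Otimes>\<^sub>M \<Omega>"
  have TT: "T \<in> {0..T}" using T0 by simp
  have \<delta>: "L2proc T \<delta>" unfolding \<delta>_def by (rule L2proc_conv(1)[OF T0 causal_measurable(1) \<eta>])
  have jm: "(\<lambda>(t, \<omega>). Y t \<omega>) \<in> borel_measurable ?\<mu>" if "L2proc T Y" for Y using that by (simp add: L2proc_def)
  have \<delta>T: "integrable \<Omega> (\<lambda>\<omega>. (norm (\<delta> T \<omega>))\<^sup>2)" "\<delta> T \<in> borel_measurable \<Omega>"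
    unfolding \<delta>_def
    by (rule L2proc_conv(2)[OF T0 causal_measurable(1) \<eta> TT],
        rule process_section_measurable[OF jm[OF \<delta>, unfolded \<delta>_def] TT])
  have XT: "integrable \<Omega> (\<lambda>\<omega>. (norm (X T \<omega>))\<^sup>2)" "X T \<in> borel_measurable \<Omega>"
    by (rule X_square_integrable[OF TT], rule X_measurable[OF TT])
  have pi: "integrable ?\<mu> (\<lambda>z. Y (fst z) (snd z) \<bullet> C (Z (fst z) (snd z)))" if "L2proc T Y" "L2proc T Z" for Y Z and C :: "L2_01 \<Rightarrow>\<^sub>L L2_01"
    using L2proc_inner[OF that(1) L2proc_blinfun[OF that(2), of C]] by (simp add: case_prod_beta')
  have ti: "integrable \<Omega> (\<lambda>\<omega>. a \<omega> \<bullet> C (b \<omega>))"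
    if a: "integrable \<Omega> (\<lambda>\<omega>. (norm (a \<omega>))\<^sup>2)" "a \<in> borel_measurable \<Omega>"
      and b: "integrable \<Omega> (\<lambda>\<omega>. (norm (b \<omega>))\<^sup>2)" "b \<in> borel_measurable \<Omega>" for a b and C :: "L2_01 \<Rightarrow>\<^sub>L L2_01"
  proof (rule Bochner_Integration.integrable_bound)
    show "integrable \<Omega> (\<lambda>\<omega>. (norm (a \<omega>))\<^sup>2 + (norm C)\<^sup>2 * (norm (b \<omega>))\<^sup>2)" using a b by simp
    show "(\<lambda>\<omega>. a \<omega> \<bullet> C (b \<omega>)) \<in> borel_measurable \<Omega>" by (intro borel_measurable_inner blinfun_measurable a b)
    have "\<bar>p \<bullet> C q\<bar> \<le> (norm p)\<^sup>2 + (norm C)\<^sup>2 * (norm q)\<^sup>2" for p q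
    proof -
      have "\<bar>p \<bullet> C q\<bar> \<le> norm p * norm (C q)" by (rule Cauchy_Schwarz_ineq2)
      also have "\<dots> \<le> norm p * (norm C * norm q)" by (intro mult_left_mono norm_blinfun) simp
      also have "\<dots> \<le> (norm p)\<^sup>2 + (norm C * norm q)\<^sup>2"
        using abs_mult_le_squares[of "norm p" "norm C * norm q"] by simp
      finally show ?thesis by (simp add: power_mult_distrib)
    qed
    then show "AE \<omega> in \<Omega>. norm (a \<omega> \<bullet> C (b \<omega>)) \<le> norm ((norm (a \<omega>))\<^sup>2 + (norm C)\<^sup>2 * (norm (b \<omega>))\<^sup>2)"
      by (intro AE_I2) (simp add: add_nonneg_nonneg)
  qed
  define q0 where "q0 z = X (fst z) (snd z) \<bullet> CM (X (fst z) (snd z)) + ctrl (fst z) (snd z) \<bullet> CR (ctrl (fst z) (snd z))" for z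
  define q1 where "q1 z = \<delta> (fst z) (snd z) \<bullet> CM (X (fst z) (snd z)) + \<eta> (fst z) (snd z) \<bullet> CR (ctrl (fst z) (snd z))" for z
  define q2 where "q2 z = \<delta> (fst z) (snd z) \<bullet> CM (\<delta> (fst z) (snd z)) + \<eta> (fst z) (snd z) \<bullet> CR (\<eta> (fst z) (snd z))" for z
  define g0 where "g0 \<omega> = X T \<omega> \<bullet> CMT (X T \<omega>)" for \<omega>
  define g1 where "g1 \<omega> = \<delta> T \<omega> \<bullet> CMT (X T \<omega>)" for \<omega>
  define g2 where "g2 \<omega> = \<delta> T \<omega> \<bullet> CMT (\<delta> T \<omega>)" for \<omega>
  have qi: "integrable ?\<mu> q0" "integrable ?\<mu> q1" "integrable ?\<mu> q2"
    unfolding q0_def[abs_def] q1_def[abs_def] q2_def[abs_def]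
    by (intro Bochner_Integration.integrable_add pi L2proc_X L2proc_ctrl \<delta> \<eta>)+
  have gi: "integrable \<Omega> g0" "integrable \<Omega> g1" "integrable \<Omega> g2"
    unfolding g0_def[abs_def] g1_def[abs_def] g2_def[abs_def] by (intro ti XT \<delta>T)+
  have CR0: "0 \<le> u \<bullet> CR u" for u
  proof -
    have "0 \<le> r * (norm u)\<^sup>2" using r by simp
    then show ?thesis using CR_coercive[of u] by (rule order_trans)
  qed
  have cross: "(\<integral>z. q1 z \<partial>?\<mu>) + (\<integral>\<omega>. g1 \<omega> \<partial>\<Omega>) = 0"
    using cross_term_zero[OF \<eta> ad] pi[OF \<delta> L2proc_X, of CM] pi[OF \<eta> L2proc_ctrl, of CR]
    unfolding q1_def g1_def \<delta>_def by simp
  have J0: "lq_cost \<Omega> T CM CR CMT ctrl X = ennreal ((\<integral>z. q0 z \<partial>?\<mu>) + (\<integral>\<omega>. g0 \<omega> \<partial>\<Omega>))"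
  proof -
    have "lq_cost \<Omega> T CM CR CMT ctrl X = (\<integral>\<^sup>+z. ennreal (q0 z) \<partial>?\<mu>) + (\<integral>\<^sup>+\<omega>. ennreal (g0 \<omega>) \<partial>\<Omega>)"
      unfolding lq_cost_split[OF ctrl_process_measurable X_process_measurable] q0_def g0_def ..
    also have "(\<integral>\<^sup>+z. ennreal (q0 z) \<partial>?\<mu>) = ennreal (\<integral>z. q0 z \<partial>?\<mu>)"
      by (rule nn_integral_eq_integral[OF qi(1)]) (simp add: q0_def CM_nonneg CR0)
    also have "(\<integral>\<^sup>+\<omega>. ennreal (g0 \<omega>) \<partial>\<Omega>) = ennreal (\<integral>\<omega>. g0 \<omega> \<partial>\<Omega>)"
      by (rule nn_integral_eq_integral[OF gi(1)]) (simp add: g0_def CMT_nonneg)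
    finally show ?thesis
      by (simp add: ennreal_plus[OF Bochner_Integration.integral_nonneg Bochner_Integration.integral_nonneg]
          q0_def g0_def CM_nonneg CMT_nonneg CR0)
  qed
  then show "lq_cost \<Omega> T CM CR CMT ctrl X < \<infinity>" by simp
  have vy: "(\<lambda>(t, \<omega>). v t \<omega>) \<in> borel_measurable ?\<mu>" "(\<lambda>(t, \<omega>). y t \<omega>) \<in> borel_measurable ?\<mu>"
    unfolding v_def y_def by (rule jm[OF L2proc_add[OF L2proc_ctrl \<eta>]], rule jm[OF L2proc_add[OF L2proc_X \<delta>]])
  have J: "lq_cost \<Omega> T CM CR CMT v y = ennreal ((\<integral>z. q0 z + 2 * q1 z + q2 z \<partial>?\<mu>) + (\<integral>\<omega>. g0 \<omega> + 2 * g1 \<omega> + g2 \<omega> \<partial>\<Omega>))"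
  proof -
    have q: "y (fst z) (snd z) \<bullet> CM (y (fst z) (snd z)) + v (fst z) (snd z) \<bullet> CR (v (fst z) (snd z)) = q0 z + 2 * q1 z + q2 z" for z
      unfolding y_def v_def quadratic_expand[OF self_adjoint(3)] quadratic_expand[OF self_adjoint(4)] q0_def q1_def q2_def by simp
    have g: "y T \<omega> \<bullet> CMT (y T \<omega>) = g0 \<omega> + 2 * g1 \<omega> + g2 \<omega>" for \<omega>
      unfolding y_def quadratic_expand[OF self_adjoint(5)] g0_def g1_def g2_def by simp
    have qn: "0 \<le> q0 z + 2 * q1 z + q2 z" for z unfolding q[symmetric] by (intro add_nonneg_nonneg CM_nonneg CR0)
    have gn: "0 \<le> g0 \<omega> + 2 * g1 \<omega> + g2 \<omega>" for \<omega> unfolding g[symmetric] by (rule CMT_nonneg)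
    have "lq_cost \<Omega> T CM CR CMT v y = (\<integral>\<^sup>+z. ennreal (q0 z + 2 * q1 z + q2 z) \<partial>?\<mu>) + (\<integral>\<^sup>+\<omega>. ennreal (g0 \<omega> + 2 * g1 \<omega> + g2 \<omega>) \<partial>\<Omega>)"
      unfolding lq_cost_split[OF vy] q g ..
    also have "(\<integral>\<^sup>+z. ennreal (q0 z + 2 * q1 z + q2 z) \<partial>?\<mu>) = ennreal (\<integral>z. q0 z + 2 * q1 z + q2 z \<partial>?\<mu>)"
      by (rule nn_integral_eq_integral) (auto intro!: Bochner_Integration.integrable_add integrable_mult_right qi simp: qn)
    also have "(\<integral>\<^sup>+\<omega>. ennreal (g0 \<omega> + 2 * g1 \<omega> + g2 \<omega>) \<partial>\<Omega>) = ennreal (\<integral>\<omega>. g0 \<omega> + 2 * g1 \<omega> + g2 \<omega> \<partial>\<Omega>)"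
      by (rule nn_integral_eq_integral) (auto intro!: Bochner_Integration.integrable_add integrable_mult_right gi simp: gn)
    finally show ?thesis
      by (simp only: ennreal_plus[OF Bochner_Integration.integral_nonneg[OF qn] Bochner_Integration.integral_nonneg[OF gn]])
  qed
  have \<eta>2: "integrable ?\<mu> (\<lambda>z. r * (norm (\<eta> (fst z) (snd z)))\<^sup>2)"
    using \<eta> by (intro integrable_mult_right) (simp add: L2proc_def case_prod_beta')
  have q2: "(\<integral>z. r * (norm (\<eta> (fst z) (snd z)))\<^sup>2 \<partial>?\<mu>) \<le> (\<integral>z. q2 z \<partial>?\<mu>)"
  proof (rule Bochner_Integration.integral_mono[OF \<eta>2 qi(3)])
    show "r * (norm (\<eta> (fst z) (snd z)))\<^sup>2 \<le> q2 z" for z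
      using CR_coercive[of "\<eta> (fst z) (snd z)"] CM_nonneg[of "\<delta> (fst z) (snd z)"] by (simp add: q2_def)
  qed
  have g2: "0 \<le> (\<integral>\<omega>. g2 \<omega> \<partial>\<Omega>)" by (simp add: g2_def CMT_nonneg)
  have "(\<integral>z. q0 z + 2 * q1 z + q2 z \<partial>?\<mu>) = (\<integral>z. q0 z \<partial>?\<mu>) + 2 * (\<integral>z. q1 z \<partial>?\<mu>) + (\<integral>z. q2 z \<partial>?\<mu>)"
    using qi by simp
  moreover have "(\<integral>\<omega>. g0 \<omega> + 2 * g1 \<omega> + g2 \<omega> \<partial>\<Omega>) = (\<integral>\<omega>. g0 \<omega> \<partial>\<Omega>) + 2 * (\<integral>\<omega>. g1 \<omega> \<partial>\<Omega>) + (\<integral>\<omega>. g2 \<omega> \<partial>\<Omega>)"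
    using gi by simp
  ultimately have le: "((\<integral>z. q0 z \<partial>?\<mu>) + (\<integral>\<omega>. g0 \<omega> \<partial>\<Omega>)) + (\<integral>z. r * (norm (\<eta> (fst z) (snd z)))\<^sup>2 \<partial>?\<mu>)
      \<le> (\<integral>z. q0 z + 2 * q1 z + q2 z \<partial>?\<mu>) + (\<integral>\<omega>. g0 \<omega> + 2 * g1 \<omega> + g2 \<omega> \<partial>\<Omega>)"
    using cross q2 g2 by linarith
  have "(\<integral>\<^sup>+z. ennreal (r * (norm (\<eta> (fst z) (snd z)))\<^sup>2) \<partial>?\<mu>) = ennreal (\<integral>z. r * (norm (\<eta> (fst z) (snd z)))\<^sup>2 \<partial>?\<mu>)"
    using r by (intro nn_integral_eq_integral[OF \<eta>2]) simp
  then have "lq_cost \<Omega> T CM CR CMT ctrl X + (\<integral>\<^sup>+z. ennreal (r * (norm (\<eta> (fst z) (snd z)))\<^sup>2) \<partial>?\<mu>)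
      = ennreal (((\<integral>z. q0 z \<partial>?\<mu>) + (\<integral>\<omega>. g0 \<omega> \<partial>\<Omega>)) + (\<integral>z. r * (norm (\<eta> (fst z) (snd z)))\<^sup>2 \<partial>?\<mu>))"
    unfolding J0 using r
    by (subst ennreal_plus) (auto intro!: add_nonneg_nonneg Bochner_Integration.integral_nonneg simp: q0_def g0_def CM_nonneg CMT_nonneg CR0)
  also have "\<dots> \<le> lq_cost \<Omega> T CM CR CMT v y" unfolding J by (rule ennreal_leI[OF le])
  finally show "lq_cost \<Omega> T CM CR CMT ctrl X + (\<integral>\<^sup>+z. ennreal (r * (norm (\<eta> (fst z) (snd z)))\<^sup>2) \<partial>?\<mu>)
      \<le> lq_cost \<Omega> T CM CR CMT v y" .
qed

lemma lq_cost_AE_cong: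
  assumes "(\<lambda>(t, \<omega>). u t \<omega>) \<in> borel_measurable (lebT T \<Otimes>\<^sub>M \<Omega>)" "(\<lambda>(t, \<omega>). x t \<omega>) \<in> borel_measurable (lebT T \<Otimes>\<^sub>M \<Omega>)"
    "(\<lambda>(t, \<omega>). u' t \<omega>) \<in> borel_measurable (lebT T \<Otimes>\<^sub>M \<Omega>)" "(\<lambda>(t, \<omega>). x' t \<omega>) \<in> borel_measurable (lebT T \<Otimes>\<^sub>M \<Omega>)"
    and u: "AE z in lebT T \<Otimes>\<^sub>M \<Omega>. u (fst z) (snd z) = u' (fst z) (snd z)"
    and x: "\<And>t. t \<in> {0..T} \<Longrightarrow> AE \<omega> in \<Omega>. x t \<omega> = x' t \<omega>"
  shows "lq_cost \<Omega> T CM CR CMT u x = lq_cost \<Omega> T CM CR CMT u' x'"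
proof -
  have "AE \<omega> in \<Omega>. x T \<omega> = x' T \<omega>" using T0 by (intro x) simp
  then have "AE \<omega> in \<Omega>. ennreal (x T \<omega> \<bullet> CMT (x T \<omega>)) = ennreal (x' T \<omega> \<bullet> CMT (x' T \<omega>))"
    by eventually_elim simp
  then have "(\<integral>\<^sup>+\<omega>. ennreal (x T \<omega> \<bullet> CMT (x T \<omega>)) \<partial>\<Omega>) = (\<integral>\<^sup>+\<omega>. ennreal (x' T \<omega> \<bullet> CMT (x' T \<omega>)) \<partial>\<Omega>)"
    by (rule nn_integral_cong_AE)
  moreover have "(\<integral>\<^sup>+z. ennreal (x (fst z) (snd z) \<bullet> CM (x (fst z) (snd z)) + u (fst z) (snd z) \<bullet> CR (u (fst z) (snd z))) \<partial>(lebT T \<Otimes>\<^sub>M \<Omega>))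
      = (\<integral>\<^sup>+z. ennreal (x' (fst z) (snd z) \<bullet> CM (x' (fst z) (snd z)) + u' (fst z) (snd z) \<bullet> CR (u' (fst z) (snd z))) \<partial>(lebT T \<Otimes>\<^sub>M \<Omega>))"
  proof (rule nn_integral_cong_AE)
    have "AE z in lebT T \<Otimes>\<^sub>M \<Omega>. x (fst z) (snd z) = x' (fst z) (snd z)" by (rule AE_process_eq[OF assms(2,4) x])
    with u show "AE z in lebT T \<Otimes>\<^sub>M \<Omega>. ennreal (x (fst z) (snd z) \<bullet> CM (x (fst z) (snd z)) + u (fst z) (snd z) \<bullet> CR (u (fst z) (snd z)))
        = ennreal (x' (fst z) (snd z) \<bullet> CM (x' (fst z) (snd z)) + u' (fst z) (snd z) \<bullet> CR (u' (fst z) (snd z)))"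
      by eventually_elim simp
  qed
  ultimately show ?thesis by (simp only: lq_cost_split[OF assms(1,2)] lq_cost_split[OF assms(3,4)])
qed

text \<open>A competitor of finite cost is square integrable since the control weight is coercive, hence it is the closed loop plus a perturbation as in \<open>cost_expansion\<close>.\<close>

theorem closed_loop_minimizes:
  assumes V: "admissible \<Omega> w T V" and Y: "mild_solution \<Omega> f lam w T G H x0 V Y"
  shows "lq_cost \<Omega> T CM CR CMT ctrl X
      + (\<integral>\<^sup>+z. ennreal (r * (norm (V (fst z) (snd z) - ctrl (fst z) (snd z)))\<^sup>2) \<partial>(lebT T \<Otimes>\<^sub>M \<Omega>))
    \<le> lq_cost \<Omega> T CM CR CMT V Y"
proof (cases "lq_cost \<Omega> T CM CR CMT V Y = \<infinity>")
  case False
  let ?\<mu> = "lebT T \<Otimes>\<^sub>M \<Omega>"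
  have Vm: "(\<lambda>(t, \<omega>). V t \<omega>) \<in> borel_measurable ?\<mu>" by (rule admissible_L2_paths(1)[OF V])
  have Ym: "(\<lambda>(t, \<omega>). Y t \<omega>) \<in> borel_measurable ?\<mu>" using Y by (simp add: mild_solution_def time_prod_def)
  have "L2proc T V"
    unfolding L2proc_def
  proof (intro conjI Vm integrableI_bounded)
    show "(\<lambda>(t, \<omega>). (norm (V t \<omega>))\<^sup>2) \<in> borel_measurable ?\<mu>"
      using borel_measurable_power[OF measurable_compose[OF Vm borel_measurable_norm]] by (simp add: case_prod_beta')
    let ?q = "\<lambda>z. Y (fst z) (snd z) \<bullet> CM (Y (fst z) (snd z)) + V (fst z) (snd z) \<bullet> CR (V (fst z) (snd z))"
    have "(\<integral>\<^sup>+z. ennreal (norm (case z of (t, \<omega>) \<Rightarrow> (norm (V t \<omega>))\<^sup>2)) \<partial>?\<mu>) \<le> (\<integral>\<^sup>+z. ennreal (1 / r) * ennreal (?q z) \<partial>?\<mu>)"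
    proof (rule nn_integral_mono)
      fix z
      have "r * (norm (V (fst z) (snd z)))\<^sup>2 \<le> ?q z"
        using CR_coercive[of "V (fst z) (snd z)"] CM_nonneg[of "Y (fst z) (snd z)"] by linarith
      then have "(norm (V (fst z) (snd z)))\<^sup>2 \<le> 1 / r * ?q z" using r by (simp add: field_simps)
      then have "ennreal ((norm (V (fst z) (snd z)))\<^sup>2) \<le> ennreal (1 / r * ?q z)" by (rule ennreal_leI)
      also have "\<dots> = ennreal (1 / r) * ennreal (?q z)" using r by (intro ennreal_mult') simp
      finally show "ennreal (norm (case z of (t, \<omega>) \<Rightarrow> (norm (V t \<omega>))\<^sup>2)) \<le> ennreal (1 / r) * ennreal (?q z)"
        by (simp add: case_prod_beta')
    qed
    also have "\<dots> = ennreal (1 / r) * (\<integral>\<^sup>+z. ennreal (?q z) \<partial>?\<mu>)"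
      using Vm Ym by (intro nn_integral_cmult measurable_compose[OF _ measurable_ennreal] borel_measurable_add borel_measurable_inner blinfun_measurable)
        (simp_all add: case_prod_beta')
    also have "ennreal (1 / r) * (\<integral>\<^sup>+z. ennreal (?q z) \<partial>?\<mu>) < \<infinity>"
    proof -
      have "(\<integral>\<^sup>+z. ennreal (?q z) \<partial>?\<mu>) \<noteq> top" using False unfolding lq_cost_split[OF Vm Ym] by simp
      then have "(\<integral>\<^sup>+z. ennreal (?q z) \<partial>?\<mu>) < top" by (simp only: less_top[symmetric] not_False_eq_True)
      then show ?thesis unfolding infinity_ennreal_def by (intro ennreal_mult_less_top[THEN iffD2]) simp
    qed
    finally show "(\<integral>\<^sup>+z. ennreal (norm (case z of (t, \<omega>) \<Rightarrow> (norm (V t \<omega>))\<^sup>2)) \<partial>?\<mu>) < \<infinity>" .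
  qed
  then have \<eta>: "L2proc T (\<lambda>t \<omega>. V t \<omega> - ctrl t \<omega>)" by (rule L2proc_diff[OF _ L2proc_ctrl])
  let ?\<delta> = "\<lambda>t \<omega>. conv G T causal H (\<lambda>s. V s \<omega> - ctrl s \<omega>) t"
  have ad: "(\<lambda>\<omega>. V t \<omega> - ctrl t \<omega>) \<in> borel_measurable (natural_filtration \<Omega> w t)" if "t \<in> {0..T}" for t
    using V that by (intro borel_measurable_diff ctrl_adapted) (auto simp: admissible_def)
  have \<delta>: "L2proc T ?\<delta>" by (rule L2proc_conv(1)[OF T0 causal_measurable(1) \<eta>])
  have "lq_cost \<Omega> T CM CR CMT V Y = lq_cost \<Omega> T CM CR CMT (\<lambda>t \<omega>. ctrl t \<omega> + (V t \<omega> - ctrl t \<omega>)) (\<lambda>t \<omega>. X t \<omega> + ?\<delta> t \<omega>)"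
  proof (rule lq_cost_AE_cong[OF Vm Ym])
    show "(\<lambda>(t, \<omega>). ctrl t \<omega> + (V t \<omega> - ctrl t \<omega>)) \<in> borel_measurable ?\<mu>" using Vm by simp
    show "(\<lambda>(t, \<omega>). X t \<omega> + ?\<delta> t \<omega>) \<in> borel_measurable ?\<mu>"
      using L2proc_add[OF L2proc_X \<delta>] by (simp add: L2proc_def)
    show "AE \<omega> in \<Omega>. Y t \<omega> = X t \<omega> + ?\<delta> t \<omega>" if "t \<in> {0..T}" for t by (rule mild_difference[OF V Y that])
  qed simp
  then show ?thesis using cost_expansion(1)[OF \<eta> ad] by simp
qed simp

lemma closed_loop_exists: "closed_loop \<Omega> f lam w T G H x0 (\<lambda>t. blinfun_apply (K t)) ctrl X"
  unfolding closed_loop_def admissible_def mild_solution_def time_prod_def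
proof (intro conjI ballI)
  show "(\<lambda>(t, \<omega>). ctrl t \<omega>) \<in> borel_measurable (lebT T \<Otimes>\<^sub>M \<Omega>)" by (rule ctrl_process_measurable)
  show "(\<lambda>(t, \<omega>). X t \<omega>) \<in> borel_measurable (lebT T \<Otimes>\<^sub>M \<Omega>)" by (rule X_process_measurable)
  show "ctrl t \<in> borel_measurable (natural_filtration \<Omega> w t)" if "t \<in> {0..T}" for t by (rule ctrl_adapted[OF that])
  show "AE \<omega> in \<Omega>. (\<integral>\<^sup>+t\<in>{0..T}. ennreal ((norm (ctrl t \<omega>))\<^sup>2) \<partial>lborel) < \<infinity>"
  proof (rule AE_I2)
    fix \<omega> assume \<omega>: "\<omega> \<in> space \<Omega>"
    have "integrable (lebT T) (\<lambda>t. (norm (ctrl t \<omega>))\<^sup>2)"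
      by (intro lebT_integral_continuous(1) continuous_on_power continuous_on_norm ctrl_continuous \<omega>)
    then show "(\<integral>\<^sup>+t\<in>{0..T}. ennreal ((norm (ctrl t \<omega>))\<^sup>2) \<partial>lborel) < \<infinity>"
      unfolding nn_integral_lebT by (subst nn_integral_eq_integral) auto
  qed
  show "\<exists>Z. has_wiener_integral \<Omega> f lam w t (\<lambda>s. op_exp ((t - s) *\<^sub>R G)) Z \<and>
      (AE \<omega> in \<Omega>. X t \<omega> = op_exp (t *\<^sub>R G) x0
        + (LINT s:{0..t}|lborel. op_exp ((t - s) *\<^sub>R G) (H (ctrl s \<omega>))) + Z \<omega>)" if t: "t \<in> {0..T}" for t
  proof (intro exI conjI AE_I2)
    show "has_wiener_integral \<Omega> f lam w t (\<lambda>s. op_exp ((t - s) *\<^sub>R G)) (noise_conv G t)"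
      using t by (intro noise_conv_wiener_integral) simp
    fix \<omega> assume \<omega>: "\<omega> \<in> space \<Omega>"
    have "(LINT s:{0..t}|lborel. op_exp ((t - s) *\<^sub>R G) (H (ctrl s \<omega>))) = conv G T causal H (\<lambda>s. ctrl s \<omega>) t"
      unfolding LINT_lebT using t by (intro conv_causal) auto
    then show "X t \<omega> = op_exp (t *\<^sub>R G) x0 + (LINT s:{0..t}|lborel. op_exp ((t - s) *\<^sub>R G) (H (ctrl s \<omega>))) + noise_conv G t \<omega>"
      using X_mild[OF t \<omega>] by simp
  qed
qed (simp add: ctrl_def)

text \<open>Since \<open>\<phi>\<close> is only integrable, Gronwall's lemma is applied to its continuous primitive.\<close>

lemma volterra_zero:
  assumes \<phi>: "integrable (lebT T) \<phi>" and L: "0 \<le> L"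
    and le: "\<And>t. t \<in> {0..T} \<Longrightarrow> 0 \<le> \<phi> t \<and> \<phi> t \<le> L * (\<integral>s. indicat_real causal (t, s) * \<phi> s \<partial>lebT T)"
    and t: "t \<in> {0..T}"
  shows "\<phi> t = (0::real)"
proof -
  have si: "set_integrable lborel {0..T} \<phi>"
    using \<phi> unfolding set_integrable_def by (subst (asm) integrable_restrict_space) auto
  have hk: "\<phi> integrable_on {0..T}" by (rule set_borel_integral_eq_integral(1)[OF si])
  define \<Phi> where "\<Phi> t = integral {0..t} \<phi>" for t
  have \<Phi>c: "continuous_on {0..T} \<Phi>" unfolding \<Phi>_def[abs_def] by (rule indefinite_integral_continuous_1[OF hk])
  have le': "\<phi> s \<le> L * \<Phi> s" if s: "s \<in> {0..T}" for s
  proof -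
    have "(\<integral>u. indicat_real causal (s, u) * \<phi> u \<partial>lebT T) = (LINT u:{0..s}|lborel. \<phi> u)"
      unfolding set_lebesgue_integral_def using s
      by (subst integral_restrict_space)
        (auto intro!: Bochner_Integration.integral_cong split: split_indicator simp: causal_def indicator_def)
    also have "\<dots> = \<Phi> s"
      unfolding \<Phi>_def using s by (intro set_borel_integral_eq_integral(2) set_integrable_subset[OF si]) auto
    finally show ?thesis using le[OF s] by simp
  qed
  have "\<Phi> s \<le> 0 + L * integral {0..s} \<Phi>" if s: "s \<in> {0..T}" for s
  proof -
    have sub: "{0..s} \<subseteq> {0..T}" using s by auto
    have "\<Phi> s \<le> integral {0..s} (\<lambda>u. L * \<Phi> u)"
      unfolding \<Phi>_def[of s]
    proof (rule integral_le)
      show "\<phi> integrable_on {0..s}" by (rule integrable_subinterval_real[OF hk sub])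
      show "(\<lambda>u. L * \<Phi> u) integrable_on {0..s}"
        by (intro integrable_continuous_interval continuous_on_mult continuous_on_const continuous_on_subset[OF \<Phi>c sub])
    qed (use le' sub in auto)
    then show ?thesis by simp
  qed
  from gronwall[OF \<Phi>c L this t] have "\<Phi> t \<le> 0" by simp
  then have "L * \<Phi> t \<le> 0" using L by (rule mult_nonneg_nonpos[rotated])
  then show ?thesis using le[OF t] le'[OF t] by simp
qed

text \<open>The feedback law bounds the difference of the controls by that of the states, and the mild equation bounds the latter by the time integral of the former.\<close>

lemma closed_loop_unique:
  assumes cl: "closed_loop \<Omega> f lam w T G H x0 (\<lambda>t. blinfun_apply (K t)) u x" and t: "t \<in> {0..T}"
  shows "AE \<omega> in \<Omega>. x t \<omega> = X t \<omega>" "AE \<omega> in \<Omega>. u t \<omega> = ctrl t \<omega>"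
proof -
  interpret PT: pair_sigma_finite "lebT T" \<Omega> by (rule pair_sigma_finite_lebT)
  let ?\<mu> = "lebT T \<Otimes>\<^sub>M \<Omega>"
  have u: "admissible \<Omega> w T u" and x: "mild_solution \<Omega> f lam w T G H x0 u x"
    and fb: "\<And>t. t \<in> {0..T} \<Longrightarrow> AE \<omega> in \<Omega>. u t \<omega> = K t (x t \<omega>)"
    using cl by (auto simp: closed_loop_def)
  define \<eta> where "\<eta> t \<omega> = u t \<omega> - ctrl t \<omega>" for t \<omega>
  define \<delta> where "\<delta> t \<omega> = conv G T causal H (\<lambda>s. \<eta> s \<omega>) t" for t \<omega>
  have \<eta>m: "(\<lambda>(t, \<omega>). \<eta> t \<omega>) \<in> borel_measurable ?\<mu>"
    unfolding \<eta>_def using borel_measurable_diff[OF admissible_L2_paths(1)[OF u] ctrl_process_measurable] by (simp add: case_prod_beta')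
  have \<delta>m: "(\<lambda>(t, \<omega>). \<delta> t \<omega>) \<in> borel_measurable ?\<mu>"
    unfolding \<delta>_def by (rule conv_process_measurable[OF \<eta>m causal_measurable(1)])
  have xd: "AE \<omega> in \<Omega>. x t \<omega> = X t \<omega> + \<delta> t \<omega>" if "t \<in> {0..T}" for t
    using mild_difference[OF u x that] by (simp add: \<delta>_def \<eta>_def)
  obtain k where k: "0 < k" "\<And>t. t \<in> {0..T} \<Longrightarrow> norm (K t) \<le> k"
    using continuous_bounded_Icc[OF K_continuous] by blast
  obtain \<kappa> where \<kappa>: "0 < \<kappa>"
    "\<And>y t. y \<in> borel_measurable (lebT T) \<Longrightarrow> integrable (lebT T) (\<lambda>s. (norm (y s))\<^sup>2) \<Longrightarrow> t \<in> {0..T} \<Longrightarrow>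
      norm (conv G T causal H y t) \<le> \<kappa> * (\<integral>s. indicat_real causal (t, s) * norm (y s) \<partial>lebT T)"
    using conv_norm_bound[OF T0 causal_measurable(1), of G H] by blast
  have "AE t in lebT T. AE \<omega> in \<Omega>. norm (\<eta> t \<omega>) \<le> k * norm (\<delta> t \<omega>)"
  proof (rule AE_I2)
    fix t assume "t \<in> space (lebT T)"
    then have t: "t \<in> {0..T}" by simp
    show "AE \<omega> in \<Omega>. norm (\<eta> t \<omega>) \<le> k * norm (\<delta> t \<omega>)"
      using fb[OF t] xd[OF t]
    proof eventually_elim
      case (elim \<omega>)
      then have "\<eta> t \<omega> = K t (\<delta> t \<omega>)" by (simp add: \<eta>_def ctrl_def blinfun.add_right)
      then show ?case by (simp only:) (rule order_trans[OF norm_blinfun mult_right_mono[OF k(2)[OF t]]], simp)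
    qed
  qed
  moreover have "{z \<in> space ?\<mu>. norm (\<eta> (fst z) (snd z)) \<le> k * norm (\<delta> (fst z) (snd z))} \<in> sets ?\<mu>"
  proof -
    have [measurable]: "(\<lambda>z. norm (\<eta> (fst z) (snd z))) \<in> borel_measurable ?\<mu>" "(\<lambda>z. norm (\<delta> (fst z) (snd z))) \<in> borel_measurable ?\<mu>"
      using measurable_compose[OF \<eta>m borel_measurable_norm] measurable_compose[OF \<delta>m borel_measurable_norm]
      by (simp_all add: case_prod_beta')
    show ?thesis by measurable
  qed
  \<comment> \<open>the feedback law holds for each time almost surely; the Volterra argument needs it along almost every path\<close>
  ultimately have ae: "AE \<omega> in \<Omega>. AE t in lebT T. norm (\<eta> t \<omega>) \<le> k * norm (\<delta> t \<omega>)"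
    by (subst PT.AE_commute[symmetric]) auto
  have zero: "AE \<omega> in \<Omega>. \<forall>t\<in>{0..T}. \<delta> t \<omega> = 0"
    using ae admissible_L2_paths(2)[OF u] AE_space
  proof eventually_elim
    case (elim \<omega>)
    have cc: "continuous_on {0..T} (\<lambda>t. (norm (ctrl t \<omega>))\<^sup>2)"
      by (intro continuous_on_power continuous_on_norm ctrl_continuous elim)
    have \<eta>p: "(\<lambda>s. \<eta> s \<omega>) \<in> borel_measurable (lebT T)" by (rule process_path_measurable[OF \<eta>m elim(3)])
    have \<delta>p: "(\<lambda>s. \<delta> s \<omega>) \<in> borel_measurable (lebT T)" by (rule process_path_measurable[OF \<delta>m elim(3)])
    have \<eta>2: "integrable (lebT T) (\<lambda>s. (norm (\<eta> s \<omega>))\<^sup>2)"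
    proof (rule Bochner_Integration.integrable_bound)
      show "integrable (lebT T) (\<lambda>s. 2 * (norm (u s \<omega>))\<^sup>2 + 2 * (norm (ctrl s \<omega>))\<^sup>2)"
        using elim(2) lebT_integral_continuous(1)[OF cc] by simp
      show "(\<lambda>s. (norm (\<eta> s \<omega>))\<^sup>2) \<in> borel_measurable (lebT T)"
        by (intro borel_measurable_power measurable_compose[OF \<eta>p borel_measurable_norm])
      show "AE s in lebT T. norm ((norm (\<eta> s \<omega>))\<^sup>2) \<le> norm (2 * (norm (u s \<omega>))\<^sup>2 + 2 * (norm (ctrl s \<omega>))\<^sup>2)"
        using norm_diff_square_triangle[of "u _ \<omega>" "ctrl _ \<omega>" 0] by (intro AE_I2) (simp add: \<eta>_def)
    qed
    have \<eta>1: "integrable (lebT T) (\<lambda>s. norm (\<eta> s \<omega>))" by (rule integrable_norm[OF lebT_Cauchy_Schwarz(1)[OF T0 \<eta>p \<eta>2]])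
    have \<delta>b: "norm (\<delta> t \<omega>) \<le> \<kappa> * (\<integral>s. norm (\<eta> s \<omega>) \<partial>lebT T)" if t: "t \<in> {0..T}" for t
    proof -
      have "(\<integral>s. indicat_real causal (t, s) * norm (\<eta> s \<omega>) \<partial>lebT T) \<le> (\<integral>s. norm (\<eta> s \<omega>) \<partial>lebT T)"
        by (rule integral_mono_AE'[OF \<eta>1]) (auto intro!: AE_I2 split: split_indicator)
      then show ?thesis
        unfolding \<delta>_def using \<kappa>(1) by (intro order_trans[OF \<kappa>(2)[OF \<eta>p \<eta>2 t]] mult_left_mono) auto
    qed
    interpret L: finite_measure "lebT T" by (rule finite_lebT)
    have \<delta>i: "integrable (lebT T) (\<lambda>s. norm (\<delta> s \<omega>))"
      using \<delta>b by (intro L.integrable_const_bound[where B="\<kappa> * (\<integral>s. norm (\<eta> s \<omega>) \<partial>lebT T)"] AE_I2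
          measurable_compose[OF \<delta>p borel_measurable_norm]) auto
    have idm: "(\<lambda>x. x) \<in> borel_measurable (lebT T)" by (intro measurable_restrict_space1) auto
    have ind: "(\<lambda>s. indicat_real causal (t, s)) \<in> borel_measurable (lebT T)" for t
      by (rule measurable_compose[OF borel_measurable_Pair[OF borel_measurable_const idm] borel_measurable_indicator[OF causal_measurable(1)]])
    have i1: "integrable (lebT T) (\<lambda>s. indicat_real causal (t, s) * \<psi> s)" if "integrable (lebT T) \<psi>" for t and \<psi> :: "real \<Rightarrow> real"
      by (rule Bochner_Integration.integrable_bound[OF that borel_measurable_times[OF ind borel_measurable_integrable[OF that]]])
        (auto intro!: AE_I2 split: split_indicator)
    have "norm (\<delta> t \<omega>) \<le> (\<kappa> * k) * (\<integral>s. indicat_real causal (t, s) * norm (\<delta> s \<omega>) \<partial>lebT T)" if t: "t \<in> {0..T}" for t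
    proof -
      have "(\<integral>s. indicat_real causal (t, s) * norm (\<eta> s \<omega>) \<partial>lebT T) \<le> (\<integral>s. k * (indicat_real causal (t, s) * norm (\<delta> s \<omega>)) \<partial>lebT T)"
      proof (rule integral_mono_AE)
        show "AE s in lebT T. indicat_real causal (t, s) * norm (\<eta> s \<omega>) \<le> k * (indicat_real causal (t, s) * norm (\<delta> s \<omega>))"
          using elim(1) by eventually_elim (auto split: split_indicator)
        show "integrable (lebT T) (\<lambda>s. indicat_real causal (t, s) * norm (\<eta> s \<omega>))" by (rule i1[OF \<eta>1])
        show "integrable (lebT T) (\<lambda>s. k * (indicat_real causal (t, s) * norm (\<delta> s \<omega>)))"
          by (intro integrable_mult_right i1[OF \<delta>i])
      qed
      then have "\<kappa> * (\<integral>s. indicat_real causal (t, s) * norm (\<eta> s \<omega>) \<partial>lebT T) \<le> \<kappa> * (k * (\<integral>s. indicat_real causal (t, s) * norm (\<delta> s \<omega>) \<partial>lebT T))"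
        using \<kappa>(1) by (intro mult_left_mono) auto
      then show ?thesis
        unfolding \<delta>_def[of t] using \<kappa>(2)[OF \<eta>p \<eta>2 t] by (simp only: mult.assoc)
    qed
    then have "norm (\<delta> t \<omega>) = 0" if "t \<in> {0..T}" for t
      using \<kappa>(1) k(1) by (intro volterra_zero[OF \<delta>i, of "\<kappa> * k"] that) auto
    then show ?case by simp
  qed
  show "AE \<omega> in \<Omega>. x t \<omega> = X t \<omega>" using xd[OF t] zero by eventually_elim (use t in simp)
  then show "AE \<omega> in \<Omega>. u t \<omega> = ctrl t \<omega>" using fb[OF t] by eventually_elim (simp add: ctrl_def)
qed

text \<open>Another optimal pair has the same cost, so the surplus $r\, E \int (v_t - u_t) \cdot (v_t - u_t)\,dt$ in \<open>closed_loop_minimizes\<close> is zero.\<close>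

theorem closed_loop_optimal:
  assumes cl: "closed_loop \<Omega> f lam w T G H x0 (\<lambda>t. blinfun_apply (K t)) u x"
  shows "lq_optimal \<Omega> f lam w T G H CM CR CMT x0 u x"
    and "lq_optimal \<Omega> f lam w T G H CM CR CMT x0 v y \<Longrightarrow> AE (t, \<omega>) in time_prod T \<Omega>. v t \<omega> = u t \<omega>"
proof -
  let ?\<mu> = "lebT T \<Otimes>\<^sub>M \<Omega>"
  have u: "admissible \<Omega> w T u" and x: "mild_solution \<Omega> f lam w T G H x0 u x"
    using cl by (auto simp: closed_loop_def)
  have um: "(\<lambda>(t, \<omega>). u t \<omega>) \<in> borel_measurable ?\<mu>" by (rule admissible_L2_paths(1)[OF u])
  have xm: "(\<lambda>(t, \<omega>). x t \<omega>) \<in> borel_measurable ?\<mu>" using x by (simp add: mild_solution_def time_prod_def)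
  have uc: "AE z in ?\<mu>. u (fst z) (snd z) = ctrl (fst z) (snd z)"
    by (rule AE_process_eq[OF um ctrl_process_measurable closed_loop_unique(2)[OF cl]])
  have cost: "lq_cost \<Omega> T CM CR CMT u x = lq_cost \<Omega> T CM CR CMT ctrl X"
    by (rule lq_cost_AE_cong[OF um xm ctrl_process_measurable X_process_measurable uc closed_loop_unique(1)[OF cl]])
  show "lq_optimal \<Omega> f lam w T G H CM CR CMT x0 u x"
    unfolding lq_optimal_def
  proof (intro conjI u x allI impI, elim conjE)
    fix v y assume "admissible \<Omega> w T v" "mild_solution \<Omega> f lam w T G H x0 v y"
    from order_trans[OF _ closed_loop_minimizes[OF this]]
    show "lq_cost \<Omega> T CM CR CMT u x \<le> lq_cost \<Omega> T CM CR CMT v y" unfolding cost by simp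
  qed
  show "AE (t, \<omega>) in time_prod T \<Omega>. v t \<omega> = u t \<omega>" if opt: "lq_optimal \<Omega> f lam w T G H CM CR CMT x0 v y"
  proof -
    have v: "admissible \<Omega> w T v" and y: "mild_solution \<Omega> f lam w T G H x0 v y"
      and le: "lq_cost \<Omega> T CM CR CMT v y \<le> lq_cost \<Omega> T CM CR CMT ctrl X"
      using opt closed_loop_exists unfolding lq_optimal_def closed_loop_def by blast+
    have vm: "(\<lambda>(t, \<omega>). v t \<omega>) \<in> borel_measurable ?\<mu>" by (rule admissible_L2_paths(1)[OF v])
    let ?D = "\<integral>\<^sup>+z. ennreal (r * (norm (v (fst z) (snd z) - ctrl (fst z) (snd z)))\<^sup>2) \<partial>?\<mu>"
    have z: "L2proc T (\<lambda>t \<omega>. 0)" using L2proc_diff[OF L2proc_X L2proc_X] by simp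
    have fin: "lq_cost \<Omega> T CM CR CMT ctrl X < \<infinity>" by (rule cost_expansion(2)[OF z]) simp
    have "lq_cost \<Omega> T CM CR CMT ctrl X + ?D \<le> lq_cost \<Omega> T CM CR CMT ctrl X + 0"
      using order_trans[OF closed_loop_minimizes[OF v y] le] by simp
    then have "?D \<le> 0" using fin by (subst (asm) ennreal_add_left_cancel_le) auto
    moreover have "(\<lambda>z. ennreal (r * (norm (v (fst z) (snd z) - ctrl (fst z) (snd z)))\<^sup>2)) \<in> borel_measurable ?\<mu>"
      using measurable_compose[OF borel_measurable_diff[OF vm ctrl_process_measurable] borel_measurable_norm]
      by (intro measurable_compose[OF _ measurable_ennreal] borel_measurable_times borel_measurable_power borel_measurable_const)
        (simp add: case_prod_beta')
    ultimately have "AE z in ?\<mu>. ennreal (r * (norm (v (fst z) (snd z) - ctrl (fst z) (snd z)))\<^sup>2) = 0"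
      by (simp add: nn_integral_0_iff_AE)
    then have "AE z in ?\<mu>. v (fst z) (snd z) = u (fst z) (snd z)"
      using uc
    proof eventually_elim
      case (elim z)
      then have "r * (norm (v (fst z) (snd z) - ctrl (fst z) (snd z)))\<^sup>2 \<le> 0" by (simp only: ennreal_eq_0_iff)
      then show ?case using r elim(2) by (simp add: mult_le_0_iff)
    qed
    then show ?thesis unfolding time_prod_def by (simp add: case_prod_beta')
  qed
qed

end

section \<open>Operators that are scalar on the orthogonal complement\<close>

text \<open>An operator which acts as the matrix \<open>M\<close> on the coordinates with respect to \<open>f\<close> and as the
  scalar \<open>\<alpha>\<close> on the orthogonal complement of the span of \<open>f\<close>.  Every operator of the control
  problem has this form, and \<open>(M, \<alpha>) \<mapsto> lift f M \<alpha>\<close> is an algebra homomorphism, so that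
  the operator Riccati equation splits into the matrix and the scalar one.\<close>

definition lift :: "('n::finite \<Rightarrow> 'a::real_inner) \<Rightarrow> real^'n^'n \<Rightarrow> real \<Rightarrow> 'a \<Rightarrow>\<^sub>L 'a" where
  "lift f M \<alpha> = Blinfun (\<lambda>v. (\<Sum>k\<in>UNIV. (M *v (\<chi> j. v \<bullet> f j)) $ k *\<^sub>R f k)
    + \<alpha> *\<^sub>R (v - (\<Sum>k\<in>UNIV. (v \<bullet> f k) *\<^sub>R f k)))"

lemma lift_apply:
  "lift f M \<alpha> v = (\<Sum>k\<in>UNIV. (M *v (\<chi> j. v \<bullet> f j)) $ k *\<^sub>R f k)
    + \<alpha> *\<^sub>R (v - (\<Sum>k\<in>UNIV. (v \<bullet> f k) *\<^sub>R f k))"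
proof -
  have "bounded_linear (\<lambda>v. \<Sum>k\<in>UNIV. (\<Sum>j\<in>UNIV. M $ k $ j * (v \<bullet> f j)) *\<^sub>R f k)"
    by (intro bounded_linear_sum bounded_linear_scaleR_const bounded_linear_mult_const
        bounded_linear_const_mult bounded_linear_inner_left)
  moreover have "bounded_linear (\<lambda>v. \<alpha> *\<^sub>R (v - (\<Sum>k\<in>UNIV. (v \<bullet> f k) *\<^sub>R f k)))"
    by (intro bounded_linear_const_scaleR bounded_linear_sub bounded_linear_ident bounded_linear_sum
        bounded_linear_scaleR_const bounded_linear_inner_left)
  ultimately have "bounded_linear (\<lambda>v. (\<Sum>k\<in>UNIV. (M *v (\<chi> j. v \<bullet> f j)) $ k *\<^sub>R f k)
    + \<alpha> *\<^sub>R (v - (\<Sum>k\<in>UNIV. (v \<bullet> f k) *\<^sub>R f k)))"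
    by (simp add: matrix_vector_mult_def bounded_linear_add)
  then show ?thesis unfolding lift_def by (simp add: bounded_linear_Blinfun_apply)
qed

lemma lift_add: "lift f M \<alpha> + lift f N \<beta> = lift f (M + N) (\<alpha> + \<beta>)"
  by (intro blinfun_eqI) (simp add: lift_apply blinfun.add_left matrix_vector_mult_add_rdistrib
      scaleR_add_left sum.distrib algebra_simps)

lemma lift_scaleR: "c *\<^sub>R lift f M \<alpha> = lift f (c *\<^sub>R M) (c * \<alpha>)"
  by (intro blinfun_eqI) (simp add: lift_apply blinfun.scaleR_left scaleR_matrix_vector_assoc[symmetric]
      scaleR_add_right scaleR_sum_right)

lemma lift_uminus: "- lift f M \<alpha> = lift f (- M) (- \<alpha>)"
  using lift_scaleR[of "- 1" f M \<alpha>] by simp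

lemma lift_bounded_linear: "bounded_linear (\<lambda>z :: (real^'n::finite^'n) \<times> real. lift f (fst z) (snd z))"
proof -
  have "linear (\<lambda>z :: (real^'n^'n) \<times> real. lift f (fst z) (snd z))"
    by (rule linearI) (simp_all add: lift_add lift_scaleR)
  then show ?thesis by (rule linear_conv_bounded_linear[THEN iffD1])
qed

lemma lift_continuous_on:
  fixes P :: "real \<Rightarrow> real^'n::finite^'n"
  assumes "continuous_on S P" "continuous_on S p"
  shows "continuous_on S (\<lambda>t. lift f (P t) (p t))"
  using bounded_linear.continuous_on[OF lift_bounded_linear continuous_on_Pair[OF assms]] by simp

lemma lift_has_vector_derivative:
  fixes P :: "real \<Rightarrow> real^'n::finite^'n"
  assumes P: "(P has_vector_derivative P') (at t within S)"
    and p: "(p has_real_derivative p') (at t within S)"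
  shows "((\<lambda>t. lift f (P t) (p t)) has_vector_derivative lift f P' p') (at t within S)"
  using bounded_linear.has_vector_derivative[OF lift_bounded_linear
      has_vector_derivative_Pair[OF P p[unfolded has_real_derivative_iff_has_vector_derivative]]] by simp

lemma inner_orthonormal_sum:
  assumes "orthonormal_family (f :: 'n::finite \<Rightarrow> 'a::real_inner)"
  shows "(\<Sum>k\<in>UNIV. c k *\<^sub>R f k) \<bullet> f j = c j"
proof -
  have "(\<Sum>k\<in>UNIV. c k *\<^sub>R f k) \<bullet> f j = (\<Sum>k\<in>UNIV. if k = j then c k else 0)"
    unfolding inner_sum_left using assms by (intro sum.cong) (auto simp: orthonormal_family_def)
  then show ?thesis by simp
qed

lemma lift_inner:
  assumes "orthonormal_family f"
  shows "lift f M \<alpha> v \<bullet> f j = (M *v (\<chi> j. v \<bullet> f j)) $ j"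
  by (simp add: lift_apply inner_add_left inner_diff_left inner_orthonormal_sum[OF assms])

lemma lift_compose:
  assumes f: "orthonormal_family f"
  shows "(lift f M \<alpha> o\<^sub>L lift f N \<beta>) = lift f (M ** N) (\<alpha> * \<beta>)"
proof (rule blinfun_eqI)
  fix v
  have *: "(\<chi> j. lift f N \<beta> v \<bullet> f j) = N *v (\<chi> j. v \<bullet> f j)"
    by (simp add: lift_inner[OF f] vec_eq_iff)
  have "lift f M \<alpha> (lift f N \<beta> v) = (\<Sum>k\<in>UNIV. (M *v (N *v (\<chi> j. v \<bullet> f j))) $ k *\<^sub>R f k)
    + \<alpha> *\<^sub>R (lift f N \<beta> v - (\<Sum>k\<in>UNIV. (lift f N \<beta> v \<bullet> f k) *\<^sub>R f k))"
    by (subst lift_apply) (simp only: *)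
  also have "lift f N \<beta> v - (\<Sum>k\<in>UNIV. (lift f N \<beta> v \<bullet> f k) *\<^sub>R f k) = \<beta> *\<^sub>R (v - (\<Sum>k\<in>UNIV. (v \<bullet> f k) *\<^sub>R f k))"
    unfolding lift_inner[OF f] by (simp add: lift_apply)
  finally show "(lift f M \<alpha> o\<^sub>L lift f N \<beta>) v = lift f (M ** N) (\<alpha> * \<beta>) v"
    by (simp add: lift_apply matrix_vector_mul_assoc)
qed

text \<open>On the orthogonal complement a low rank operator vanishes, so that \<open>X v\<close> depends on the
  coordinates of \<open>v\<close> alone; it lies in the span, so that it is determined by its coordinates.
  The indices of \<^const>\<open>proj_matrix\<close> are the reverse of those of the matrix that acts on coordinates; as \<open>X\<close> is
  self-adjoint, the two matrices agree.\<close>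

lemma low_rank_eq_lift:
  fixes f :: "'n::finite \<Rightarrow> 'a::real_inner"
  assumes f: "orthonormal_family f" and X: "self_adjoint X" "low_rank X (span (range f))"
  shows "X + x *\<^sub>R id_blinfun = lift f (proj_matrix f X + mat x) x"
proof (rule blinfun_eqI)
  fix v
  let ?y = "\<Sum>k\<in>UNIV. (v \<bullet> f k) *\<^sub>R f k"
  have y: "?y \<in> span (range f)" by (rule span_sum) (simp add: span_base span_scale)
  have "orthogonal (v - ?y) (f j)" for j
    by (simp add: orthogonal_def inner_diff_left inner_orthonormal_sum[OF f])
  then have "orthogonal (v - ?y) z" if "z \<in> span (range f)" for z
    using orthogonal_to_span[OF that, of "v - ?y"] by blast
  then have "v - ?y \<in> (span (range f))\<^sup>\<bottom>" by (simp add: orthogonal_comp_def orthogonal_commute)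
  then have "X (v - ?y) = 0" using X(2) by (auto simp: low_rank_def)
  then have Xv: "X v = X ?y" by (simp add: blinfun.diff_right)
  have "X ?y \<in> span (range f)" using X(2) y by (auto simp: low_rank_def invariant_subspace_def)
  then have "orth_proj (span (range f)) (X ?y) = X ?y"
    by (intro orth_proj_eqI) (auto simp: orthogonal_comp_def orthogonal_def)
  then have "X v = (\<Sum>k\<in>UNIV. (X ?y \<bullet> f k) *\<^sub>R f k)"
    unfolding Xv orth_proj_span_range[OF f] by simp
  moreover have "X ?y \<bullet> f k = (proj_matrix f X *v (\<chi> j. v \<bullet> f j)) $ k" for k
  proof -
    have "X ?y \<bullet> f k = (\<Sum>j\<in>UNIV. (v \<bullet> f j) * (X (f j) \<bullet> f k))"
      by (simp add: blinfun.sum_right blinfun.scaleR_right inner_sum_left)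
    also have "\<dots> = (\<Sum>j\<in>UNIV. proj_matrix f X $ k $ j * (v \<bullet> f j))"
      using X(1) by (intro sum.cong) (auto simp: proj_matrix_def self_adjoint_def inner_commute mult.commute)
    finally show ?thesis by (simp add: matrix_vector_mult_def)
  qed
  ultimately have "X v = (\<Sum>k\<in>UNIV. (proj_matrix f X *v (\<chi> j. v \<bullet> f j)) $ k *\<^sub>R f k)" by simp
  moreover have "(mat x :: real^'n^'n) *v c = x *\<^sub>R c" for c
    by (simp add: matrix_vector_mult_def mat_def vec_eq_iff if_distrib[where f="\<lambda>a. a * _"] cong: if_cong)
  ultimately show "(X + x *\<^sub>R id_blinfun) v = lift f (proj_matrix f X + mat x) x v"
    by (simp add: lift_apply blinfun.add_left blinfun.scaleR_left matrix_vector_mult_add_rdistrib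
        scaleR_add_left sum.distrib scaleR_diff_right scaleR_sum_right)
qed

lemma transpose_proj_matrix:
  assumes "self_adjoint X"
  shows "transpose (proj_matrix f X + mat x) = proj_matrix f X + mat x"
  using assms by (auto simp: vec_eq_iff transpose_def proj_matrix_def mat_def self_adjoint_def inner_commute)

text \<open>Nonnegativity and coercivity pass from an operator to its matrix.\<close>

lemma inner_proj_matrix:
  fixes f :: "'n::finite \<Rightarrow> 'a::real_inner"
  shows "c \<bullet> ((proj_matrix f X + mat x) *v c)
    = (\<Sum>k\<in>UNIV. c $ k *\<^sub>R f k) \<bullet> X (\<Sum>k\<in>UNIV. c $ k *\<^sub>R f k) + x * (norm c)\<^sup>2"
proof -
  have "(mat x :: real^'n^'n) *v c = x *\<^sub>R c"
    by (simp add: matrix_vector_mult_def mat_def vec_eq_iff if_distrib[where f="\<lambda>a. a * _"] cong: if_cong)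
  moreover have "c \<bullet> (proj_matrix f X *v c) = (\<Sum>k\<in>UNIV. c $ k *\<^sub>R f k) \<bullet> X (\<Sum>k\<in>UNIV. c $ k *\<^sub>R f k)"
    by (simp add: inner_vec_def matrix_vector_mult_def proj_matrix_def blinfun.sum_right blinfun.scaleR_right
        inner_sum_left inner_sum_right sum_distrib_left mult.assoc) (simp add: inner_commute mult.commute mult.left_commute)
  ultimately show ?thesis
    by (simp add: matrix_vector_mult_add_rdistrib inner_add_right power2_norm_eq_inner)
qed

section \<open>The projected problem\<close>

lemma invertible_positive_definite:
  fixes X :: "real^'n^'n"
  assumes "0 < r" and "\<And>c. r * (norm c)\<^sup>2 \<le> c \<bullet> (X *v c)"
  shows "invertible X"
proof -
  have "c = 0" if "X *v c = 0" for c
  proof -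
    have "r * (norm c)\<^sup>2 \<le> 0" using assms(2)[of c] that by simp
    then show ?thesis using assms(1) by (simp add: mult_le_0_iff)
  qed
  then obtain Y where "Y ** X = mat 1" using matrix_left_invertible_ker[of X] by auto
  then show ?thesis by (metis invertible_def matrix_left_right_inverse)
qed

lemma matrix_inv_positive_definite:
  fixes X :: "real^'n^'n"
  assumes r: "0 < r" and X: "\<And>c. r * (norm c)\<^sup>2 \<le> c \<bullet> (X *v c)"
  shows "0 \<le> c \<bullet> (matrix_inv X *v c)" and "c \<bullet> (matrix_inv X *v c) = 0 \<Longrightarrow> c = 0"
proof -
  let ?d = "matrix_inv X *v c"
  have c: "X *v ?d = c"
    by (simp add: matrix_vector_mul_assoc matrix_inv_eq(1)[OF invertible_positive_definite[OF assms]])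
  have le: "r * (norm ?d)\<^sup>2 \<le> c \<bullet> ?d" using X[of ?d] by (simp add: c inner_commute)
  have "0 \<le> r * (norm ?d)\<^sup>2" using r by simp
  then show "0 \<le> c \<bullet> (matrix_inv X *v c)" using le by (rule order_trans)
  assume "c \<bullet> (matrix_inv X *v c) = 0"
  then have "?d = 0" using le r by (simp add: mult_le_0_iff)
  then show "c = 0" using c by simp
qed

lemma matrix_mul_minus_left: "(- X) ** Y = - (X ** Y)" for X :: "real^'n^'m" and Y :: "real^'k^'n"
  by (simp add: vec_eq_iff matrix_matrix_mult_def sum_negf)

lemma matrix_mul_minus_right: "X ** (- Y) = - (X ** Y)" for X :: "real^'n^'m" and Y :: "real^'k^'n"
  by (simp add: vec_eq_iff matrix_matrix_mult_def sum_negf)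

text \<open>The coefficient $B^* R^{-1} B$ of the quadratic term is nonnegative because $R$ is positive definite.\<close>

lemma matrix_riccati_exists:
  fixes A B M MT R :: "real^'n^'n"
  assumes r: "0 < r" and R: "\<And>c. r * (norm c)\<^sup>2 \<le> c \<bullet> ((R + mat r) *v c)"
    and M: "\<And>c. 0 \<le> c \<bullet> ((M + mat m) *v c)" and MT: "\<And>c. 0 \<le> c \<bullet> ((MT + mat mT) *v c)"
  obtains P where "matrix_riccati A a B b M m MT mT R r T P"
proof -
  let ?S = "transpose (B + mat b) ** matrix_inv (R + mat r) ** (B + mat b)"
  have S: "v \<bullet> (?S *v v) = ((B + mat b) *v v) \<bullet> (matrix_inv (R + mat r) *v ((B + mat b) *v v))" for v
    by (simp add: matrix_vector_mul_assoc[symmetric] inner_matrix_transpose)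
  obtain P where "P T = MT + mat mT" and P: "\<And>t. t \<le> T \<Longrightarrow> (P has_vector_derivative
      - (transpose (A + mat a) ** P t + P t ** (A + mat a) - P t ** ?S ** P t + (M + mat m))) (at t within {..T})"
  proof (rule riccati_solution_exists[of ?S "M + mat m" "MT + mat mT" T "A + mat a"])
    show "0 \<le> v \<bullet> (?S *v v)" for v unfolding S by (rule matrix_inv_positive_definite(1)[OF r R])
    show "?S *v v = 0" if "v \<bullet> (?S *v v) = 0" for v
      using matrix_inv_positive_definite(2)[OF r R that[unfolded S]] by (simp add: matrix_vector_mul_assoc[symmetric])
  qed (use M MT in auto)
  moreover have "(P has_vector_derivative - (transpose (A + mat a) ** P t + P t ** (A + mat a) - P t ** ?S ** P t
      + (M + mat m))) (at t within {0..T})" if "t \<in> {0..T}" for t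
    using that by (intro has_vector_derivative_within_subset[OF P]) auto
  ultimately have "matrix_riccati A a B b M m MT mT R r T P"
    unfolding matrix_riccati_def by (simp add: matrix_mul_assoc)
  then show ?thesis by (rule that)
qed

text \<open>The scalar equation is the matrix equation of size one.\<close>

lemma scalar_riccati_exists:
  assumes r: "0 < r" and m: "0 \<le> m" "0 \<le> mT"
  obtains p where "scalar_riccati a b m mT r T p"
proof -
  have v: "(mat x :: real^1^1) *v c = x *\<^sub>R c" for x c
    by (simp add: matrix_vector_mult_def mat_def vec_eq_iff)
  have sq: "c \<bullet> (x *\<^sub>R c) = x * (norm c)\<^sup>2" for x and c :: "real^1" by (simp add: power2_norm_eq_inner)
  obtain P :: "real \<Rightarrow> real^1^1" where PT: "P T = mat mT" and P: "\<And>t. t \<le> T \<Longrightarrow> (P has_vector_derivative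
      - (transpose (mat a) ** P t + P t ** mat a - P t ** mat (b\<^sup>2 / r) ** P t + mat m)) (at t within {..T})"
  proof (rule riccati_solution_exists[of "mat (b\<^sup>2 / r) :: real^1^1" "mat m" "mat mT" T "mat a"])
    show "0 \<le> v \<bullet> (mat (b\<^sup>2 / r) *v v)" for v :: "real^1" unfolding v sq using r by simp
    show "mat (b\<^sup>2 / r) *v v = 0" if "v \<bullet> (mat (b\<^sup>2 / r) *v v) = 0" for v :: "real^1"
      using that unfolding v sq by auto
    show "0 \<le> v \<bullet> (mat m *v v)" "0 \<le> v \<bullet> (mat mT *v v)" for v :: "real^1" unfolding v sq using m by simp_all
  qed auto
  have "scalar_riccati a b m mT r T (\<lambda>t. P t $ 1 $ 1)"
    unfolding scalar_riccati_def
  proof (intro conjI ballI)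
    fix t assume "t \<in> {0..T}"
    then have "(P has_vector_derivative
      - (transpose (mat a) ** P t + P t ** mat a - P t ** mat (b\<^sup>2 / r) ** P t + mat m)) (at t within {0..T})"
      by (intro has_vector_derivative_within_subset[OF P]) auto
    then have "((\<lambda>t. P t $ 1 $ 1) has_vector_derivative
      (- (transpose (mat a) ** P t + P t ** mat a - P t ** mat (b\<^sup>2 / r) ** P t + mat m)) $ 1 $ 1) (at t within {0..T})"
      by (intro bounded_linear.has_vector_derivative[OF bounded_linear_compose[OF bounded_linear_vec_nth bounded_linear_vec_nth]])
    then show "((\<lambda>t. P t $ 1 $ 1) has_real_derivative
        - (2 * a * P t $ 1 $ 1 - b\<^sup>2 / r * (P t $ 1 $ 1)\<^sup>2 + m)) (at t within {0..T})"
      unfolding has_real_derivative_iff_has_vector_derivative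
      by (simp add: matrix_matrix_mult_def transpose_def mat_def power2_eq_square algebra_simps)
  qed (simp add: PT mat_def)
  then show ?thesis by (rule that)
qed

theorem theorem4p1:
  fixes \<Omega> :: "'w measure"
    and f :: "'n::finite \<Rightarrow> L2_01"
    and A B Q M MT R :: "L2_01 \<Rightarrow>\<^sub>L L2_01"
    and a b m mT r T :: real
    and lam :: "'n \<Rightarrow> real"
    and W :: "'n \<Rightarrow> real \<Rightarrow> 'w \<Rightarrow> real"
    and w :: "real \<Rightarrow> 'w \<Rightarrow> L2_01"
    and x0 :: L2_01
  assumes "prob_space \<Omega>" and "0 < T"
    and "orthonormal_family f"
    and "symmetric_integral_operator A" and "symmetric_integral_operator B"
    and "self_adjoint A" and "self_adjoint B"
    and "self_adjoint M" and "nonneg_operator M"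
    and "self_adjoint MT" and "nonneg_operator MT"
    and "self_adjoint R" and "nonneg_operator R"
    and "0 \<le> m" and "0 \<le> mT" and "0 < r"
    and "low_rank A (span (range f))" and "low_rank B (span (range f))" and "low_rank Q (span (range f))"
    and "low_rank M (span (range f))" and "low_rank MT (span (range f))" and "low_rank R (span (range f))"
    and "Q_noise \<Omega> Q f lam W w"
  shows "(\<exists>P. matrix_riccati (proj_matrix f A) a (proj_matrix f B) b (proj_matrix f M) m
            (proj_matrix f MT) mT (proj_matrix f R) r T P) \<and>
    (\<exists>p. scalar_riccati a b m mT r T p) \<and>
    (\<forall>P p. matrix_riccati (proj_matrix f A) a (proj_matrix f B) b (proj_matrix f M) m
            (proj_matrix f MT) mT (proj_matrix f R) r T P \<and>
        scalar_riccati a b m mT r T p \<longrightarrow>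
      (let G = A + a *\<^sub>R id_blinfun;
           H = B + b *\<^sub>R id_blinfun;
           CM = M + m *\<^sub>R id_blinfun;
           CR = R + r *\<^sub>R id_blinfun;
           CMT = MT + mT *\<^sub>R id_blinfun;
           K = (\<lambda>t. feedback_control f (proj_matrix f B) b (proj_matrix f R) r (P t) (p t))
       in
        (\<exists>u x. closed_loop \<Omega> f lam w T G H x0 K u x) \<and>
        (\<forall>u x. closed_loop \<Omega> f lam w T G H x0 K u x \<longrightarrow>
          lq_optimal \<Omega> f lam w T G H CM CR CMT x0 u x \<and>
          (\<forall>v y. lq_optimal \<Omega> f lam w T G H CM CR CMT x0 v y \<longrightarrow>
            (AE (t, \<omega>) in time_prod T \<Omega>. v t \<omega> = u t \<omega>)))))"
proof -
  note f = assms(3) and r = \<open>0 < r\<close>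
  let ?A = "proj_matrix f A" and ?B = "proj_matrix f B" and ?M = "proj_matrix f M"
    and ?MT = "proj_matrix f MT" and ?R = "proj_matrix f R"
  have R: "r * (norm c)\<^sup>2 \<le> c \<bullet> ((?R + mat r) *v c)" for c
    using \<open>nonneg_operator R\<close> unfolding inner_proj_matrix by (simp add: nonneg_operator_def)
  have MM: "0 \<le> c \<bullet> ((?M + mat m) *v c)" "0 \<le> c \<bullet> ((?MT + mat mT) *v c)" for c
    using \<open>nonneg_operator M\<close> \<open>0 \<le> m\<close> \<open>nonneg_operator MT\<close> \<open>0 \<le> mT\<close>
    unfolding inner_proj_matrix by (simp_all add: nonneg_operator_def)
  obtain P where P: "matrix_riccati ?A a ?B b ?M m ?MT mT ?R r T P"
    by (rule matrix_riccati_exists[OF r R MM])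
  obtain p where p: "scalar_riccati a b m mT r T p"
    by (rule scalar_riccati_exists[OF r \<open>0 \<le> m\<close> \<open>0 \<le> mT\<close>])
  have "(\<exists>u x. closed_loop \<Omega> f lam w T (A + a *\<^sub>R id_blinfun) (B + b *\<^sub>R id_blinfun) x0
          (\<lambda>t. feedback_control f ?B b ?R r (P t) (p t)) u x) \<and>
      (\<forall>u x. closed_loop \<Omega> f lam w T (A + a *\<^sub>R id_blinfun) (B + b *\<^sub>R id_blinfun) x0
          (\<lambda>t. feedback_control f ?B b ?R r (P t) (p t)) u x \<longrightarrow>
        lq_optimal \<Omega> f lam w T (A + a *\<^sub>R id_blinfun) (B + b *\<^sub>R id_blinfun) (M + m *\<^sub>R id_blinfun)
          (R + r *\<^sub>R id_blinfun) (MT + mT *\<^sub>R id_blinfun) x0 u x \<and>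
        (\<forall>v y. lq_optimal \<Omega> f lam w T (A + a *\<^sub>R id_blinfun) (B + b *\<^sub>R id_blinfun) (M + m *\<^sub>R id_blinfun)
          (R + r *\<^sub>R id_blinfun) (MT + mT *\<^sub>R id_blinfun) x0 v y \<longrightarrow>
          (AE (t, \<omega>) in time_prod T \<Omega>. v t \<omega> = u t \<omega>)))"
    if P: "matrix_riccati ?A a ?B b ?M m ?MT mT ?R r T P" and p: "scalar_riccati a b m mT r T p" for P p
  proof -
    let ?G = "A + a *\<^sub>R id_blinfun" and ?H = "B + b *\<^sub>R id_blinfun" and ?CM = "M + m *\<^sub>R id_blinfun"
      and ?CR = "R + r *\<^sub>R id_blinfun" and ?CMT = "MT + mT *\<^sub>R id_blinfun"
    note low = low_rank_eq_lift[OF f]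
    have G: "?G = lift f (?A + mat a) a" and H: "?H = lift f (?B + mat b) b" and CM: "?CM = lift f (?M + mat m) m"
      and CR: "?CR = lift f (?R + mat r) r" and CMT: "?CMT = lift f (?MT + mat mT) mT"
      by (rule low; fact)+
    have tA: "transpose (?A + mat a) = ?A + mat a" and tB: "transpose (?B + mat b) = ?B + mat b"
      by (rule transpose_proj_matrix; fact)+
    have inv: "(?R + mat r) ** matrix_inv (?R + mat r) = mat 1"
      by (rule matrix_inv_eq(1)[OF invertible_positive_definite[OF r R]])
    \<comment> \<open>the gain and the operator Riccati solution, assembled from the matrix and the scalar ones\<close>
    define \<K> where "\<K> t = lift f (- matrix_inv (?R + mat r) ** (?B + mat b) ** P t) (- (b / r) * p t)" for t
    define \<P> where "\<P> t = lift f (P t) (p t)" for t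
    have K: "(\<lambda>t. feedback_control f ?B b ?R r (P t) (p t)) = (\<lambda>t. blinfun_apply (\<K> t))"
      unfolding feedback_control_def \<K>_def lift_apply proj_coords_def orth_proj_orthogonal_comp[OF f]
        orth_proj_span_range[OF f] tB
      by (simp add: inner_orthonormal_sum[OF f])
    have dP: "(P has_vector_derivative - ((?A + mat a) ** P t + P t ** (?A + mat a)
         - P t ** (?B + mat b) ** matrix_inv (?R + mat r) ** (?B + mat b) ** P t + (?M + mat m))) (at t within {0..T})"
      if "t \<in> {0..T}" for t using P that unfolding matrix_riccati_def tA tB by blast
    have dp: "(p has_real_derivative - (2 * a * p t - b\<^sup>2 / r * (p t)\<^sup>2 + m)) (at t within {0..T})"
      if "t \<in> {0..T}" for t using p that unfolding scalar_riccati_def by blast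
    have adj: "self_adjoint (X + x *\<^sub>R id_blinfun)" if "self_adjoint X" for X :: "L2_01 \<Rightarrow>\<^sub>L L2_01" and x
      using that by (simp add: self_adjoint_def blinfun.add_left blinfun.scaleR_left inner_add_left inner_add_right)
    have pos: "v \<bullet> (X + x *\<^sub>R id_blinfun) v = v \<bullet> X v + x * (norm v)\<^sup>2" for X :: "L2_01 \<Rightarrow>\<^sub>L L2_01" and x v
      by (simp add: blinfun.add_left blinfun.scaleR_left inner_add_right power2_norm_eq_inner)
    have fb: "?CR o\<^sub>L \<K> t = - (?H o\<^sub>L \<P> t)" for t
    proof -
      have "(?R + mat r) ** (- matrix_inv (?R + mat r) ** (?B + mat b) ** P t)
          = - (((?R + mat r) ** matrix_inv (?R + mat r)) ** ((?B + mat b) ** P t))"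
        by (simp only: matrix_mul_assoc matrix_mul_minus_left matrix_mul_minus_right)
      then show ?thesis using r
        unfolding CR H \<K>_def \<P>_def lift_compose[OF f] lift_uminus inv by simp
    qed
    interpret prob_space \<Omega> by fact
    interpret q_noise \<Omega> W f lam w
      using \<open>Q_noise \<Omega> Q f lam W w\<close> by unfold_locales (auto simp: Q_noise_def)
    interpret lq_setting \<Omega> W f lam w T r ?G ?H ?CM ?CR ?CMT x0 \<K> \<P>
    proof unfold_locales
      show "continuous_on {0..T} \<K>"
      proof -
        have "continuous_on {0..T} P" "continuous_on {0..T} p"
          unfolding continuous_on_eq_continuous_within
          using has_vector_derivative_continuous[OF dP] DERIV_continuous[OF dp] by blast+
        moreover have "continuous_on {0..T} (\<lambda>t. - matrix_inv (?R + mat r) ** (?B + mat b) ** P t)"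
          if "continuous_on {0..T} P"
          by (rule bounded_linear.continuous_on[OF bounded_bilinear.bounded_linear_right[OF bounded_bilinear_matrix_mult] that])
        ultimately show ?thesis unfolding \<K>_def
          by (intro lift_continuous_on continuous_on_mult continuous_on_const) auto
      qed
      show "(\<P> has_vector_derivative - ((?G o\<^sub>L \<P> t) + (\<P> t o\<^sub>L (?G + (?H o\<^sub>L \<K> t))) + ?CM)) (at t within {0..T})"
        if t: "t \<in> {0..T}" for t
      proof -
        have mat_eq: "X ** Z + Z ** (X + Y ** (- V ** Y ** Z)) + N = X ** Z + Z ** X - Z ** Y ** V ** Y ** Z + N"
          for X Y Z V N :: "real^'n^'n"
          by (simp only: matrix_add_ldistrib matrix_mul_assoc matrix_mul_minus_left matrix_mul_minus_right) simp
        have "(?G o\<^sub>L \<P> t) + (\<P> t o\<^sub>L (?G + (?H o\<^sub>L \<K> t))) + ?CM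
          = lift f ((?A + mat a) ** P t + P t ** ((?A + mat a) + (?B + mat b) ** (- matrix_inv (?R + mat r) ** (?B + mat b) ** P t)) + (?M + mat m))
              (a * p t + p t * (a + b * (- (b / r) * p t)) + m)"
          unfolding G H CM \<P>_def \<K>_def lift_compose[OF f] lift_add by simp
        also have "\<dots> = lift f ((?A + mat a) ** P t + P t ** (?A + mat a)
         - P t ** (?B + mat b) ** matrix_inv (?R + mat r) ** (?B + mat b) ** P t + (?M + mat m))
              (2 * a * p t - b\<^sup>2 / r * (p t)\<^sup>2 + m)"
          unfolding mat_eq by (simp add: power2_eq_square algebra_simps)
        finally have eq: "(?G o\<^sub>L \<P> t) + (\<P> t o\<^sub>L (?G + (?H o\<^sub>L \<K> t))) + ?CM = lift f ((?A + mat a) ** P t + P t ** (?A + mat a)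
         - P t ** (?B + mat b) ** matrix_inv (?R + mat r) ** (?B + mat b) ** P t + (?M + mat m))
              (2 * a * p t - b\<^sup>2 / r * (p t)\<^sup>2 + m)" .
        show ?thesis
          unfolding eq unfolding \<P>_def[abs_def] lift_uminus by (rule lift_has_vector_derivative[OF dP[OF t] dp[OF t]])
      qed
      show "\<P> T = ?CMT" using P p unfolding \<P>_def CMT by (simp add: matrix_riccati_def scalar_riccati_def)
      show "0 \<le> v \<bullet> ?CM v" "0 \<le> v \<bullet> ?CMT v" "r * (norm v)\<^sup>2 \<le> v \<bullet> ?CR v" for v
        using \<open>nonneg_operator M\<close> \<open>0 \<le> m\<close> \<open>nonneg_operator MT\<close> \<open>0 \<le> mT\<close> \<open>nonneg_operator R\<close>
        unfolding pos by (simp_all add: nonneg_operator_def)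
    qed (use assms adj fb in auto)
    obtain X c where "\<And>t. t \<in> {0..T} \<Longrightarrow> X t \<in> borel_measurable (natural_filtration \<Omega> w t)"
      and "\<And>\<omega>. \<omega> \<in> space \<Omega> \<Longrightarrow> X 0 \<omega> = x0 \<and> continuous_on {0..T} (\<lambda>t. X t \<omega>) \<and>
        (\<forall>t\<in>{0..T}. ((\<lambda>t. X t \<omega> - noise_path t \<omega>) has_vector_derivative drift t (X t \<omega>)) (at t within {0..T}))"
      and "0 \<le> c" and "\<And>t \<omega>. t \<in> {0..T} \<Longrightarrow> \<omega> \<in> space \<Omega> \<Longrightarrow>
        (norm (X t \<omega>))\<^sup>2 \<le> c * (1 + (norm (noise_path t \<omega>))\<^sup>2 + (\<integral>s. (norm (noise_path s \<omega>))\<^sup>2 \<partial>lebT T))"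
      using state_exists by blast
    then interpret lq_state \<Omega> W f lam w T r ?G ?H ?CM ?CR ?CMT x0 \<K> \<P> X c
      by unfold_locales blast+
    show ?thesis unfolding K using closed_loop_exists closed_loop_optimal by blast
  qed
  with P p show ?thesis unfolding Let_def by blast
qed
end
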